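(* Let $(X,g)$ be a smooth compact manifold with boundary of dimension $n+1$ with a singular metric blowing up at $\partial X$ with exponent $\beta>0$, as described in the context, and let $(\phi_j)_{j\ge1}$ be the associated sequence of eigenfunctions of $\triangle_g$. If $\beta\ge\beta_c=2/n$, then there exists a density-one subsequence $(\phi_{j_k})_{k\ge1}$ of $(\phi_j)_{j\ge1}$ that concentrates on $\partial X$, meaning that for every compact subset $K\subset X\setminus\partial X$, $$\lim_{k\to+\infty}\int_K|\phi_{j_k}|^2\,dv_g=0 .$$
   Context: Setting. Let $n\ge 1$ and let $X$ be a smooth compact manifold of dimension $n+1$ with boundary $\partial X$. A neighborhood of $\partial X$ is diffeomorphic to $[0,1)\times M$, where $M$ is a smooth compact manifold (without boundary) of dimension $n$, with $\partial X$ identified with $\{0\}\times M=\{u=0\}$, $u\in[0,1)$ being a transverse coordinate. Let $0<\alpha<2$ and let $g$ be a Riemannian metric, smooth on $X\setminus\partial X$, such that near $\partial X$ one has $g=\bar g/u^\alpha$ with $\bar g$ a smooth (nonsingular) Riemannian metric up to the boundary. By a known normal form, the collar coordinates are chosen so that $g=u^{-\alpha}(du^2+g_0(u))$, with $g_0(u)$ a Riemannian metric on $M$ depending smoothly on $u\in[0,1)$. Setting $x=\int_0^u s^{-\alpha/2}\,ds=(1-\frac{\alpha}{2})^{-1}u^{1-\frac{\alpha}{2}}$, one has near $\partial X$ $$g=dx^2+x^{-\beta}g_1(x),\qquad \beta=\frac{2\alpha}{2-\alpha}\in(0,+\infty),$$ where $g_1(x)=(1-\frac{\alpha}{2})^{-\beta}g_0(u(x))$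 is a Riemannian metric on $M$ depending smoothly on $x>0$ and continuous at $x=0$. $v_g$ is the Riemannian volume measure of $(X,g)$. Laplacian. $\triangle_g\ge 0$ is the (nonnegative) Laplace-Beltrami operator of $g$ on $L^2(X,dv_g)$ with core $C_0^\infty(X\setminus\partial X)$; it is essentially self-adjoint when $\beta\ge\beta_c$. Its spectrum is discrete, with eigenvalues $0<\lambda_1\le\lambda_2\le\cdots$ repeated according to multiplicity and an associated orthonormal basis of eigenfunctions $(\phi_j)_{j\ge1}$ of $L^2(X,dv_g)$. Density one. A subsequence $(\phi_{j_k})_{k\ge1}$, with $j_1<j_2<\cdots$, is of density one if $\frac{1}{N}\#\{k : j_k\le N\}\to1$ as $N\to+\infty$. *)

theory Defs
  imports "HOL-Analysis.Analysis"
begin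

section \<open>Smooth maps between subsets of Euclidean spaces\<close>

text \<open>\<open>Ck k f S\<close> says that \<open>f\<close> is of class \<open>k\<close> on \<open>S\<close>; it is only used for open sets \<open>S\<close>. On a
  finite-dimensional domain, continuity of all iterated directional derivatives is the usual
  condition.\<close>

primrec Ck :: "nat \<Rightarrow> ('e::real_normed_vector \<Rightarrow> 'f::real_normed_vector) \<Rightarrow> 'e set \<Rightarrow> bool" where
  "Ck 0 f S \<longleftrightarrow> continuous_on S f"
| "Ck (Suc k) f S \<longleftrightarrow>
     (\<forall>x\<in>S. f differentiable (at x)) \<and> (\<forall>v. Ck k (\<lambda>x. frechet_derivative f (at x) v) S)"

text \<open>On arbitrary sets, in particular on relatively open subsets of a half-space, smoothness means
  local extendability to a smooth map on an open set.\<close>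

definition smooth_on :: "'e::real_normed_vector set \<Rightarrow> ('e \<Rightarrow> 'f::real_normed_vector) \<Rightarrow> bool" where
  "smooth_on S f \<longleftrightarrow>
     (\<forall>x\<in>S. \<exists>U h. open U \<and> x \<in> U \<and> (\<forall>k. Ck k h U) \<and> (\<forall>y\<in>S \<inter> U. h y = f y))"


section \<open>Smooth manifolds with boundary\<close>

text \<open>A chart \<open>(U, \<phi>)\<close> consists of its domain and its coordinate map; values of \<open>\<phi>\<close> outside \<open>U\<close> are
  irrelevant. Charts take values in a model set \<open>H\<close>: the closed half-space for manifolds with
  boundary, the whole space for manifolds without boundary.\<close>

type_synonym ('a, 'e) chart = "'a set \<times> ('a \<Rightarrow> 'e)"

text \<open>The index type \<open>'n option\<close> has \<open>CARD('n) + 1\<close> elements; the index \<open>None\<close> is the coordinate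
  transverse to the boundary.\<close>

definition half_space :: "(real ^ 'n::finite option) set" where
  "half_space = {y. 0 \<le> y $ None}"

definition smooth_manifold ::
    "'e::euclidean_space set \<Rightarrow> 'a topology \<Rightarrow> ('a, 'e) chart set \<Rightarrow> bool" where
  "smooth_manifold H X A \<longleftrightarrow>
     Hausdorff_space X \<and> second_countable X \<and>
     (\<Union>(U, \<phi>)\<in>A. U) = topspace X \<and>
     (\<forall>(U, \<phi>)\<in>A. openin X U \<and> openin (top_of_set H) (\<phi> ` U) \<and>
        homeomorphic_map (subtopology X U) (top_of_set (\<phi> ` U)) \<phi>) \<and>
     (\<forall>(U, \<phi>)\<in>A. \<forall>(V, \<psi>)\<in>A. smooth_on (\<phi> ` (U \<inter> V)) (\<psi> \<circ> inv_into U \<phi>))"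

definition boundary :: "('a, real ^ 'n::finite option) chart set \<Rightarrow> 'a set" where
  "boundary A = {p. \<exists>(U, \<phi>)\<in>A. p \<in> U \<and> \<phi> p $ None = 0}"

definition interior_part :: "'a topology \<Rightarrow> ('a, real ^ 'n::finite option) chart set \<Rightarrow> 'a set" where
  "interior_part X A = topspace X - boundary A"

definition restrict_atlas :: "('a, 'e) chart set \<Rightarrow> 'a set \<Rightarrow> ('a, 'e) chart set" where
  "restrict_atlas A W = (\<lambda>(U, \<phi>). (U \<inter> W, \<phi>)) ` A"

definition smooth_map ::
    "('a, 'e::real_normed_vector) chart set \<Rightarrow> ('b, 'f::real_normed_vector) chart set \<Rightarrow> ('a \<Rightarrow> 'b) \<Rightarrow> bool"
  where
  "smooth_map A B f \<longleftrightarrow>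
     (\<forall>(U, \<phi>)\<in>A. \<forall>(V, \<psi>)\<in>B. smooth_on (\<phi> ` (U \<inter> f -` V)) (\<psi> \<circ> f \<circ> inv_into U \<phi>))"

definition diffeomorphic_maps ::
    "'a topology \<Rightarrow> ('a, 'e::real_normed_vector) chart set \<Rightarrow>
     'b topology \<Rightarrow> ('b, 'f::real_normed_vector) chart set \<Rightarrow> ('a \<Rightarrow> 'b) \<Rightarrow> ('b \<Rightarrow> 'a) \<Rightarrow> bool" where
  "diffeomorphic_maps X A Y B f h \<longleftrightarrow>
     homeomorphic_maps X Y f h \<and> smooth_map A B f \<and> smooth_map B A h"

text \<open>The product charts of \<open>[0,1) \<times> M\<close>.\<close>

definition cylinder_atlas ::
    "('b, real ^ 'n::finite) chart set \<Rightarrow> (real \<times> 'b, real ^ 'n option) chart set" where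
  "cylinder_atlas B =
     (\<lambda>(V, \<psi>). ({0..<1} \<times> V,
        \<lambda>(u, m). \<chi> i. case i of None \<Rightarrow> u | Some j \<Rightarrow> \<psi> m $ j)) ` B"

text \<open>\<open>W\<close> is an open neighbourhood of the boundary, \<open>\<Phi>\<close> is a diffeomorphism of \<open>[0,1) \<times> M\<close>
  onto \<open>W\<close> with inverse \<open>\<Psi>\<close>, identifying \<open>{0} \<times> M\<close> with the boundary. The transverse coordinate
  is \<open>u = fst \<circ> \<Psi>\<close>.\<close>

definition collar ::
    "'a topology \<Rightarrow> ('a, real ^ 'n::finite option) chart set \<Rightarrow>
     'b topology \<Rightarrow> ('b, real ^ 'n) chart set \<Rightarrow>
     'a set \<Rightarrow> (real \<times> 'b \<Rightarrow> 'a) \<Rightarrow> ('a \<Rightarrow> real \<times> 'b) \<Rightarrow> bool" where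
  "collar X A M B W \<Phi> \<Psi> \<longleftrightarrow>
     openin X W \<and> boundary A \<subseteq> W \<and>
     diffeomorphic_maps (prod_topology (top_of_set {0..<1}) M) (cylinder_atlas B)
       (subtopology X W) (restrict_atlas A W) \<Phi> \<Psi> \<and>
     \<Phi> ` ({0} \<times> topspace M) = boundary A"


section \<open>Riemannian metrics\<close>

text \<open>A metric is given by its coefficient matrices \<open>G (U, \<phi>) y\<close> in each chart, as functions of the
  coordinates \<open>y \<in> \<phi> ` U\<close>, subject to the transformation law of covariant 2-tensors. The
  derivatives of the coordinate changes are taken within the chart image, so that they are
  one-sided in the transverse direction at boundary points.\<close>

type_synonym ('a, 'k) tensor2 = "('a, real ^ 'k) chart \<Rightarrow> real ^ 'k \<Rightarrow> real ^ 'k ^ 'k"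

definition riemannian_metric_on ::
    "('a, real ^ 'k::finite) chart set \<Rightarrow> 'a set \<Rightarrow> ('a, 'k) tensor2 \<Rightarrow> bool" where
  "riemannian_metric_on A S G \<longleftrightarrow>
     (\<forall>(U, \<phi>)\<in>A.
        smooth_on (\<phi> ` (U \<inter> S)) (G (U, \<phi>)) \<and>
        (\<forall>y\<in>\<phi> ` (U \<inter> S). transpose (G (U, \<phi>) y) = G (U, \<phi>) y \<and>
           (\<forall>w. w \<noteq> 0 \<longrightarrow> 0 < w \<bullet> (G (U, \<phi>) y *v w)))) \<and>
     (\<forall>(U, \<phi>)\<in>A. \<forall>(V, \<psi>)\<in>A. \<forall>p\<in>U \<inter> V \<inter> S.
        let J = jacobian (\<psi> \<circ> inv_into U \<phi>) (at (\<phi> p) within \<phi> ` (U \<inter> V))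
        in G (U, \<phi>) (\<phi> p) = transpose J ** G (V, \<psi>) (\<psi> p) ** J)"

text \<open>Near the boundary, \<open>G\<close> is \<open>u\<close> to the power \<open>-\<alpha>\<close> times a metric that is smooth and
  nondegenerate up to the boundary.\<close>

definition boundary_blow_up ::
    "'a topology \<Rightarrow> ('a, real ^ 'n::finite option) chart set \<Rightarrow> 'a set \<Rightarrow> ('a \<Rightarrow> real) \<Rightarrow> real \<Rightarrow>
     ('a, 'n option) tensor2 \<Rightarrow> bool" where
  "boundary_blow_up X A W u \<alpha> G \<longleftrightarrow>
     (\<exists>V Gbar. openin X V \<and> boundary A \<subseteq> V \<and> V \<subseteq> W \<and> riemannian_metric_on A V Gbar \<and>
        (\<forall>(U, \<phi>)\<in>A. \<forall>p\<in>U \<inter> V - boundary A.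
           G (U, \<phi>) (\<phi> p) = (u p powr (-\<alpha>)) *\<^sub>R Gbar (U, \<phi>) (\<phi> p)))"

text \<open>The following conditions determine the Riemannian measure uniquely; the boundary is a null
  set.\<close>

definition riemannian_volume ::
    "'a topology \<Rightarrow> ('a, real ^ 'n::finite option) chart set \<Rightarrow> ('a, 'n option) tensor2 \<Rightarrow>
     'a measure \<Rightarrow> bool" where
  "riemannian_volume X A G v \<longleftrightarrow>
     space v = topspace X \<and> sets v = sigma_sets (topspace X) {U. openin X U} \<and>
     emeasure v (boundary A) = 0 \<and>
     (\<forall>(U, \<phi>)\<in>A. \<forall>E\<in>sets v. E \<subseteq> U \<inter> interior_part X A \<longrightarrow>
        emeasure v E = (\<integral>\<^sup>+ y \<in> \<phi> ` E. ennreal (sqrt (det (G (U, \<phi>) y))) \<partial>lborel))"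


section \<open>The Laplace-Beltrami operator\<close>

definition partial_deriv ::
    "'k::finite \<Rightarrow> (real ^ 'k \<Rightarrow> complex) \<Rightarrow> real ^ 'k \<Rightarrow> complex" where
  "partial_deriv i h y = frechet_derivative h (at y) (axis i 1)"

definition coord_laplacian ::
    "(real ^ 'k::finite \<Rightarrow> real ^ 'k ^ 'k) \<Rightarrow> (real ^ 'k \<Rightarrow> complex) \<Rightarrow> real ^ 'k \<Rightarrow> complex" where
  "coord_laplacian G h y =
     - ((1 / sqrt (det (G y))) *\<^sub>R
        (\<Sum>i\<in>UNIV. partial_deriv i
           (\<lambda>z. \<Sum>j\<in>UNIV. (sqrt (det (G z)) * matrix_inv (G z) $ i $ j) *\<^sub>R partial_deriv j h z) y))"

text \<open>At interior points the value does not depend on the chart chosen, by the transformation law of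
  the metric. On the boundary, a null set, the value is set to 0.\<close>

definition laplacian ::
    "('a, real ^ 'n::finite option) chart set \<Rightarrow> ('a, 'n option) tensor2 \<Rightarrow>
     ('a \<Rightarrow> complex) \<Rightarrow> 'a \<Rightarrow> complex" where
  "laplacian A G f p =
     (if p \<in> boundary A then 0
      else let c = (SOME c. c \<in> A \<and> p \<in> fst c)
           in coord_laplacian (G c) (f \<circ> inv_into (fst c) (snd c)) (snd c p))"

definition test_functions ::
    "'a topology \<Rightarrow> ('a, real ^ 'n::finite option) chart set \<Rightarrow> ('a \<Rightarrow> complex) set" where
  "test_functions X A =
     {f. (\<forall>(U, \<phi>)\<in>A. smooth_on (\<phi> ` U) (f \<circ> inv_into U \<phi>)) \<and>
         (\<exists>K. compactin X K \<and> K \<subseteq> interior_part X A \<and> (\<forall>p\<in>topspace X - K. f p = 0))}"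

definition L2 :: "'a measure \<Rightarrow> ('a \<Rightarrow> complex) set" where
  "L2 v = {f. f \<in> borel_measurable v \<and> integrable v (\<lambda>p. (cmod (f p))\<^sup>2)}"

definition L2_inner :: "'a measure \<Rightarrow> ('a \<Rightarrow> complex) \<Rightarrow> ('a \<Rightarrow> complex) \<Rightarrow> complex" where
  "L2_inner v f h = (LINT p|v. f p * cnj (h p))"

text \<open>The lower integral of nonnegative functions is used so that nonintegrable differences do
  not count as small.\<close>

definition L2_tendsto ::
    "'a measure \<Rightarrow> (nat \<Rightarrow> 'a \<Rightarrow> complex) \<Rightarrow> ('a \<Rightarrow> complex) \<Rightarrow> bool" where
  "L2_tendsto v s f \<longleftrightarrow> (\<lambda>k. \<integral>\<^sup>+ p. ennreal ((cmod (s k p - f p))\<^sup>2) \<partial>v) \<longlonglongrightarrow> 0"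

text \<open>The graph of the operator: the closure in \<open>L2 v\<close> of the differential operator on its core of
  smooth functions with compact support away from the boundary.\<close>

definition laplace_graph ::
    "'a topology \<Rightarrow> ('a, real ^ 'n::finite option) chart set \<Rightarrow> ('a, 'n option) tensor2 \<Rightarrow>
     'a measure \<Rightarrow> (('a \<Rightarrow> complex) \<times> ('a \<Rightarrow> complex)) set" where
  "laplace_graph X A G v =
     {(f, h). f \<in> L2 v \<and> h \<in> L2 v \<and>
        (\<exists>s. (\<forall>k. s k \<in> test_functions X A) \<and>
             L2_tendsto v s f \<and> L2_tendsto v (\<lambda>k. laplacian A G (s k)) h)}"

definition orthonormal_basis :: "'a measure \<Rightarrow> (nat \<Rightarrow> 'a \<Rightarrow> complex) \<Rightarrow> bool" where
  "orthonormal_basis v \<phi> \<longleftrightarrow>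
     (\<forall>i. \<phi> i \<in> L2 v) \<and>
     (\<forall>i j. L2_inner v (\<phi> i) (\<phi> j) = (if i = j then 1 else 0)) \<and>
     (\<forall>f\<in>L2 v. L2_tendsto v (\<lambda>N p. \<Sum>j<N. L2_inner v f (\<phi> j) * \<phi> j p) f)"

text \<open>Indices start at 0: \<open>ev j\<close> and \<open>\<phi> j\<close> are the eigenvalue and eigenfunction number \<open>j + 1\<close>.\<close>

definition laplace_eigenbasis ::
    "'a topology \<Rightarrow> ('a, real ^ 'n::finite option) chart set \<Rightarrow> ('a, 'n option) tensor2 \<Rightarrow>
     'a measure \<Rightarrow> (nat \<Rightarrow> real) \<Rightarrow> (nat \<Rightarrow> 'a \<Rightarrow> complex) \<Rightarrow> bool" where
  "laplace_eigenbasis X A G v ev \<phi> \<longleftrightarrow>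
     (\<forall>j. 0 < ev j) \<and> mono ev \<and> orthonormal_basis v \<phi> \<and>
     (\<forall>j. (\<phi> j, \<lambda>p. of_real (ev j) * \<phi> j p) \<in> laplace_graph X A G v)"

text \<open>Since indices start at 0, the terms with number at most \<open>N\<close> are those with \<open>s k < N\<close>.\<close>

definition density_one_subseq :: "(nat \<Rightarrow> nat) \<Rightarrow> bool" where
  "density_one_subseq s \<longleftrightarrow>
     strict_mono s \<and> (\<lambda>N. real (card {k. s k < N}) / real N) \<longlonglongrightarrow> 1"

end

theory Submission
  imports Defs
begin

text \<open>The mass of an eigenfunction in a fixed part of the interior is compared with the number of
  eigenvalues. Let \<open>d = CARD('n) + 1\<close> be the dimension of the manifold, and let
  \<open>E\<close> be a coordinate ball whose closure does not meet the boundary.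

  Upper bound for the mass. In coordinates, \<open>E\<close> is covered by cubes of side
  \<open>r\<close>. On each cube a function is, up to its mean, of the order of \<open>r\<close>
  times its gradient (\<open>grid_Poincare\<close>), and Green's formula controls the gradient on
  \<open>E\<close> by the function and its Laplacian (\<open>coordinate_energy_bound\<close>). The
  means are inner products with about \<open>1 / r ^ d\<close> functions; by Bessel's inequality,
  applied to the orthonormal eigenfunctions, their total contribution to the masses of all
  eigenfunctions is at most \<open>C / r ^ d\<close>. Therefore the masses in \<open>E\<close> of
  the first \<open>N\<close> eigenfunctions add up to at most \<open>C / r ^ d + C * r\<^sup>2 *
  (\<Sum>j<N. 1 + ev j)\<close> (\<open>mass_sum_bound\<close>). With \<open>r\<close> a small
  multiple of \<open>1 / sqrt (ev (N - 1))\<close>, the mean of these masses tends to 0 as soon as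
  \<open>sqrt (ev (N - 1)) ^ d / N\<close> does (\<open>negligible_mean_chart_ball\<close>).

  Lower bound for the number of eigenvalues. What remains is that the number of eigenvalues below
  \<open>\<mu>\<close> grows faster than \<open>sqrt \<mu> ^ d\<close>, which is where the
  singularity enters. At height \<open>h\<close> above the boundary the inverse metric is at most
  of the order of \<open>h powr \<alpha>\<close> (\<open>boundary_chart\<close>), so that a bump
  of radius proportional to \<open>h powr (\<alpha> / 2) / sqrt \<mu>\<close> has Rayleigh
  quotient below \<open>\<mu> / 2\<close>. Once \<open>\<mu>\<close> is large, about \<open>h powr
  (1 - \<alpha> * d / 2) * sqrt \<mu> ^ d\<close> such bumps fit into the layer between the
  heights \<open>h\<close> and \<open>2 * h\<close>. The condition \<open>\<beta> \<ge> 2 /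
  n\<close> means \<open>\<alpha> * d \<ge> 2\<close>; hence every layer contributes at least
  \<open>\<kappa> * sqrt \<mu> ^ d\<close> bumps with the same \<open>\<kappa>\<close>
  (\<open>trial_functions_in_layer\<close>). There are infinitely many disjoint layers, so the
  total exceeds every multiple of \<open>sqrt \<mu> ^ d\<close>. Bumps with disjoint supports are
  counted against eigenvalues by a trace argument (\<open>card_trial_functions_le\<close>). A
  boundary point exists, since on a compact manifold without boundary the constants would have
  eigenvalue 0 (\<open>boundary_nonempty\<close>).

  Conclusion. For each coordinate ball the mean mass of the first \<open>N\<close> eigenfunctions
  tends to 0. By a lemma of Koopman and von Neumann the masses themselves then tend to 0 along a
  subsequence of density one, and one subsequence serves the countably many sets of a base of the
  topology, hence all compact subsets of the interior (\<open>concentration\<close>).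

  Two facts on the Laplacian have to be established beforehand: its value does not depend on the
  chart chosen (\<open>coord_laplacian_transition\<close>), and Green's formula holds on the
  manifold (\<open>Green\<close>). The former follows from the weak form of the operator in a
  chart, the latter by cutting a test function into pieces supported in charts.\<close>

section \<open>Calculus of smooth functions\<close>

lemma Ck_cong_open:
  assumes "open S" and "\<And>x. x \<in> S \<Longrightarrow> f x = g x" and "Ck k f S"
  shows "Ck k g S"
  using assms(2,3)
proof (induction k arbitrary: f g)
  case 0
  then show ?case by (simp cong: continuous_on_cong)
next
  case (Suc k)
  have deriv: "(g has_derivative frechet_derivative f (at x)) (at x)" if "x \<in> S" for x
  proof (rule has_derivative_transform_within_open[OF _ assms(1) that])
    show "(f has_derivative frechet_derivative f (at x)) (at x)"
      using Suc.prems(2) that by (simp add: frechet_derivative_works[symmetric])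
  qed (use Suc.prems(1) in auto)
  then have eq: "frechet_derivative f (at x) v = frechet_derivative g (at x) v" if "x \<in> S" for x v
    using that frechet_derivative_at by metis
  have "Ck k (\<lambda>x. frechet_derivative g (at x) v) S" for v
    by (rule Suc.IH[of "\<lambda>x. frechet_derivative f (at x) v"]) (use eq Suc.prems(2) in auto)
  moreover have "\<forall>x\<in>S. g differentiable (at x)"
    using deriv unfolding differentiable_def by blast
  ultimately show ?case by simp
qed

lemma Ck_subset: "Ck k f S \<Longrightarrow> T \<subseteq> S \<Longrightarrow> Ck k f T"
  by (induction k arbitrary: f) (auto intro: continuous_on_subset)

lemma Ck_Suc_imp_Ck: "Ck (Suc k) f S \<Longrightarrow> Ck k f S"
proof (induction k arbitrary: f)
  case 0
  then show ?case
    by (auto intro!: continuous_at_imp_continuous_on differentiable_imp_continuous_within)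
next
  case (Suc k)
  then show ?case by (metis Ck.simps(2))
qed

lemma Ck_imp_continuous_on: "Ck k f S \<Longrightarrow> continuous_on S f"
proof (induction k)
  case (Suc k)
  then show ?case using Ck_Suc_imp_Ck by blast
qed simp

lemma Ck_local:
  assumes "\<And>x. x \<in> S \<Longrightarrow> \<exists>U. open U \<and> x \<in> U \<and> Ck k f U"
  shows "Ck k f S"
  using assms
proof (induction k arbitrary: f)
  case 0
  then show ?case
    by (meson Ck.simps(1) continuous_at_imp_continuous_on continuous_on_eq_continuous_at)
next
  case (Suc k)
  then show ?case by (metis Ck.simps(2))
qed

lemma smooth_on_iff_Ck:
  assumes "open S"
  shows "smooth_on S f \<longleftrightarrow> (\<forall>k. Ck k f S)"
proof
  assume f: "smooth_on S f"
  show "\<forall>k. Ck k f S"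
  proof
    fix k
    show "Ck k f S"
    proof (rule Ck_local)
      fix x assume "x \<in> S"
      then obtain U h where U: "open U" "x \<in> U" "\<forall>k. Ck k h U" "\<forall>y\<in>S \<inter> U. h y = f y"
        using f unfolding smooth_on_def by metis
      have "Ck k h (S \<inter> U)" using U(3) by (meson Ck_subset inf_le2)
      then have "Ck k f (S \<inter> U)"
        using Ck_cong_open[of "S \<inter> U" h f k] U assms by auto
      then show "\<exists>U. open U \<and> x \<in> U \<and> Ck k f U" using U \<open>x \<in> S\<close> assms by blast
    qed
  qed
next
  assume "\<forall>k. Ck k f S"
  then show "smooth_on S f" unfolding smooth_on_def using assms by blast
qed

lemma smooth_on_subset: "smooth_on S f \<Longrightarrow> T \<subseteq> S \<Longrightarrow> smooth_on T f"
proof -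
  assume f: "smooth_on S f" and "T \<subseteq> S"
  show "smooth_on T f"
    unfolding smooth_on_def
  proof
    fix x assume "x \<in> T"
    then obtain U h where U: "open U" "x \<in> U" "\<forall>k. Ck k h U" "\<forall>y\<in>S \<inter> U. h y = f y"
      using f \<open>T \<subseteq> S\<close> unfolding smooth_on_def by (metis subsetD)
    then have "\<forall>y\<in>T \<inter> U. h y = f y" using \<open>T \<subseteq> S\<close> by auto
    with U show "\<exists>U h. open U \<and> x \<in> U \<and> (\<forall>k. Ck k h U) \<and> (\<forall>y\<in>T \<inter> U. h y = f y)" by blast
  qed
qed

lemma Ck_const [simp]: "Ck k (\<lambda>x. c) S"
proof (induction k arbitrary: c)
  case (Suc k)
  have "frechet_derivative (\<lambda>x. c) (at x) = (\<lambda>v. 0)" for x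
    using frechet_derivative_at[OF has_derivative_const[of c "at x"]] by simp
  then show ?case using Suc[of 0] by simp
qed simp

lemma Ck_bounded_linear:
  assumes "bounded_linear f"
  shows "Ck k f S"
proof (cases k)
  case 0
  then show ?thesis using assms by (simp add: linear_continuous_on)
next
  case (Suc m)
  have "frechet_derivative f (at x) = f" for x
    using assms bounded_linear_imp_has_derivative frechet_derivative_at by metis
  then show ?thesis
    using Suc assms bounded_linear_imp_differentiable by auto
qed

lemma Ck_add:
  assumes "open S" "Ck k f S" "Ck k g S"
  shows "Ck k (\<lambda>x. f x + g x) S"
  using assms(2,3)
proof (induction k arbitrary: f g)
  case 0
  then show ?case by (simp add: continuous_on_add)
next
  case (Suc k)
  have d: "((\<lambda>x. f x + g x) has_derivative
      (\<lambda>v. frechet_derivative f (at x) v + frechet_derivative g (at x) v)) (at x)" if "x \<in> S" for x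
    using Suc.prems that
    by (intro has_derivative_add) (auto simp: frechet_derivative_works[symmetric])
  have "Ck k (\<lambda>x. frechet_derivative (\<lambda>x. f x + g x) (at x) v) S" for v
  proof (rule Ck_cong_open[OF assms(1)])
    show "Ck k (\<lambda>x. frechet_derivative f (at x) v + frechet_derivative g (at x) v) S"
      using Suc by simp
    show "frechet_derivative f (at x) v + frechet_derivative g (at x) v =
      frechet_derivative (\<lambda>x. f x + g x) (at x) v" if "x \<in> S" for x
      using frechet_derivative_at[OF d[OF that]] by metis
  qed
  then show ?case using d by (auto simp: differentiable_def)
qed

lemma Ck_bounded_bilinear:
  assumes "bounded_bilinear bil" "open S" "Ck k f S" "Ck k g S"
  shows "Ck k (\<lambda>x. bil (f x) (g x)) S"
  using assms(3,4)
proof (induction k arbitrary: f g)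
  case 0
  then show ?case using assms(1) by (simp add: bounded_bilinear.continuous_on)
next
  case (Suc k)
  have d: "((\<lambda>x. bil (f x) (g x)) has_derivative
      (\<lambda>v. bil (f x) (frechet_derivative g (at x) v) + bil (frechet_derivative f (at x) v) (g x)))
      (at x)" if "x \<in> S" for x
    using Suc.prems that
    by (intro bounded_bilinear.FDERIV[OF assms(1)]) (auto simp: frechet_derivative_works[symmetric])
  have "Ck k (\<lambda>x. frechet_derivative (\<lambda>x. bil (f x) (g x)) (at x) v) S" for v
  proof (rule Ck_cong_open[OF assms(2)])
    show "Ck k (\<lambda>x. bil (f x) (frechet_derivative g (at x) v) +
       bil (frechet_derivative f (at x) v) (g x)) S"
      using Suc.prems Ck_Suc_imp_Ck[OF Suc.prems(1)] Ck_Suc_imp_Ck[OF Suc.prems(2)]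
      by (intro Ck_add assms Suc.IH) auto
    show "bil (f x) (frechet_derivative g (at x) v) + bil (frechet_derivative f (at x) v) (g x) =
      frechet_derivative (\<lambda>x. bil (f x) (g x)) (at x) v" if "x \<in> S" for x
      using frechet_derivative_at[OF d[OF that]] by metis
  qed
  then show ?case using d by (auto simp: differentiable_def)
qed

lemmas Ck_mult = Ck_bounded_bilinear[OF bounded_bilinear_mult]
lemmas Ck_scaleR = Ck_bounded_bilinear[OF bounded_bilinear_scaleR]

lemma Ck_sum:
  assumes "open S" "\<And>i. i \<in> I \<Longrightarrow> Ck k (f i) S"
  shows "Ck k (\<lambda>x. \<Sum>i\<in>I. f i x) S"
  using assms(2) by (induction I rule: infinite_finite_induct) (auto intro: Ck_add[OF assms(1)])

lemma Ck_prod: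
  fixes f :: "'i \<Rightarrow> 'a::real_normed_vector \<Rightarrow> 'b::{real_normed_field}"
  assumes "open S" "\<And>i. i \<in> I \<Longrightarrow> Ck k (f i) S"
  shows "Ck k (\<lambda>x. \<Prod>i\<in>I. f i x) S"
  using assms(2) by (induction I rule: infinite_finite_induct) (auto intro: Ck_mult[OF assms(1)])

lemma Ck_linear_compose:
  assumes "bounded_linear L" "Ck k f S" "open S"
  shows "Ck k (\<lambda>x. L (f x)) S"
  using assms(2)
proof (induction k arbitrary: f)
  case 0
  then show ?case using assms(1) by (simp add: bounded_linear.continuous_on)
next
  case (Suc k)
  have d: "((\<lambda>x. L (f x)) has_derivative (\<lambda>v. L (frechet_derivative f (at x) v))) (at x)" if "x \<in> S" for x
    using Suc.prems that
    by (intro bounded_linear.has_derivative[OF assms(1)]) (auto simp: frechet_derivative_works[symmetric])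
  have "Ck k (\<lambda>x. frechet_derivative (\<lambda>x. L (f x)) (at x) v) S" for v
    using Suc by (intro Ck_cong_open[OF assms(3) _ Suc.IH]) (auto simp: frechet_derivative_at[OF d, symmetric])
  then show ?case using d by (auto simp: differentiable_def)
qed

lemma Ck_diff:
  assumes "open S" "Ck k f S" "Ck k g S"
  shows "Ck k (\<lambda>x. f x - g x) S"
  using Ck_add[OF assms(1,2) Ck_linear_compose[OF bounded_linear_minus[OF bounded_linear_ident] assms(3,1)]]
  by simp

text \<open>The chain rule in coordinates; the derivative is expanded along a basis so that the
  induction hypothesis applies to each term.\<close>

lemma Ck_compose:
  fixes g :: "'a::real_normed_vector \<Rightarrow> 'b::euclidean_space" and f :: "'b \<Rightarrow> 'c::real_normed_vector"
  assumes "open S" "open T" "g ` S \<subseteq> T" "Ck k f T" "Ck k g S"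
  shows "Ck k (\<lambda>x. f (g x)) S"
  using assms(4,5)
proof (induction k arbitrary: f)
  case 0
  then show ?case using assms(3) by (simp add: continuous_on_compose2)
next
  case (Suc k)
  have d: "((\<lambda>x. f (g x)) has_derivative
      (\<lambda>v. frechet_derivative f (at (g x)) (frechet_derivative g (at x) v))) (at x)" if "x \<in> S" for x
    using Suc.prems that assms(3)
    by (intro has_derivative_compose[where g = f and f = g])
       (auto simp: frechet_derivative_works[symmetric])
  have "Ck k (\<lambda>x. frechet_derivative (\<lambda>x. f (g x)) (at x) v) S" for v
  proof (rule Ck_cong_open[OF assms(1)])
    show "Ck k (\<lambda>x. \<Sum>b\<in>Basis. (frechet_derivative g (at x) v \<bullet> b) *\<^sub>R frechet_derivative f (at (g x)) b) S"
    proof (intro Ck_sum Ck_scaleR assms(1))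
      show "Ck k (\<lambda>x. frechet_derivative g (at x) v \<bullet> b) S" for b
        using Suc.prems
        by (intro Ck_linear_compose[where L = "\<lambda>z. z \<bullet> b"] assms(1) bounded_linear_inner_left) auto
      show "Ck k (\<lambda>x. frechet_derivative f (at (g x)) b) S" for b
        using Suc.prems Ck_Suc_imp_Ck[OF Suc.prems(2)]
        by (intro Suc.IH[of "\<lambda>y. frechet_derivative f (at y) b"]) auto
    qed
    fix x assume x: "x \<in> S"
    have "bounded_linear (frechet_derivative f (at (g x)))"
      using Suc.prems x assms(3) frechet_derivative_works has_derivative_bounded_linear by fastforce
    then interpret bl: bounded_linear "frechet_derivative f (at (g x))" .
    have "frechet_derivative f (at (g x)) (frechet_derivative g (at x) v) =
      frechet_derivative f (at (g x)) (\<Sum>b\<in>Basis. (frechet_derivative g (at x) v \<bullet> b) *\<^sub>R b)"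
      by (simp add: euclidean_representation)
    also have "\<dots> = (\<Sum>b\<in>Basis. (frechet_derivative g (at x) v \<bullet> b) *\<^sub>R frechet_derivative f (at (g x)) b)"
      by (simp add: bl.sum bl.scaleR)
    finally show "(\<Sum>b\<in>Basis. (frechet_derivative g (at x) v \<bullet> b) *\<^sub>R frechet_derivative f (at (g x)) b) =
      frechet_derivative (\<lambda>x. f (g x)) (at x) v"
      using frechet_derivative_at[OF d[OF x]] by metis
  qed
  then show ?case using d by (auto simp: differentiable_def)
qed

text \<open>For functions such as the inverse or the square root, whose derivative is an expression
  in the function itself, this turns smoothness into an induction on the order.\<close>

lemma Ck_SucI:
  assumes "open S" "\<And>x. x \<in> S \<Longrightarrow> (f has_derivative f' x) (at x)" "\<And>v. Ck k (\<lambda>x. f' x v) S"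
  shows "Ck (Suc k) f S"
proof -
  have "Ck k (\<lambda>x. frechet_derivative f (at x) v) S" for v
    using assms by (intro Ck_cong_open[OF assms(1) _ assms(3)[of v]]) (use frechet_derivative_at[OF assms(2)] in metis)
  then show ?thesis using assms(2) by (auto simp: differentiable_def)
qed

lemma Ck_inverse: "Ck k (inverse :: real \<Rightarrow> real) (- {0})"
proof (induction k)
  case 0
  then show ?case by (auto intro!: continuous_intros)
next
  case (Suc k)
  show ?case
  proof (rule Ck_SucI[where f' = "\<lambda>x v. - (inverse x * v * inverse x)"])
    show "Ck k (\<lambda>x. - (inverse x * v * inverse x)) (- {0})" for v :: real
      by (rule Ck_linear_compose[where L = uminus, OF bounded_linear_minus[OF bounded_linear_ident]],
          rule Ck_mult[OF _ Ck_mult[OF _ Suc Ck_const] Suc]) auto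
  qed (auto intro: has_derivative_inverse')
qed

lemma Ck_sqrt: "Ck k sqrt {0<..}"
proof (induction k)
  case 0
  then show ?case by (auto intro!: continuous_intros)
next
  case (Suc k)
  show ?case
  proof (intro Ck_SucI[where f' = "\<lambda>x v. v * (inverse (sqrt x) / 2)"])
    show "Ck k (\<lambda>x. v * (inverse (sqrt x) / 2)) {0<..}" for v
      by (rule Ck_mult[OF _ Ck_const Ck_linear_compose[OF bounded_linear_divide
            Ck_compose[where f = inverse, OF _ _ _ Ck_inverse Suc]]]) auto
  qed (auto intro!: derivative_eq_intros simp: field_simps)
qed

section \<open>Smooth cutoff functions\<close>

text \<open>With \<open>m = 0\<close> this is the standard example of a smooth function that is flat
  at 0. The factors \<open>inverse t ^ m\<close> make the family closed under differentiation up to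
  linear combinations, so that smoothness of all members is proved by one induction.\<close>

definition flat_exp :: "nat \<Rightarrow> real \<Rightarrow> real" where
  "flat_exp m t = (if t > 0 then inverse t ^ m * exp (- inverse t) else 0)"

lemma flat_exp_tendsto_0: "(flat_exp m \<longlongrightarrow> 0) (at 0)"
proof -
  have "((\<lambda>t::real. inverse t ^ m * exp (- inverse t)) \<longlongrightarrow> 0) (at_right 0)"
  proof -
    have "((\<lambda>x::real. x ^ m / exp x) \<longlongrightarrow> 0) at_top" by (rule tendsto_power_div_exp_0)
    then have "((\<lambda>t::real. inverse t ^ m / exp (inverse t)) \<longlongrightarrow> 0) (at_right 0)"
      using filterlim_compose[OF _ filterlim_inverse_at_top_right] by blast
    then show ?thesis by (simp add: exp_minus field_simps)
  qed
  then have "(flat_exp m \<longlongrightarrow> 0) (at_right 0)"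
    by (rule Lim_transform_eventually) (auto simp: flat_exp_def eventually_at_filter)
  moreover have "(flat_exp m \<longlongrightarrow> 0) (at_left 0)"
    by (rule Lim_transform_eventually[where f = "\<lambda>_. 0"]) (auto simp: flat_exp_def eventually_at_filter)
  ultimately show ?thesis by (simp add: filterlim_split_at)
qed

lemma flat_exp_has_derivative:
  "(flat_exp m has_real_derivative (flat_exp (m + 2) t - real m * flat_exp (m + 1) t)) (at t)"
proof -
  consider "t > 0" | "t = 0" | "t < 0" by linarith
  then show ?thesis
  proof cases
    case 1
    have "((\<lambda>t. inverse t ^ m * exp (- inverse t)) has_real_derivative
      (flat_exp (m + 2) t - real m * flat_exp (m + 1) t)) (at t)"
    proof -
      have "((\<lambda>t. inverse t ^ m * exp (- inverse t)) has_real_derivative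
        (real m * (inverse t ^ (m - 1) * - (inverse t)\<^sup>2)) * exp (- inverse t)
          + (exp (- inverse t) * (inverse t)\<^sup>2) * inverse t ^ m) (at t)"
        using 1 by (intro DERIV_mult DERIV_power DERIV_fun_exp)
          (auto intro!: derivative_eq_intros simp: power2_eq_square)
      moreover have "(real m * (inverse t ^ (m - 1) * - (inverse t)\<^sup>2)) * exp (- inverse t)
          + (exp (- inverse t) * (inverse t)\<^sup>2) * inverse t ^ m =
          flat_exp (m + 2) t - real m * flat_exp (m + 1) t"
        using 1 by (cases m) (simp_all add: flat_exp_def power2_eq_square algebra_simps)
      ultimately show ?thesis by simp
    qed
    then show ?thesis
      by (rule has_field_derivative_transform_within_open[where S = "{0<..}"]) (use 1 in \<open>auto simp: flat_exp_def\<close>)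
  next
    case 2
    have "((\<lambda>h. (flat_exp m (0 + h) - flat_exp m 0) / h) \<longlongrightarrow> 0) (at 0)"
      by (rule Lim_transform_eventually[OF flat_exp_tendsto_0[of "Suc m"]])
         (auto simp: flat_exp_def eventually_at_filter field_simps)
    then show ?thesis using 2 by (simp add: DERIV_def flat_exp_def)
  next
    case 3
    have "((\<lambda>t. 0) has_real_derivative (flat_exp (m + 2) t - real m * flat_exp (m + 1) t)) (at t)"
      using 3 by (simp add: flat_exp_def)
    then show ?thesis
      by (rule has_field_derivative_transform_within_open[where S = "{..<0}"]) (use 3 in \<open>auto simp: flat_exp_def\<close>)
  qed
qed

lemma Ck_flat_exp: "Ck k (flat_exp m) UNIV"
proof (induction k arbitrary: m)
  case 0
  have "\<forall>t. isCont (flat_exp m) t" using flat_exp_has_derivative DERIV_isCont by blast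
  then show ?case by (simp add: continuous_at_imp_continuous_on)
next
  case (Suc k)
  show ?case
  proof (rule Ck_SucI[where f' = "\<lambda>t v. (flat_exp (m + 2) t - real m * flat_exp (m + 1) t) * v"])
    show "Ck k (\<lambda>t. (flat_exp (m + 2) t - real m * flat_exp (m + 1) t) * v) UNIV" for v
      by (rule Ck_mult[OF open_UNIV Ck_diff[OF open_UNIV Suc Ck_mult[OF open_UNIV Ck_const Suc]] Ck_const])
  qed (use flat_exp_has_derivative[of m] in \<open>auto simp: has_field_derivative_def\<close>)
qed

text \<open>A smooth function equal to 1 on the ball of radius 1 and vanishing outside the ball of
  radius 2.\<close>

definition plateau :: "'a::euclidean_space \<Rightarrow> real" where
  "plateau x = flat_exp 0 (4 - x \<bullet> x) * inverse (flat_exp 0 (4 - x \<bullet> x) + flat_exp 0 (x \<bullet> x - 1))"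

lemma flat_exp_pos: "t > 0 \<Longrightarrow> flat_exp m t > 0"
  and flat_exp_nonneg: "flat_exp m t \<ge> 0"
  and flat_exp_zero: "t \<le> 0 \<Longrightarrow> flat_exp m t = 0"
  by (auto simp: flat_exp_def)

lemma plateau_denominator_pos: "flat_exp 0 (4 - t) + flat_exp 0 (t - 1) > 0"
  using flat_exp_pos[of "4 - t" 0] flat_exp_pos[of "t - 1" 0] flat_exp_nonneg[of 0 "4 - t"]
    flat_exp_nonneg[of 0 "t - 1"] by (cases "t < 4") linarith+

lemma Ck_plateau: "Ck k plateau UNIV"
proof -
  have sq: "Ck k (\<lambda>x::'a. x \<bullet> x) UNIV"
    by (rule Ck_bounded_bilinear[OF bounded_bilinear_inner open_UNIV])
      (rule Ck_bounded_linear[OF bounded_linear_ident])+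
  have 1: "Ck k (\<lambda>x::'a. flat_exp 0 (4 - x \<bullet> x)) UNIV"
    by (rule Ck_compose[OF open_UNIV open_UNIV _ Ck_flat_exp Ck_diff[OF open_UNIV Ck_const sq]]) simp
  have 2: "Ck k (\<lambda>x::'a. flat_exp 0 (x \<bullet> x - 1)) UNIV"
    by (rule Ck_compose[OF open_UNIV open_UNIV _ Ck_flat_exp Ck_diff[OF open_UNIV sq Ck_const]]) simp
  have "flat_exp 0 (4 - t) + flat_exp 0 (t - 1) \<noteq> 0" for t
    using plateau_denominator_pos[of t] by linarith
  then have "Ck k (\<lambda>x::'a. inverse (flat_exp 0 (4 - x \<bullet> x) + flat_exp 0 (x \<bullet> x - 1))) UNIV"
    by (intro Ck_compose[OF open_UNIV _ _ Ck_inverse Ck_add[OF open_UNIV 1 2]]) auto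
  then show ?thesis
    unfolding plateau_def[abs_def] by (intro Ck_mult[OF open_UNIV 1])
qed

lemma plateau_eq_1: "norm x \<le> 1 \<Longrightarrow> plateau x = 1"
proof -
  assume "norm x \<le> 1"
  then have "x \<bullet> x \<le> 1" by (simp add: dot_square_norm power_le_one)
  then show ?thesis using flat_exp_pos[of "4 - x \<bullet> x" 0] by (simp add: plateau_def flat_exp_zero)
qed

lemma plateau_eq_0: "norm x \<ge> 2 \<Longrightarrow> plateau x = 0"
proof -
  assume "norm x \<ge> 2"
  then have "x \<bullet> x \<ge> 4" using power_mono[of 2 "norm x" 2] by (simp add: dot_square_norm)
  then show ?thesis by (simp add: plateau_def flat_exp_zero)
qed

lemma plateau_nonneg: "plateau x \<ge> 0"
  unfolding plateau_def using plateau_denominator_pos[of "x \<bullet> x"] by (simp add: flat_exp_nonneg)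

lemma plateau_le_1: "plateau x \<le> 1"
  unfolding plateau_def using plateau_denominator_pos[of "x \<bullet> x"] flat_exp_nonneg[of 0 "x \<bullet> x - 1"]
  by (simp add: field_simps)

section \<open>Smooth functions with compact support on Euclidean space\<close>

lemma frechet_derivative_zero_outside:
  fixes F :: "'a::real_normed_vector \<Rightarrow> 'b::real_normed_vector"
  assumes "closed T" "\<And>x. x \<notin> T \<Longrightarrow> F x = 0" "x \<notin> T"
  shows "frechet_derivative F (at x) = (\<lambda>v. 0)"
proof -
  have "(F has_derivative (\<lambda>v. 0)) (at x)"
    by (rule has_derivative_transform_within_open[where s = "- T" and f = "\<lambda>x. 0"])
      (use assms in auto)
  then show ?thesis using frechet_derivative_at by metis
qed

lemma continuous_compact_support_bounded:
  fixes F :: "'a::real_normed_vector \<Rightarrow> 'b::real_normed_vector"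
  assumes "compact T" "\<And>x. x \<notin> T \<Longrightarrow> F x = 0" "continuous_on T F"
  shows "\<exists>M\<ge>0. \<forall>x. norm (F x) \<le> M"
proof -
  have "bounded (F ` T)" using assms(1,3) compact_continuous_image compact_imp_bounded by blast
  then obtain M where "\<forall>x\<in>T. norm (F x) \<le> M" unfolding bounded_iff by auto
  then have "norm (F x) \<le> max M 0" for x using assms(2)[of x] by (cases "x \<in> T") auto
  then show ?thesis by (meson max.cobounded2)
qed

lemma continuous_compact_support_integrable:
  fixes F :: "'a::euclidean_space \<Rightarrow> 'b::{banach, second_countable_topology}"
  assumes "compact T" "\<And>x. x \<notin> T \<Longrightarrow> F x = 0" "continuous_on T F"
  shows "integrable lborel F"
proof -
  have "integrable lborel (\<lambda>x. indicator T x *\<^sub>R F x)"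
    by (rule borel_integrable_compact[OF assms(1,3)])
  also have "(\<lambda>x. indicator T x *\<^sub>R F x) = F" using assms(2) by (auto simp: indicator_def)
  finally show ?thesis .
qed

lemma integral_lborel_shift:
  fixes F :: "'a::euclidean_space \<Rightarrow> 'b::{banach, second_countable_topology}"
  assumes "F \<in> borel_measurable borel"
  shows "(LINT y|lborel. F (y + h)) = (LINT y|lborel. F y)"
proof -
  have "(LINT y|lborel. F y) = (LINT y|distr lborel borel ((+) h). F y)"
    by (simp add: lborel_distr_plus)
  also have "\<dots> = (LINT y|lborel. F (h + y))" using assms by (subst integral_distr) auto
  finally show ?thesis by (simp add: add.commute)
qed

lemma nn_integral_lborel_shift:
  fixes F :: "'a::euclidean_space \<Rightarrow> ennreal"
  assumes "F \<in> borel_measurable borel"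
  shows "(\<integral>\<^sup>+ y. F (y + h) \<partial>lborel) = (\<integral>\<^sup>+ y. F y \<partial>lborel)"
proof -
  have "(\<integral>\<^sup>+ y. F y \<partial>lborel) = (\<integral>\<^sup>+ y. F y \<partial>distr lborel borel ((+) h))"
    by (simp add: lborel_distr_plus)
  also have "\<dots> = (\<integral>\<^sup>+ y. F (h + y) \<partial>lborel)" using assms by (subst nn_integral_distr) auto
  finally show ?thesis by (simp add: add.commute)
qed

locale compactly_supported_C1 =
  fixes F :: "'a::euclidean_space \<Rightarrow> 'b::euclidean_space" and T :: "'a set"
  assumes C1: "Ck 1 F UNIV" and compact_T: "compact T" and zero: "\<And>x. x \<notin> T \<Longrightarrow> F x = 0"
begin

lemma has_derivative: "(F has_derivative frechet_derivative F (at x)) (at x)"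
  using C1 by (auto simp: frechet_derivative_works[symmetric])

lemma continuous: "continuous_on S F"
  using C1 Ck_imp_continuous_on continuous_on_subset by blast

lemma continuous_derivative: "continuous_on S (\<lambda>x. frechet_derivative F (at x) v)"
  using C1 continuous_on_subset[of UNIV] by auto

lemma integrable: "integrable lborel F"
  by (rule continuous_compact_support_integrable[OF compact_T zero continuous])

lemma measurable [measurable]: "F \<in> borel_measurable borel"
  by (rule borel_measurable_continuous_onI[OF continuous])

lemma derivative_zero: "x \<notin> T \<Longrightarrow> frechet_derivative F (at x) v = 0"
  using frechet_derivative_zero_outside[OF compact_imp_closed[OF compact_T] zero] by simp

text \<open>The difference quotients of \<open>F\<close> are bounded by a constant, and by
  \<open>quotient_support\<close> they vanish outside a common compact set; this is what dominated
  convergence needs below.\<close>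

lemma quotient_bound:
  shows "\<exists>M\<ge>0. \<forall>y t. norm (F (y + t *\<^sub>R h) - F y) \<le> M * \<bar>t\<bar>"
proof -
  obtain M where M: "M \<ge> 0" "\<And>x. norm (frechet_derivative F (at x) h) \<le> M"
    using continuous_compact_support_bounded[OF compact_T derivative_zero continuous_derivative] by blast
  have "norm (F (y + t *\<^sub>R h) - F y) \<le> M * \<bar>t\<bar>" for y t
  proof -
    have d: "((\<lambda>s. F (y + s *\<^sub>R h)) has_derivative (\<lambda>s. s *\<^sub>R frechet_derivative F (at (y + x *\<^sub>R h)) h))
       (at x)" for x
    proof -
      have "((\<lambda>s. F (y + s *\<^sub>R h)) has_derivative (\<lambda>s. frechet_derivative F (at (y + x *\<^sub>R h)) (s *\<^sub>R h)))
       (at x)"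
        by (rule has_derivative_compose[OF _ has_derivative]) (auto intro!: derivative_eq_intros)
      then show ?thesis using has_derivative_bounded_linear[OF has_derivative]
        by (simp add: linear_simps)
    qed
    have "norm (F (y + t *\<^sub>R h) - F (y + 0 *\<^sub>R h)) \<le> M * norm (t - 0)"
    proof (rule differentiable_bound[where S = UNIV and f = "\<lambda>s. F (y + s *\<^sub>R h)"])
      show "onorm (\<lambda>s::real. s *\<^sub>R frechet_derivative F (at (y + x *\<^sub>R h)) h) \<le> M" for x
      proof (rule onorm_le)
        fix s :: real
        show "norm (s *\<^sub>R frechet_derivative F (at (y + x *\<^sub>R h)) h) \<le> M * norm s"
          using mult_right_mono[OF M(2)[of "y + x *\<^sub>R h"], of "\<bar>s\<bar>"] by (simp add: mult.commute)
      qed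
    qed (use d in auto)
    then show ?thesis by simp
  qed
  then show ?thesis using M(1) by blast
qed

lemma quotient_tendsto:
  "(\<lambda>n. real (Suc n) *\<^sub>R (F (y + inverse (real (Suc n)) *\<^sub>R h) - F y)) \<longlonglongrightarrow> frechet_derivative F (at y) h"
proof -
  let ?t = "\<lambda>n. inverse (real (Suc n))"
  have bl: "bounded_linear (frechet_derivative F (at y))"
    using has_derivative_bounded_linear[OF has_derivative] .
  have "((\<lambda>t. F (y + t *\<^sub>R h)) has_derivative (\<lambda>t. frechet_derivative F (at (y + 0 *\<^sub>R h)) (t *\<^sub>R h))) (at 0)"
    by (rule has_derivative_compose[OF _ has_derivative]) (auto intro!: derivative_eq_intros)
  then have "((\<lambda>t. norm (F (y + t *\<^sub>R h) - F y - t *\<^sub>R frechet_derivative F (at y) h) / norm t) \<longlongrightarrow> 0) (at 0)"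
    using bl by (simp add: linear_simps has_derivative_at)
  moreover have "filterlim ?t (at 0) sequentially"
    unfolding filterlim_at using LIMSEQ_inverse_real_of_nat by simp
  ultimately have "(\<lambda>n. norm (F (y + ?t n *\<^sub>R h) - F y - ?t n *\<^sub>R frechet_derivative F (at y) h) / norm (?t n)) \<longlonglongrightarrow> 0"
    by (rule filterlim_compose)
  moreover have "norm (F (y + ?t n *\<^sub>R h) - F y - ?t n *\<^sub>R frechet_derivative F (at y) h) / norm (?t n) =
    norm (real (Suc n) *\<^sub>R (F (y + ?t n *\<^sub>R h) - F y) - frechet_derivative F (at y) h)" for n
  proof -
    have "real (Suc n) *\<^sub>R (F (y + ?t n *\<^sub>R h) - F y) - frechet_derivative F (at y) h =
      real (Suc n) *\<^sub>R (F (y + ?t n *\<^sub>R h) - F y - ?t n *\<^sub>R frechet_derivative F (at y) h)"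
      by (simp add: scaleR_right_diff_distrib del: of_nat_Suc)
    then show ?thesis by (simp add: divide_inverse del: of_nat_Suc)
  qed
  ultimately have "(\<lambda>n. norm (real (Suc n) *\<^sub>R (F (y + ?t n *\<^sub>R h) - F y) - frechet_derivative F (at y) h)) \<longlonglongrightarrow> 0"
    by (simp only:)
  then show ?thesis by (rule LIM_zero_cancel[OF tendsto_norm_zero_cancel])
qed

lemma quotient_support:
  "\<exists>T'. compact T' \<and> (\<forall>y t. y \<notin> T' \<longrightarrow> \<bar>t\<bar> \<le> 1 \<longrightarrow> F (y + t *\<^sub>R h) - F y = 0)"
proof -
  obtain R where R: "\<And>x. x \<in> T \<Longrightarrow> norm x \<le> R"
    using compact_imp_bounded[OF compact_T] unfolding bounded_iff by blast
  have "F (y + t *\<^sub>R h) - F y = 0" if "y \<notin> cball 0 (R + norm h)" "\<bar>t\<bar> \<le> 1" for y t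
  proof -
    have "norm y > R + norm h" using that by simp
    moreover have "norm y - norm (t *\<^sub>R h) \<le> norm (y + t *\<^sub>R h)" by (rule norm_diff_ineq)
    moreover have "norm (t *\<^sub>R h) \<le> norm h" using that(2) by (simp add: mult_left_le_one_le)
    moreover have "0 \<le> norm h" by simp
    ultimately have "\<not> norm (y + t *\<^sub>R h) \<le> R" "\<not> norm y \<le> R" by linarith+
    then show ?thesis using R zero by (metis diff_self)
  qed
  then show ?thesis by (meson compact_cball)
qed

text \<open>Translation invariance makes the integral of each difference quotient vanish; dominated
  convergence carries this over to the derivative.\<close>

lemma integral_derivative: "(LINT y|lborel. frechet_derivative F (at y) h) = 0"
proof -
  let ?t = "\<lambda>n. inverse (real (Suc n))"
  let ?q = "\<lambda>n y. real (Suc n) *\<^sub>R (F (y + ?t n *\<^sub>R h) - F y)"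
  obtain M where M: "M \<ge> 0" "\<And>y t. norm (F (y + t *\<^sub>R h) - F y) \<le> M * \<bar>t\<bar>"
    using quotient_bound by blast
  obtain T' where T': "compact T'" "\<And>y t. y \<notin> T' \<Longrightarrow> \<bar>t\<bar> \<le> 1 \<Longrightarrow> F (y + t *\<^sub>R h) - F y = 0"
    using quotient_support by blast
  have q: "norm (?q n y) \<le> M * indicator T' y" for n y
  proof (cases "y \<in> T'")
    case True
    have "norm (?q n y) = real (Suc n) * norm (F (y + ?t n *\<^sub>R h) - F y)" by (simp del: of_nat_Suc)
    also have "\<dots> \<le> real (Suc n) * (M * \<bar>?t n\<bar>)" by (intro mult_left_mono M) auto
    also have "\<dots> = M" by (simp del: of_nat_Suc)
    finally show ?thesis using True by simp
  next
    case False
    have "\<bar>?t n\<bar> \<le> 1" by (simp add: inverse_le_1_iff)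
    then show ?thesis using T'(2)[OF False, of "?t n"] False by simp
  qed
  have shift: "integrable lborel (\<lambda>y. F (y + c))" for c
  proof -
    have "integrable (distr lborel borel ((+) c)) F" using integrable by (simp add: lborel_distr_plus)
    then have "integrable lborel (\<lambda>y. F (c + y))" by (subst (asm) integrable_distr_eq) auto
    then show ?thesis by (simp add: add.commute)
  qed
  have "(LINT y|lborel. ?q n y) = 0" for n
  proof -
    have "(LINT y|lborel. ?q n y) = real (Suc n) *\<^sub>R ((LINT y|lborel. F (y + ?t n *\<^sub>R h)) - (LINT y|lborel. F y))"
      using shift integrable by (subst integral_scaleR_right) (auto simp: Bochner_Integration.integral_diff)
    then show ?thesis by (simp add: integral_lborel_shift)
  qed
  moreover have "(\<lambda>n. LINT y|lborel. ?q n y) \<longlonglongrightarrow> (LINT y|lborel. frechet_derivative F (at y) h)"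
  proof (rule integral_dominated_convergence[where w = "\<lambda>y. M * indicator T' y"])
    show "(\<lambda>y. frechet_derivative F (at y) h) \<in> borel_measurable lborel"
      using borel_measurable_continuous_onI[OF continuous_derivative] by simp
    show "integrable lborel (\<lambda>y. M * indicator T' y)"
      using T'(1) by (intro integrable_mult_right integrable_real_indicator)
        (use emeasure_compact_finite[OF T'(1)] in \<open>auto simp: borel_compact\<close>)
    show "AE y in lborel. norm (?q n y) \<le> M * indicator T' y" for n
      using q[of n] by (intro AE_I2) simp
    show "AE y in lborel. (\<lambda>n. ?q n y) \<longlonglongrightarrow> frechet_derivative F (at y) h"
      by (intro AE_I2 quotient_tendsto)
  qed simp
  ultimately have "(\<lambda>n::nat. 0) \<longlonglongrightarrow> (LINT y|lborel. frechet_derivative F (at y) h)"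
    by (simp only:)
  then show ?thesis by (rule LIMSEQ_unique[OF _ tendsto_const])
qed

lemma shift_difference_integrable: "integrable lborel (\<lambda>y. (norm (F (y + h) - F y))\<^sup>2)"
proof -
  obtain T' where T': "compact T'" "\<And>y t. y \<notin> T' \<Longrightarrow> \<bar>t\<bar> \<le> 1 \<Longrightarrow> F (y + t *\<^sub>R h) - F y = 0"
    using quotient_support by blast
  have 1: "(norm (F (x + h) - F x))\<^sup>2 = 0" if "x \<notin> T'" for x
    using T'(2)[OF that, of 1] by simp
  have 2: "continuous_on T' (\<lambda>y. (norm (F (y + h) - F y))\<^sup>2)"
    by (intro continuous_intros continuous_on_compose2[OF continuous[of UNIV]]) (auto intro: continuous)
  show ?thesis by (rule continuous_compact_support_integrable[OF T'(1) 1 2])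
qed

text \<open>The shift by \<open>h\<close> is split into \<open>n + 1\<close> equal small shifts. By
  the Cauchy-Schwarz inequality and translation invariance the left-hand side is at most the
  integral of the squared difference quotient with step \<open>1 / (n + 1)\<close>, which tends to
  the right-hand side.\<close>

lemma integral_shift_difference:
  "(LINT y|lborel. (norm (F (y + h) - F y))\<^sup>2) \<le> (LINT y|lborel. (norm (frechet_derivative F (at y) h))\<^sup>2)"
proof -
  let ?t = "\<lambda>n. inverse (real (Suc n))"
  let ?q = "\<lambda>n y. (norm (real (Suc n) *\<^sub>R (F (y + ?t n *\<^sub>R h) - F y)))\<^sup>2"
  obtain M where M: "M \<ge> 0" "\<And>y t. norm (F (y + t *\<^sub>R h) - F y) \<le> M * \<bar>t\<bar>"
    using quotient_bound by blast
  obtain T' where T': "compact T'" "\<And>y t. y \<notin> T' \<Longrightarrow> \<bar>t\<bar> \<le> 1 \<Longrightarrow> F (y + t *\<^sub>R h) - F y = 0"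
    using quotient_support by blast
  have q: "?q n y \<le> M\<^sup>2 * indicator T' y" for n y
  proof (cases "y \<in> T'")
    case True
    have "norm (real (Suc n) *\<^sub>R (F (y + ?t n *\<^sub>R h) - F y)) = real (Suc n) * norm (F (y + ?t n *\<^sub>R h) - F y)"
      by (simp del: of_nat_Suc)
    also have "\<dots> \<le> real (Suc n) * (M * \<bar>?t n\<bar>)" by (intro mult_left_mono M) auto
    also have "\<dots> = M" by (simp del: of_nat_Suc)
    finally show ?thesis using True by (simp add: power_mono del: of_nat_Suc)
  next
    case False
    have "\<bar>?t n\<bar> \<le> 1" by (simp add: inverse_le_1_iff)
    then show ?thesis using T'(2)[OF False, of "?t n"] False by simp
  qed
  have lim: "(\<lambda>n. LINT y|lborel. ?q n y) \<longlonglongrightarrow> (LINT y|lborel. (norm (frechet_derivative F (at y) h))\<^sup>2)"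
  proof (rule integral_dominated_convergence[where w = "\<lambda>y. M\<^sup>2 * indicator T' y"])
    show "(\<lambda>y. (norm (frechet_derivative F (at y) h))\<^sup>2) \<in> borel_measurable lborel"
      using borel_measurable_continuous_onI[OF continuous_derivative] by simp
    show "integrable lborel (\<lambda>y. M\<^sup>2 * indicator T' y)"
      using T'(1) by (intro integrable_mult_right integrable_real_indicator)
        (use emeasure_compact_finite[OF T'(1)] in \<open>auto simp: borel_compact\<close>)
    show "AE y in lborel. (\<lambda>n. ?q n y) \<longlonglongrightarrow> (norm (frechet_derivative F (at y) h))\<^sup>2"
      by (intro AE_I2 tendsto_power tendsto_norm quotient_tendsto)
    show "AE y in lborel. norm (?q n y) \<le> M\<^sup>2 * indicator T' y" for n
      using q[of n] by (intro AE_I2) simp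
  qed simp
  moreover have "(LINT y|lborel. (norm (F (y + h) - F y))\<^sup>2) \<le> (LINT y|lborel. ?q n y)" for n
  proof -
    let ?m = "Suc n"
    let ?d = "\<lambda>y. F (y + ?t n *\<^sub>R h) - F y"
    \<comment> \<open>Telescoping sum over the \<open>?m\<close> small shifts.\<close>
    have "(norm (F (y + h) - F y))\<^sup>2 \<le> real ?m * (\<Sum>k<?m. (norm (?d (y + (real k * ?t n) *\<^sub>R h)))\<^sup>2)" for y
    proof -
      have "F (y + (real j * ?t n) *\<^sub>R h) - F y = (\<Sum>k<j. ?d (y + (real k * ?t n) *\<^sub>R h))" for j
      proof (induction j)
        case (Suc j)
        have "y + (real (Suc j) * ?t n) *\<^sub>R h = y + (real j * ?t n) *\<^sub>R h + ?t n *\<^sub>R h"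
          by (simp add: algebra_simps scaleR_add_left)
        then show ?case using Suc by (simp add: algebra_simps)
      qed simp
      from this[of ?m] have "F (y + h) - F y = (\<Sum>k<?m. ?d (y + (real k * ?t n) *\<^sub>R h))"
        by (simp del: of_nat_Suc)
      then have "norm (F (y + h) - F y) \<le> (\<Sum>k<?m. norm (?d (y + (real k * ?t n) *\<^sub>R h)))"
        by (simp only: norm_sum)
      then have "(norm (F (y + h) - F y))\<^sup>2 \<le> (\<Sum>k<?m. norm (?d (y + (real k * ?t n) *\<^sub>R h)))\<^sup>2"
        by (intro power_mono) auto
      also have "\<dots> \<le> (\<Sum>k<?m. (norm (?d (y + (real k * ?t n) *\<^sub>R h)))\<^sup>2) * real (card {..<?m})"
        by (rule sum_squared_le_sum_of_squares)
      finally show ?thesis by (simp add: mult.commute)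
    qed
    note pw = this
    have sh: "integrable lborel (\<lambda>y. (norm (?d (y + c)))\<^sup>2)"
         "(LINT y|lborel. (norm (?d (y + c)))\<^sup>2) = (LINT y|lborel. (norm (?d y))\<^sup>2)" for c
    proof -
      have "integrable (distr lborel borel ((+) c)) (\<lambda>y. (norm (?d y))\<^sup>2)"
        using shift_difference_integrable by (simp add: lborel_distr_plus)
      then have "integrable lborel (\<lambda>y. (norm (?d (c + y)))\<^sup>2)" by (subst (asm) integrable_distr_eq) auto
      then show "integrable lborel (\<lambda>y. (norm (?d (y + c)))\<^sup>2)" by (simp add: add.commute)
      show "(LINT y|lborel. (norm (?d (y + c)))\<^sup>2) = (LINT y|lborel. (norm (?d y))\<^sup>2)"
        by (rule integral_lborel_shift[of "\<lambda>y. (norm (?d y))\<^sup>2" c]) measurable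
    qed
    have "(LINT y|lborel. (norm (F (y + h) - F y))\<^sup>2) \<le>
        (LINT y|lborel. real ?m * (\<Sum>k<?m. (norm (?d (y + (real k * ?t n) *\<^sub>R h)))\<^sup>2))"
      using sh(1) by (intro integral_mono pw shift_difference_integrable integrable_mult_right
         Bochner_Integration.integrable_sum)
    also have "\<dots> = real ?m * (\<Sum>k<?m. (LINT y|lborel. (norm (?d y))\<^sup>2))"
      by (subst integral_mult_right_zero, subst Bochner_Integration.integral_sum) (auto simp only: sh)
    also have "\<dots> = (LINT y|lborel. (real ?m)\<^sup>2 * (norm (?d y))\<^sup>2)"
      by (simp add: power2_eq_square del: of_nat_Suc)
    also have "\<dots> = (LINT y|lborel. ?q n y)"
      by (simp add: power_mult_distrib del: of_nat_Suc)
    finally show ?thesis .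
  qed
  ultimately show ?thesis by (meson LIMSEQ_le_const)
qed

end

section \<open>A Poincare inequality on a grid of cubes\<close>

definition cube :: "real \<Rightarrow> int ^ 'k::finite \<Rightarrow> (real ^ 'k) set" where
  "cube r z = {x. \<forall>i. \<lfloor>x $ i / r\<rfloor> = z $ i}"

lemma cube_sets [measurable]: "cube r z \<in> sets borel"
proof -
  have "cube r z = {x \<in> space borel. \<forall>i. \<lfloor>x $ i / r\<rfloor> = z $ i}" by (simp add: cube_def)
  also have "\<dots> \<in> sets borel" by measurable
  finally show ?thesis .
qed

lemma cube_memD:
  assumes "x \<in> cube r z" "r > 0"
  shows "r * of_int (z $ i) \<le> x $ i" "x $ i < r * (of_int (z $ i) + 1)"
proof -
  have "\<lfloor>x $ i / r\<rfloor> = z $ i" using assms(1) by (simp add: cube_def)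
  then have "of_int (z $ i) \<le> x $ i / r" "x $ i / r < of_int (z $ i) + 1" by linarith+
  then show "r * of_int (z $ i) \<le> x $ i" "x $ i < r * (of_int (z $ i) + 1)"
    using assms(2) by (auto simp: field_simps)
qed

lemma cube_diff:
  assumes "x \<in> cube r z" "y \<in> cube r z" "r > 0"
  shows "\<bar>y $ i - x $ i\<bar> \<le> r"
  using cube_memD[OF assms(1,3), of i] cube_memD[OF assms(2,3), of i] by (simp add: algebra_simps abs_le_iff)

lemma prod_Basis_vec: "(\<Prod>b\<in>(Basis::(real ^ 'k::finite) set). f b) = (\<Prod>i\<in>UNIV. f (axis i 1))"
proof -
  have "(Basis::(real ^ 'k) set) = (\<lambda>i. axis i 1) ` UNIV" by (auto simp: Basis_vec_def)
  then have "(\<Prod>b\<in>(Basis::(real ^ 'k) set). f b) = (\<Prod>b\<in>(\<lambda>i. axis i 1) ` UNIV. f b)" by metis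
  also have "\<dots> = (\<Prod>i\<in>UNIV. f (axis i 1))"
    by (subst prod.reindex) (auto simp: inj_on_def axis_eq_axis)
  finally show ?thesis .
qed

lemma emeasure_cube:
  assumes "r > 0"
  shows "emeasure lborel (cube r z :: (real ^ 'k::finite) set) = ennreal (r ^ CARD('k))"
proof -
  let ?a = "\<chi> i. r * of_int (z $ i) :: real ^ 'k" and ?b = "\<chi> i. r * (of_int (z $ i) + 1) :: real ^ 'k"
  have le: "?a \<bullet> b \<le> ?b \<bullet> b" if "b \<in> Basis" for b
    using that assms by (auto simp: Basis_vec_def inner_axis algebra_simps)
  have prod: "(\<Prod>b\<in>Basis. (?b - ?a) \<bullet> b) = r ^ CARD('k)"
    by (simp add: prod_Basis_vec inner_axis algebra_simps)
  have "cube r z \<subseteq> cbox ?a ?b"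
  proof -
    have "r * of_int (z $ i) \<le> x $ i \<and> x $ i \<le> r * (of_int (z $ i) + 1)" if "x \<in> cube r z" for x i
      using cube_memD[OF that assms, of i] by simp
    then show ?thesis by (simp add: subset_iff mem_box_cart)
  qed
  then have 1: "emeasure lborel (cube r z) \<le> emeasure lborel (cbox ?a ?b)"
    by (intro emeasure_mono) auto
  have "box ?a ?b \<subseteq> cube r z"
  proof
    fix x assume x: "x \<in> box ?a ?b"
    have "\<lfloor>x $ i / r\<rfloor> = z $ i" for i
    proof -
      have "r * of_int (z $ i) < x $ i" "x $ i < r * (of_int (z $ i) + 1)"
        using x by (auto simp: mem_box_cart)
      then show ?thesis using assms by (intro floor_unique) (auto simp: field_simps)
    qed
    then show "x \<in> cube r z" by (simp add: cube_def)
  qed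
  then have 2: "emeasure lborel (box ?a ?b) \<le> emeasure lborel (cube r z)"
    by (intro emeasure_mono) auto
  have "emeasure lborel (cbox ?a ?b) = ennreal (r ^ CARD('k))"
    by (subst emeasure_lborel_cbox) (use le prod in auto)
  moreover have "emeasure lborel (box ?a ?b) = ennreal (r ^ CARD('k))"
    by (subst emeasure_lborel_box) (use le prod in auto)
  ultimately show ?thesis using 1 2 by simp
qed

lemma finite_cubes_cover:
  assumes "bounded (S :: (real ^ 'k::finite) set)" "r > 0"
  shows "\<exists>Z. finite Z \<and> S \<subseteq> (\<Union>z\<in>Z. cube r z)"
proof -
  obtain R where R: "\<And>x. x \<in> S \<Longrightarrow> norm x \<le> R" using assms(1) unfolding bounded_iff by blast
  define f where "f x = (\<chi> i. \<lfloor>x $ i / r\<rfloor> :: int ^ 'k)" for x :: "real ^ 'k"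
  have "f ` S \<subseteq> vec_lambda ` (PiE UNIV (\<lambda>i. {\<lfloor>- R / r\<rfloor>..\<lfloor>R / r\<rfloor>}))"
  proof
    fix z assume "z \<in> f ` S"
    then obtain x where x: "x \<in> S" "z = f x" by blast
    have "\<bar>x $ i\<bar> \<le> R" for i using R[OF x(1)] component_le_norm_cart[of x i] by linarith
    then have "- R / r \<le> x $ i / r \<and> x $ i / r \<le> R / r" for i
      using assms(2) by (metis abs_le_iff divide_right_mono less_imp_le minus_le_iff)
    then have "(\<lambda>i. \<lfloor>x $ i / r\<rfloor>) \<in> PiE UNIV (\<lambda>i. {\<lfloor>- R / r\<rfloor>..\<lfloor>R / r\<rfloor>})"
      by (auto intro!: floor_mono)
    then show "z \<in> vec_lambda ` (PiE UNIV (\<lambda>i. {\<lfloor>- R / r\<rfloor>..\<lfloor>R / r\<rfloor>}))"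
      using x(2) by (auto simp: f_def)
  qed
  moreover have "finite (vec_lambda ` (PiE (UNIV::'k set) (\<lambda>i. {\<lfloor>- R / r\<rfloor>..\<lfloor>R / r\<rfloor>})))"
    by (intro finite_imageI finite_PiE) auto
  ultimately have "finite (f ` S)" by (rule finite_subset)
  moreover have "S \<subseteq> (\<Union>z\<in>f ` S. cube r z)" by (auto simp: cube_def f_def)
  ultimately show ?thesis by blast
qed

lemma cubes_disjoint: "x \<in> cube r z \<Longrightarrow> x \<in> cube r z' \<Longrightarrow> z = z'"
  by (auto simp: cube_def vec_eq_iff)

text \<open>The difference of \<open>F x\<close> and the mean of \<open>F\<close> over
  \<open>Q\<close> is the mean over \<open>y\<close> of \<open>F x - F y\<close>, to which the
  Cauchy-Schwarz inequality is applied.\<close>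

lemma pointwise_mean_bound:
  fixes F :: "'a::euclidean_space \<Rightarrow> 'b::euclidean_space"
  assumes F: "F \<in> borel_measurable borel" "\<And>x. norm (F x) \<le> M"
    and Q: "Q \<in> sets borel" "emeasure lborel Q = ennreal q" "q > 0"
  shows "ennreal ((norm (F x))\<^sup>2) \<le> ennreal (2 / q\<^sup>2 * (norm (LINT y:Q|lborel. F y))\<^sup>2)
    + ennreal (2 / q) * (\<integral>\<^sup>+ y. ennreal ((norm (F x - F y))\<^sup>2) * indicator Q y \<partial>lborel)"
proof -
  have meas: "measure lborel Q = q" using Q by (simp add: measure_def)
  have int_bdd: "integrable lborel (\<lambda>y. indicator Q y *\<^sub>R G y)"
    if "G \<in> borel_measurable borel" "\<And>y. norm (G y) \<le> B" for G :: "'a \<Rightarrow> 'c::euclidean_space" and B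
  proof (rule Bochner_Integration.integrable_bound[where f = "\<lambda>y. B * indicator Q y"])
    show "integrable lborel (\<lambda>y. B * indicator Q y)"
      using Q by (intro integrable_mult_right integrable_real_indicator) auto
    show "AE y in lborel. norm (indicator Q y *\<^sub>R G y) \<le> norm (B * indicator Q y :: real)"
      using that(2) by (intro AE_I2) (auto simp: indicator_def intro: order_trans[OF _ abs_ge_self])
  qed (use that Q in measurable)
  have [measurable]: "F \<in> borel_measurable borel" "Q \<in> sets borel" using F Q by auto
  define a where "a y = norm (F x - F y)" for y
  have a_le: "a y \<le> 2 * M" for y unfolding a_def
    using norm_triangle_ineq4[of "F x" "F y"] F(2)[of x] F(2)[of y] by linarith
  have a0: "a y \<ge> 0" for y by (simp add: a_def)
  have am [measurable]: "a \<in> borel_measurable borel" unfolding a_def by measurable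
  have ia: "integrable lborel (\<lambda>y. indicator Q y *\<^sub>R a y)"
    using a_le a0 by (intro int_bdd[of _ "2 * M"]) (auto)
  have ia2: "integrable lborel (\<lambda>y. indicator Q y *\<^sub>R (a y)\<^sup>2)"
  proof (rule int_bdd)
    show "norm ((a y)\<^sup>2) \<le> (2 * M)\<^sup>2" for y using power_mono[OF a_le a0, of y 2] by simp
  qed measurable
  have i1: "integrable lborel (\<lambda>y. indicator Q y :: real)"
    using Q by (intro integrable_real_indicator) auto
  have iF: "integrable lborel (\<lambda>y. indicator Q y *\<^sub>R F y)" by (rule int_bdd[OF F])
  have iFx: "integrable lborel (\<lambda>y. indicator Q y *\<^sub>R F x)"
    by (rule int_bdd[of _ "norm (F x)"]) auto
  define A where "A = (LINT y|lborel. indicator Q y *\<^sub>R a y)"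
  define A2 where "A2 = (LINT y|lborel. indicator Q y *\<^sub>R (a y)\<^sup>2)"
  \<comment> \<open>The Cauchy-Schwarz inequality for \<open>a\<close> on \<open>Q\<close>: the
    variance of \<open>a\<close> is nonnegative.\<close>
  have "0 \<le> (LINT y|lborel. indicator Q y *\<^sub>R (a y - A / q)\<^sup>2)" by (intro integral_nonneg_AE) auto
  also have "\<dots> = (LINT y|lborel. (indicator Q y *\<^sub>R (a y)\<^sup>2 - (2 * A / q) * (indicator Q y *\<^sub>R a y))
      + (A / q)\<^sup>2 * indicator Q y)"
    by (intro Bochner_Integration.integral_cong) (auto simp: power2_eq_square algebra_simps indicator_def)
  also have "\<dots> = A2 - (2 * A / q) * A + (A / q)\<^sup>2 * q"
  proof -
    let ?f = "\<lambda>y. indicator Q y *\<^sub>R (a y)\<^sup>2" and ?g = "\<lambda>y. (2 * A / q) * (indicator Q y *\<^sub>R a y)"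
      and ?h = "\<lambda>y. (A / q)\<^sup>2 * indicator Q y"
    have g: "integrable lborel ?g" by (rule integrable_mult_right[OF ia])
    have h: "integrable lborel ?h" by (rule integrable_mult_right[OF i1])
    have "(LINT y|lborel. (?f y - ?g y) + ?h y) = (LINT y|lborel. ?f y) - (LINT y|lborel. ?g y) + (LINT y|lborel. ?h y)"
      using Bochner_Integration.integral_add[OF Bochner_Integration.integrable_diff[OF ia2 g] h]
        Bochner_Integration.integral_diff[OF ia2 g] by simp
    also have "(LINT y|lborel. ?f y) = A2" by (simp add: A2_def)
    also have "(LINT y|lborel. ?g y) = 2 * A / q * A" unfolding A_def by (rule integral_mult_right_zero)
    also have "(LINT y|lborel. ?h y) = (A / q)\<^sup>2 * q"
      using Q meas by (subst integral_mult_right_zero) auto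
    finally show ?thesis .
  qed
  also have "\<dots> = A2 - A\<^sup>2 / q" using Q(3) by (simp add: power2_eq_square field_simps)
  finally have AA: "A\<^sup>2 \<le> q * A2" using Q(3) by (simp add: field_simps)
  have "q *\<^sub>R F x - (LINT y:Q|lborel. F y) = (LINT y|lborel. indicator Q y *\<^sub>R F x - indicator Q y *\<^sub>R F y)"
    using iF iFx Q meas by (subst Bochner_Integration.integral_diff) (auto simp: set_lebesgue_integral_def)
  also have "norm \<dots> \<le> A" unfolding A_def
    by (rule Bochner_Integration.integral_norm_bound_integral[OF Bochner_Integration.integrable_diff[OF iFx iF] ia])
      (auto simp: a_def indicator_def)
  finally have n: "norm (q *\<^sub>R F x - (LINT y:Q|lborel. F y)) \<le> A" .
  have "norm (q *\<^sub>R F x) \<le> norm (LINT y:Q|lborel. F y) + A"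
    using n norm_triangle_sub[of "q *\<^sub>R F x" "LINT y:Q|lborel. F y"] by linarith
  then have "q * norm (F x) \<le> norm (LINT y:Q|lborel. F y) + A" using Q(3) by simp
  then have "(q * norm (F x))\<^sup>2 \<le> (norm (LINT y:Q|lborel. F y) + A)\<^sup>2"
    using Q(3) by (intro power_mono) auto
  also have "\<dots> \<le> 2 * (norm (LINT y:Q|lborel. F y))\<^sup>2 + 2 * A\<^sup>2"
    using sum_squares_bound[of "norm (LINT y:Q|lborel. F y)" A] by (simp add: power2_sum)
  also have "\<dots> \<le> 2 * (norm (LINT y:Q|lborel. F y))\<^sup>2 + 2 * (q * A2)" using AA by simp
  finally have "(norm (F x))\<^sup>2 \<le> 2 / q\<^sup>2 * (norm (LINT y:Q|lborel. F y))\<^sup>2 + 2 / q * A2"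
    using Q(3) by (simp add: power_mult_distrib power2_eq_square field_simps)
  moreover have "A2 \<ge> 0" unfolding A2_def by (intro integral_nonneg_AE) auto
  ultimately have "ennreal ((norm (F x))\<^sup>2) \<le> ennreal (2 / q\<^sup>2 * (norm (LINT y:Q|lborel. F y))\<^sup>2) + ennreal (2 / q) * ennreal A2"
    using Q(3) by (simp add: ennreal_mult[symmetric] ennreal_plus[symmetric] ennreal_leI del: ennreal_plus)
  also have "ennreal A2 = (\<integral>\<^sup>+ y. ennreal (indicator Q y *\<^sub>R (a y)\<^sup>2) \<partial>lborel)"
    unfolding A2_def by (rule nn_integral_eq_integral[symmetric, OF ia2]) auto
  also have "\<dots> = (\<integral>\<^sup>+ y. ennreal ((norm (F x - F y))\<^sup>2) * indicator Q y \<partial>lborel)"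
    by (intro nn_integral_cong) (auto simp: a_def indicator_def)
  finally show ?thesis .
qed

text \<open>On each cube the function is compared with its mean; the resulting double integrals over all
  cubes are part of the integral of the squared translation differences over small shifts.\<close>

lemma grid_Poincare:
  fixes F :: "real ^ 'k::finite \<Rightarrow> 'b::euclidean_space"
  assumes F: "F \<in> borel_measurable borel" "\<And>x. norm (F x) \<le> M"
    and r: "r > 0" and Z: "finite Z" "\<And>x. x \<notin> (\<Union>z\<in>Z. cube r z) \<Longrightarrow> F x = 0"
    and D: "\<And>h. (\<And>i. \<bar>h $ i\<bar> \<le> r) \<Longrightarrow> (\<integral>\<^sup>+ y. ennreal ((norm (F (y + h) - F y))\<^sup>2) \<partial>lborel) \<le> D"
  shows "(\<integral>\<^sup>+ x. ennreal ((norm (F x))\<^sup>2) \<partial>lborel) \<le>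
    (\<Sum>z\<in>Z. ennreal (2 / r ^ CARD('k) * (norm (LINT y:cube r z|lborel. F y))\<^sup>2)) + ennreal (2 * 2 ^ CARD('k)) * D"
proof -
  have [measurable]: "F \<in> borel_measurable borel" by (rule F)
  let ?q = "r ^ CARD('k)"
  have q: "?q > 0" using r by simp
  define k where "k x y = ennreal ((norm (F x - F y))\<^sup>2)" for x y
  \<comment> \<open>Two points of the same cube differ by an element of \<open>B\<close>. The
    quotient of the volume \<open>(2 * r) ^ CARD('k)\<close> of \<open>B\<close> by that of a cube
    gives the factor \<open>2 ^ CARD('k)\<close>.\<close>
  define B where "B = {h :: real ^ 'k. \<forall>i. \<bar>h $ i\<bar> \<le> r}"
  define I where "I x = (\<integral>\<^sup>+ y. k x y * indicator B (y - x) \<partial>lborel)" for x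
  have B_eq: "B = cbox (\<chi> i. - r) (\<chi> i. r)" by (auto simp: B_def mem_box_cart abs_le_iff minus_le_iff)
  have B [measurable]: "B \<in> sets borel" unfolding B_eq by simp
  have eB: "emeasure lborel B = ennreal ((2 * r) ^ CARD('k))"
  proof -
    have "(\<Prod>b\<in>Basis. ((\<chi> i. r) - (\<chi> i. - r) :: real ^ 'k) \<bullet> b) = (2 * r) ^ CARD('k)"
      by (simp add: prod_Basis_vec inner_axis)
    then show ?thesis unfolding B_eq
      by (subst emeasure_lborel_cbox) (use r in \<open>auto simp: Basis_vec_def inner_axis\<close>)
  qed
  have km [measurable]: "(\<lambda>(x, y). k x y) \<in> borel_measurable (borel \<Otimes>\<^sub>M borel)" unfolding k_def by measurable
  have [measurable]: "(\<lambda>y. k x y) \<in> borel_measurable borel" for x unfolding k_def by measurable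
  have Im [measurable]: "I \<in> borel_measurable borel"
    unfolding I_def k_def by measurable
  let ?c = "\<lambda>z. ennreal (2 / ?q\<^sup>2 * (norm (LINT y:cube r z|lborel. F y))\<^sup>2)"
  have pt: "ennreal ((norm (F x))\<^sup>2) \<le> (\<Sum>z\<in>Z. ?c z * indicator (cube r z) x) + ennreal (2 / ?q) * I x" for x
  proof (cases "x \<in> (\<Union>z\<in>Z. cube r z)")
    case True
    then obtain z where z: "z \<in> Z" "x \<in> cube r z" by blast
    have "ennreal ((norm (F x))\<^sup>2) \<le> ?c z + ennreal (2 / ?q) * (\<integral>\<^sup>+ y. k x y * indicator (cube r z) y \<partial>lborel)"
      unfolding k_def by (rule pointwise_mean_bound[OF F cube_sets emeasure_cube[OF r] q])
    also have "(\<integral>\<^sup>+ y. k x y * indicator (cube r z) y \<partial>lborel) \<le> I x"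
      unfolding I_def using cube_diff[OF z(2) _ r]
      by (intro nn_integral_mono) (auto simp: indicator_def B_def)
    also have "?c z = ?c z * indicator (cube r z) x" using z by simp
    also have "?c z * indicator (cube r z) x \<le> (\<Sum>z\<in>Z. ?c z * indicator (cube r z) x)"
      using z Z(1) by (intro member_le_sum[where f = "\<lambda>z. ?c z * indicator (cube r z) x"]) auto
    finally show ?thesis by (simp add: add_right_mono mult_left_mono)
  next
    case False
    then show ?thesis using Z(2) by simp
  qed
  have "(\<integral>\<^sup>+ x. ennreal ((norm (F x))\<^sup>2) \<partial>lborel) \<le>
     (\<integral>\<^sup>+ x. (\<Sum>z\<in>Z. ?c z * indicator (cube r z) x) + ennreal (2 / ?q) * I x \<partial>lborel)"
    by (intro nn_integral_mono pt)
  also have "\<dots> = (\<Sum>z\<in>Z. ?c z * emeasure lborel (cube r z)) + ennreal (2 / ?q) * (\<integral>\<^sup>+ x. I x \<partial>lborel)"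
    by (subst nn_integral_add) (auto simp: nn_integral_sum nn_integral_cmult)
  also have "(\<Sum>z\<in>Z. ?c z * emeasure lborel (cube r z)) =
     (\<Sum>z\<in>Z. ennreal (2 / ?q * (norm (LINT y:cube r z|lborel. F y))\<^sup>2))"
    using r by (intro sum.cong) (auto simp: emeasure_cube ennreal_mult[symmetric] power2_eq_square)
  also have "(\<integral>\<^sup>+ x. I x \<partial>lborel) \<le> D * ennreal ((2 * r) ^ CARD('k))"
  proof -
    have "I x = (\<integral>\<^sup>+ h. k x (h + x) * indicator B h \<partial>lborel)" for x
      unfolding I_def using nn_integral_lborel_shift[of "\<lambda>y. k x y * indicator B (y - x)" x] by simp
    then have "(\<integral>\<^sup>+ x. I x \<partial>lborel) = (\<integral>\<^sup>+ x. (\<integral>\<^sup>+ h. k x (h + x) * indicator B h \<partial>lborel) \<partial>lborel)" by simp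
    also have "\<dots> = (\<integral>\<^sup>+ h. (\<integral>\<^sup>+ x. k x (h + x) * indicator B h \<partial>lborel) \<partial>lborel)"
    proof -
      have "(\<lambda>(x, h). k x (h + x) * indicator B h) \<in> borel_measurable (lborel \<Otimes>\<^sub>M lborel)"
        unfolding k_def by measurable
      from lborel_pair.Fubini'[OF this] show ?thesis by simp
    qed
    also have "\<dots> \<le> (\<integral>\<^sup>+ h. D * indicator B h \<partial>lborel)"
    proof (intro nn_integral_mono)
      fix h :: "real ^ 'k"
      show "(\<integral>\<^sup>+ x. k x (h + x) * indicator B h \<partial>lborel) \<le> D * indicator B h"
      proof (cases "h \<in> B")
        case True
        then have "(\<integral>\<^sup>+ y. ennreal ((norm (F (y + h) - F y))\<^sup>2) \<partial>lborel) \<le> D" by (intro D) (auto simp: B_def)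
        then show ?thesis using True by (simp add: k_def norm_minus_commute add.commute)
      qed simp
    qed
    also have "\<dots> = D * ennreal ((2 * r) ^ CARD('k))" by (simp add: nn_integral_cmult eB)
    finally show ?thesis .
  qed
  also have "ennreal (2 / ?q) * (D * ennreal ((2 * r) ^ CARD('k))) = (ennreal (2 / ?q) * ennreal ((2 * r) ^ CARD('k))) * D"
    by (simp add: mult_ac)
  also have "ennreal (2 / ?q) * ennreal ((2 * r) ^ CARD('k)) = ennreal (2 * 2 ^ CARD('k))"
    using r by (subst ennreal_mult[symmetric]) (auto simp: power_mult_distrib)
  finally show ?thesis by (simp add: add_left_mono mult_left_mono)
qed

section \<open>Square integrable functions\<close>

definition L2_sq :: "'a measure \<Rightarrow> ('a \<Rightarrow> complex) \<Rightarrow> real" where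
  "L2_sq v f = (LINT p|v. (cmod (f p))\<^sup>2)"

lemma borel_measurable_cnj [measurable]:
  "f \<in> borel_measurable M \<Longrightarrow> (\<lambda>x. cnj (f x)) \<in> borel_measurable M"
  by (rule borel_measurable_continuous_on[of cnj]) (auto intro: continuous_intros)

lemma L2_measurable [measurable_dest]: "f \<in> L2 v \<Longrightarrow> f \<in> borel_measurable v"
  by (simp add: L2_def)

lemma L2_sq_nonneg [simp]: "0 \<le> L2_sq v f"
  unfolding L2_sq_def by (intro integral_nonneg_AE) auto

lemma L2_iff_nn_integral:
  assumes "f \<in> borel_measurable v"
  shows "f \<in> L2 v \<longleftrightarrow> (\<integral>\<^sup>+ p. ennreal ((cmod (f p))\<^sup>2) \<partial>v) < \<infinity>"
  using assms unfolding L2_def by (auto simp: integrable_iff_bounded)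

lemma nn_integral_L2:
  "f \<in> L2 v \<Longrightarrow> (\<integral>\<^sup>+ p. ennreal ((cmod (f p))\<^sup>2) \<partial>v) = ennreal (L2_sq v f)"
  unfolding L2_sq_def by (rule nn_integral_eq_integral) (auto simp: L2_def)

lemma L2_bound:
  assumes "f \<in> borel_measurable v" "integrable v g" "\<And>p. p \<in> space v \<Longrightarrow> (cmod (f p))\<^sup>2 \<le> g p"
  shows "f \<in> L2 v"
proof -
  have "norm ((cmod (f p))\<^sup>2) \<le> norm (g p)" if "p \<in> space v" for p
    using assms(3)[OF that] by simp
  then have "integrable v (\<lambda>p. (cmod (f p))\<^sup>2)"
    using assms(1) by (intro Bochner_Integration.integrable_bound[OF assms(2)] AE_I2) auto
  then show ?thesis using assms(1) by (simp add: L2_def)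
qed

lemma cmod_add_sq_le: "(cmod (a + b))\<^sup>2 \<le> 2 * (cmod a)\<^sup>2 + 2 * (cmod b)\<^sup>2"
proof -
  have "(cmod (a + b))\<^sup>2 \<le> (cmod a + cmod b)\<^sup>2" by (intro power_mono norm_triangle_ineq) auto
  also have "\<dots> \<le> 2 * (cmod a)\<^sup>2 + 2 * (cmod b)\<^sup>2"
    using sum_squares_bound[of "cmod a" "cmod b"] by (simp add: power2_sum)
  finally show ?thesis .
qed

lemma L2_add:
  assumes "f \<in> L2 v" "h \<in> L2 v"
  shows "(\<lambda>p. f p + h p) \<in> L2 v"
proof (rule L2_bound)
  show "integrable v (\<lambda>p. 2 * (cmod (f p))\<^sup>2 + 2 * (cmod (h p))\<^sup>2)"
    using assms by (auto simp: L2_def)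
qed (use assms cmod_add_sq_le in auto)

lemma L2_scale:
  assumes "f \<in> L2 v"
  shows "(\<lambda>p. c * f p) \<in> L2 v"
proof (rule L2_bound)
  show "integrable v (\<lambda>p. (cmod c)\<^sup>2 * (cmod (f p))\<^sup>2)" using assms by (auto simp: L2_def)
qed (use assms in \<open>auto simp: norm_mult power_mult_distrib\<close>)

lemma L2_zero [simp]: "(\<lambda>p. 0) \<in> L2 v" by (simp add: L2_def)

lemma L2_sum: "(\<And>i. i \<in> I \<Longrightarrow> f i \<in> L2 v) \<Longrightarrow> (\<lambda>p. \<Sum>i\<in>I. f i p) \<in> L2 v"
  by (induction I rule: infinite_finite_induct) (auto intro: L2_add)

lemma L2_diff: "f \<in> L2 v \<Longrightarrow> h \<in> L2 v \<Longrightarrow> (\<lambda>p. f p - h p) \<in> L2 v"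
  using L2_add[of f v "\<lambda>p. -1 * h p"] L2_scale[of h v "-1"] by simp

lemma L2_indicator: "f \<in> L2 v \<Longrightarrow> E \<in> sets v \<Longrightarrow> (\<lambda>p. indicator E p * f p) \<in> L2 v"
  by (rule L2_bound[where g = "\<lambda>p. (cmod (f p))\<^sup>2"]) (auto simp: L2_def indicator_def)

lemma integrable_L2_inner:
  assumes "f \<in> L2 v" "h \<in> L2 v"
  shows "integrable v (\<lambda>p. f p * cnj (h p))"
proof (rule Bochner_Integration.integrable_bound)
  show "integrable v (\<lambda>p. (cmod (f p))\<^sup>2 + (cmod (h p))\<^sup>2)" using assms by (auto simp: L2_def)
  have "cmod (f p) * cmod (h p) \<le> (cmod (f p))\<^sup>2 + (cmod (h p))\<^sup>2" for p
  proof -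
    have "2 * (cmod (f p) * cmod (h p)) \<le> (cmod (f p))\<^sup>2 + (cmod (h p))\<^sup>2"
      using sum_squares_bound[of "cmod (f p)" "cmod (h p)"] by simp
    moreover have "0 \<le> cmod (f p) * cmod (h p)" by simp
    ultimately show ?thesis by linarith
  qed
  then show "AE p in v. norm (f p * cnj (h p)) \<le> norm ((cmod (f p))\<^sup>2 + (cmod (h p))\<^sup>2)"
    by (intro AE_I2) (simp add: norm_mult)
qed (use assms in measurable)

lemma L2_inner_add_left:
  assumes "f \<in> L2 v" "g \<in> L2 v" "h \<in> L2 v"
  shows "L2_inner v (\<lambda>p. f p + g p) h = L2_inner v f h + L2_inner v g h"
  using integrable_L2_inner[OF assms(1,3)] integrable_L2_inner[OF assms(2,3)]
  by (simp add: L2_inner_def algebra_simps)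

lemma L2_inner_scale_left: "L2_inner v (\<lambda>p. c * f p) h = c * L2_inner v f h"
  unfolding L2_inner_def by (simp add: mult.assoc)

lemma L2_inner_cnj: "L2_inner v h f = cnj (L2_inner v f h)"
  unfolding L2_inner_def by (simp add: mult.commute flip: Bochner_Integration.integral_cnj)

lemma L2_inner_sum_left:
  assumes "finite I" "\<And>i. i \<in> I \<Longrightarrow> f i \<in> L2 v" "h \<in> L2 v"
  shows "L2_inner v (\<lambda>p. \<Sum>i\<in>I. f i p) h = (\<Sum>i\<in>I. L2_inner v (f i) h)"
  using assms(1,2)
proof (induction I rule: finite_induct)
  case empty
  then show ?case by (simp add: L2_inner_def)
next
  case (insert i I)
  then have "L2_inner v (\<lambda>p. f i p + (\<Sum>i\<in>I. f i p)) h = L2_inner v (f i) h + L2_inner v (\<lambda>p. \<Sum>i\<in>I. f i p) h"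
    using assms(3) by (intro L2_inner_add_left L2_sum) auto
  then show ?case using insert by simp
qed

lemma L2_inner_self: "L2_inner v f f = of_real (L2_sq v f)"
proof -
  have "L2_inner v f f = (LINT p|v. complex_of_real ((cmod (f p))\<^sup>2))"
    unfolding L2_inner_def by (simp add: complex_norm_square[symmetric] del: of_real_power)
  also have "\<dots> = of_real (L2_sq v f)" unfolding L2_sq_def by (rule integral_complex_of_real)
  finally show ?thesis .
qed

lemma L2_Cauchy_Schwarz:
  assumes "f \<in> L2 v" "h \<in> L2 v"
  shows "cmod (L2_inner v f h) \<le> sqrt (L2_sq v f) * sqrt (L2_sq v h)"
proof -
  have [measurable]: "f \<in> borel_measurable v" "h \<in> borel_measurable v" using assms by auto
  let ?A = "\<integral>\<^sup>+ p. ennreal (cmod (f p)) * ennreal (cmod (h p)) \<partial>v"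
  have "ennreal (cmod (L2_inner v f h)) \<le> (\<integral>\<^sup>+ p. norm (f p * cnj (h p)) \<partial>v)"
    unfolding L2_inner_def by (rule integral_norm_bound_ennreal[OF integrable_L2_inner[OF assms]])
  also have "\<dots> = ?A" by (intro nn_integral_cong) (simp add: norm_mult ennreal_mult)
  finally have "(ennreal (cmod (L2_inner v f h)))\<^sup>2 \<le> ?A\<^sup>2" by (intro power_mono) auto
  also have "\<dots> \<le> (\<integral>\<^sup>+ p. (ennreal (cmod (f p)))\<^sup>2 \<partial>v) * (\<integral>\<^sup>+ p. (ennreal (cmod (h p)))\<^sup>2 \<partial>v)"
    by (rule Cauchy_Schwarz_nn_integral) measurable
  also have "\<dots> = ennreal (L2_sq v f * L2_sq v h)"
    using nn_integral_L2[OF assms(1)] nn_integral_L2[OF assms(2)] by (simp add: ennreal_power ennreal_mult)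
  finally have "(cmod (L2_inner v f h))\<^sup>2 \<le> L2_sq v f * L2_sq v h"
    by (simp add: ennreal_power)
  then show ?thesis by (simp add: real_le_rsqrt flip: real_sqrt_mult)
qed

lemma L2_sq_diff_expand:
  assumes "f \<in> L2 v" "h \<in> L2 v"
  shows "L2_sq v (\<lambda>p. f p - h p) = L2_sq v f - 2 * Re (L2_inner v f h) + L2_sq v h"
proof -
  have d: "(\<lambda>p. f p - h p) \<in> L2 v" by (rule L2_diff[OF assms])
  have m: "(\<lambda>p. - 1 * h p) \<in> L2 v" by (rule L2_scale[OF assms(2)])
  have *: "L2_inner v (\<lambda>p. f p - h p) g = L2_inner v f g - L2_inner v h g" if "g \<in> L2 v" for g
    using L2_inner_add_left[OF assms(1) m that] L2_inner_scale_left[of v "-1" h g] by simp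
  have "of_real (L2_sq v (\<lambda>p. f p - h p)) = L2_inner v f (\<lambda>p. f p - h p) - L2_inner v h (\<lambda>p. f p - h p)"
    using *[OF d] by (simp add: L2_inner_self)
  also have "\<dots> = cnj (L2_inner v f f - L2_inner v h f) - cnj (L2_inner v f h - L2_inner v h h)"
    using *[OF assms(1)] *[OF assms(2)] L2_inner_cnj[of v f "\<lambda>p. f p - h p"]
      L2_inner_cnj[of v h "\<lambda>p. f p - h p"] by simp
  finally have "complex_of_real (L2_sq v (\<lambda>p. f p - h p)) =
      cnj (L2_inner v f f - L2_inner v h f) - cnj (L2_inner v f h - L2_inner v h h)" .
  from arg_cong[OF this, of Re] show ?thesis
    using L2_inner_cnj[of v h f] by (simp add: L2_inner_self)
qed

text \<open>The sequences that define the graph of the operator are only required to consist of test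
  functions; this makes their Laplacians square integrable from some index on.\<close>

lemma L2_tendsto_eventually_L2:
  assumes "L2_tendsto v s f" "f \<in> L2 v" "\<And>k. s k \<in> borel_measurable v"
  shows "\<forall>\<^sub>F k in sequentially. s k \<in> L2 v"
proof -
  have "\<forall>\<^sub>F k in sequentially. (\<integral>\<^sup>+ p. ennreal ((cmod (s k p - f p))\<^sup>2) \<partial>v) < 1"
    using assms(1) unfolding L2_tendsto_def by (rule order_tendstoD) simp
  then show ?thesis
  proof eventually_elim
    case (elim k)
    have "(\<lambda>p. s k p - f p) \<in> L2 v"
      using elim assms by (subst L2_iff_nn_integral) (auto intro: less_trans)
    then show ?case using L2_add[OF _ assms(2)] by fastforce
  qed
qed

lemma L2_tendsto_L2_sq_diff:
  assumes "L2_tendsto v s f" "f \<in> L2 v" "\<And>k. s k \<in> L2 v"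
  shows "(\<lambda>k. L2_sq v (\<lambda>p. s k p - f p)) \<longlonglongrightarrow> 0"
proof -
  have "(\<lambda>k. ennreal (L2_sq v (\<lambda>p. s k p - f p))) \<longlonglongrightarrow> ennreal 0"
    using assms nn_integral_L2[OF L2_diff[OF assms(3,2)]] unfolding L2_tendsto_def by simp
  then show ?thesis by (subst (asm) tendsto_ennreal_iff) auto
qed

lemma L2_tendsto_inner:
  assumes "L2_tendsto v s f" "f \<in> L2 v" "\<And>k. s k \<in> L2 v" "h \<in> L2 v"
  shows "(\<lambda>k. L2_inner v (s k) h) \<longlonglongrightarrow> L2_inner v f h"
proof -
  have "(\<lambda>k. sqrt (L2_sq v (\<lambda>p. s k p - f p)) * sqrt (L2_sq v h)) \<longlonglongrightarrow> sqrt 0 * sqrt (L2_sq v h)"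
    by (intro tendsto_mult tendsto_real_sqrt tendsto_const L2_tendsto_L2_sq_diff[OF assms(1-3)])
  then have lim: "(\<lambda>k. sqrt (L2_sq v (\<lambda>p. s k p - f p)) * sqrt (L2_sq v h)) \<longlonglongrightarrow> 0" by simp
  have bound: "norm (L2_inner v (s k) h - L2_inner v f h) \<le> sqrt (L2_sq v (\<lambda>p. s k p - f p)) * sqrt (L2_sq v h)" for k
  proof -
    have "L2_inner v (\<lambda>p. (s k p - f p) + f p) h = L2_inner v (\<lambda>p. s k p - f p) h + L2_inner v f h"
      by (rule L2_inner_add_left[OF L2_diff[OF assms(3,2)] assms(2,4)])
    then have "L2_inner v (s k) h - L2_inner v f h = L2_inner v (\<lambda>p. s k p - f p) h" by simp
    then show ?thesis using L2_Cauchy_Schwarz[OF L2_diff[OF assms(3,2)] assms(4)] by simp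
  qed
  have "(\<lambda>k. L2_inner v (s k) h - L2_inner v f h) \<longlonglongrightarrow> 0"
    by (rule Lim_null_comparison[OF always_eventually lim]) (rule allI[OF bound])
  then show ?thesis by (rule LIM_zero_cancel)
qed

lemma L2_tendsto_L2_sq:
  assumes "L2_tendsto v s f" "f \<in> L2 v" "\<And>k. s k \<in> L2 v"
  shows "(\<lambda>k. L2_sq v (s k)) \<longlonglongrightarrow> L2_sq v f"
proof -
  have "(\<lambda>k. L2_sq v (\<lambda>p. s k p - f p) + 2 * Re (L2_inner v (s k) f) - L2_sq v f) \<longlonglongrightarrow>
     0 + 2 * Re (L2_inner v f f) - L2_sq v f"
    by (intro tendsto_add tendsto_diff tendsto_mult tendsto_Re tendsto_const
      L2_tendsto_L2_sq_diff[OF assms] L2_tendsto_inner[OF assms assms(2)])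
  then show ?thesis using L2_sq_diff_expand[OF assms(3,2)] by (simp add: L2_inner_self)
qed

lemma L2_tendsto_indicator:
  assumes "L2_tendsto v s f"
  shows "L2_tendsto v (\<lambda>k p. indicator E p * s k p) (\<lambda>p. indicator E p * f p)"
  unfolding L2_tendsto_def
proof (rule tendsto_sandwich[OF _ _ tendsto_const assms[unfolded L2_tendsto_def]])
  show "\<forall>\<^sub>F k in sequentially. (\<integral>\<^sup>+ p. ennreal ((cmod (indicator E p * s k p - indicator E p * f p))\<^sup>2) \<partial>v)
     \<le> (\<integral>\<^sup>+ p. ennreal ((cmod (s k p - f p))\<^sup>2) \<partial>v)"
    by (intro always_eventually allI nn_integral_mono) (auto simp: indicator_def)
qed simp

lemma L2_tendsto_subseq:
  assumes "L2_tendsto v s f" "strict_mono r"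
  shows "L2_tendsto v (\<lambda>k. s (r k)) f"
  using LIMSEQ_subseq_LIMSEQ[OF assms(1)[unfolded L2_tendsto_def] assms(2)]
  unfolding L2_tendsto_def by (simp add: o_def)

text \<open>The squared distance of \<open>h\<close> to its projection onto the span of the family
  is nonnegative.\<close>

lemma Bessel:
  assumes "finite I" "\<And>i. i \<in> I \<Longrightarrow> f i \<in> L2 v" "\<And>i. i \<in> I \<Longrightarrow> L2_sq v (f i) > 0"
    and orth: "\<And>i j. i \<in> I \<Longrightarrow> j \<in> I \<Longrightarrow> i \<noteq> j \<Longrightarrow> L2_inner v (f i) (f j) = 0" and h: "h \<in> L2 v"
  shows "(\<Sum>i\<in>I. (cmod (L2_inner v h (f i)))\<^sup>2 / L2_sq v (f i)) \<le> L2_sq v h"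
proof -
  define c where "c i = L2_inner v h (f i) / of_real (L2_sq v (f i))" for i
  define g where "g p = (\<Sum>i\<in>I. c i * f i p)" for p
  define S where "S = (\<Sum>i\<in>I. (cmod (L2_inner v h (f i)))\<^sup>2 / L2_sq v (f i))"
  have cf: "(\<lambda>p. c i * f i p) \<in> L2 v" if "i \<in> I" for i using assms(2) that by (intro L2_scale)
  have g: "g \<in> L2 v" unfolding g_def[abs_def] by (intro L2_sum cf)
  have inner_g: "L2_inner v g w = (\<Sum>i\<in>I. c i * L2_inner v (f i) w)" if "w \<in> L2 v" for w
    unfolding g_def[abs_def] using L2_inner_sum_left[OF assms(1) cf that] by (simp add: L2_inner_scale_left)
  have ch: "c i * L2_inner v (f i) h = of_real ((cmod (L2_inner v h (f i)))\<^sup>2 / L2_sq v (f i))" for i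
    using L2_inner_cnj[of v "f i" h] by (simp add: c_def complex_norm_square[symmetric] del: of_real_power)
  have gh: "L2_inner v g h = of_real S"
    using inner_g[OF h] ch by (simp add: S_def)
  have "L2_inner v (f i) g = L2_inner v (f i) h" if "i \<in> I" for i
  proof -
    have "L2_inner v g (f i) = (\<Sum>j\<in>I. c j * L2_inner v (f j) (f i))" using inner_g assms(2) that by simp
    also have "\<dots> = (\<Sum>j\<in>{i}. c j * L2_inner v (f j) (f i))"
      using that orth assms(1) by (intro sum.mono_neutral_right) auto
    also have "\<dots> = L2_inner v h (f i)" using assms(3)[OF that] by (simp add: c_def L2_inner_self)
    finally show ?thesis by (metis L2_inner_cnj)
  qed
  then have gg: "L2_inner v g g = of_real S" using inner_g[OF g] inner_g[OF h] gh by simp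
  have "L2_inner v h g = of_real S" using gh L2_inner_cnj[of v h g] by simp
  moreover have "L2_sq v g = S" using gg by (simp add: L2_inner_self)
  ultimately have "L2_sq v (\<lambda>p. h p - g p) = L2_sq v h - S" using L2_sq_diff_expand[OF h g] by simp
  then show ?thesis using L2_sq_nonneg[of v "\<lambda>p. h p - g p"] by (simp add: S_def)
qed

lemma orthonormal_L2_sq: "orthonormal_basis v \<phi> \<Longrightarrow> L2_sq v (\<phi> j) = 1"
  unfolding orthonormal_basis_def using L2_inner_self[of v "\<phi> j"] by (metis of_real_eq_1_iff)

lemma Bessel_orthonormal:
  assumes "orthonormal_basis v \<phi>" "h \<in> L2 v"
  shows "(\<Sum>j<N. (cmod (L2_inner v (\<phi> j) h))\<^sup>2) \<le> L2_sq v h"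
proof -
  have "cmod (L2_inner v (\<phi> j) h) = cmod (L2_inner v h (\<phi> j))" for j
    using L2_inner_cnj[of v "\<phi> j" h] by simp
  then show ?thesis
    using Bessel[of "{..<N}" \<phi> v h] assms orthonormal_L2_sq[OF assms(1)]
    by (simp add: orthonormal_basis_def)
qed

lemma Parseval:
  assumes "orthonormal_basis v \<phi>" "f \<in> L2 v" "h \<in> L2 v"
  shows "(\<lambda>N. \<Sum>j<N. L2_inner v f (\<phi> j) * L2_inner v (\<phi> j) h) \<longlonglongrightarrow> L2_inner v f h"
proof -
  have phi: "\<phi> j \<in> L2 v" for j using assms(1) by (simp add: orthonormal_basis_def)
  have "(\<lambda>N. L2_inner v (\<lambda>p. \<Sum>j<N. L2_inner v f (\<phi> j) * \<phi> j p) h) \<longlonglongrightarrow> L2_inner v f h"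
    using assms phi by (intro L2_tendsto_inner L2_sum L2_scale) (auto simp: orthonormal_basis_def)
  moreover have "L2_inner v (\<lambda>p. \<Sum>j<N. L2_inner v f (\<phi> j) * \<phi> j p) h =
      (\<Sum>j<N. L2_inner v f (\<phi> j) * L2_inner v (\<phi> j) h)" for N
    using L2_inner_sum_left[of "{..<N}" "\<lambda>j p. L2_inner v f (\<phi> j) * \<phi> j p" v h] L2_scale[OF phi] assms(3)
    by (simp add: L2_inner_scale_left)
  ultimately show ?thesis by simp
qed

section \<open>Counting eigenvalues with trial functions\<close>

text \<open>By Parseval the modes of \<open>f\<close> with index at least \<open>n\<close> carry at
  most the quadratic form of \<open>f\<close> divided by \<open>\<mu>\<close>, hence at most half of
  the squared norm.\<close>

lemma low_modes_dominate:
  assumes \<phi>: "orthonormal_basis v \<phi>" and f: "f \<in> L2 v" "h \<in> L2 v"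
    and diag: "\<And>j. L2_inner v (\<phi> j) h = of_real (ev j) * L2_inner v (\<phi> j) f"
    and ev: "\<And>j. 0 \<le> ev j" "\<And>j. j \<ge> n \<Longrightarrow> \<mu> \<le> ev j" "0 < \<mu>"
    and quot: "Re (L2_inner v f h) \<le> \<mu> / 2 * L2_sq v f"
  shows "L2_sq v f / 2 \<le> (\<Sum>j<n. (cmod (L2_inner v (\<phi> j) f))\<^sup>2)"
proof -
  define c where "c j = (cmod (L2_inner v (\<phi> j) f))\<^sup>2" for j
  have prod: "L2_inner v f (\<phi> j) * L2_inner v (\<phi> j) f = of_real (c j)" for j
    using L2_inner_cnj[of v f "\<phi> j"] by (simp add: c_def complex_norm_square mult.commute del: of_real_power)
  have "(\<lambda>N. \<Sum>j<N. complex_of_real (c j)) \<longlonglongrightarrow> of_real (L2_sq v f)"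
    using Parseval[OF \<phi> f(1) f(1)] prod by (simp add: L2_inner_self)
  then have lim1: "(\<lambda>N. \<Sum>j<N. c j) \<longlonglongrightarrow> L2_sq v f"
    by (simp add: tendsto_of_real_iff flip: of_real_sum)
  have "L2_inner v f (\<phi> j) * L2_inner v (\<phi> j) h = of_real (ev j * c j)" for j
    using prod[of j] diag[of j] by (simp add: mult.left_commute)
  then have "(\<lambda>N. \<Sum>j<N. complex_of_real (ev j * c j)) \<longlonglongrightarrow> L2_inner v f h"
    using Parseval[OF \<phi> f] by simp
  from tendsto_Re[OF this] have lim2: "(\<lambda>N. \<Sum>j<N. ev j * c j) \<longlonglongrightarrow> Re (L2_inner v f h)" by simp
  have c0: "c j \<ge> 0" for j by (simp add: c_def)
  have "L2_sq v f \<le> (\<Sum>j<n. c j) + Re (L2_inner v f h) / \<mu>"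
  proof (rule LIMSEQ_le[OF lim1 tendsto_add[OF tendsto_const tendsto_divide[OF lim2 tendsto_const]]])
    show "\<exists>N0. \<forall>N\<ge>N0. (\<Sum>j<N. c j) \<le> (\<Sum>j<n. c j) + (\<Sum>j<N. ev j * c j) / \<mu>"
    proof (intro exI[of _ n] allI impI)
      fix N assume "N \<ge> n"
      then have "(\<Sum>j<N. c j) = (\<Sum>j<n. c j) + (\<Sum>j\<in>{n..<N}. c j)"
        by (simp add: lessThan_atLeast0 sum.atLeastLessThan_concat)
      also have "(\<Sum>j\<in>{n..<N}. c j) \<le> (\<Sum>j\<in>{n..<N}. ev j * c j / \<mu>)"
      proof (rule sum_mono)
        fix j assume "j \<in> {n..<N}"
        then have "\<mu> * c j \<le> ev j * c j" using ev c0 by (intro mult_right_mono) auto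
        then show "c j \<le> ev j * c j / \<mu>" using ev(3) by (simp add: field_simps)
      qed
      also have "\<dots> \<le> (\<Sum>j<N. ev j * c j / \<mu>)"
        using ev c0 by (intro sum_mono2) (auto intro!: divide_nonneg_pos)
      finally show "(\<Sum>j<N. c j) \<le> (\<Sum>j<n. c j) + (\<Sum>j<N. ev j * c j) / \<mu>"
        by (simp add: sum_divide_distrib)
    qed
  qed (use ev in simp)
  also have "Re (L2_inner v f h) / \<mu> \<le> L2_sq v f / 2" using quot ev(3) by (simp add: field_simps)
  finally show ?thesis by (simp add: c_def)
qed

text \<open>The squared coefficients of the normalised trial functions in the first \<open>n\<close>
  modes are summed in two orders. Each trial function contributes at least 1/2; each mode
  contributes at most 1 by Bessel's inequality for the orthogonal trial functions. Comparing the two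
  totals counts the eigenvalues up to a factor 2.\<close>

lemma card_trial_functions_le:
  assumes \<phi>: "orthonormal_basis v \<phi>" and I: "finite I"
    and f: "\<And>i. i \<in> I \<Longrightarrow> f i \<in> L2 v" "\<And>i. i \<in> I \<Longrightarrow> h i \<in> L2 v" "\<And>i. i \<in> I \<Longrightarrow> L2_sq v (f i) > 0"
    and orth: "\<And>i j. i \<in> I \<Longrightarrow> j \<in> I \<Longrightarrow> i \<noteq> j \<Longrightarrow> L2_inner v (f i) (f j) = 0"
    and diag: "\<And>i j. i \<in> I \<Longrightarrow> L2_inner v (\<phi> j) (h i) = of_real (ev j) * L2_inner v (\<phi> j) (f i)"
    and ev: "\<And>j. 0 \<le> ev j" "\<And>j. j \<ge> n \<Longrightarrow> \<mu> \<le> ev j" "0 < \<mu>"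
    and quot: "\<And>i. i \<in> I \<Longrightarrow> Re (L2_inner v (f i) (h i)) \<le> \<mu> / 2 * L2_sq v (f i)"
  shows "real (card I) \<le> 2 * real n"
proof -
  have "real (card I) / 2 = (\<Sum>i\<in>I. 1 / 2)" by simp
  also have "\<dots> \<le> (\<Sum>i\<in>I. (\<Sum>j<n. (cmod (L2_inner v (\<phi> j) (f i)))\<^sup>2 / L2_sq v (f i)))"
  proof (rule sum_mono)
    fix i assume i: "i \<in> I"
    have "L2_sq v (f i) / 2 \<le> (\<Sum>j<n. (cmod (L2_inner v (\<phi> j) (f i)))\<^sup>2)"
      by (rule low_modes_dominate[OF \<phi> f(1)[OF i] f(2)[OF i] diag[OF i] ev quot[OF i]])
    then show "1 / 2 \<le> (\<Sum>j<n. (cmod (L2_inner v (\<phi> j) (f i)))\<^sup>2 / L2_sq v (f i))"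
      using f(3)[OF i] by (simp add: sum_divide_distrib[symmetric] field_simps)
  qed
  also have "\<dots> = (\<Sum>j<n. (\<Sum>i\<in>I. (cmod (L2_inner v (\<phi> j) (f i)))\<^sup>2 / L2_sq v (f i)))"
    by (rule sum.swap)
  also have "\<dots> \<le> (\<Sum>j<n. L2_sq v (\<phi> j))"
    using \<phi> by (intro sum_mono Bessel[OF I f(1) f(3) orth]) (auto simp: orthonormal_basis_def)
  also have "\<dots> = real n" by (simp add: orthonormal_L2_sq[OF \<phi>])
  finally show ?thesis by simp
qed

section \<open>Subsequences of density one\<close>

text \<open>An index is discarded when its term exceeds the square root of the running supremum of the
  Cesaro means; as the suprema decrease, Markov's inequality bounds the number of discarded
  indices below any N.\<close>

lemma Koopman_von_Neumann:
  fixes b :: "nat \<Rightarrow> real"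
  assumes b: "\<And>j. 0 \<le> b j" and lim: "(\<lambda>N. (\<Sum>j<N. b j) / real N) \<longlonglongrightarrow> 0"
  shows "\<exists>s. density_one_subseq s \<and> (\<lambda>k. b (s k)) \<longlonglongrightarrow> 0"
proof -
  define m where "m N = (\<Sum>j<N. b j) / real N" for N
  define d where "d N = (SUP M\<in>{N..}. m M) + 1 / real (Suc N)" for N
  have m0: "m N \<ge> 0" for N unfolding m_def using b by (auto intro!: divide_nonneg_nonneg sum_nonneg)
  have "Bseq m" using lim unfolding m_def[abs_def] by (intro convergent_imp_Bseq convergentI)
  then have bdd: "bdd_above (m ` S)" for S
    by (metis Bseq_eq_bounded bdd_above_mono bounded_imp_bdd_above image_mono subset_UNIV)
  have md: "m M < d N" if "N \<le> M" for M N
  proof -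
    have "m M \<le> (SUP M\<in>{N..}. m M)" using that by (intro cSUP_upper bdd) auto
    then show ?thesis unfolding d_def by (rule less_le_trans[OF le_less_trans[OF _ less_add_same_cancel1[THEN iffD2]]]) auto
  qed
  have d_pos: "d N > 0" for N using md[of N N] m0[of N] by linarith
  have d_mono: "d N \<le> d M" if "M \<le> N" for M N
  proof -
    have "(SUP M\<in>{N..}. m M) \<le> (SUP M\<in>{M..}. m M)" using that by (intro cSUP_subset_mono bdd) auto
    moreover have "1 / real (Suc N) \<le> 1 / real (Suc M)" using that by (intro divide_left_mono) auto
    ultimately show ?thesis unfolding d_def by linarith
  qed
  have "d \<longlonglongrightarrow> 0"
  proof -
    have "(\<lambda>N. SUP M\<in>{N..}. m M) \<longlonglongrightarrow> 0"
    proof (rule LIMSEQ_I)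
      fix e :: real assume e: "e > 0"
      have "\<forall>\<^sub>F N in sequentially. m N < e / 2"
        using lim e unfolding m_def[abs_def] by (intro order_tendstoD(2)) auto
      then obtain N0 where N0: "\<And>N. N \<ge> N0 \<Longrightarrow> m N < e / 2" by (auto simp: eventually_sequentially)
      show "\<exists>N0. \<forall>N\<ge>N0. norm ((SUP M\<in>{N..}. m M) - 0) < e"
      proof (intro exI[of _ N0] allI impI)
        fix N assume "N \<ge> N0"
        then have "(SUP M\<in>{N..}. m M) \<le> e / 2" using N0 by (intro cSUP_least) (auto intro: less_imp_le)
        moreover have "m N \<le> (SUP M\<in>{N..}. m M)" by (intro cSUP_upper bdd) auto
        ultimately show "norm ((SUP M\<in>{N..}. m M) - 0) < e" using e m0[of N] by simp
      qed
    qed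
    from tendsto_add[OF this LIMSEQ_inverse_real_of_nat] show ?thesis
      unfolding d_def[abs_def] by (simp add: inverse_eq_divide)
  qed
  then have sd: "(\<lambda>N. sqrt (d N)) \<longlonglongrightarrow> 0" using tendsto_real_sqrt by fastforce
  define S where "S = {j. b j \<le> sqrt (d j)}"
  have bad: "real (card ({..<N} - S)) \<le> real N * sqrt (d N)" for N
  proof (cases "N = 0")
    case False
    have "real (card ({..<N} - S)) * sqrt (d N) = (\<Sum>j\<in>{..<N} - S. sqrt (d N))" by simp
    also have "\<dots> \<le> (\<Sum>j\<in>{..<N} - S. b j)"
    proof (rule sum_mono)
      fix j assume "j \<in> {..<N} - S"
      then have "sqrt (d N) \<le> sqrt (d j)" "sqrt (d j) < b j" using d_mono by (auto simp: S_def)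
      then show "sqrt (d N) \<le> b j" by linarith
    qed
    also have "\<dots> \<le> (\<Sum>j<N. b j)" using b by (intro sum_mono2) auto
    also have "\<dots> = real N * m N" using False by (simp add: m_def)
    also have "\<dots> \<le> real N * d N" using md[of N N] by (intro mult_left_mono) auto
    also have "\<dots> = real N * sqrt (d N) * sqrt (d N)" using d_pos[of N] by simp
    finally show ?thesis using d_pos[of N] by simp
  qed simp
  have cardS: "real (card (S \<inter> {..<N})) = real N - real (card ({..<N} - S))" for N
  proof -
    have "card {..<N} = card (S \<inter> {..<N}) + card ({..<N} - S)"
      by (metis Int_commute card_Int_Diff finite_lessThan)
    then show ?thesis by simp
  qed
  have dens: "(\<lambda>N. real (card (S \<inter> {..<N})) / real N) \<longlonglongrightarrow> 1"
  proof (rule tendsto_sandwich)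
    show "\<forall>\<^sub>F N in sequentially. 1 - sqrt (d N) \<le> real (card (S \<inter> {..<N})) / real N"
      using eventually_gt_at_top[of 0]
    proof eventually_elim
      case (elim N)
      then show ?case using bad[of N] cardS[of N] by (simp add: field_simps)
    qed
    show "\<forall>\<^sub>F N in sequentially. real (card (S \<inter> {..<N})) / real N \<le> 1"
      using eventually_gt_at_top[of 0]
    proof eventually_elim
      case (elim N)
      then show ?case using cardS[of N] by (simp add: field_simps)
    qed
    show "(\<lambda>N. 1 - sqrt (d N)) \<longlonglongrightarrow> 1" using tendsto_diff[OF tendsto_const sd, of 1] by simp
  qed simp
  have "infinite S"
  proof
    assume "finite S"
    have "(\<lambda>N. real (card S) / real N) \<longlonglongrightarrow> 0" by (rule lim_const_over_n)
    then have "(\<lambda>N. real (card (S \<inter> {..<N})) / real N) \<longlonglongrightarrow> 0"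
      by (rule Lim_null_comparison[rotated])
        (use \<open>finite S\<close> in \<open>auto intro!: always_eventually divide_right_mono card_mono\<close>)
    then show False using dens LIMSEQ_unique by fastforce
  qed
  define s where "s = enumerate S"
  have s: "strict_mono s" unfolding s_def using \<open>infinite S\<close> strict_mono_enumerate by blast
  have range: "range s = S" unfolding s_def using \<open>infinite S\<close> range_enumerate by blast
  have "card {k. s k < N} = card (S \<inter> {..<N})" for N
  proof -
    have "s ` {k. s k < N} = S \<inter> {..<N}" using range by auto
    then show ?thesis by (metis card_image inj_on_subset s strict_mono_imp_inj_on subset_UNIV)
  qed
  then have "density_one_subseq s" unfolding density_one_subseq_def using s dens by simp
  moreover have "(\<lambda>k. b (s k)) \<longlonglongrightarrow> 0"
  proof (rule Lim_null_comparison)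
    show "\<forall>\<^sub>F k in sequentially. norm (b (s k)) \<le> sqrt (d (s k))"
      using range b by (intro always_eventually) (auto simp: S_def)
    show "(\<lambda>k. sqrt (d (s k))) \<longlonglongrightarrow> 0"
      using LIMSEQ_subseq_LIMSEQ[OF sd s] by (simp add: o_def)
  qed
  ultimately show ?thesis by blast
qed

text \<open>Countably many bounded sequences are handled at once through a geometrically weighted sum.\<close>

lemma Koopman_von_Neumann_countable:
  fixes a :: "nat \<Rightarrow> nat \<Rightarrow> real"
  assumes a: "\<And>m j. 0 \<le> a m j" "\<And>m j. a m j \<le> 1"
    and lim: "\<And>m. (\<lambda>N. (\<Sum>j<N. a m j) / real N) \<longlonglongrightarrow> 0"
  shows "\<exists>s. density_one_subseq s \<and> (\<forall>m. (\<lambda>k. a m (s k)) \<longlonglongrightarrow> 0)"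
proof -
  define b where "b j = (\<Sum>m. (1 / 2) ^ m * a m j)" for j
  have g: "summable (\<lambda>m. (1 / 2 :: real) ^ m)" by (simp add: summable_geometric)
  have sm: "summable (\<lambda>m. (1 / 2) ^ m * a m j)" for j
    by (rule summable_comparison_test'[OF g, of 0]) (use a in \<open>auto simp: abs_mult mult_left_le\<close>)
  have b_ge: "(1 / 2) ^ m * a m j \<le> b j" for m j
    unfolding b_def using sum_le_suminf[OF sm, of "{m}" j] a by simp
  have b0: "0 \<le> b j" for j using b_ge[of 0 j] a(1)[of 0 j] by simp
  have eq: "(\<Sum>j<N. b j) / real N = (\<Sum>m. (1 / 2) ^ m * ((\<Sum>j<N. a m j) / real N))" for N
  proof -
    have "(\<Sum>j<N. b j) = (\<Sum>m. \<Sum>j<N. (1 / 2) ^ m * a m j)"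
      unfolding b_def by (rule suminf_sum[symmetric]) (rule sm)
    then have "(\<Sum>j<N. b j) / real N = (\<Sum>m. (\<Sum>j<N. (1 / 2) ^ m * a m j) / real N)"
      using suminf_divide[OF summable_sum[of "{..<N}" "\<lambda>j m. (1 / 2) ^ m * a m j", OF sm], of "real N"] by simp
    then show ?thesis by (simp add: sum_distrib_left)
  qed
  have bound: "norm ((1 / 2) ^ m * ((\<Sum>j<N. a m j) / real N)) \<le> (1 / 2) ^ m" for m N
  proof -
    have "(\<Sum>j<N. a m j) \<le> (\<Sum>j<N. 1)" by (intro sum_mono a)
    then have "(\<Sum>j<N. a m j) / real N \<le> 1" by (cases "N = 0") (auto simp: field_simps)
    moreover have "(\<Sum>j<N. a m j) / real N \<ge> 0" by (intro divide_nonneg_nonneg sum_nonneg a) auto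
    ultimately have "norm ((\<Sum>j<N. a m j) / real N) \<le> 1" by simp
    from mult_left_mono[OF this, of "(1 / 2) ^ m"] show ?thesis by (simp only: norm_mult) simp
  qed
  have "(\<lambda>N. \<Sum>m. (1 / 2) ^ m * ((\<Sum>j<N. a m j) / real N)) \<longlonglongrightarrow> (\<Sum>m. 0)"
  proof (rule tannerys_theorem[OF _ _ g, THEN conjunct2, THEN conjunct2])
    show "(\<lambda>N. (1 / 2) ^ m * ((\<Sum>j<N. a m j) / real N)) \<longlonglongrightarrow> 0" for m
      using tendsto_mult[OF tendsto_const lim[of m], of "(1 / 2) ^ m"] by simp
    show "\<forall>\<^sub>F (m, N) in at_top \<times>\<^sub>F sequentially. norm ((1 / 2) ^ m * ((\<Sum>j<N. a m j) / real N)) \<le> (1 / 2) ^ m"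
      using bound by (intro always_eventually) auto
  qed simp
  then have "(\<lambda>N. (\<Sum>j<N. b j) / real N) \<longlonglongrightarrow> 0" using eq by simp
  from Koopman_von_Neumann[OF b0 this]
  obtain s where s: "density_one_subseq s" "(\<lambda>k. b (s k)) \<longlonglongrightarrow> 0" by blast
  have "(\<lambda>k. a m (s k)) \<longlonglongrightarrow> 0" for m
  proof (rule Lim_null_comparison)
    show "\<forall>\<^sub>F k in sequentially. norm (a m (s k)) \<le> 2 ^ m * b (s k)"
      using b_ge[of m] a(1) by (intro always_eventually) (auto simp: power_divide field_simps)
    show "(\<lambda>k. 2 ^ m * b (s k)) \<longlonglongrightarrow> 0" using tendsto_mult[OF tendsto_const s(2), of "2 ^ m"] by simp
  qed
  then show ?thesis using s(1) by blast
qed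

section \<open>Charts near interior points\<close>

locale singular_riemannian =
  fixes X :: "'a topology" and A :: "('a, real ^ 'n::finite option) chart set"
    and g :: "('a, 'n option) tensor2" and v :: "'a measure"
  assumes manifold: "smooth_manifold half_space X A"
    and metric: "riemannian_metric_on A (interior_part X A) g"
    and volume: "riemannian_volume X A g v"
begin

abbreviation Xint where "Xint \<equiv> interior_part X A"

lemma hausdorff: "Hausdorff_space X" and covers: "(\<Union>(U, \<phi>)\<in>A. U) = topspace X"
  and second_countable: "second_countable X"
  using manifold by (auto simp: smooth_manifold_def)

lemma chart:
  assumes "(U, \<phi>) \<in> A"
  shows "openin X U" "openin (top_of_set half_space) (\<phi> ` U)"
    "homeomorphic_map (subtopology X U) (top_of_set (\<phi> ` U)) \<phi>"
  using manifold assms by (auto simp: smooth_manifold_def)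

lemma chart_subset: "(U, \<phi>) \<in> A \<Longrightarrow> U \<subseteq> topspace X"
  using chart(1) openin_subset by blast

lemma chart_topspace: "(U, \<phi>) \<in> A \<Longrightarrow> topspace (subtopology X U) = U"
  using chart_subset by (metis topspace_subtopology_subset)

lemma chart_inj: "(U, \<phi>) \<in> A \<Longrightarrow> inj_on \<phi> U"
  using chart(3) chart_topspace unfolding homeomorphic_map_def by metis

lemma inv_chart [simp]: "(U, \<phi>) \<in> A \<Longrightarrow> p \<in> U \<Longrightarrow> inv_into U \<phi> (\<phi> p) = p"
  using chart_inj inv_into_f_f by metis

lemma chart_nonneg: "(U, \<phi>) \<in> A \<Longrightarrow> p \<in> U \<Longrightarrow> 0 \<le> \<phi> p $ None"
  using openin_imp_subset[OF chart(2)] by (auto simp: half_space_def)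

lemma transition_smooth:
  "(U, \<phi>) \<in> A \<Longrightarrow> (V, \<psi>) \<in> A \<Longrightarrow> smooth_on (\<phi> ` (U \<inter> V)) (\<psi> \<circ> inv_into U \<phi>)"
  using manifold by (auto simp: smooth_manifold_def)

lemma chart_image_openin:
  assumes "(U, \<phi>) \<in> A" "openin X S" "S \<subseteq> U"
  shows "openin (top_of_set half_space) (\<phi> ` S)"
proof -
  have "openin (subtopology X U) S" using assms openin_open_subtopology[OF chart(1)[OF assms(1)]] by blast
  then have "openin (top_of_set (\<phi> ` U)) (\<phi> ` S)"
    using chart(3)[OF assms(1)] homeomorphic_imp_open_map open_map_def by blast
  then show ?thesis using chart(2)[OF assms(1)] openin_trans by blast
qed

lemma chart_preimage_open:
  assumes "(U, \<phi>) \<in> A" "open T"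
  shows "openin X {p \<in> U. \<phi> p \<in> T}"
proof -
  have "continuous_map (subtopology X U) (top_of_set (\<phi> ` U)) \<phi>"
    using chart(3)[OF assms(1)] homeomorphic_imp_continuous_map by blast
  then have "continuous_map (subtopology X U) euclidean \<phi>"
    using continuous_map_into_fulltopology by blast
  then have "openin (subtopology X U) {p \<in> topspace (subtopology X U). \<phi> p \<in> T}"
    using openin_continuous_map_preimage[of _ euclidean \<phi> T] assms(2) open_openin by blast
  then have "openin X {p \<in> topspace (subtopology X U). \<phi> p \<in> T}"
    by (rule openin_trans_full[OF _ chart(1)[OF assms(1)]])
  then show ?thesis by (simp only: chart_topspace[OF assms(1)])
qed

text \<open>Invariance of domain: a transition map is open near a point of the open half-space, so it cannot
  send that point to the edge of the half-space.\<close>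

lemma interior_if_positive:
  assumes "(U, \<phi>) \<in> A" "p \<in> U" "0 < \<phi> p $ None"
  shows "p \<in> Xint"
proof (rule ccontr)
  assume "p \<notin> Xint"
  then obtain V \<psi> where V: "(V, \<psi>) \<in> A" "p \<in> V" "\<psi> p $ None = 0"
    using assms chart_subset unfolding interior_part_def boundary_def by blast
  have "openin X (U \<inter> V)" using chart(1) assms V by blast
  then have "openin (top_of_set half_space) (\<phi> ` (U \<inter> V))"
    by (intro chart_image_openin[OF assms(1)]) auto
  then obtain T where T: "open T" "\<phi> ` (U \<inter> V) = half_space \<inter> T"
    by (auto simp: openin_open)
  define S where "S = T \<inter> {y. 0 < y $ None}"
  have "open {y :: real ^ 'n option. 0 < y $ None}"
    by (intro open_Collect_less continuous_intros)
  then have S: "open S" using T by (auto simp: S_def)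
  have S_sub: "S \<subseteq> \<phi> ` (U \<inter> V)" using T by (auto simp: S_def half_space_def)
  have pS: "\<phi> p \<in> S" using T assms V by (auto simp: S_def half_space_def)
  let ?f = "\<psi> \<circ> inv_into U \<phi>"
  have "smooth_on S ?f" by (rule smooth_on_subset[OF transition_smooth[OF assms(1) V(1)] S_sub])
  then have "continuous_on S ?f" using smooth_on_iff_Ck[OF S] Ck_imp_continuous_on by blast
  moreover have "inj_on ?f S"
  proof (rule inj_onI)
    fix x y assume xy: "x \<in> S" "y \<in> S" "?f x = ?f y"
    then obtain p q where "p \<in> U \<inter> V" "q \<in> U \<inter> V" "x = \<phi> p" "y = \<phi> q" using S_sub by blast
    then show "x = y" using xy assms(1) chart_inj[OF V(1)] by (auto dest: inj_onD)
  qed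
  ultimately have "open (?f ` S)" using S invariance_of_domain by blast
  moreover have f: "?f (\<phi> p) = \<psi> p" using assms by simp
  then have "\<psi> p \<in> ?f ` S" using pS by (metis image_eqI)
  ultimately obtain e where e: "e > 0" "ball (\<psi> p) e \<subseteq> ?f ` S" by (auto simp: open_contains_ball)
  let ?z = "\<psi> p - axis None (e / 2)"
  have "norm (axis None (e / 2) :: real ^ 'n option) = e / 2"
  proof -
    have "(axis None (e / 2) :: real ^ 'n option) = (e / 2) *\<^sub>R axis None 1"
      by (simp add: vec_eq_iff axis_def)
    then show ?thesis using e(1) by simp
  qed
  then have "?z \<in> ball (\<psi> p) e" using e(1) by (simp add: dist_norm)
  then have "?z \<in> ?f ` S" using e(2) by blast
  then obtain x where "x \<in> S" "?f x = ?z" by (metis imageE)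
  then obtain q where "q \<in> U \<inter> V" "x = \<phi> q" using S_sub by blast
  then have "\<psi> q = ?z" using \<open>?f x = ?z\<close> assms(1) by simp
  moreover have "0 \<le> \<psi> q $ None" using chart_nonneg[OF V(1)] \<open>q \<in> U \<inter> V\<close> by blast
  ultimately show False using V(3) e(1) by (simp add: axis_def)
qed

lemma interior_iff_positive:
  assumes "(U, \<phi>) \<in> A" "p \<in> U"
  shows "p \<in> Xint \<longleftrightarrow> 0 < \<phi> p $ None"
proof
  assume "p \<in> Xint"
  then have "\<phi> p $ None \<noteq> 0" using assms by (auto simp: interior_part_def boundary_def)
  then show "0 < \<phi> p $ None" using chart_nonneg[OF assms] by simp
qed (use interior_if_positive assms in blast)

lemma interior_chart_open:
  assumes "(U, \<phi>) \<in> A"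
  shows "openin X (U \<inter> Xint)"
proof -
  have "U \<inter> Xint = {p \<in> U. \<phi> p \<in> {y. 0 < y $ None}}"
    using interior_iff_positive[OF assms] by blast
  moreover have "open {y :: real ^ 'n option. 0 < y $ None}"
    by (intro open_Collect_less continuous_intros)
  ultimately show ?thesis using chart_preimage_open[OF assms, of "{y. 0 < y $ None}"] by simp
qed

lemma interior_open: "openin X Xint"
proof -
  have "Xint = (\<Union>(U, \<phi>)\<in>A. U \<inter> Xint)" using covers by (auto simp: interior_part_def)
  moreover have "openin X (\<Union>(U, \<phi>)\<in>A. U \<inter> Xint)"
    using interior_chart_open by (intro openin_Union) auto
  ultimately show ?thesis by simp
qed

lemma interior_subset: "Xint \<subseteq> topspace X" by (auto simp: interior_part_def)

lemma interior_chartE: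
  assumes "p \<in> Xint"
  obtains U \<phi> where "(U, \<phi>) \<in> A" "p \<in> U"
  using assms covers interior_subset by blast

lemma chart_image_open:
  assumes "(U, \<phi>) \<in> A" "openin X S" "S \<subseteq> U \<inter> Xint"
  shows "open (\<phi> ` S)"
proof -
  obtain T where T: "open T" "\<phi> ` S = half_space \<inter> T"
    using chart_image_openin[OF assms(1,2)] assms(3) by (auto simp: openin_open)
  have "\<phi> ` S \<subseteq> {y. 0 < y $ None}" using assms interior_iff_positive by blast
  then have "\<phi> ` S = T \<inter> {y. 0 < y $ None}" using T by (auto simp: half_space_def)
  moreover have "open {y :: real ^ 'n option. 0 < y $ None}"
    by (intro open_Collect_less continuous_intros)
  ultimately show ?thesis using T by auto
qed

definition coords :: "'a set \<Rightarrow> ('a \<Rightarrow> real ^ 'n option) \<Rightarrow> (real ^ 'n option) set" where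
  "coords U \<phi> = \<phi> ` (U \<inter> Xint)"

lemma coords_open: "(U, \<phi>) \<in> A \<Longrightarrow> open (coords U \<phi>)"
  unfolding coords_def using chart_image_open interior_chart_open by blast

lemma inv_coords:
  assumes "(U, \<phi>) \<in> A" "y \<in> coords U \<phi>"
  shows "inv_into U \<phi> y \<in> U \<inter> Xint" "\<phi> (inv_into U \<phi> y) = y"
  using assms by (auto simp: coords_def)

lemma chart_in_coords: "p \<in> U \<Longrightarrow> p \<in> Xint \<Longrightarrow> \<phi> p \<in> coords U \<phi>"
  by (auto simp: coords_def)

lemma inv_image_compact:
  assumes "(U, \<phi>) \<in> A" "compact T" "T \<subseteq> coords U \<phi>"
  shows "compactin X (inv_into U \<phi> ` T)"
proof -
  obtain h where h: "homeomorphic_maps (subtopology X U) (top_of_set (\<phi> ` U)) \<phi> h"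
    using chart(3)[OF assms(1)] homeomorphic_map_maps by blast
  have TU: "T \<subseteq> \<phi> ` U" using assms(3) by (auto simp: coords_def)
  have "inv_into U \<phi> y = h y" if "y \<in> \<phi> ` U" for y
    using h that chart_topspace[OF assms(1)] assms(1) by (auto simp: homeomorphic_maps_def)
  then have "inv_into U \<phi> ` T = h ` T" using TU by (intro image_cong) auto
  moreover have "compactin (top_of_set (\<phi> ` U)) T"
    using assms(2) TU by (simp add: compactin_subtopology)
  then have "compactin (subtopology X U) (h ` T)"
    using h image_compactin unfolding homeomorphic_maps_def by blast
  ultimately show ?thesis by (simp add: compactin_subtopology)
qed

lemma chart_image_compact:
  assumes "(U, \<phi>) \<in> A" "compactin X K" "K \<subseteq> U"
  shows "compact (\<phi> ` K)"
proof -
  have "compactin (subtopology X U) K" using assms by (simp add: compactin_subtopology)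
  moreover have "continuous_map (subtopology X U) (top_of_set (\<phi> ` U)) \<phi>"
    using chart(3)[OF assms(1)] homeomorphic_imp_continuous_map by blast
  ultimately have "compactin (top_of_set (\<phi> ` U)) (\<phi> ` K)" using image_compactin by blast
  then show ?thesis by (simp add: compactin_subtopology)
qed

section \<open>The Riemannian measure in a chart\<close>

lemma space_v [simp]: "space v = topspace X" and
  sets_v: "sets v = sigma_sets (topspace X) {U. openin X U}" and
  emeasure_chart: "(U, \<phi>) \<in> A \<Longrightarrow> E \<in> sets v \<Longrightarrow> E \<subseteq> U \<inter> Xint \<Longrightarrow>
    emeasure v E = (\<integral>\<^sup>+ y \<in> \<phi> ` E. ennreal (sqrt (det (g (U, \<phi>) y))) \<partial>lborel)" and
  boundary_null: "emeasure v (boundary A) = 0"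
  using volume unfolding riemannian_volume_def by auto

lemma open_sets: "openin X S \<Longrightarrow> S \<in> sets v"
  unfolding sets_v by (auto intro: sigma_sets.Basic)

lemma compact_sets: "compactin X K \<Longrightarrow> K \<in> sets v"
proof -
  assume K: "compactin X K"
  then have "openin X (topspace X - K)"
    using compactin_imp_closedin[OF hausdorff] by blast
  then have "topspace X - (topspace X - K) \<in> sets v" using open_sets sets.compl_sets[of _ v] by simp
  then show ?thesis using compactin_subset_topspace[OF K] by (simp add: double_diff)
qed

lemma metric_smooth: "(U, \<phi>) \<in> A \<Longrightarrow> smooth_on (coords U \<phi>) (g (U, \<phi>))"
  and metric_sym: "(U, \<phi>) \<in> A \<Longrightarrow> y \<in> coords U \<phi> \<Longrightarrow> transpose (g (U, \<phi>) y) = g (U, \<phi>) y"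
  and metric_pos: "(U, \<phi>) \<in> A \<Longrightarrow> y \<in> coords U \<phi> \<Longrightarrow> w \<noteq> 0 \<Longrightarrow> 0 < w \<bullet> (g (U, \<phi>) y *v w)"
  using metric unfolding riemannian_metric_on_def coords_def by blast+

lemma metric_Ck: "(U, \<phi>) \<in> A \<Longrightarrow> Ck k (\<lambda>y. g (U, \<phi>) y $ i $ j) (coords U \<phi>)"
proof -
  assume c: "(U, \<phi>) \<in> A"
  have "Ck k (g (U, \<phi>)) (coords U \<phi>)"
    using smooth_on_iff_Ck[OF coords_open[OF c]] metric_smooth[OF c] by blast
  then show ?thesis
    by (intro Ck_linear_compose[OF bounded_linear_vec_nth] coords_open[OF c])
qed

end

lemma posdef_invertible:
  fixes G :: "real ^ 'k::finite ^ 'k"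
  assumes "\<And>w. w \<noteq> 0 \<Longrightarrow> 0 < w \<bullet> (G *v w)"
  shows "invertible G"
proof -
  have "w = 0" if "G *v w = 0" for w using assms[of w] that by force
  then show ?thesis using invertible_left_inverse matrix_left_invertible_ker by blast
qed

text \<open>The segment from the identity to a positive definite matrix consists of invertible matrices, so
  the determinant keeps its sign along it.\<close>

lemma posdef_det_pos:
  fixes G :: "real ^ 'k::finite ^ 'k"
  assumes "\<And>w. w \<noteq> 0 \<Longrightarrow> 0 < w \<bullet> (G *v w)"
  shows "0 < det G"
proof (rule ccontr)
  define H where "H t = (1 - t) *\<^sub>R mat 1 + t *\<^sub>R G" for t :: real
  assume neg: "\<not> 0 < det G"
  have H: "H 0 = mat 1" "H 1 = G" by (auto simp: H_def)
  have cont: "continuous_on {0..1} (\<lambda>t. det (H t))"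
    unfolding det_def H_def by (intro continuous_intros)
  have "\<exists>t. 0 \<le> t \<and> t \<le> 1 \<and> det (H t) = 0"
    by (rule IVT2') (use neg H cont in auto)
  then obtain t where t: "0 \<le> t" "t \<le> 1" "det (H t) = 0" by blast
  have "0 < w \<bullet> (H t *v w)" if "w \<noteq> 0" for w
  proof -
    have eq: "w \<bullet> (H t *v w) = (1 - t) * (w \<bullet> w) + t * (w \<bullet> (G *v w))"
      by (simp add: H_def matrix_vector_mult_add_rdistrib inner_add_right flip: scaleR_matrix_vector_assoc)
    show ?thesis
    proof (cases "t = 0")
      case True
      then show ?thesis using that eq by simp
    next
      case False
      then have "0 < t * (w \<bullet> (G *v w))" using t assms[OF that] by simp
      moreover have "0 \<le> (1 - t) * (w \<bullet> w)" using t by simp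
      ultimately show ?thesis using eq by linarith
    qed
  qed
  then have "invertible (H t)" by (rule posdef_invertible)
  then show False using t(3) invertible_det_nz by blast
qed

lemma matrix_inv_both:
  fixes G :: "real ^ 'k::finite ^ 'k"
  assumes "invertible G"
  shows matrix_inv_right: "G ** matrix_inv G = mat 1" and matrix_inv_left: "matrix_inv G ** G = mat 1"
proof -
  have "G ** matrix_inv G = mat 1 \<and> matrix_inv G ** G = mat 1"
    using assms unfolding invertible_def matrix_inv_def by (rule someI_ex)
  then show "G ** matrix_inv G = mat 1" "matrix_inv G ** G = mat 1" by auto
qed

lemma posdef_inverse_pos:
  fixes G :: "real ^ 'k::finite ^ 'k"
  assumes "\<And>w. w \<noteq> 0 \<Longrightarrow> 0 < w \<bullet> (G *v w)" "x \<noteq> 0"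
  shows "0 < x \<bullet> (matrix_inv G *v x)"
proof -
  let ?y = "matrix_inv G *v x"
  have Gy: "G *v ?y = x"
    using matrix_inv_right[OF posdef_invertible[OF assms(1)]] by (simp add: matrix_vector_mul_assoc)
  then have "?y \<noteq> 0" using assms(2) by auto
  then have "0 < ?y \<bullet> (G *v ?y)" by (rule assms(1))
  then show ?thesis using Gy by (simp add: inner_commute)
qed

context singular_riemannian
begin

definition density :: "'a set \<Rightarrow> ('a \<Rightarrow> real ^ 'n option) \<Rightarrow> real ^ 'n option \<Rightarrow> real" where
  "density U \<phi> y = sqrt (det (g (U, \<phi>) y))"

lemma density_pos: "(U, \<phi>) \<in> A \<Longrightarrow> y \<in> coords U \<phi> \<Longrightarrow> 0 < density U \<phi> y"
  unfolding density_def using posdef_det_pos[OF metric_pos] by simp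

lemma det_Ck:
  assumes "open S" "\<And>i j. Ck k (\<lambda>y. G y $ i $ j) S"
  shows "Ck k (\<lambda>y. det (G y :: real ^ 'k::finite ^ 'k)) S"
  unfolding det_def by (intro Ck_sum Ck_mult Ck_prod Ck_const assms)

lemma density_Ck: assumes "(U, \<phi>) \<in> A" shows "Ck k (density U \<phi>) (coords U \<phi>)"
  unfolding density_def[abs_def]
proof (rule Ck_compose[OF coords_open[OF assms] _ _ Ck_sqrt])
  show "Ck k (\<lambda>y. det (g (U, \<phi>) y)) (coords U \<phi>)"
    by (rule det_Ck[OF coords_open[OF assms] metric_Ck[OF assms]])
  show "(\<lambda>y. det (g (U, \<phi>) y)) ` coords U \<phi> \<subseteq> {0<..}"
    using posdef_det_pos[OF metric_pos[OF assms]] by auto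
qed simp

lemma chart_measurable:
  assumes "(U, \<phi>) \<in> A"
  shows "\<phi> \<in> borel_measurable (restrict_space v (U \<inter> Xint))"
proof (rule borel_measurableI)
  fix S :: "(real ^ 'n option) set" assume "open S"
  have sp: "space (restrict_space v (U \<inter> Xint)) = U \<inter> Xint"
    using chart_subset[OF assms] by (auto simp: space_restrict_space)
  have "openin X ({p \<in> U. \<phi> p \<in> S} \<inter> (U \<inter> Xint))"
    by (intro openin_Int chart_preimage_open[OF assms \<open>open S\<close>] interior_chart_open[OF assms])
  moreover have "{p \<in> U. \<phi> p \<in> S} \<inter> (U \<inter> Xint) = \<phi> -` S \<inter> (U \<inter> Xint)" by auto
  ultimately show "\<phi> -` S \<inter> space (restrict_space v (U \<inter> Xint)) \<in> sets (restrict_space v (U \<inter> Xint))"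
    using open_sets[OF interior_chart_open[OF assms]] open_sets by (auto simp: sp sets_restrict_space_iff)
qed

lemma inv_chart_measurable:
  assumes "(U, \<phi>) \<in> A"
  shows "inv_into U \<phi> \<in> measurable (restrict_space borel (coords U \<phi>)) v"
proof (rule measurable_sigma_sets[OF sets_v])
  have sp: "space (restrict_space borel (coords U \<phi>)) = coords U \<phi>" by (simp add: space_restrict_space)
  show "inv_into U \<phi> \<in> space (restrict_space borel (coords U \<phi>)) \<rightarrow> topspace X"
    using inv_coords[OF assms] chart_subset[OF assms] by (auto simp: sp)
  show "{U. openin X U} \<subseteq> Pow (topspace X)" using openin_subset by auto
  fix S assume "S \<in> {U. openin X U}"
  then have "openin X (S \<inter> (U \<inter> Xint))" using interior_chart_open[OF assms] by auto
  then have "open (\<phi> ` (S \<inter> (U \<inter> Xint)))" by (intro chart_image_open[OF assms]) auto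
  moreover have "inv_into U \<phi> -` S \<inter> coords U \<phi> = \<phi> ` (S \<inter> (U \<inter> Xint))"
    using assms by (auto simp: coords_def)
  ultimately show "inv_into U \<phi> -` S \<inter> space (restrict_space borel (coords U \<phi>)) \<in> sets (restrict_space borel (coords U \<phi>))"
    using coords_open[OF assms] by (auto simp: sp sets_restrict_space_iff)
qed

text \<open>Extension by 0, so that a function concentrated on the chart domain becomes a function
  on the whole coordinate space.\<close>

definition pull :: "'a set \<Rightarrow> ('a \<Rightarrow> real ^ 'n option) \<Rightarrow> ('a \<Rightarrow> 'b::zero) \<Rightarrow> real ^ 'n option \<Rightarrow> 'b" where
  "pull U \<phi> f y = (if y \<in> coords U \<phi> then f (inv_into U \<phi> y) else 0)"

lemma pull_measurable:
  fixes f :: "'a \<Rightarrow> 'b::{zero, topological_space}"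
  assumes "(U, \<phi>) \<in> A" "f \<in> borel_measurable v"
  shows "pull U \<phi> f \<in> borel_measurable borel"
  unfolding pull_def
  using measurable_compose[OF inv_chart_measurable[OF assms(1)] assms(2)] coords_open[OF assms(1)]
  by (intro measurable_If_restrict_space_iff[THEN iffD2]) auto

lemma density_measurable:
  assumes "(U, \<phi>) \<in> A"
  shows "(\<lambda>y. indicator (coords U \<phi>) y * density U \<phi> y) \<in> borel_measurable borel"
  using borel_measurable_continuous_on_indicator[of "coords U \<phi>" "density U \<phi>"]
    Ck_imp_continuous_on[OF density_Ck[OF assms, of 0]] coords_open[OF assms] by (simp add: scaleR_conv_of_real)

text \<open>The formula for the measure of the measurable subsets of a chart domain says that the
  chart carries the Riemannian measure to a weighted Lebesgue measure. All integrals over chart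
  domains are computed in coordinates through this lemma.\<close>

lemma distr_chart:
  assumes "(U, \<phi>) \<in> A"
  shows "distr (restrict_space v (U \<inter> Xint)) borel \<phi> =
    Nonnegative_Lebesgue_Integration.density lborel (\<lambda>y. ennreal (indicator (coords U \<phi>) y * density U \<phi> y))"
proof (rule measure_eqI)
  fix S assume "S \<in> sets (distr (restrict_space v (U \<inter> Xint)) borel \<phi>)"
  then have S: "S \<in> sets borel" by simp
  have Om: "U \<inter> Xint \<in> sets v" using open_sets[OF interior_chart_open[OF assms]] .
  have sp: "space (restrict_space v (U \<inter> Xint)) = U \<inter> Xint"
    using chart_subset[OF assms] by (auto simp: space_restrict_space)
  let ?E = "\<phi> -` S \<inter> (U \<inter> Xint)"
  have E: "?E \<in> sets v"
    using measurable_sets[OF chart_measurable[OF assms] S] Om sets_restrict_space_iff[of "U \<inter> Xint" v]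
      sets.Int_space_eq2[OF Om] by (simp add: sp)
  have Om': "U \<inter> Xint \<inter> space v \<in> sets v" using Om sets.Int_space_eq2[OF Om] by simp
  have "emeasure (distr (restrict_space v (U \<inter> Xint)) borel \<phi>) S = emeasure (restrict_space v (U \<inter> Xint)) ?E"
    using S chart_measurable[OF assms] by (simp add: emeasure_distr sp)
  also have "\<dots> = emeasure v ?E" by (rule emeasure_restrict_space[OF Om']) blast
  also have "emeasure v ?E = (\<integral>\<^sup>+ y \<in> \<phi> ` ?E. ennreal (sqrt (det (g (U, \<phi>) y))) \<partial>lborel)"
    by (rule emeasure_chart[OF assms E]) auto
  also have "\<phi> ` ?E = S \<inter> coords U \<phi>" by (auto simp: coords_def)
  also have "(\<integral>\<^sup>+ y \<in> S \<inter> coords U \<phi>. ennreal (sqrt (det (g (U, \<phi>) y))) \<partial>lborel) =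
     (\<integral>\<^sup>+ y. ennreal (indicator (coords U \<phi>) y * density U \<phi> y) * indicator S y \<partial>lborel)"
    by (intro nn_integral_cong) (auto simp: indicator_def density_def)
  also have "\<dots> = emeasure (Nonnegative_Lebesgue_Integration.density lborel (\<lambda>y. ennreal (indicator (coords U \<phi>) y * density U \<phi> y))) S"
    using S density_measurable[OF assms] by (simp add: emeasure_density)
  finally show "emeasure (distr (restrict_space v (U \<inter> Xint)) borel \<phi>) S = \<dots>" .
qed simp

lemma integral_chart:
  fixes f :: "'a \<Rightarrow> 'b::{banach, second_countable_topology}"
  assumes c: "(U, \<phi>) \<in> A" and f: "f \<in> borel_measurable v" "\<And>p. p \<in> topspace X \<Longrightarrow> p \<notin> U \<inter> Xint \<Longrightarrow> f p = 0"
  shows "integrable v f \<longleftrightarrow> integrable lborel (\<lambda>y. density U \<phi> y *\<^sub>R pull U \<phi> f y)"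
    and "(LINT p|v. f p) = (LINT y|lborel. density U \<phi> y *\<^sub>R pull U \<phi> f y)"
proof -
  have Om: "U \<inter> Xint \<in> sets v" using open_sets[OF interior_chart_open[OF c]] .
  have sp: "space (restrict_space v (U \<inter> Xint)) = U \<inter> Xint"
    using chart_subset[OF c] by (auto simp: space_restrict_space)
  have f_ind: "indicator (U \<inter> Xint) p *\<^sub>R f p = f p" if "p \<in> space v" for p
    using f(2)[of p] that by (cases "p \<in> U \<inter> Xint") auto
  have pull_phi: "pull U \<phi> f (\<phi> p) = f p" if "p \<in> space (restrict_space v (U \<inter> Xint))" for p
    using that c by (auto simp: sp pull_def coords_def)
  have dens: "(indicator (coords U \<phi>) y * density U \<phi> y) *\<^sub>R pull U \<phi> f y = density U \<phi> y *\<^sub>R pull U \<phi> f y" for y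
    by (simp add: pull_def)
  have nonneg: "0 \<le> indicator (coords U \<phi>) y * density U \<phi> y" for y
    using density_pos[OF c, of y] by (auto simp: indicator_def)
  have pm: "pull U \<phi> f \<in> borel_measurable borel" by (rule pull_measurable[OF c f(1)])
  have "integrable v f \<longleftrightarrow> integrable v (\<lambda>p. indicator (U \<inter> Xint) p *\<^sub>R f p)"
    using f_ind by (intro Bochner_Integration.integrable_cong) auto
  also have "\<dots> \<longleftrightarrow> integrable (restrict_space v (U \<inter> Xint)) f"
    using Om sets.Int_space_eq2[OF Om] by (subst integrable_restrict_space) (auto simp: set_integrable_def)
  also have "\<dots> \<longleftrightarrow> integrable (restrict_space v (U \<inter> Xint)) (\<lambda>p. pull U \<phi> f (\<phi> p))"
    using pull_phi by (intro Bochner_Integration.integrable_cong) auto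
  also have "\<dots> \<longleftrightarrow> integrable (distr (restrict_space v (U \<inter> Xint)) borel \<phi>) (pull U \<phi> f)"
    by (rule integrable_distr_eq[OF chart_measurable[OF c] pm, symmetric])
  also have "\<dots> \<longleftrightarrow> integrable lborel (\<lambda>y. (indicator (coords U \<phi>) y * density U \<phi> y) *\<^sub>R pull U \<phi> f y)"
    unfolding distr_chart[OF c] using pm density_measurable[OF c] nonneg
    by (intro integrable_density) auto
  finally show "integrable v f \<longleftrightarrow> integrable lborel (\<lambda>y. density U \<phi> y *\<^sub>R pull U \<phi> f y)"
    by (simp only: dens)
  have "(LINT p|v. f p) = (LINT p|v. indicator (U \<inter> Xint) p *\<^sub>R f p)"
    using f_ind by (intro Bochner_Integration.integral_cong) auto
  also have "\<dots> = (LINT p|restrict_space v (U \<inter> Xint). f p)"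
    using Om sets.Int_space_eq2[OF Om] by (subst integral_restrict_space) (auto simp: set_lebesgue_integral_def)
  also have "\<dots> = (LINT p|restrict_space v (U \<inter> Xint). pull U \<phi> f (\<phi> p))"
    using pull_phi by (intro Bochner_Integration.integral_cong) auto
  also have "\<dots> = (LINT y|distr (restrict_space v (U \<inter> Xint)) borel \<phi>. pull U \<phi> f y)"
    by (rule integral_distr[OF chart_measurable[OF c] pm, symmetric])
  also have "\<dots> = (LINT y|lborel. (indicator (coords U \<phi>) y * density U \<phi> y) *\<^sub>R pull U \<phi> f y)"
    unfolding distr_chart[OF c] using pm density_measurable[OF c] nonneg
    by (intro integral_density) auto
  finally show "(LINT p|v. f p) = (LINT y|lborel. density U \<phi> y *\<^sub>R pull U \<phi> f y)"
    by (simp only: dens)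
qed

end

section \<open>Sums and products of smooth functions\<close>

lemma smooth_on_bilinear:
  assumes "bounded_bilinear bil" "smooth_on S f" "smooth_on S h"
  shows "smooth_on S (\<lambda>x. bil (f x) (h x))"
  unfolding smooth_on_def
proof
  fix x assume x: "x \<in> S"
  obtain U1 h1 where 1: "open U1" "x \<in> U1" "\<forall>k. Ck k h1 U1" "\<forall>y\<in>S \<inter> U1. h1 y = f y"
    using assms(2) x unfolding smooth_on_def by metis
  obtain U2 h2 where 2: "open U2" "x \<in> U2" "\<forall>k. Ck k h2 U2" "\<forall>y\<in>S \<inter> U2. h2 y = h y"
    using assms(3) x unfolding smooth_on_def by metis
  have "\<forall>k. Ck k (\<lambda>x. bil (h1 x) (h2 x)) (U1 \<inter> U2)"
    using 1 2 by (auto intro!: Ck_bounded_bilinear[OF assms(1)] intro: Ck_subset)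
  then show "\<exists>U ha. open U \<and> x \<in> U \<and> (\<forall>k. Ck k ha U) \<and> (\<forall>y\<in>S \<inter> U. ha y = bil (f y) (h y))"
    using 1 2 by (intro exI[of _ "U1 \<inter> U2"] exI[of _ "\<lambda>x. bil (h1 x) (h2 x)"]) auto
qed

lemma smooth_on_add:
  assumes "smooth_on S f" "smooth_on S h"
  shows "smooth_on S (\<lambda>x. f x + h x)"
  unfolding smooth_on_def
proof
  fix x assume x: "x \<in> S"
  obtain U1 h1 where 1: "open U1" "x \<in> U1" "\<forall>k. Ck k h1 U1" "\<forall>y\<in>S \<inter> U1. h1 y = f y"
    using assms(1) x unfolding smooth_on_def by metis
  obtain U2 h2 where 2: "open U2" "x \<in> U2" "\<forall>k. Ck k h2 U2" "\<forall>y\<in>S \<inter> U2. h2 y = h y"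
    using assms(2) x unfolding smooth_on_def by metis
  have "\<forall>k. Ck k (\<lambda>x. h1 x + h2 x) (U1 \<inter> U2)"
    using 1 2 by (auto intro!: Ck_add intro: Ck_subset)
  then show "\<exists>U ha. open U \<and> x \<in> U \<and> (\<forall>k. Ck k ha U) \<and> (\<forall>y\<in>S \<inter> U. ha y = f y + h y)"
    using 1 2 by (intro exI[of _ "U1 \<inter> U2"] exI[of _ "\<lambda>x. h1 x + h2 x"]) auto
qed

lemma smooth_on_linear:
  assumes "bounded_linear L" "smooth_on S f"
  shows "smooth_on S (\<lambda>x. L (f x))"
  unfolding smooth_on_def
proof
  fix x assume x: "x \<in> S"
  obtain U1 h1 where 1: "open U1" "x \<in> U1" "\<forall>k. Ck k h1 U1" "\<forall>y\<in>S \<inter> U1. h1 y = f y"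
    using assms(2) x unfolding smooth_on_def by metis
  then show "\<exists>U ha. open U \<and> x \<in> U \<and> (\<forall>k. Ck k ha U) \<and> (\<forall>y\<in>S \<inter> U. ha y = L (f y))"
    by (intro exI[of _ U1] exI[of _ "\<lambda>x. L (h1 x)"]) (auto intro!: Ck_linear_compose[OF assms(1)])
qed

lemma frechet_derivative_cong_open:
  assumes "open S" "x \<in> S" "\<And>y. y \<in> S \<Longrightarrow> f y = h y"
  shows "frechet_derivative f (at x) = frechet_derivative h (at x)"
proof -
  have "(f has_derivative f') (at x) \<longleftrightarrow> (h has_derivative f') (at x)" for f'
    using has_derivative_transform_within_open[of f f' x UNIV S h]
      has_derivative_transform_within_open[of h f' x UNIV S f] assms by auto
  then show ?thesis unfolding frechet_derivative_def by presburger
qed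

section \<open>Quadratic forms under changes of coordinates\<close>

text \<open>The product is complex bilinear. Conjugates are inserted only where energies are
  considered.\<close>

definition coord_gradient_product ::
    "(real ^ 'k::finite \<Rightarrow> real ^ 'k ^ 'k) \<Rightarrow> (real ^ 'k \<Rightarrow> complex) \<Rightarrow> (real ^ 'k \<Rightarrow> complex) \<Rightarrow> real ^ 'k \<Rightarrow> complex" where
  "coord_gradient_product G f h y =
     (\<Sum>i\<in>UNIV. \<Sum>j\<in>UNIV. (matrix_inv (G y) $ i $ j) *\<^sub>R (partial_deriv i f y * partial_deriv j h y))"

lemma partial_deriv_Ck: "Ck (Suc k) h S \<Longrightarrow> Ck k (partial_deriv i h) S"
  unfolding partial_deriv_def by simp

text \<open>By Cramer's rule the entries of the inverse matrix are quotients of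
  determinants.\<close>

lemma matrix_inv_Ck:
  assumes "open S" "\<And>i j. Ck k (\<lambda>y. G y $ i $ j) S" "\<And>y w. y \<in> S \<Longrightarrow> w \<noteq> 0 \<Longrightarrow> 0 < w \<bullet> (G y *v w)"
  shows "Ck k (\<lambda>y. matrix_inv (G y :: real ^ 'k::finite ^ 'k) $ i $ j) S"
proof (rule Ck_cong_open[OF assms(1)])
  let ?M = "\<lambda>y. (\<chi> a b. if b = i then axis j 1 $ a else G y $ a $ b) :: real ^ 'k ^ 'k"
  have detG: "Ck k (\<lambda>y. det (G y)) S"
    unfolding det_def by (intro Ck_sum[OF assms(1)] Ck_mult[OF assms(1)] Ck_prod[OF assms(1)] Ck_const assms(2))
  have entry: "Ck k (\<lambda>y. ?M y $ a $ b) S" for a b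
    using assms(2) by (cases "b = i") auto
  have "Ck k (\<lambda>y. det (?M y)) S"
    unfolding det_def by (intro Ck_sum[OF assms(1)] Ck_mult[OF assms(1)] Ck_prod[OF assms(1)] Ck_const entry)
  moreover have "Ck k (\<lambda>y. inverse (det (G y))) S"
    by (rule Ck_compose[OF assms(1) _ _ Ck_inverse detG]) (use posdef_det_pos[OF assms(3)] in force)+
  ultimately show "Ck k (\<lambda>y. det (?M y) * inverse (det (G y))) S"
    by (rule Ck_mult[OF assms(1)])
  fix y assume y: "y \<in> S"
  let ?x = "matrix_inv (G y) *v axis j 1"
  have inv: "invertible (G y)" by (rule posdef_invertible[OF assms(3)[OF y]])
  have "G y *v ?x = axis j 1" using matrix_inv_right[OF inv] by (simp add: matrix_vector_mul_assoc)
  moreover have "det (G y) \<noteq> 0" using inv invertible_det_nz by blast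
  ultimately have "?x = (\<chi> k. det (\<chi> a b. if b = k then axis j 1 $ a else G y $ a $ b) / det (G y))"
    using cramer by blast
  then have "?x $ i = det (?M y) / det (G y)" by simp
  moreover have "?x $ i = matrix_inv (G y) $ i $ j"
    by (simp add: matrix_vector_mult_basis column_def)
  ultimately show "det (?M y) * inverse (det (G y)) = matrix_inv (G y) $ i $ j"
    by (simp add: divide_inverse)
qed

lemma sum4_swap:
  "(\<Sum>i\<in>I. \<Sum>j\<in>J. \<Sum>k\<in>K. \<Sum>l\<in>L. F i j k l) = (\<Sum>k\<in>K. \<Sum>l\<in>L. \<Sum>i\<in>I. \<Sum>j\<in>J. F i j k l)"
proof -
  have "(\<Sum>i\<in>I. \<Sum>j\<in>J. \<Sum>k\<in>K. \<Sum>l\<in>L. F i j k l) = (\<Sum>i\<in>I. \<Sum>k\<in>K. \<Sum>j\<in>J. \<Sum>l\<in>L. F i j k l)"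
    by (intro sum.cong refl sum.swap)
  also have "\<dots> = (\<Sum>k\<in>K. \<Sum>i\<in>I. \<Sum>j\<in>J. \<Sum>l\<in>L. F i j k l)" by (rule sum.swap)
  also have "\<dots> = (\<Sum>k\<in>K. \<Sum>i\<in>I. \<Sum>l\<in>L. \<Sum>j\<in>J. F i j k l)"
    by (intro sum.cong refl sum.swap)
  also have "\<dots> = (\<Sum>k\<in>K. \<Sum>l\<in>L. \<Sum>i\<in>I. \<Sum>j\<in>J. F i j k l)"
    by (intro sum.cong refl sum.swap)
  finally show ?thesis .
qed

text \<open>Here \<open>J\<close> is the Jacobian matrix of a transition map: a congruence of
  metrics induces one of their inverses, in the opposite direction. The next lemma turns this into
  the invariance of the product of two gradients.\<close>

lemma inverse_congruence:
  fixes J G G' :: "real ^ 'k::finite ^ 'k"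
  assumes G: "G = transpose J ** G' ** J" and "invertible G" "invertible G'"
  shows "J ** matrix_inv G ** transpose J = matrix_inv G'"
proof -
  have "det G = det J * det G' * det J" unfolding G by (simp add: det_mul det_transpose)
  then have J: "invertible J" using assms(2) by (auto simp: invertible_det_nz)
  let ?B = "J ** matrix_inv G ** transpose J"
  have "(?B ** G') ** J = J ** (matrix_inv G ** (transpose J ** G' ** J))"
    by (simp add: matrix_mul_assoc)
  also have "\<dots> = J" using matrix_inv_left[OF assms(2)] by (simp add: G[symmetric])
  finally have "((?B ** G') ** J) ** matrix_inv J = J ** matrix_inv J" by simp
  then have "?B ** G' = mat 1"
    using matrix_inv_right[OF J] by (simp add: matrix_mul_assoc[symmetric])
  then have "(?B ** G') ** matrix_inv G' = matrix_inv G'" by simp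
  then show ?thesis using matrix_inv_right[OF assms(3)] by (simp add: matrix_mul_assoc[symmetric])
qed

lemma bilinear_form_congruence:
  fixes J G G' :: "real ^ 'k::finite ^ 'k" and a b a' b' :: "'k \<Rightarrow> complex"
  assumes B: "J ** B ** transpose J = B'"
    and a: "\<And>i. a i = (\<Sum>k\<in>UNIV. (J $ k $ i) *\<^sub>R a' k)" and b: "\<And>i. b i = (\<Sum>k\<in>UNIV. (J $ k $ i) *\<^sub>R b' k)"
  shows "(\<Sum>i\<in>UNIV. \<Sum>j\<in>UNIV. (B $ i $ j) *\<^sub>R (a i * b j)) = (\<Sum>k\<in>UNIV. \<Sum>l\<in>UNIV. (B' $ k $ l) *\<^sub>R (a' k * b' l))"
proof -
  have "B' $ k $ l = (\<Sum>i\<in>UNIV. \<Sum>j\<in>UNIV. J $ k $ i * B $ i $ j * J $ l $ j)" for k l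
  proof -
    have "B' $ k $ l = (\<Sum>j\<in>UNIV. \<Sum>i\<in>UNIV. J $ k $ i * B $ i $ j * J $ l $ j)"
      unfolding B[symmetric] by (simp add: matrix_matrix_mult_def transpose_def sum_distrib_right)
    also have "\<dots> = (\<Sum>i\<in>UNIV. \<Sum>j\<in>UNIV. J $ k $ i * B $ i $ j * J $ l $ j)" by (rule sum.swap)
    finally show ?thesis .
  qed
  then have "(\<Sum>k\<in>UNIV. \<Sum>l\<in>UNIV. (B' $ k $ l) *\<^sub>R (a' k * b' l)) =
    (\<Sum>k\<in>UNIV. \<Sum>l\<in>UNIV. \<Sum>i\<in>UNIV. \<Sum>j\<in>UNIV. (J $ k $ i * B $ i $ j * J $ l $ j) *\<^sub>R (a' k * b' l))"
    by (simp add: scaleR_sum_left)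
  also have "\<dots> = (\<Sum>i\<in>UNIV. \<Sum>j\<in>UNIV. \<Sum>k\<in>UNIV. \<Sum>l\<in>UNIV. (J $ k $ i * B $ i $ j * J $ l $ j) *\<^sub>R (a' k * b' l))"
    by (rule sum4_swap)
  also have "\<dots> = (\<Sum>i\<in>UNIV. \<Sum>j\<in>UNIV. (B $ i $ j) *\<^sub>R (a i * b j))"
  proof (intro sum.cong refl)
    fix i j
    have "(B $ i $ j) *\<^sub>R (a i * b j) = (\<Sum>k\<in>UNIV. \<Sum>l\<in>UNIV. (B $ i $ j) *\<^sub>R ((J $ k $ i) *\<^sub>R a' k * ((J $ l $ j) *\<^sub>R b' l)))"
      unfolding a b sum_product by (simp add: scaleR_sum_right)
    also have "\<dots> = (\<Sum>k\<in>UNIV. \<Sum>l\<in>UNIV. (J $ k $ i * B $ i $ j * J $ l $ j) *\<^sub>R (a' k * b' l))"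
      by (simp add: mult_ac)
    finally show "(\<Sum>k\<in>UNIV. \<Sum>l\<in>UNIV. (J $ k $ i * B $ i $ j * J $ l $ j) *\<^sub>R (a' k * b' l)) =
        (B $ i $ j) *\<^sub>R (a i * b j)" by simp
  qed
  finally show ?thesis by simp
qed

section \<open>Integration by parts and bump functions\<close>

text \<open>The product of \<open>f\<close> and \<open>W\<close>, extended by 0, is continuously
  differentiable on the whole space, and its derivatives have integral 0.\<close>

lemma integral_by_parts_compact_support:
  fixes f W :: "'e::euclidean_space \<Rightarrow> complex"
  assumes O: "open O'" "compact T" "T \<subseteq> O'"
    and f: "Ck 1 f UNIV" "\<And>y. y \<notin> T \<Longrightarrow> f y = 0" and W: "Ck 1 W O'"
  shows "integrable lborel (\<lambda>y. f y * frechet_derivative W (at y) e)" (is "integrable _ ?A")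
    and "integrable lborel (\<lambda>y. frechet_derivative f (at y) e * W y)" (is "integrable _ ?B")
    and "(LINT y|lborel. f y * frechet_derivative W (at y) e) = - (LINT y|lborel. frechet_derivative f (at y) e * W y)"
proof -
  interpret f: compactly_supported_C1 f T using f O by unfold_locales auto
  define F where "F y = (if y \<in> O' then f y * W y else 0)" for y
  have F0: "F y = 0" if "y \<notin> T" for y using that f(2) by (simp add: F_def)
  have FO: "Ck 1 F O'"
    by (rule Ck_cong_open[OF O(1) _ Ck_mult[OF O(1) Ck_subset[OF f(1)] W]]) (auto simp: F_def)
  have FT: "Ck 1 F (- T)"
    by (rule Ck_cong_open[OF _ _ Ck_const[of _ 0]]) (use O compact_imp_closed F0 in auto)
  have "Ck 1 F UNIV"
  proof (rule Ck_local)
    fix x :: 'e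
    have "open (- T)" using O(2) compact_imp_closed by blast
    then show "\<exists>U. open U \<and> x \<in> U \<and> Ck 1 F U" using FO FT O(1,3) by (cases "x \<in> T") blast+
  qed
  then interpret F: compactly_supported_C1 F T using F0 O by unfold_locales auto
  have W_diff: "(W has_derivative frechet_derivative W (at y)) (at y)" if "y \<in> O'" for y
    using W that by (auto simp: frechet_derivative_works[symmetric])
  have dF: "frechet_derivative F (at y) e = f y * frechet_derivative W (at y) e + frechet_derivative f (at y) e * W y" for y
  proof (cases "y \<in> O'")
    case True
    have "((\<lambda>y. f y * W y) has_derivative
       (\<lambda>v. f y * frechet_derivative W (at y) v + frechet_derivative f (at y) v * W y)) (at y)"
      by (rule has_derivative_mult[OF f.has_derivative W_diff[OF True]])
    then have "(F has_derivative
       (\<lambda>v. f y * frechet_derivative W (at y) v + frechet_derivative f (at y) v * W y)) (at y)"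
      by (rule has_derivative_transform_within_open[OF _ O(1) True]) (simp add: F_def)
    from frechet_derivative_at[OF this] show ?thesis by metis
  next
    case False
    then have "y \<notin> T" using O(3) by blast
    then show ?thesis using f.derivative_zero F.derivative_zero f(2) by simp
  qed
  have cW: "continuous_on T (\<lambda>y. frechet_derivative W (at y) e)" "continuous_on T W"
    using W O(3) Ck_imp_continuous_on[OF W] by (auto intro: continuous_on_subset)
  show A: "integrable lborel ?A"
    by (rule continuous_compact_support_integrable[OF O(2)])
      (use f(2) in \<open>auto intro!: continuous_intros f.continuous cW\<close>)
  show B: "integrable lborel ?B"
    by (rule continuous_compact_support_integrable[OF O(2)])
      (use f.derivative_zero in \<open>auto intro!: continuous_on_mult f.continuous_derivative cW\<close>)
  have "0 = (LINT y|lborel. frechet_derivative F (at y) e)" using F.integral_derivative by simp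
  also have "\<dots> = (LINT y|lborel. ?A y) + (LINT y|lborel. ?B y)"
    unfolding dF by (rule Bochner_Integration.integral_add[OF A B])
  finally show "(LINT y|lborel. ?A y) = - (LINT y|lborel. ?B y)" by (simp add: eq_neg_iff_add_eq_0)
qed

text \<open>A cutoff with value 1 on the closed ball of radius \<open>\<rho>\<close> and support in
  the ball of radius \<open>2 * \<rho>\<close>.\<close>

definition bump :: "'e::euclidean_space \<Rightarrow> real \<Rightarrow> 'e \<Rightarrow> complex" where
  "bump y0 \<rho> y = of_real (plateau ((1 / \<rho>) *\<^sub>R (y - y0)))"

lemma bump_Ck: "Ck k (bump y0 \<rho>) UNIV"
proof -
  have 1: "Ck k (\<lambda>y. (1 / \<rho>) *\<^sub>R (y - y0)) UNIV"
    by (rule Ck_scaleR[OF open_UNIV Ck_const Ck_diff[OF open_UNIV Ck_bounded_linear[OF bounded_linear_ident] Ck_const]])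
  have 2: "Ck k (\<lambda>y. plateau ((1 / \<rho>) *\<^sub>R (y - y0))) UNIV"
    by (rule Ck_compose[OF open_UNIV open_UNIV _ Ck_plateau 1]) simp
  show ?thesis unfolding bump_def[abs_def]
    by (rule Ck_linear_compose[OF bounded_linear_of_real 2 open_UNIV])
qed

lemma bump_scaled_norm: "\<rho> > 0 \<Longrightarrow> norm ((1 / \<rho>) *\<^sub>R (y - y0)) = dist y0 y / \<rho>"
  by (simp only: norm_scaleR) (simp add: dist_norm norm_minus_commute)

lemma bump_eq_1: "\<rho> > 0 \<Longrightarrow> y \<in> cball y0 \<rho> \<Longrightarrow> bump y0 \<rho> y = 1"
  unfolding bump_def by (subst plateau_eq_1) (simp_all only: bump_scaled_norm, simp_all add: field_simps)

lemma bump_eq_0: "\<rho> > 0 \<Longrightarrow> y \<notin> ball y0 (2 * \<rho>) \<Longrightarrow> bump y0 \<rho> y = 0"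
  unfolding bump_def by (subst plateau_eq_0) (simp_all only: bump_scaled_norm, simp_all add: field_simps)

lemma bump_real: "bump y0 \<rho> y = of_real (Re (bump y0 \<rho> y))"
  and bump_nonneg: "0 \<le> Re (bump y0 \<rho> y)" and bump_le_1: "Re (bump y0 \<rho> y) \<le> 1"
  using plateau_nonneg plateau_le_1 by (simp_all add: bump_def)

lemma bump_norm: "cmod (bump y0 \<rho> y) \<le> 1"
  using bump_nonneg[of y0 \<rho> y] bump_le_1[of y0 \<rho> y] by (subst bump_real) (simp only: norm_of_real abs_of_nonneg)

text \<open>If \<open>c y\<close> were not 0, the real part of \<open>cnj (c y) * c\<close> would be
  at least a positive constant \<open>m\<close> on a ball around \<open>y\<close>, and a bump
  supported in this ball would have positive integral against it.\<close>

lemma zero_if_orthogonal_to_bumps: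
  fixes c :: "'e::euclidean_space \<Rightarrow> complex"
  assumes O: "open O'" "continuous_on O' c"
    and orth: "\<And>y \<rho>. \<rho> > 0 \<Longrightarrow> cball y (2 * \<rho>) \<subseteq> O' \<Longrightarrow> (LINT x|lborel. bump y \<rho> x * c x) = 0"
    and y: "y \<in> O'"
  shows "c y = 0"
proof (rule ccontr)
  assume nz: "c y \<noteq> 0"
  define m where "m = (cmod (c y))\<^sup>2 / 2"
  have m: "m > 0" using nz by (simp add: m_def)
  have "continuous_on O' (\<lambda>x. Re (cnj (c y) * c x))" using O(2) by (intro continuous_intros)
  then have "open (O' \<inter> (\<lambda>x. Re (cnj (c y) * c x)) -` {m<..})"
    using O(1) by (intro continuous_open_preimage) auto
  moreover have "Re (cnj (c y) * c y) = 2 * m"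
    by (simp add: m_def cmod_power2) (simp add: power2_eq_square)
  then have "y \<in> O' \<inter> (\<lambda>x. Re (cnj (c y) * c x)) -` {m<..}" using y m by simp
  ultimately obtain e where e: "e > 0" "cball y e \<subseteq> O' \<inter> (\<lambda>x. Re (cnj (c y) * c x)) -` {m<..}"
    by (meson open_contains_cball)
  define \<rho> where "\<rho> = e / 2"
  have \<rho>: "\<rho> > 0" "cball y (2 * \<rho>) \<subseteq> O'" using e by (auto simp: \<rho>_def)
  let ?T = "cball y (2 * \<rho>)"
  have zero: "bump y \<rho> x = 0" if "x \<notin> ?T" for x
    using bump_eq_0[OF \<rho>(1), of x y] that by auto
  have int: "integrable lborel (\<lambda>x. bump y \<rho> x * c x)"
    by (rule continuous_compact_support_integrable[of ?T])
      (use zero \<rho> O in \<open>auto intro!: continuous_on_mult intro: continuous_on_subset[OF Ck_imp_continuous_on[OF bump_Ck[of 0]]]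
         continuous_on_subset\<close>)
  have "m * measure lborel (ball y \<rho>) = (LINT x|lborel. m * indicator (ball y \<rho>) x)" by simp
  also have "\<dots> \<le> (LINT x|lborel. Re (cnj (c y) * (bump y \<rho> x * c x)))"
  proof (rule integral_mono)
    show "integrable lborel (\<lambda>x. m * indicator (ball y \<rho>) x)"
      using emeasure_lborel_ball_finite[of y \<rho>]
      by (intro integrable_mult_right integrable_real_indicator) auto
    show "integrable lborel (\<lambda>x. Re (cnj (c y) * (bump y \<rho> x * c x)))"
      using int by (intro integrable_Re integrable_mult_right)
    fix x
    let ?b = "Re (bump y \<rho> x)"
    obtain r where r: "bump y \<rho> x = of_real r" using bump_real by blast
    have eq: "Re (cnj (c y) * (bump y \<rho> x * c x)) = ?b * Re (cnj (c y) * c x)"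
      by (simp add: r algebra_simps)
    have ge: "m \<le> Re (cnj (c y) * c x)" if "x \<in> ?T" using that e(2) by (force simp: \<rho>_def)
    have one: "?b = 1" if "x \<in> ball y \<rho>" using bump_eq_1[OF \<rho>(1), of x y] that by simp
    have zero': "?b = 0" if "x \<notin> ?T" using zero[OF that] by simp
    show "m * indicator (ball y \<rho>) x \<le> Re (cnj (c y) * (bump y \<rho> x * c x))"
    proof (cases "x \<in> ball y \<rho>")
      case True
      then have "x \<in> ?T" using \<rho>(1) by simp
      then show ?thesis unfolding eq one[OF True] using True ge by simp
    next
      case False
      have "0 \<le> ?b * Re (cnj (c y) * c x)"
      proof (cases "x \<in> ?T")
        case True
        then have "0 \<le> Re (cnj (c y) * c x)" using ge m by linarith
        then show ?thesis by (rule mult_nonneg_nonneg[OF bump_nonneg])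
      next
        case False
        show ?thesis by (simp only: zero'[OF False] mult_zero_left order_refl)
      qed
      then show ?thesis unfolding eq using False by simp
    qed
  qed
  also have "\<dots> = Re (cnj (c y) * (LINT x|lborel. bump y \<rho> x * c x))"
    using int by (subst integral_Re) auto
  also have "\<dots> = 0" using orth[OF \<rho>] by simp
  finally have "measure lborel (ball y \<rho>) \<le> 0" using m by (simp add: mult_le_0_iff)
  moreover have "measure lborel (ball y \<rho>) > 0" using content_ball_pos[OF \<rho>(1)] by simp
  ultimately show False by linarith
qed

section \<open>The Laplacian on test functions\<close>

context singular_riemannian
begin

abbreviation tests where "tests \<equiv> test_functions X A"

lemma test_smooth: "f \<in> tests \<Longrightarrow> (U, \<phi>) \<in> A \<Longrightarrow> smooth_on (\<phi> ` U) (\<lambda>y. f (inv_into U \<phi> y))"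
  unfolding test_functions_def o_def by blast

lemma test_Ck: "f \<in> tests \<Longrightarrow> (U, \<phi>) \<in> A \<Longrightarrow> Ck k (\<lambda>y. f (inv_into U \<phi> y)) (coords U \<phi>)"
  using smooth_on_subset[OF test_smooth, of f U \<phi> "coords U \<phi>"] smooth_on_iff_Ck[OF coords_open]
  unfolding coords_def by blast

lemma test_support:
  assumes "f \<in> tests"
  obtains K where "compactin X K" "K \<subseteq> Xint" "\<And>p. p \<in> topspace X - K \<Longrightarrow> f p = 0"
  using assms unfolding test_functions_def by blast

lemma testI:
  assumes "\<And>U \<phi>. (U, \<phi>) \<in> A \<Longrightarrow> smooth_on (\<phi> ` U) (\<lambda>y. f (inv_into U \<phi> y))"
    and "compactin X K" "K \<subseteq> Xint" "\<And>p. p \<in> topspace X - K \<Longrightarrow> f p = 0"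
  shows "f \<in> tests"
  using assms unfolding test_functions_def o_def by blast

lemma test_mult: assumes "f \<in> tests" "h \<in> tests" shows "(\<lambda>p. f p * h p) \<in> tests"
proof -
  obtain K where K: "compactin X K" "K \<subseteq> Xint" "\<And>p. p \<in> topspace X - K \<Longrightarrow> f p = 0"
    using test_support[OF assms(1)] by blast
  show ?thesis
  proof (rule testI[OF _ K(1,2)])
    show "smooth_on (\<phi> ` U) (\<lambda>y. f (inv_into U \<phi> y) * h (inv_into U \<phi> y))" if "(U, \<phi>) \<in> A" for U \<phi>
      by (rule smooth_on_bilinear[OF bounded_bilinear_mult test_smooth[OF assms(1) that] test_smooth[OF assms(2) that]])
  qed (use K(3) in simp)
qed

lemma test_add: assumes "f \<in> tests" "h \<in> tests" shows "(\<lambda>p. f p + h p) \<in> tests"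
proof -
  obtain K where K: "compactin X K" "K \<subseteq> Xint" "\<And>p. p \<in> topspace X - K \<Longrightarrow> f p = 0"
    using test_support[OF assms(1)] by blast
  obtain K' where K': "compactin X K'" "K' \<subseteq> Xint" "\<And>p. p \<in> topspace X - K' \<Longrightarrow> h p = 0"
    using test_support[OF assms(2)] by blast
  show ?thesis
  proof (rule testI[OF _ compactin_Un[OF K(1) K'(1)]])
    show "smooth_on (\<phi> ` U) (\<lambda>y. f (inv_into U \<phi> y) + h (inv_into U \<phi> y))" if "(U, \<phi>) \<in> A" for U \<phi>
      by (rule smooth_on_add[OF test_smooth[OF assms(1) that] test_smooth[OF assms(2) that]])
  qed (use K K' in auto)
qed

lemma test_linear:
  assumes "f \<in> tests" "bounded_linear L" shows "(\<lambda>p. L (f p)) \<in> tests"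
proof -
  obtain K where K: "compactin X K" "K \<subseteq> Xint" "\<And>p. p \<in> topspace X - K \<Longrightarrow> f p = 0"
    using test_support[OF assms(1)] by blast
  show ?thesis
  proof (rule testI[OF _ K(1,2)])
    show "smooth_on (\<phi> ` U) (\<lambda>y. L (f (inv_into U \<phi> y)))" if "(U, \<phi>) \<in> A" for U \<phi>
      by (rule smooth_on_linear[OF assms(2) test_smooth[OF assms(1) that]])
  qed (use K(3) linear_0[OF bounded_linear.linear[OF assms(2)]] in simp)
qed

lemmas test_cnj = test_linear[OF _ bounded_linear_cnj]

lemma test_diff: "f \<in> tests \<Longrightarrow> h \<in> tests \<Longrightarrow> (\<lambda>p. f p - h p) \<in> tests"
  using test_add[OF _ test_linear[OF _ bounded_linear_minus[OF bounded_linear_ident]]] by simp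

lemma pull_compact_support:
  assumes c: "(U, \<phi>) \<in> A" and f: "f \<in> tests" and K: "compactin X K" "K \<subseteq> U \<inter> Xint"
    "\<And>p. p \<in> topspace X - K \<Longrightarrow> f p = 0"
  shows "Ck k (pull U \<phi> f) UNIV" "compact (\<phi> ` K)" "\<phi> ` K \<subseteq> coords U \<phi>" "\<And>y. y \<notin> \<phi> ` K \<Longrightarrow> pull U \<phi> f y = 0"
proof -
  show cpt: "compact (\<phi> ` K)" using chart_image_compact[OF c K(1)] K(2) by blast
  show "\<phi> ` K \<subseteq> coords U \<phi>" using K(2) by (auto simp: coords_def)
  show zero: "pull U \<phi> f y = 0" if "y \<notin> \<phi> ` K" for y
  proof (cases "y \<in> coords U \<phi>")
    case True
    then have "inv_into U \<phi> y \<notin> K" using that inv_coords(2)[OF c True] by (metis image_eqI)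
    then show ?thesis using True K(3) inv_coords(1)[OF c True] chart_subset[OF c] by (auto simp: pull_def)
  qed (simp add: pull_def)
  show "Ck k (pull U \<phi> f) UNIV"
  proof (rule Ck_local)
    fix x
    have 1: "Ck k (pull U \<phi> f) (coords U \<phi>)"
      by (rule Ck_cong_open[OF coords_open[OF c] _ test_Ck[OF f c]]) (simp add: pull_def)
    have 2: "open (- (\<phi> ` K))" using cpt compact_imp_closed by blast
    have 3: "Ck k (pull U \<phi> f) (- (\<phi> ` K))"
      by (rule Ck_cong_open[OF 2 _ Ck_const[of _ 0]]) (use zero in auto)
    show "\<exists>V. open V \<and> x \<in> V \<and> Ck k (pull U \<phi> f) V"
    proof (cases "x \<in> \<phi> ` K")
      case True
      then have "x \<in> coords U \<phi>" using K(2) by (auto simp: coords_def)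
      then show ?thesis using 1 coords_open[OF c] by blast
    qed (use 2 3 in blast)
  qed
qed

text \<open>The inverse construction to \<open>pull\<close>: a function of the coordinates, extended
  by 0 to the manifold.\<close>

definition push :: "'a set \<Rightarrow> ('a \<Rightarrow> real ^ 'n option) \<Rightarrow> (real ^ 'n option \<Rightarrow> complex) \<Rightarrow> 'a \<Rightarrow> complex" where
  "push U \<phi> b p = (if p \<in> U \<inter> Xint then b (\<phi> p) else 0)"

lemma push_support:
  assumes "T \<subseteq> coords U \<phi>" "\<And>y. y \<notin> T \<Longrightarrow> b y = 0" "(U, \<phi>) \<in> A" "p \<notin> inv_into U \<phi> ` T"
  shows "push U \<phi> b p = 0"
proof (cases "p \<in> U \<inter> Xint")
  case True
  then have "\<phi> p \<notin> T" using assms(3,4) by (metis Int_iff image_eqI inv_chart)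
  then show ?thesis using assms(2) by (simp add: push_def)
qed (auto simp: push_def)

text \<open>In another chart, the extension is near points of the first chart domain a composition
  with a transition map. Near all other points it vanishes, as the support of \<open>b\<close> is
  carried to a compact, hence closed set.\<close>

lemma push_test:
  assumes c: "(U, \<phi>) \<in> A" and b: "\<And>k. Ck k b UNIV" and T: "compact T" "T \<subseteq> coords U \<phi>" "\<And>y. y \<notin> T \<Longrightarrow> b y = 0"
  shows "push U \<phi> b \<in> tests"
proof -
  let ?K = "inv_into U \<phi> ` T"
  have K: "compactin X ?K" by (rule inv_image_compact[OF c T(1,2)])
  have K_sub: "?K \<subseteq> U \<inter> Xint" using T(2) inv_coords(1)[OF c] by blast
  have zero: "push U \<phi> b p = 0" if "p \<notin> ?K" for p by (rule push_support[OF T(2,3) c that])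
  show ?thesis
  proof (rule testI[OF _ K])
    fix V \<psi> assume V: "(V, \<psi>) \<in> A"
    show "smooth_on (\<psi> ` V) (\<lambda>y. push U \<phi> b (inv_into V \<psi> y))"
      unfolding smooth_on_def
    proof
      fix y assume "y \<in> \<psi> ` V"
      then obtain q where q: "q \<in> V" "y = \<psi> q" by blast
      show "\<exists>N h. open N \<and> y \<in> N \<and> (\<forall>k. Ck k h N) \<and> (\<forall>z\<in>\<psi> ` V \<inter> N. h z = push U \<phi> b (inv_into V \<psi> z))"
      proof (cases "q \<in> U \<inter> Xint")
        case True
        let ?N = "\<psi> ` (V \<inter> (U \<inter> Xint))"
        have "openin X (V \<inter> (U \<inter> Xint))" using chart(1)[OF V] interior_chart_open[OF c] by blast
        then have N: "open ?N" by (intro chart_image_open[OF V]) auto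
        have "smooth_on ?N (\<phi> \<circ> inv_into V \<psi>)"
          by (rule smooth_on_subset[OF transition_smooth[OF V c]]) blast
        then have tau: "Ck k (\<phi> \<circ> inv_into V \<psi>) ?N" for k using smooth_on_iff_Ck[OF N] by blast
        have "Ck k (\<lambda>z. b ((\<phi> \<circ> inv_into V \<psi>) z)) ?N" for k
          by (rule Ck_compose[OF N open_UNIV _ b tau]) simp
        moreover have "b ((\<phi> \<circ> inv_into V \<psi>) z) = push U \<phi> b (inv_into V \<psi> z)" if "z \<in> ?N" for z
          using that V by (auto simp: push_def)
        moreover have "y \<in> ?N" using q True by blast
        ultimately show ?thesis using N by (intro exI[of _ ?N] exI[of _ "\<lambda>z. b ((\<phi> \<circ> inv_into V \<psi>) z)"]) auto
      next
        case False
        have "openin X (V - ?K)"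
          using chart(1)[OF V] compactin_imp_closedin[OF hausdorff K] by (rule openin_diff)
        then have "openin (top_of_set half_space) (\<psi> ` (V - ?K))" by (intro chart_image_openin[OF V]) auto
        then obtain N where N: "open N" "\<psi> ` (V - ?K) = half_space \<inter> N" by (auto simp: openin_open)
        have "y \<in> N" using q False K_sub N(2) by blast
        moreover have "push U \<phi> b (inv_into V \<psi> z) = 0" if "z \<in> \<psi> ` V \<inter> N" for z
        proof -
          have "z \<in> half_space" using that openin_imp_subset[OF chart(2)[OF V]] by blast
          then have "z \<in> \<psi> ` (V - ?K)" unfolding N(2) using that by simp
          then obtain p where "p \<in> V - ?K" "z = \<psi> p" by (rule imageE)
          then show ?thesis using zero[of p] inv_chart[OF V, of p] by simp
        qed
        ultimately show ?thesis using N(1) by (intro exI[of _ N] exI[of _ "\<lambda>z. 0"]) auto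
      qed
    qed
  qed (use K_sub zero in auto)
qed

lemma pull_push: "(U, \<phi>) \<in> A \<Longrightarrow> pull U \<phi> (push U \<phi> b) y = (if y \<in> coords U \<phi> then b y else 0)"
proof (cases "y \<in> coords U \<phi>")
  case True
  then show "(U, \<phi>) \<in> A \<Longrightarrow> ?thesis" using inv_coords[of U \<phi> y] by (simp add: pull_def push_def)
qed (simp add: pull_def)

text \<open>The chart is selected as in the definition of \<open>laplacian\<close>; the value is the
  same in every chart by \<open>gradient_product_transition\<close>.\<close>

definition gradient_product :: "('a \<Rightarrow> complex) \<Rightarrow> ('a \<Rightarrow> complex) \<Rightarrow> 'a \<Rightarrow> complex" where
  "gradient_product f h p =
     (if p \<in> Xint then let c = SOME c. c \<in> A \<and> p \<in> fst c
        in coord_gradient_product (g c) (f \<circ> inv_into (fst c) (snd c)) (h \<circ> inv_into (fst c) (snd c)) (snd c p)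
      else 0)"

lemma test_has_derivative:
  assumes "f \<in> tests" "(U, \<phi>) \<in> A" "y \<in> coords U \<phi>"
  shows "((\<lambda>y. f (inv_into U \<phi> y)) has_derivative frechet_derivative (\<lambda>y. f (inv_into U \<phi> y)) (at y)) (at y)"
  using test_Ck[OF assms(1,2), of 1] assms(3) by (auto simp: frechet_derivative_works[symmetric])

lemma partial_deriv_transition:
  assumes f: "f \<in> tests" and c: "(U, \<phi>) \<in> A" "(V, \<psi>) \<in> A" and p: "p \<in> U" "p \<in> V" "p \<in> Xint"
  shows "partial_deriv i (\<lambda>y. f (inv_into U \<phi> y)) (\<phi> p) =
     (\<Sum>k\<in>UNIV. (jacobian (\<psi> \<circ> inv_into U \<phi>) (at (\<phi> p) within \<phi> ` (U \<inter> V)) $ k $ i) *\<^sub>R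
        partial_deriv k (\<lambda>y. f (inv_into V \<psi> y)) (\<psi> p))"
proof -
  let ?N = "\<phi> ` (U \<inter> V \<inter> Xint)"
  let ?t = "\<psi> \<circ> inv_into U \<phi>"
  have "openin X (U \<inter> V \<inter> Xint)" using chart(1)[OF c(1)] chart(1)[OF c(2)] interior_open by blast
  then have N: "open ?N" by (intro chart_image_open[OF c(1)]) auto
  have pN: "\<phi> p \<in> ?N" using p by blast
  have within: "at (\<phi> p) within \<phi> ` (U \<inter> V) = at (\<phi> p)"
    by (rule at_within_open_subset[OF pN N]) blast
  have "smooth_on ?N ?t" by (rule smooth_on_subset[OF transition_smooth[OF c]]) blast
  then have "Ck 1 ?t ?N" using smooth_on_iff_Ck[OF N] by blast
  then have dt: "(?t has_derivative frechet_derivative ?t (at (\<phi> p))) (at (\<phi> p))"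
    using pN by (auto simp: frechet_derivative_works[symmetric])
  let ?fU = "\<lambda>y. f (inv_into U \<phi> y)" and ?fV = "\<lambda>y. f (inv_into V \<psi> y)"
  let ?D = "frechet_derivative ?fV (at (\<psi> p))" and ?Dt = "frechet_derivative ?t (at (\<phi> p))"
  have tp: "?t (\<phi> p) = \<psi> p" using p c by simp
  have dV: "(?fV has_derivative ?D) (at (?t (\<phi> p)))"
    unfolding tp by (rule test_has_derivative[OF f c(2)]) (use p in \<open>auto simp: coords_def\<close>)
  have "((\<lambda>y. ?fV (?t y)) has_derivative (\<lambda>v. ?D (?Dt v))) (at (\<phi> p))"
    by (rule has_derivative_compose[OF dt dV])
  moreover have "?fV (?t y) = ?fU y" if "y \<in> ?N" for y using that c by auto
  ultimately have "(?fU has_derivative (\<lambda>v. ?D (?Dt v))) (at (\<phi> p))"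
    by (rule has_derivative_transform_within_open[OF _ N pN])
  then have eq: "frechet_derivative ?fU (at (\<phi> p)) v = ?D (?Dt v)" for v
    using frechet_derivative_at by metis
  interpret D: bounded_linear ?D using has_derivative_bounded_linear[OF dV] .
  let ?w = "?Dt (axis i 1)"
  have "?w = (\<Sum>k\<in>UNIV. (?w $ k) *\<^sub>R axis k 1)"
    by (metis (no_types, lifting) basis_expansion scalar_mult_eq_scaleR sum.cong)
  then have "?D ?w = ?D (\<Sum>k\<in>UNIV. (?w $ k) *\<^sub>R axis k 1)" by metis
  also have "\<dots> = (\<Sum>k\<in>UNIV. (?w $ k) *\<^sub>R ?D (axis k 1))" by (simp add: D.sum D.scaleR)
  finally show ?thesis
    unfolding partial_deriv_def eq jacobian_def within by (simp add: matrix_def)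
qed

lemma metric_transition:
  assumes c: "(U, \<phi>) \<in> A" "(V, \<psi>) \<in> A" and p: "p \<in> U" "p \<in> V" "p \<in> Xint"
  shows "g (U, \<phi>) (\<phi> p) = transpose (jacobian (\<psi> \<circ> inv_into U \<phi>) (at (\<phi> p) within \<phi> ` (U \<inter> V)))
     ** g (V, \<psi>) (\<psi> p) ** jacobian (\<psi> \<circ> inv_into U \<phi>) (at (\<phi> p) within \<phi> ` (U \<inter> V))"
  using metric c p unfolding riemannian_metric_on_def Let_def by blast

lemma gradient_product_transition:
  assumes f: "f \<in> tests" "h \<in> tests" and c: "(U, \<phi>) \<in> A" "(V, \<psi>) \<in> A" and p: "p \<in> U" "p \<in> V" "p \<in> Xint"
  shows "coord_gradient_product (g (U, \<phi>)) (\<lambda>y. f (inv_into U \<phi> y)) (\<lambda>y. h (inv_into U \<phi> y)) (\<phi> p) =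
    coord_gradient_product (g (V, \<psi>)) (\<lambda>y. f (inv_into V \<psi> y)) (\<lambda>y. h (inv_into V \<psi> y)) (\<psi> p)"
proof -
  have "invertible (g (U, \<phi>) (\<phi> p))" "invertible (g (V, \<psi>) (\<psi> p))"
    using posdef_invertible[OF metric_pos[OF c(1)]] posdef_invertible[OF metric_pos[OF c(2)]]
      chart_in_coords[OF p(1,3)] chart_in_coords[OF p(2,3)] by blast+
  from inverse_congruence[OF metric_transition[OF c p] this] show ?thesis
    unfolding coord_gradient_product_def
    by (rule bilinear_form_congruence) (rule partial_deriv_transition[OF _ c p] f)+
qed

lemma some_chart:
  assumes "p \<in> Xint"
  obtains V \<psi> where "(V, \<psi>) \<in> A" "p \<in> V" "(SOME c. c \<in> A \<and> p \<in> fst c) = (V, \<psi>)"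
proof -
  obtain U \<phi> where "(U, \<phi>) \<in> A" "p \<in> U" using interior_chartE[OF assms] by blast
  then have "\<exists>c. c \<in> A \<and> p \<in> fst c" by force
  then have "(SOME c. c \<in> A \<and> p \<in> fst c) \<in> A \<and> p \<in> fst (SOME c. c \<in> A \<and> p \<in> fst c)" by (rule someI_ex)
  moreover obtain V \<psi> where eq: "(SOME c. c \<in> A \<and> p \<in> fst c) = (V, \<psi>)" by (rule prod.exhaust)
  ultimately have "(V, \<psi>) \<in> A" "p \<in> V" by simp_all
  then show ?thesis using that eq by blast
qed

lemma gradient_product_chart:
  assumes f: "f \<in> tests" "h \<in> tests" and c: "(U, \<phi>) \<in> A" and p: "p \<in> U" "p \<in> Xint"
  shows "gradient_product f h p =
    coord_gradient_product (g (U, \<phi>)) (\<lambda>y. f (inv_into U \<phi> y)) (\<lambda>y. h (inv_into U \<phi> y)) (\<phi> p)"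
proof -
  obtain V \<psi> where V: "(V, \<psi>) \<in> A" "p \<in> V" "(SOME c. c \<in> A \<and> p \<in> fst c) = (V, \<psi>)"
    using some_chart[OF p(2)] by blast
  then show ?thesis
    using gradient_product_transition[OF f V(1) c V(2) p] p(2) by (simp add: gradient_product_def o_def)
qed

text \<open>Laplacians and products of gradients are continuous only in the interior, where they are
  given chart by chart; on the boundary they are 0 by convention.\<close>

lemma borel_measurable_locally_continuous:
  fixes F :: "'a \<Rightarrow> complex"
  assumes zero: "\<And>p. p \<in> topspace X \<Longrightarrow> p \<notin> Xint \<Longrightarrow> F p = 0"
    and cont: "\<And>U \<phi>. (U, \<phi>) \<in> A \<Longrightarrow> continuous_on (coords U \<phi>) (\<lambda>y. F (inv_into U \<phi> y))"
  shows "F \<in> borel_measurable v"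
proof (rule borel_measurableI)
  fix S :: "complex set" assume S: "open S"
  have "openin X {p \<in> Xint. F p \<in> S}"
  proof (subst openin_subopen, intro ballI)
    fix p assume "p \<in> {p \<in> Xint. F p \<in> S}"
    then have p: "p \<in> Xint" "F p \<in> S" by auto
    obtain U \<phi> where c: "(U, \<phi>) \<in> A" "p \<in> U" using interior_chartE[OF p(1)] by blast
    let ?T = "coords U \<phi> \<inter> (\<lambda>y. F (inv_into U \<phi> y)) -` S"
    have "open ?T" by (rule continuous_open_preimage[OF cont[OF c(1)] coords_open[OF c(1)] S])
    then have "openin X {q \<in> U. \<phi> q \<in> ?T}" by (rule chart_preimage_open[OF c(1)])
    moreover have "p \<in> {q \<in> U. \<phi> q \<in> ?T}" using p c by (auto simp: coords_def)
    moreover have "{q \<in> U. \<phi> q \<in> ?T} \<subseteq> {p \<in> Xint. F p \<in> S}"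
    proof
      fix q assume q: "q \<in> {q \<in> U. \<phi> q \<in> ?T}"
      then have "inv_into U \<phi> (\<phi> q) \<in> Xint" using inv_coords(1)[OF c(1), of "\<phi> q"] by blast
      moreover have "inv_into U \<phi> (\<phi> q) = q" using q inv_chart[OF c(1)] by blast
      ultimately show "q \<in> {p \<in> Xint. F p \<in> S}" using q by auto
    qed
    ultimately show "\<exists>T. openin X T \<and> p \<in> T \<and> T \<subseteq> {p \<in> Xint. F p \<in> S}" by blast
  qed
  then have 1: "{p \<in> Xint. F p \<in> S} \<in> sets v" by (rule open_sets)
  have 2: "topspace X - Xint \<in> sets v" using sets.compl_sets[OF open_sets[OF interior_open]] by simp
  have "F -` S \<inter> space v = {p \<in> Xint. F p \<in> S} \<union> (if 0 \<in> S then topspace X - Xint else {})"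
  proof (intro set_eqI iffI)
    fix p assume "p \<in> F -` S \<inter> space v"
    then show "p \<in> {p \<in> Xint. F p \<in> S} \<union> (if 0 \<in> S then topspace X - Xint else {})"
      using zero[of p] by (cases "p \<in> Xint") auto
  next
    fix p assume "p \<in> {p \<in> Xint. F p \<in> S} \<union> (if 0 \<in> S then topspace X - Xint else {})"
    then show "p \<in> F -` S \<inter> space v"
      using zero[of p] interior_subset by (auto split: if_splits)
  qed
  then show "F -` S \<inter> space v \<in> sets v" using 1 2 by auto
qed

lemma test_measurable: assumes "f \<in> tests" shows "f \<in> borel_measurable v"
proof (rule borel_measurable_locally_continuous)
  show "f p = 0" if "p \<in> topspace X" "p \<notin> Xint" for p
  proof -
    show ?thesis
    proof (rule test_support[OF assms])
      fix K assume K: "compactin X K" "K \<subseteq> Xint" "\<And>p. p \<in> topspace X - K \<Longrightarrow> f p = 0"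
      show ?thesis by (rule K(3)) (use that K(2) in blast)
    qed
  qed
qed (rule Ck_imp_continuous_on[OF test_Ck[OF assms, of _ _ 0]])

lemma gradient_product_continuous:
  assumes f: "f \<in> tests" "h \<in> tests" and c: "(U, \<phi>) \<in> A"
  shows "continuous_on (coords U \<phi>)
    (coord_gradient_product (g (U, \<phi>)) (\<lambda>y. f (inv_into U \<phi> y)) (\<lambda>y. h (inv_into U \<phi> y)))"
proof -
  have "continuous_on (coords U \<phi>) (\<lambda>y. matrix_inv (g (U, \<phi>) y) $ i $ j)" for i j
    by (rule Ck_imp_continuous_on[OF matrix_inv_Ck[OF coords_open[OF c] metric_Ck[OF c] metric_pos[OF c], of 0]])
  moreover have "continuous_on (coords U \<phi>) (partial_deriv i (\<lambda>y. s (inv_into U \<phi> y)))" if "s \<in> tests" for s i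
    by (rule Ck_imp_continuous_on[OF partial_deriv_Ck[OF test_Ck[OF that c, of 1, unfolded One_nat_def]]])
  ultimately show ?thesis unfolding coord_gradient_product_def[abs_def]
    by (intro continuous_on_sum continuous_on_scaleR continuous_on_mult) (use f in auto)
qed

lemma gradient_product_measurable:
  assumes "f \<in> tests" "h \<in> tests"
  shows "gradient_product f h \<in> borel_measurable v"
proof (rule borel_measurable_locally_continuous)
  fix U \<phi> assume c: "(U, \<phi>) \<in> A"
  have "gradient_product f h (inv_into U \<phi> y) =
    coord_gradient_product (g (U, \<phi>)) (\<lambda>y. f (inv_into U \<phi> y)) (\<lambda>y. h (inv_into U \<phi> y)) y" if "y \<in> coords U \<phi>" for y
    using gradient_product_chart[OF assms c, of "inv_into U \<phi> y"] inv_coords[OF c that] by simp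
  then show "continuous_on (coords U \<phi>) (\<lambda>y. gradient_product f h (inv_into U \<phi> y))"
    using gradient_product_continuous[OF assms c] by (simp cong: continuous_on_cong)
qed (simp add: gradient_product_def)

text \<open>The flux is the vector field whose divergence appears in the Laplacian.\<close>

definition flux :: "'a set \<Rightarrow> ('a \<Rightarrow> real ^ 'n option) \<Rightarrow> ('a \<Rightarrow> complex) \<Rightarrow> 'n option \<Rightarrow> real ^ 'n option \<Rightarrow> complex" where
  "flux U \<phi> s i z = (\<Sum>j\<in>UNIV. (sqrt (det (g (U, \<phi>) z)) * matrix_inv (g (U, \<phi>) z) $ i $ j) *\<^sub>R
     partial_deriv j (\<lambda>y. s (inv_into U \<phi> y)) z)"

lemma flux_Ck:
  assumes s: "s \<in> tests" and c: "(U, \<phi>) \<in> A"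
  shows "Ck k (flux U \<phi> s i) (coords U \<phi>)"
  unfolding flux_def[abs_def]
  by (intro Ck_sum[OF coords_open[OF c]] Ck_scaleR[OF coords_open[OF c]]
      Ck_mult[OF coords_open[OF c] density_Ck[OF c, unfolded density_def[abs_def]]
        matrix_inv_Ck[OF coords_open[OF c] metric_Ck[OF c] metric_pos[OF c]]]
      partial_deriv_Ck test_Ck[OF s c])

lemma coord_laplacian_flux:
  "coord_laplacian (g (U, \<phi>)) (\<lambda>y. s (inv_into U \<phi> y)) y =
    - ((1 / density U \<phi> y) *\<^sub>R (\<Sum>i\<in>UNIV. partial_deriv i (flux U \<phi> s i) y))"
  unfolding coord_laplacian_def flux_def[abs_def] density_def ..

lemma coord_laplacian_continuous:
  assumes s: "s \<in> tests" and c: "(U, \<phi>) \<in> A"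
  shows "continuous_on (coords U \<phi>) (coord_laplacian (g (U, \<phi>)) (\<lambda>y. s (inv_into U \<phi> y)))"
proof -
  have "continuous_on (coords U \<phi>) (partial_deriv i (flux U \<phi> s i))" for i
    by (rule Ck_imp_continuous_on[OF partial_deriv_Ck[OF flux_Ck[OF s c, of 1, unfolded One_nat_def]]])
  moreover have "continuous_on (coords U \<phi>) (density U \<phi>)"
    by (rule Ck_imp_continuous_on[OF density_Ck[OF c, of 0]])
  moreover have "density U \<phi> y \<noteq> 0" if "y \<in> coords U \<phi>" for y using density_pos[OF c that] by simp
  ultimately show ?thesis unfolding coord_laplacian_flux[abs_def]
    by (intro continuous_on_minus continuous_on_scaleR continuous_on_divide continuous_on_sum continuous_on_const) auto
qed

lemma integration_by_parts_coords:
  assumes c: "(U, \<phi>) \<in> A" and f: "f \<in> tests" and K: "compactin X K" "K \<subseteq> U \<inter> Xint"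
    "\<And>p. p \<in> topspace X - K \<Longrightarrow> f p = 0" and s: "s \<in> tests"
  shows "(LINT y|lborel. density U \<phi> y *\<^sub>R (pull U \<phi> f y * coord_laplacian (g (U, \<phi>)) (\<lambda>y. s (inv_into U \<phi> y)) y)) =
    (LINT y|lborel. density U \<phi> y *\<^sub>R coord_gradient_product (g (U, \<phi>)) (pull U \<phi> f) (\<lambda>y. s (inv_into U \<phi> y)) y)"
proof -
  note P = pull_compact_support[OF c f K]
  let ?f = "pull U \<phi> f"
  let ?D = "\<lambda>i y. frechet_derivative (flux U \<phi> s i) (at y) (axis i 1)"
  note ibp = integral_by_parts_compact_support[OF coords_open[OF c] P(2,3) P(1) P(4) flux_Ck[OF s c]]
  have 1: "density U \<phi> y *\<^sub>R (?f y * coord_laplacian (g (U, \<phi>)) (\<lambda>y. s (inv_into U \<phi> y)) y) =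
     (\<Sum>i\<in>UNIV. - (?f y * ?D i y))" for y
  proof (cases "y \<in> coords U \<phi>")
    case True
    have "density U \<phi> y *\<^sub>R (?f y * - ((1 / density U \<phi> y) *\<^sub>R (\<Sum>i\<in>UNIV. ?D i y))) = - (?f y * (\<Sum>i\<in>UNIV. ?D i y))"
      using density_pos[OF c True] by simp
    then show ?thesis by (simp add: coord_laplacian_flux partial_deriv_def sum_distrib_left sum_negf)
  qed (simp add: pull_def)
  have 2: "density U \<phi> y *\<^sub>R coord_gradient_product (g (U, \<phi>)) ?f (\<lambda>y. s (inv_into U \<phi> y)) y =
     (\<Sum>i\<in>UNIV. frechet_derivative ?f (at y) (axis i 1) * flux U \<phi> s i y)" for y
    by (simp add: coord_gradient_product_def flux_def density_def partial_deriv_def scaleR_sum_right sum_distrib_left mult_ac)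
  have "(LINT y|lborel. (\<Sum>i\<in>UNIV. - (?f y * ?D i y))) = (\<Sum>i\<in>UNIV. - (LINT y|lborel. ?f y * ?D i y))"
    using ibp(1) by (subst Bochner_Integration.integral_sum) auto
  also have "\<dots> = (\<Sum>i\<in>UNIV. (LINT y|lborel. frechet_derivative ?f (at y) (axis i 1) * flux U \<phi> s i y))"
  proof (intro sum.cong refl)
    fix i
    have "(LINT y|lborel. ?f y * ?D i y) = - (LINT y|lborel. frechet_derivative ?f (at y) (axis i 1) * flux U \<phi> s i y)"
      by (rule ibp(3))
    then show "- (LINT y|lborel. ?f y * ?D i y) = (LINT y|lborel. frechet_derivative ?f (at y) (axis i 1) * flux U \<phi> s i y)"
      by simp
  qed
  also have "\<dots> = (LINT y|lborel. (\<Sum>i\<in>UNIV. frechet_derivative ?f (at y) (axis i 1) * flux U \<phi> s i y))"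
    using ibp(2) by (subst Bochner_Integration.integral_sum) auto
  finally show ?thesis by (simp only: 1 2)
qed

lemma coord_gradient_product_pull:
  assumes c: "(U, \<phi>) \<in> A" and y: "y \<in> coords U \<phi>"
  shows "coord_gradient_product (g (U, \<phi>)) (pull U \<phi> f) h y =
    coord_gradient_product (g (U, \<phi>)) (\<lambda>y. f (inv_into U \<phi> y)) h y"
proof -
  have "frechet_derivative (pull U \<phi> f) (at y) = frechet_derivative (\<lambda>y. f (inv_into U \<phi> y)) (at y)"
    by (rule frechet_derivative_cong_open[OF coords_open[OF c] y]) (simp add: pull_def)
  then show ?thesis by (simp add: coord_gradient_product_def partial_deriv_def)
qed

lemma gradient_product_zero:
  assumes f: "f \<in> tests" and s: "s \<in> tests" and K: "compactin X K" "\<And>p. p \<in> topspace X - K \<Longrightarrow> f p = 0"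
    and p: "p \<in> topspace X - K"
  shows "gradient_product f s p = 0"
proof (cases "p \<in> Xint")
  case True
  obtain U \<phi> where c: "(U, \<phi>) \<in> A" "p \<in> U" using interior_chartE[OF True] by blast
  have op: "openin X (U \<inter> Xint - K)"
    by (rule openin_diff[OF interior_chart_open[OF c(1)] compactin_imp_closedin[OF hausdorff K(1)]])
  have "open (\<phi> ` (U \<inter> Xint - K))" by (rule chart_image_open[OF c(1) op]) blast
  moreover have "\<phi> p \<in> \<phi> ` (U \<inter> Xint - K)" using True c p by blast
  moreover have "f (inv_into U \<phi> y) = 0" if "y \<in> \<phi> ` (U \<inter> Xint - K)" for y
    using that c(1) K(2) chart_subset[OF c(1)] by auto
  ultimately have "frechet_derivative (\<lambda>y. f (inv_into U \<phi> y)) (at (\<phi> p)) = frechet_derivative (\<lambda>y. 0) (at (\<phi> p))"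
    by (rule frechet_derivative_cong_open)
  also have "\<dots> = (\<lambda>v. 0)" using frechet_derivative_at[OF has_derivative_const] by metis
  finally show ?thesis
    unfolding gradient_product_chart[OF f s c True] by (simp add: coord_gradient_product_def partial_deriv_def)
qed (simp add: gradient_product_def)

lemma push_measurable:
  assumes c: "(U, \<phi>) \<in> A" and b: "b \<in> borel_measurable borel"
  shows "push U \<phi> b \<in> borel_measurable v"
proof -
  have "(\<lambda>p. b (\<phi> p)) \<in> borel_measurable (restrict_space v (U \<inter> Xint))"
    by (rule measurable_compose[OF chart_measurable[OF c] b])
  moreover have "{p \<in> space v. p \<in> U \<inter> Xint} \<in> sets v"
  proof -
    have "{p \<in> space v. p \<in> U \<inter> Xint} = U \<inter> Xint" using chart_subset[OF c] by auto
    then show ?thesis using open_sets[OF interior_chart_open[OF c]] by simp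
  qed
  ultimately show ?thesis unfolding push_def
  proof (subst measurable_If_restrict_space_iff)
    assume a: "(\<lambda>p. b (\<phi> p)) \<in> borel_measurable (restrict_space v (U \<inter> Xint))"
    then show "(\<lambda>p. b (\<phi> p)) \<in> borel_measurable (restrict_space v {p. p \<in> U \<inter> Xint}) \<and>
        (\<lambda>p. 0) \<in> borel_measurable (restrict_space v {p. p \<notin> U \<inter> Xint})"
      by (simp only: Collect_mem_eq) simp
  qed simp
qed

text \<open>The weak form of the Laplacian: tested against a function supported in one chart, the coordinate
  expression yields the integral of the chart independent gradient product.\<close>

lemma weak_laplacian_chart:
  assumes c: "(U, \<phi>) \<in> A" and f: "f \<in> tests" and K: "compactin X K" "K \<subseteq> U \<inter> Xint"
    "\<And>p. p \<in> topspace X - K \<Longrightarrow> f p = 0" and s: "s \<in> tests"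
  defines "H \<equiv> (\<lambda>q. f q * push U \<phi> (coord_laplacian (g (U, \<phi>)) (\<lambda>y. s (inv_into U \<phi> y))) q)"
  shows "integrable v H" "integrable v (gradient_product f s)" "(LINT q|v. H q) = (LINT q|v. gradient_product f s q)"
proof -
  note P = pull_compact_support[OF c f K]
  let ?L = "coord_laplacian (g (U, \<phi>)) (\<lambda>y. s (inv_into U \<phi> y))"
  let ?G = "coord_gradient_product (g (U, \<phi>)) (pull U \<phi> f) (\<lambda>y. s (inv_into U \<phi> y))"
  have "(\<lambda>y. indicator (coords U \<phi>) y *\<^sub>R ?L y) \<in> borel_measurable borel"
    using coords_open[OF c] by (intro borel_measurable_continuous_on_indicator coord_laplacian_continuous[OF s c]) auto
  then have "(\<lambda>q. f q * push U \<phi> (\<lambda>y. indicator (coords U \<phi>) y *\<^sub>R ?L y) q) \<in> borel_measurable v"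
    by (intro borel_measurable_times test_measurable[OF f] push_measurable[OF c])
  moreover have "push U \<phi> (\<lambda>y. indicator (coords U \<phi>) y *\<^sub>R ?L y) q = push U \<phi> ?L q" for q
    using c by (auto simp: push_def coords_def)
  ultimately have Hm: "H \<in> borel_measurable v" by (simp add: H_def)
  have H0: "H p = 0" if "p \<in> topspace X" "p \<notin> U \<inter> Xint" for p
    using that by (auto simp: H_def push_def)
  have pullH: "pull U \<phi> H y = pull U \<phi> f y * ?L y" for y
    using inv_coords[OF c, of y] by (auto simp: pull_def H_def push_def)
  have cd: "continuous_on (\<phi> ` K) (density U \<phi>)"
    by (rule continuous_on_subset[OF Ck_imp_continuous_on[OF density_Ck[OF c, of 0]] P(3)])
  have cf: "continuous_on (\<phi> ` K) (pull U \<phi> f)"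
    by (rule continuous_on_subset[OF Ck_imp_continuous_on[OF P(1)[of 0]] subset_UNIV])
  have cL: "continuous_on (\<phi> ` K) ?L"
    by (rule continuous_on_subset[OF coord_laplacian_continuous[OF s c] P(3)])
  have "integrable lborel (\<lambda>y. density U \<phi> y *\<^sub>R (pull U \<phi> f y * ?L y))"
    by (rule continuous_compact_support_integrable[OF P(2)])
      (use P(4) in \<open>auto intro!: continuous_on_scaleR continuous_on_mult cd cf cL\<close>)
  then show "integrable v H" using integral_chart(1)[OF c Hm H0] by (simp add: pullH)
  have Gm: "gradient_product f s \<in> borel_measurable v" by (rule gradient_product_measurable[OF f s])
  have G0: "gradient_product f s p = 0" if "p \<in> topspace X" "p \<notin> U \<inter> Xint" for p
    using gradient_product_zero[OF f s K(1,3), of p] that K(2) by blast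
  have G_out: "?G y = 0" if "y \<notin> \<phi> ` K" for y
    using frechet_derivative_zero_outside[OF compact_imp_closed[OF P(2)] P(4) that]
    by (simp add: coord_gradient_product_def partial_deriv_def)
  have pullG: "pull U \<phi> (gradient_product f s) y = ?G y" for y
  proof (cases "y \<in> coords U \<phi>")
    case True
    then show ?thesis
      using gradient_product_chart[OF f s c, of "inv_into U \<phi> y"] inv_coords[OF c True]
        coord_gradient_product_pull[OF c True] by (simp add: pull_def)
  next
    case False
    then have "y \<notin> \<phi> ` K" using P(3) by blast
    then show ?thesis using G_out False by (simp add: pull_def)
  qed
  have "continuous_on (coords U \<phi>) ?G"
    using gradient_product_continuous[OF f s c] coord_gradient_product_pull[OF c]
    by (simp cong: continuous_on_cong)
  then have "continuous_on (\<phi> ` K) ?G" by (rule continuous_on_subset[OF _ P(3)])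
  then have "integrable lborel (\<lambda>y. density U \<phi> y *\<^sub>R ?G y)"
    by (intro continuous_compact_support_integrable[OF P(2)]) (use G_out in \<open>auto intro!: continuous_on_scaleR cd\<close>)
  then show "integrable v (gradient_product f s)" using integral_chart(1)[OF c Gm G0] by (simp add: pullG)
  have "(LINT q|v. H q) = (LINT y|lborel. density U \<phi> y *\<^sub>R (pull U \<phi> f y * ?L y))"
    using integral_chart(2)[OF c Hm H0] by (simp add: pullH)
  also have "\<dots> = (LINT y|lborel. density U \<phi> y *\<^sub>R ?G y)" by (rule integration_by_parts_coords[OF c f K s])
  also have "\<dots> = (LINT q|v. gradient_product f s q)"
    using integral_chart(2)[OF c Gm G0] by (simp add: pullG)
  finally show "(LINT q|v. H q) = (LINT q|v. gradient_product f s q)" .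
qed

text \<open>By \<open>weak_laplacian_chart\<close>, the integrals of both expressions against a bump
  supported in the overlap are equal, namely to the integral of the same product of gradients.
  Continuous functions with this property agree. The weak form reduces the claim to the
  transformation of first derivatives.\<close>

lemma coord_laplacian_transition:
  assumes s: "s \<in> tests" and c: "(U, \<phi>) \<in> A" "(V, \<psi>) \<in> A" and p: "p \<in> U" "p \<in> V" "p \<in> Xint"
  shows "coord_laplacian (g (U, \<phi>)) (\<lambda>y. s (inv_into U \<phi> y)) (\<phi> p) =
    coord_laplacian (g (V, \<psi>)) (\<lambda>y. s (inv_into V \<psi> y)) (\<psi> p)"
proof -
  let ?LU = "coord_laplacian (g (U, \<phi>)) (\<lambda>y. s (inv_into U \<phi> y))"
  let ?LV = "coord_laplacian (g (V, \<psi>)) (\<lambda>y. s (inv_into V \<psi> y))"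
  let ?t = "\<psi> \<circ> inv_into U \<phi>"
  let ?N = "\<phi> ` (U \<inter> V \<inter> Xint)"
  have "openin X (U \<inter> V \<inter> Xint)" using chart(1)[OF c(1)] chart(1)[OF c(2)] interior_open by blast
  then have N: "open ?N" by (intro chart_image_open[OF c(1)]) auto
  have N_sub: "?N \<subseteq> coords U \<phi>" by (auto simp: coords_def)
  have "smooth_on ?N ?t" by (rule smooth_on_subset[OF transition_smooth[OF c]]) blast
  then have t: "continuous_on ?N ?t" using smooth_on_iff_Ck[OF N] Ck_imp_continuous_on by blast
  have t_im: "?t ` ?N \<subseteq> coords V \<psi>" using c by (auto simp: coords_def)
  define e where "e y = density U \<phi> y *\<^sub>R (?LU y - ?LV (?t y))" for y
  have "continuous_on ?N e" unfolding e_def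
    by (intro continuous_on_scaleR continuous_on_diff
      continuous_on_subset[OF coord_laplacian_continuous[OF s c(1)] N_sub]
      continuous_on_compose2[OF coord_laplacian_continuous[OF s c(2)] t t_im]
      continuous_on_subset[OF Ck_imp_continuous_on[OF density_Ck[OF c(1), of 0]] N_sub])
  moreover have "(LINT y|lborel. bump z \<rho> y * e y) = 0" if \<rho>: "\<rho> > 0" "cball z (2 * \<rho>) \<subseteq> ?N" for z \<rho>
  proof -
    let ?T = "cball z (2 * \<rho>)"
    let ?f = "push U \<phi> (bump z \<rho>)"
    let ?K = "inv_into U \<phi> ` ?T"
    have bz: "bump z \<rho> y = 0" if "y \<notin> ?T" for y using bump_eq_0[OF \<rho>(1), of y z] that by auto
    have TU: "?T \<subseteq> coords U \<phi>" using \<rho>(2) N_sub by blast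
    have f: "?f \<in> tests" by (rule push_test[OF c(1) bump_Ck compact_cball TU bz])
    have K: "compactin X ?K" by (rule inv_image_compact[OF c(1) compact_cball TU])
    have KU: "?K \<subseteq> U \<inter> Xint" and KV: "?K \<subseteq> V \<inter> Xint" using \<rho>(2) c(1) by auto
    have fz: "?f q = 0" if "q \<in> topspace X - ?K" for q
      using push_support[of ?T U \<phi> "bump z \<rho>", OF TU bz c(1), of q] that by auto
    let ?HU = "\<lambda>q. ?f q * push U \<phi> ?LU q" and ?HV = "\<lambda>q. ?f q * push V \<psi> ?LV q"
    note WU = weak_laplacian_chart[OF c(1) f K KU fz s] and WV = weak_laplacian_chart[OF c(2) f K KV fz s]
    let ?d = "\<lambda>q. ?HU q - ?HV q"
    have dm: "?d \<in> borel_measurable v" using WU(1) WV(1) by auto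
    have d0: "?d q = 0" if "q \<in> topspace X" "q \<notin> U \<inter> Xint" for q using that by (auto simp: push_def)
    have "0 = (LINT q|v. ?d q)"
      using Bochner_Integration.integral_diff[OF WU(1) WV(1)] WU(3) WV(3) by simp
    also have "\<dots> = (LINT y|lborel. density U \<phi> y *\<^sub>R pull U \<phi> ?d y)" by (rule integral_chart(2)[OF c(1) dm d0])
    also have "\<dots> = (LINT y|lborel. bump z \<rho> y * e y)"
    proof (rule Bochner_Integration.integral_cong[OF refl])
      fix y
      show "density U \<phi> y *\<^sub>R pull U \<phi> ?d y = bump z \<rho> y * e y"
      proof (cases "y \<in> ?T")
        case True
        then obtain q where q: "q \<in> U \<inter> V \<inter> Xint" "y = \<phi> q" using \<rho>(2) by blast
        then have "y \<in> coords U \<phi>" by (auto simp: coords_def)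
        then show ?thesis using q c by (simp add: pull_def push_def e_def algebra_simps)
      next
        case False
        then have "bump z \<rho> y = 0" by (rule bz)
        then show ?thesis using inv_coords[OF c(1), of y] by (auto simp: pull_def push_def)
      qed
    qed
    finally show ?thesis by simp
  qed
  ultimately have "e (\<phi> p) = 0"
    by (rule zero_if_orthogonal_to_bumps[OF N]) (use p in auto)
  then show ?thesis using density_pos[OF c(1) chart_in_coords[OF p(1,3)]] p(1) c(1) by (simp add: e_def)
qed

lemma laplacian_chart:
  assumes s: "s \<in> tests" and c: "(U, \<phi>) \<in> A" and p: "p \<in> U" "p \<in> Xint"
  shows "laplacian A g s p = coord_laplacian (g (U, \<phi>)) (\<lambda>y. s (inv_into U \<phi> y)) (\<phi> p)"
proof -
  obtain V \<psi> where V: "(V, \<psi>) \<in> A" "p \<in> V" "(SOME c. c \<in> A \<and> p \<in> fst c) = (V, \<psi>)"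
    using some_chart[OF p(2)] by blast
  moreover have "p \<notin> boundary A" using p(2) by (simp add: interior_part_def)
  ultimately show ?thesis
    using coord_laplacian_transition[OF s V(1) c V(2) p] by (simp add: laplacian_def o_def)
qed

lemma laplacian_boundary: "p \<in> topspace X \<Longrightarrow> p \<notin> Xint \<Longrightarrow> laplacian A g s p = 0"
  by (simp add: laplacian_def interior_part_def)

lemma laplacian_measurable:
  assumes s: "s \<in> tests"
  shows "laplacian A g s \<in> borel_measurable v"
proof (rule borel_measurable_locally_continuous[OF laplacian_boundary])
  fix U \<phi> assume c: "(U, \<phi>) \<in> A"
  have "laplacian A g s (inv_into U \<phi> y) = coord_laplacian (g (U, \<phi>)) (\<lambda>y. s (inv_into U \<phi> y)) y" if "y \<in> coords U \<phi>" for y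
    using laplacian_chart[OF s c, of "inv_into U \<phi> y"] inv_coords[OF c that] by simp
  then show "continuous_on (coords U \<phi>) (\<lambda>y. laplacian A g s (inv_into U \<phi> y))"
    using coord_laplacian_continuous[OF s c] by (simp cong: continuous_on_cong)
qed

text \<open>Integrability is part of the predicate so that it is additive in
  \<open>f\<close>.\<close>

definition satisfies_Green :: "('a \<Rightarrow> complex) \<Rightarrow> ('a \<Rightarrow> complex) \<Rightarrow> bool" where
  "satisfies_Green f s \<longleftrightarrow> integrable v (\<lambda>p. f p * laplacian A g s p) \<and> integrable v (gradient_product f s) \<and>
     (LINT p|v. f p * laplacian A g s p) = (LINT p|v. gradient_product f s p)"

lemma Green_chart:
  assumes c: "(U, \<phi>) \<in> A" and f: "f \<in> tests" and K: "compactin X K" "K \<subseteq> U"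
    "\<And>p. p \<in> topspace X - K \<Longrightarrow> f p = 0" and K': "compactin X K'" "K' \<subseteq> Xint"
    "\<And>p. p \<in> topspace X - K' \<Longrightarrow> f p = 0" and s: "s \<in> tests"
  shows "satisfies_Green f s"
proof -
  have KK: "compactin X (K \<inter> K')"
    using closed_Int_compactin[OF compactin_imp_closedin[OF hausdorff K'(1)] K(1)] by (simp add: Int_commute)
  have sub: "K \<inter> K' \<subseteq> U \<inter> Xint" using K K' by blast
  have zero: "f p = 0" if "p \<in> topspace X - (K \<inter> K')" for p using that K(3) K'(3) by blast
  note W = weak_laplacian_chart[OF c f KK sub zero s]
  have eq: "f p * laplacian A g s p = f p * push U \<phi> (coord_laplacian (g (U, \<phi>)) (\<lambda>y. s (inv_into U \<phi> y))) p"
    if "p \<in> space v" for p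
  proof (cases "p \<in> U \<inter> Xint")
    case True
    then show ?thesis using laplacian_chart[OF s c, of p] by (simp add: push_def)
  next
    case False
    then have "f p = 0" using that sub zero by auto
    then show ?thesis by simp
  qed
  let ?H = "\<lambda>p. f p * push U \<phi> (coord_laplacian (g (U, \<phi>)) (\<lambda>y. s (inv_into U \<phi> y))) p"
  have "integrable v (\<lambda>p. f p * laplacian A g s p) \<longleftrightarrow> integrable v ?H"
    by (rule Bochner_Integration.integrable_cong[OF refl eq])
  moreover have "(LINT p|v. f p * laplacian A g s p) = (LINT p|v. ?H p)"
    by (rule Bochner_Integration.integral_cong[OF refl eq])
  ultimately show ?thesis unfolding satisfies_Green_def using W by simp
qed

lemma partial_deriv_add:
  assumes "f \<in> tests" "h \<in> tests" "(U, \<phi>) \<in> A" "y \<in> coords U \<phi>"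
  shows "partial_deriv i (\<lambda>y. f (inv_into U \<phi> y) + h (inv_into U \<phi> y)) y =
    partial_deriv i (\<lambda>y. f (inv_into U \<phi> y)) y + partial_deriv i (\<lambda>y. h (inv_into U \<phi> y)) y"
  unfolding partial_deriv_def
    frechet_derivative_at[OF has_derivative_add[OF test_has_derivative[OF assms(1,3,4)]
      test_has_derivative[OF assms(2,3,4)]], symmetric] ..

lemma gradient_product_add:
  assumes "f \<in> tests" "h \<in> tests" "s \<in> tests"
  shows "gradient_product (\<lambda>p. f p + h p) s p = gradient_product f s p + gradient_product h s p"
proof (cases "p \<in> Xint")
  case True
  obtain U \<phi> where c: "(U, \<phi>) \<in> A" "p \<in> U" using interior_chartE[OF True] by blast
  have y: "\<phi> p \<in> coords U \<phi>" using c True by (auto simp: coords_def)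
  show ?thesis
    unfolding gradient_product_chart[OF assms(1,3) c True] gradient_product_chart[OF assms(2,3) c True]
      gradient_product_chart[OF test_add[OF assms(1,2)] assms(3) c True] coord_gradient_product_def
      partial_deriv_add[OF assms(1,2) c(1) y]
    by (simp add: algebra_simps scaleR_add_right sum.distrib)
qed (simp add: gradient_product_def)

lemma Green_add:
  assumes "f \<in> tests" "h \<in> tests" "s \<in> tests" "satisfies_Green f s" "satisfies_Green h s"
  shows "satisfies_Green (\<lambda>p. f p + h p) s"
proof -
  have "gradient_product (\<lambda>p. f p + h p) s = (\<lambda>p. gradient_product f s p + gradient_product h s p)"
    using gradient_product_add[OF assms(1-3)] by blast
  then show ?thesis
    using assms(4,5) unfolding satisfies_Green_def by (simp add: ring_distribs)
qed

text \<open>These functions play the part of a partition of unity: products with them and with their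
  complements break a test function into pieces supported in charts.\<close>

definition chart_plateau :: "('a \<Rightarrow> complex) \<Rightarrow> bool" where
  "chart_plateau \<eta> \<longleftrightarrow> \<eta> \<in> tests \<and>
     (\<exists>U \<phi> K. (U, \<phi>) \<in> A \<and> compactin X K \<and> K \<subseteq> U \<and> (\<forall>p\<in>topspace X - K. \<eta> p = 0))"

text \<open>Each step of the induction splits off the part of the function that is supported in one
  chart, multiplying it by a cutoff and by its complement.\<close>

lemma Green_of_plateaus:
  assumes "\<And>\<eta>. \<eta> \<in> set xs \<Longrightarrow> chart_plateau \<eta>" "f \<in> tests" "s \<in> tests"
    "\<And>p. p \<in> topspace X \<Longrightarrow> f p * (\<Prod>\<eta>\<leftarrow>xs. 1 - \<eta> p) = 0"
  shows "satisfies_Green f s"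
  using assms
proof (induction xs arbitrary: f)
  case Nil
  have zero: "f p = 0" if "p \<in> topspace X" for p using Nil.prems(4)[OF that] by simp
  have "compactin X {}" by simp
  then have "gradient_product f s p = 0" if "p \<in> space v" for p
    using gradient_product_zero[OF Nil.prems(2,3), of "{}" p] zero that by simp
  note z1 = this
  have z2: "f p * laplacian A g s p = 0" if "p \<in> space v" for p using zero that by simp
  show ?case unfolding satisfies_Green_def
    using Bochner_Integration.integrable_cong[of v v "gradient_product f s" "\<lambda>p. 0", OF refl z1]
      Bochner_Integration.integral_cong[of v v "gradient_product f s" "\<lambda>p. 0", OF refl z1]
      Bochner_Integration.integrable_cong[of v v "\<lambda>p. f p * laplacian A g s p" "\<lambda>p. 0", OF refl z2]
      Bochner_Integration.integral_cong[of v v "\<lambda>p. f p * laplacian A g s p" "\<lambda>p. 0", OF refl z2] by simp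
next
  case (Cons \<eta> xs)
  obtain U \<phi> K where K: "\<eta> \<in> tests" "(U, \<phi>) \<in> A" "compactin X K" "K \<subseteq> U" "\<And>p. p \<in> topspace X - K \<Longrightarrow> \<eta> p = 0"
    using Cons.prems(1)[of \<eta>] unfolding chart_plateau_def by auto
  let ?f1 = "\<lambda>p. f p * \<eta> p" and ?f2 = "\<lambda>p. f p - f p * \<eta> p"
  have t1: "?f1 \<in> tests" by (rule test_mult[OF Cons.prems(2) K(1)])
  have t2: "?f2 \<in> tests" by (rule test_diff[OF Cons.prems(2) t1])
  obtain K' where K': "compactin X K'" "K' \<subseteq> Xint" "\<And>p. p \<in> topspace X - K' \<Longrightarrow> ?f1 p = 0"
    using test_support[OF t1] by blast
  have "satisfies_Green ?f1 s"
    by (rule Green_chart[OF K(2) t1 K(3,4) _ K' Cons.prems(3)]) (use K(5) in auto)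
  moreover have "satisfies_Green ?f2 s"
  proof (rule Cons.IH[OF _ t2 Cons.prems(3)])
    show "?f2 p * (\<Prod>\<eta>\<leftarrow>xs. 1 - \<eta> p) = 0" if "p \<in> topspace X" for p
      using Cons.prems(4)[OF that] by (auto simp: algebra_simps)
  qed (use Cons.prems(1) in auto)
  ultimately have "satisfies_Green (\<lambda>p. ?f1 p + ?f2 p) s" by (rule Green_add[OF t1 t2 Cons.prems(3)])
  then show ?case by simp
qed

text \<open>The cutoffs of \<open>Green_of_plateaus\<close> come from this lemma: around each
  interior point there is one with value 1 on a neighbourhood.\<close>

lemma plateau_near:
  assumes p: "p \<in> Xint"
  obtains N \<eta> where "openin X N" "p \<in> N" "chart_plateau \<eta>" "\<And>q. q \<in> N \<Longrightarrow> \<eta> q = 1"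
proof -
  obtain U \<phi> where c: "(U, \<phi>) \<in> A" "p \<in> U" using interior_chartE[OF p] by blast
  have "\<phi> p \<in> coords U \<phi>" using c p by (auto simp: coords_def)
  then obtain e where e: "e > 0" "cball (\<phi> p) e \<subseteq> coords U \<phi>"
    using coords_open[OF c(1)] open_contains_cball by blast
  define \<rho> where "\<rho> = e / 2"
  have \<rho>: "\<rho> > 0" and TU: "cball (\<phi> p) (2 * \<rho>) \<subseteq> coords U \<phi>" using e by (auto simp: \<rho>_def)
  let ?\<eta> = "push U \<phi> (bump (\<phi> p) \<rho>)"
  let ?N = "{q \<in> U. \<phi> q \<in> ball (\<phi> p) \<rho>}"
  let ?K = "inv_into U \<phi> ` cball (\<phi> p) (2 * \<rho>)"
  have bz: "bump (\<phi> p) \<rho> y = 0" if "y \<notin> cball (\<phi> p) (2 * \<rho>)" for y using bump_eq_0[OF \<rho>, of y "\<phi> p"] that by auto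
  have "?\<eta> \<in> tests" by (rule push_test[OF c(1) bump_Ck compact_cball TU bz])
  moreover have "compactin X ?K" by (rule inv_image_compact[OF c(1) compact_cball TU])
  moreover have "?K \<subseteq> U" using TU inv_coords(1)[OF c(1)] by blast
  moreover have "\<forall>q\<in>topspace X - ?K. ?\<eta> q = 0"
    using push_support[of _ U \<phi> "bump (\<phi> p) \<rho>", OF TU bz c(1)] by blast
  ultimately have "chart_plateau ?\<eta>" unfolding chart_plateau_def using c(1) by blast
  moreover have "openin X ?N" by (rule chart_preimage_open[OF c(1)]) simp
  moreover have "p \<in> ?N" using c \<rho> by simp
  moreover have "?\<eta> q = 1" if "q \<in> ?N" for q
  proof -
    have "\<phi> q \<in> cball (\<phi> p) \<rho>" "\<phi> q \<in> cball (\<phi> p) (2 * \<rho>)" using that \<rho> by auto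
    then have "q \<in> Xint" using TU inv_coords(1)[OF c(1)] that c(1) by force
    then show ?thesis using that bump_eq_1[OF \<rho> \<open>\<phi> q \<in> cball (\<phi> p) \<rho>\<close>] by (simp add: push_def)
  qed
  ultimately show ?thesis using that by blast
qed

lemma plateau_cover:
  assumes K: "compactin X K" "K \<subseteq> Xint"
  obtains H where "finite H" "\<And>\<eta>. \<eta> \<in> H \<Longrightarrow> chart_plateau \<eta>" "\<And>q. q \<in> K \<Longrightarrow> \<exists>\<eta>\<in>H. \<eta> q = 1"
proof -
  have "\<exists>N \<eta>. openin X N \<and> p \<in> N \<and> chart_plateau \<eta> \<and> (\<forall>q\<in>N. \<eta> q = 1)" if "p \<in> K" for p
    using plateau_near[of p] K(2) that by (metis subsetD)
  then obtain N \<eta> where N: "\<And>p. p \<in> K \<Longrightarrow> openin X (N p) \<and> p \<in> N p \<and> chart_plateau (\<eta> p) \<and> (\<forall>q\<in>N p. \<eta> p q = 1)"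
    by metis
  have "(\<forall>V\<in>N ` K. openin X V) \<and> K \<subseteq> \<Union> (N ` K)" using N by blast
  then obtain F where F: "finite F" "F \<subseteq> N ` K" "K \<subseteq> \<Union> F"
    using K(1) unfolding compactin_def by metis
  then obtain J where J: "finite J" "J \<subseteq> K" "F = N ` J" by (meson finite_subset_image)
  show ?thesis
  proof (rule that[of "\<eta> ` J"])
    show "\<exists>\<eta>'\<in>\<eta> ` J. \<eta>' q = 1" if "q \<in> K" for q using that F(3) J N by blast
  qed (use J N in auto)
qed

theorem Green:
  assumes f: "f \<in> tests" and s: "s \<in> tests"
  shows "integrable v (\<lambda>p. f p * laplacian A g s p)" "integrable v (gradient_product f s)"
    "(LINT p|v. f p * laplacian A g s p) = (LINT p|v. gradient_product f s p)"
proof -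
  obtain K where K: "compactin X K" "K \<subseteq> Xint" "\<And>p. p \<in> topspace X - K \<Longrightarrow> f p = 0"
    using test_support[OF f] by blast
  obtain H where H: "finite H" "\<And>\<eta>. \<eta> \<in> H \<Longrightarrow> chart_plateau \<eta>" "\<And>q. q \<in> K \<Longrightarrow> \<exists>\<eta>\<in>H. \<eta> q = 1"
    using plateau_cover[OF K(1,2)] by blast
  obtain xs where xs: "set xs = H" using H(1) finite_list by blast
  have "satisfies_Green f s"
  proof (rule Green_of_plateaus[OF _ f s, of xs])
    show "f q * (\<Prod>\<eta>\<leftarrow>xs. 1 - \<eta> q) = 0" if "q \<in> topspace X" for q
    proof (cases "q \<in> K")
      case True
      then obtain \<eta> where "\<eta> \<in> set xs" "\<eta> q = 1" using H(3) xs by blast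
      then have "0 \<in> set (map (\<lambda>\<eta>. 1 - \<eta> q) xs)" by force
      then show ?thesis by (simp add: prod_list_zero_iff)
    qed (use K(3) that in auto)
  qed (use H(2) xs in auto)
  then show "integrable v (\<lambda>p. f p * laplacian A g s p)" "integrable v (gradient_product f s)"
    "(LINT p|v. f p * laplacian A g s p) = (LINT p|v. gradient_product f s p)"
    unfolding satisfies_Green_def by auto
qed

end

section \<open>Upper bound for the mass in a coordinate ball\<close>

text \<open>The constant is the minimum of the form over the compact product of \<open>T\<close> and
  the unit sphere.\<close>

lemma quadratic_form_lower_bound:
  fixes B :: "'x::euclidean_space \<Rightarrow> real ^ 'k::finite ^ 'k"
  assumes T: "compact T" and B: "\<And>i j. continuous_on T (\<lambda>y. B y $ i $ j)"
    and pos: "\<And>y w. y \<in> T \<Longrightarrow> w \<noteq> 0 \<Longrightarrow> 0 < w \<bullet> (B y *v w)"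
  shows "\<exists>\<kappa>>0. \<forall>y\<in>T. \<forall>w. \<kappa> * (w \<bullet> w) \<le> w \<bullet> (B y *v w)"
proof (cases "T = {}")
  case False
  define q where "q z = snd z \<bullet> (B (fst z) *v snd z)" for z :: "'x \<times> (real ^ 'k)"
  have q_sum: "q z = (\<Sum>i\<in>UNIV. snd z $ i * (\<Sum>j\<in>UNIV. B (fst z) $ i $ j * snd z $ j))" for z
    by (simp add: q_def inner_vec_def matrix_vector_mult_def)
  have cB: "continuous_on (T \<times> sphere 0 1) (\<lambda>z. B (fst z) $ i $ j)" for i j
    by (rule continuous_on_compose2[OF B continuous_on_fst[OF continuous_on_id]]) auto
  have "continuous_on (T \<times> sphere 0 1) q"
    unfolding q_sum by (intro continuous_intros cB)
  moreover have "compact (T \<times> (sphere 0 1 :: (real ^ 'k) set))" using T by (intro compact_Times) auto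
  moreover have "T \<times> (sphere 0 1 :: (real ^ 'k) set) \<noteq> {}"
  proof -
    have "axis (undefined :: 'k) 1 \<in> (sphere 0 1 :: (real ^ 'k) set)" by simp
    then show ?thesis using False by blast
  qed
  ultimately obtain z where z: "z \<in> T \<times> sphere 0 1" "\<And>z'. z' \<in> T \<times> sphere 0 1 \<Longrightarrow> q z \<le> q z'"
    using continuous_attains_inf by metis
  have "q z > 0" unfolding q_def using z(1) by (intro pos) auto
  moreover have "q z * (w \<bullet> w) \<le> w \<bullet> (B y *v w)" if "y \<in> T" for y w
  proof (cases "w = 0")
    case False
    let ?u = "(1 / norm w) *\<^sub>R w"
    have "q z \<le> q (y, ?u)" using that False by (intro z(2)) auto
    also have "q (y, ?u) = (w \<bullet> (B y *v w)) / (norm w)\<^sup>2"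
      by (simp add: q_def matrix_vector_mult_scaleR power2_eq_square)
    finally show ?thesis using False by (simp add: field_simps dot_square_norm)
  qed simp
  ultimately show ?thesis by blast
qed (use zero_less_one in blast)

lemma complex_quadratic_form:
  fixes B :: "real ^ 'k::finite ^ 'k" and a :: "'k \<Rightarrow> complex"
  shows "Re (\<Sum>i\<in>UNIV. \<Sum>j\<in>UNIV. (B $ i $ j) *\<^sub>R (cnj (a i) * a j)) =
    (\<chi> i. Re (a i)) \<bullet> (B *v (\<chi> i. Re (a i))) + (\<chi> i. Im (a i)) \<bullet> (B *v (\<chi> i. Im (a i)))"
  by (simp add: inner_vec_def matrix_vector_mult_def sum_distrib_left sum.distrib[symmetric] algebra_simps)

lemma complex_quadratic_form_bound:
  fixes B :: "real ^ 'k::finite ^ 'k" and a :: "'k \<Rightarrow> complex"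
  assumes "\<And>w. \<kappa> * (w \<bullet> w) \<le> w \<bullet> (B *v w)"
  shows "\<kappa> * (\<Sum>i\<in>UNIV. (cmod (a i))\<^sup>2) \<le> Re (\<Sum>i\<in>UNIV. \<Sum>j\<in>UNIV. (B $ i $ j) *\<^sub>R (cnj (a i) * a j))"
proof -
  let ?x = "(\<chi> i. Re (a i)) :: real ^ 'k" and ?y = "(\<chi> i. Im (a i)) :: real ^ 'k"
  have "(\<Sum>i\<in>UNIV. (cmod (a i))\<^sup>2) = ?x \<bullet> ?x + ?y \<bullet> ?y"
    by (simp add: inner_vec_def cmod_power2 sum.distrib) (simp add: power2_eq_square)
  then show ?thesis
    unfolding complex_quadratic_form using assms[of ?x] assms[of ?y] by (simp add: distrib_left)
qed

context singular_riemannian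
begin

lemma partial_deriv_cnj:
  assumes "s \<in> tests" "(U, \<phi>) \<in> A" "y \<in> coords U \<phi>"
  shows "partial_deriv i (\<lambda>y. cnj (s (inv_into U \<phi> y))) y = cnj (partial_deriv i (\<lambda>y. s (inv_into U \<phi> y)) y)"
  unfolding partial_deriv_def
    frechet_derivative_at[OF bounded_linear.has_derivative[OF bounded_linear_cnj test_has_derivative[OF assms]], symmetric] ..

lemma gradient_square_chart:
  assumes s: "s \<in> tests" and c: "(U, \<phi>) \<in> A" and p: "p \<in> U" "p \<in> Xint"
  shows "gradient_product (\<lambda>p. cnj (s p)) s p =
    (\<Sum>i\<in>UNIV. \<Sum>j\<in>UNIV. (matrix_inv (g (U, \<phi>) (\<phi> p)) $ i $ j) *\<^sub>R
      (cnj (partial_deriv i (\<lambda>y. s (inv_into U \<phi> y)) (\<phi> p)) * partial_deriv j (\<lambda>y. s (inv_into U \<phi> y)) (\<phi> p)))"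
  unfolding gradient_product_chart[OF test_cnj[OF s] s c p] coord_gradient_product_def
    partial_deriv_cnj[OF s c chart_in_coords[OF p]] ..

lemma gradient_square_nonneg:
  assumes s: "s \<in> tests"
  shows "0 \<le> Re (gradient_product (\<lambda>p. cnj (s p)) s p)"
proof (cases "p \<in> Xint")
  case True
  obtain U \<phi> where c: "(U, \<phi>) \<in> A" "p \<in> U" using interior_chartE[OF True] by blast
  have y: "\<phi> p \<in> coords U \<phi>" using c True by (auto simp: coords_def)
  have "0 * (w \<bullet> w) \<le> w \<bullet> (matrix_inv (g (U, \<phi>) (\<phi> p)) *v w)" for w
    using posdef_inverse_pos[OF metric_pos[OF c(1) y], of w] by (cases "w = 0") (auto intro: less_imp_le)
  from complex_quadratic_form_bound[OF this] show ?thesis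
    unfolding gradient_square_chart[OF s c True] by simp
qed (simp add: gradient_product_def)

lemma L2_sq_chart:
  assumes c: "(U, \<phi>) \<in> A" and f: "f \<in> borel_measurable v" "\<And>p. p \<in> topspace X \<Longrightarrow> p \<notin> U \<inter> Xint \<Longrightarrow> f p = 0"
  shows "f \<in> L2 v \<longleftrightarrow> integrable lborel (\<lambda>y. density U \<phi> y * (cmod (pull U \<phi> f y))\<^sup>2)"
    and "L2_sq v f = (LINT y|lborel. density U \<phi> y * (cmod (pull U \<phi> f y))\<^sup>2)"
proof -
  let ?F = "\<lambda>p. (cmod (f p))\<^sup>2"
  have m: "?F \<in> borel_measurable v" using f(1) by measurable
  have z: "?F p = 0" if "p \<in> topspace X" "p \<notin> U \<inter> Xint" for p using f(2)[OF that] by simp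
  have pull: "pull U \<phi> ?F y = (cmod (pull U \<phi> f y))\<^sup>2" for y by (simp add: pull_def)
  show "f \<in> L2 v \<longleftrightarrow> integrable lborel (\<lambda>y. density U \<phi> y * (cmod (pull U \<phi> f y))\<^sup>2)"
    using integral_chart(1)[OF c m z] f(1) by (simp add: L2_def pull)
  show "L2_sq v f = (LINT y|lborel. density U \<phi> y * (cmod (pull U \<phi> f y))\<^sup>2)"
    using integral_chart(2)[OF c m z] by (simp add: L2_sq_def pull)
qed

text \<open>Green's formula for a test function and its conjugate, followed by the Cauchy-Schwarz
  inequality.\<close>

lemma energy_le:
  assumes s: "s \<in> tests" "s \<in> L2 v" "laplacian A g s \<in> L2 v"
  shows "Re (LINT p|v. gradient_product (\<lambda>p. cnj (s p)) s p) \<le> sqrt (L2_sq v s) * sqrt (L2_sq v (laplacian A g s))"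
proof -
  have "(LINT p|v. gradient_product (\<lambda>p. cnj (s p)) s p) = L2_inner v (laplacian A g s) s"
    using Green(3)[OF test_cnj[OF s(1)] s(1)] by (simp add: L2_inner_def mult.commute)
  also have "cmod \<dots> \<le> sqrt (L2_sq v (laplacian A g s)) * sqrt (L2_sq v s)" by (rule L2_Cauchy_Schwarz[OF s(3,2)])
  finally show ?thesis using complex_Re_le_cmod order_trans by (metis mult.commute)
qed

lemma pull_bump_test:
  assumes c: "(U, \<phi>) \<in> A" and \<rho>: "\<rho> > 0" "cball y0 (2 * \<rho>) \<subseteq> coords U \<phi>"
  shows "push U \<phi> (bump y0 \<rho>) \<in> tests" "compactin X (inv_into U \<phi> ` cball y0 (2 * \<rho>))"
    "inv_into U \<phi> ` cball y0 (2 * \<rho>) \<subseteq> U \<inter> Xint"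
    "\<And>p. p \<notin> inv_into U \<phi> ` cball y0 (2 * \<rho>) \<Longrightarrow> push U \<phi> (bump y0 \<rho>) p = 0"
    "\<phi> ` inv_into U \<phi> ` cball y0 (2 * \<rho>) = cball y0 (2 * \<rho>)"
proof -
  let ?T = "cball y0 (2 * \<rho>)"
  have bz: "bump y0 \<rho> y = 0" if "y \<notin> ?T" for y using bump_eq_0[OF \<rho>(1), of y y0] that by auto
  show "push U \<phi> (bump y0 \<rho>) \<in> tests" by (rule push_test[OF c bump_Ck compact_cball \<rho>(2) bz])
  show "compactin X (inv_into U \<phi> ` ?T)" by (rule inv_image_compact[OF c compact_cball \<rho>(2)])
  show "inv_into U \<phi> ` ?T \<subseteq> U \<inter> Xint" using \<rho>(2) inv_coords(1)[OF c] by blast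
  show "push U \<phi> (bump y0 \<rho>) p = 0" if "p \<notin> inv_into U \<phi> ` ?T" for p
    by (rule push_support[OF \<rho>(2) bz c that])
  have "\<phi> (inv_into U \<phi> y) = y" if "y \<in> ?T" for y using inv_coords(2)[OF c] \<rho>(2) that by blast
  then show "\<phi> ` inv_into U \<phi> ` ?T = ?T" by (force simp: image_iff)
qed

text \<open>On compact subsets of a chart the Riemannian and the Lebesgue measure are comparable; by
  the next lemma, the Riemannian length of a gradient there controls the Euclidean one.\<close>

lemma density_bounds:
  assumes c: "(U, \<phi>) \<in> A" and T: "compact T" "T \<subseteq> coords U \<phi>"
  shows "\<exists>w1 w2. 0 < w1 \<and> 0 < w2 \<and> (\<forall>y\<in>T. w1 \<le> density U \<phi> y \<and> density U \<phi> y \<le> w2)"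
proof (cases "T = {}")
  case False
  have "continuous_on T (density U \<phi>)"
    by (rule continuous_on_subset[OF Ck_imp_continuous_on[OF density_Ck[OF c, of 0]] T(2)])
  then obtain y1 y2 where y: "y1 \<in> T" "\<forall>y\<in>T. density U \<phi> y1 \<le> density U \<phi> y"
     "y2 \<in> T" "\<forall>y\<in>T. density U \<phi> y \<le> density U \<phi> y2"
    using continuous_attains_inf[OF T(1) False] continuous_attains_sup[OF T(1) False] by metis
  then show ?thesis using density_pos[OF c] T(2) by (metis subsetD)
qed (auto intro: exI[of _ 1])

lemma inverse_metric_lower_bound:
  assumes c: "(U, \<phi>) \<in> A" and T: "compact T" "T \<subseteq> coords U \<phi>"
  shows "\<exists>\<kappa>>0. \<forall>y\<in>T. \<forall>w. \<kappa> * (w \<bullet> w) \<le> w \<bullet> (matrix_inv (g (U, \<phi>) y) *v w)"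
proof (rule quadratic_form_lower_bound[OF T(1)])
  show "continuous_on T (\<lambda>y. matrix_inv (g (U, \<phi>) y) $ i $ j)" for i j
    by (rule continuous_on_subset[OF Ck_imp_continuous_on[OF
      matrix_inv_Ck[OF coords_open[OF c] metric_Ck[OF c] metric_pos[OF c], of 0]] T(2)])
  show "0 < w \<bullet> (matrix_inv (g (U, \<phi>) y) *v w)" if "y \<in> T" "w \<noteq> 0" for y w
    by (rule posdef_inverse_pos[OF metric_pos[OF c]]) (use that T in auto)
qed

text \<open>On the support of the cutoff the metric is comparable with the Euclidean one and the
  derivatives of the cutoff are bounded; the energy of \<open>s\<close> itself is bounded through
  Green's formula by \<open>energy_le\<close>.\<close>

lemma coordinate_energy_bound:
  assumes c: "(U, \<phi>) \<in> A" and \<rho>: "\<rho> > 0" "cball y0 (2 * \<rho>) \<subseteq> coords U \<phi>"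
  shows "\<exists>C\<ge>0. \<forall>s\<in>tests. s \<in> L2 v \<longrightarrow> laplacian A g s \<in> L2 v \<longrightarrow>
    (LINT y|lborel. (\<Sum>i\<in>UNIV. (cmod (partial_deriv i (pull U \<phi> (\<lambda>p. push U \<phi> (bump y0 \<rho>) p * s p)) y))\<^sup>2))
      \<le> C * (L2_sq v s + sqrt (L2_sq v s) * sqrt (L2_sq v (laplacian A g s)))"
proof -
  let ?T = "cball y0 (2 * \<rho>)"
  let ?K = "inv_into U \<phi> ` ?T"
  let ?b = "push U \<phi> (bump y0 \<rho>)"
  let ?d = "real CARD('n option)"
  note PB = pull_bump_test[OF c \<rho>]
  have cT: "compact ?T" by simp
  obtain w1 w2 where w: "0 < w1" "0 < w2" "\<And>y. y \<in> ?T \<Longrightarrow> w1 \<le> density U \<phi> y \<and> density U \<phi> y \<le> w2"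
    using density_bounds[OF c cT \<rho>(2)] by blast
  obtain \<kappa> where \<kappa>: "\<kappa> > 0" "\<And>y w. y \<in> ?T \<Longrightarrow> \<kappa> * (w \<bullet> w) \<le> w \<bullet> (matrix_inv (g (U, \<phi>) y) *v w)"
    using inverse_metric_lower_bound[OF c cT \<rho>(2)] by blast
  have "\<exists>M\<ge>0. \<forall>y. norm (partial_deriv i (bump y0 \<rho>) y) \<le> M" for i
  proof (rule continuous_compact_support_bounded[OF cT])
    show "partial_deriv i (bump y0 \<rho>) x = 0" if "x \<notin> ?T" for x
      unfolding partial_deriv_def
      by (subst frechet_derivative_zero_outside[of ?T]) (use that bump_eq_0[OF \<rho>(1), of _ y0] in auto)
    show "continuous_on ?T (partial_deriv i (bump y0 \<rho>))"
      by (rule continuous_on_subset[OF Ck_imp_continuous_on[OF partial_deriv_Ck[OF bump_Ck[of "Suc 0"]]]]) simp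
  qed
  then obtain M where M: "\<And>i. M i \<ge> 0" "\<And>i y. cmod (partial_deriv i (bump y0 \<rho>) y) \<le> M i" by metis
  define B where "B = (\<Sum>i\<in>UNIV. (M i)\<^sup>2)"
  have B0: "B \<ge> 0" by (simp add: B_def sum_nonneg)
  define C where "C = max (2 * B / w1) (2 / (\<kappa> * w1))"
  have C: "C \<ge> 0" "2 * B / w1 \<le> C" "2 / (\<kappa> * w1) \<le> C" using B0 w \<kappa> by (auto simp: C_def le_max_iff_disj)
  have "(LINT y|lborel. (\<Sum>i\<in>UNIV. (cmod (partial_deriv i (pull U \<phi> (\<lambda>p. ?b p * s p)) y))\<^sup>2))
      \<le> C * (L2_sq v s + sqrt (L2_sq v s) * sqrt (L2_sq v (laplacian A g s)))"
    if s: "s \<in> tests" "s \<in> L2 v" "laplacian A g s \<in> L2 v" for s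
  proof -
    let ?f = "\<lambda>p. ?b p * s p"
    let ?s = "\<lambda>y. s (inv_into U \<phi> y)"
    have f: "?f \<in> tests" by (rule test_mult[OF PB(1) s(1)])
    have fz: "?f p = 0" if "p \<in> topspace X - ?K" for p using PB(4)[of p] that by simp
    note P = pull_compact_support[OF c f PB(2,3) fz, unfolded PB(5)]
    have dF: "partial_deriv i (pull U \<phi> ?f) y =
       (if y \<in> ?T then partial_deriv i (bump y0 \<rho>) y * ?s y + bump y0 \<rho> y * partial_deriv i ?s y else 0)" for i y
    proof (cases "y \<in> ?T")
      case True
      then have y: "y \<in> coords U \<phi>" using \<rho>(2) by blast
      have db: "(bump y0 \<rho> has_derivative frechet_derivative (bump y0 \<rho>) (at y)) (at y)"
        using bump_Ck[of 1 y0 \<rho>] by (auto simp: frechet_derivative_works[symmetric])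
      have "((\<lambda>y. bump y0 \<rho> y * ?s y) has_derivative
         (\<lambda>v. bump y0 \<rho> y * frechet_derivative ?s (at y) v + frechet_derivative (bump y0 \<rho>) (at y) v * ?s y)) (at y)"
        by (rule has_derivative_mult[OF db test_has_derivative[OF s(1) c y]])
      then have "(pull U \<phi> ?f has_derivative
         (\<lambda>v. bump y0 \<rho> y * frechet_derivative ?s (at y) v + frechet_derivative (bump y0 \<rho>) (at y) v * ?s y)) (at y)"
      proof (rule has_derivative_transform_within_open[OF _ coords_open[OF c] y])
        fix x assume x: "x \<in> coords U \<phi>"
        then show "bump y0 \<rho> x * ?s x = pull U \<phi> ?f x" using inv_coords[OF c x] by (simp add: pull_def push_def)
      qed
      from frechet_derivative_at[OF this, symmetric] show ?thesis using True by (simp add: partial_deriv_def)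
    next
      case False
      have "frechet_derivative (pull U \<phi> ?f) (at y) = (\<lambda>v. 0)"
        by (rule frechet_derivative_zero_outside[of ?T]) (use False P(4) in auto)
      then show ?thesis using False by (simp add: partial_deriv_def)
    qed
    \<comment> \<open>The squared gradient of the cut off function is at most the density times
      \<open>R\<close> in coordinates. The first summand comes from the derivatives of the cutoff,
      the second from those of \<open>s\<close>.\<close>
    define R where "R p = indicator ?K p * (2 * B / w1 * (cmod (s p))\<^sup>2 + 2 / (\<kappa> * w1) * Re (gradient_product (\<lambda>p. cnj (s p)) s p))" for p
    define R' where "R' p = C * ((cmod (s p))\<^sup>2 + Re (gradient_product (\<lambda>p. cnj (s p)) s p))" for p
    note G = Green[OF test_cnj[OF s(1)] s(1)]
    have gm [measurable]: "gradient_product (\<lambda>p. cnj (s p)) s \<in> borel_measurable v" using G(2) by auto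
    have sm [measurable]: "s \<in> borel_measurable v" by (rule test_measurable[OF s(1)])
    have Km [measurable]: "?K \<in> sets v" by (rule compact_sets[OF PB(2)])
    have Rm: "R \<in> borel_measurable v" unfolding R_def by measurable
    have R'i: "integrable v R'" unfolding R'_def using G(2) s(2) by (auto simp: L2_def)
    have gn: "0 \<le> Re (gradient_product (\<lambda>p. cnj (s p)) s p)" for p by (rule gradient_square_nonneg[OF s(1)])
    have R0: "0 \<le> R p" for p
      unfolding R_def using gn[of p] B0 w \<kappa> by (intro mult_nonneg_nonneg add_nonneg_nonneg) auto
    have RR': "R p \<le> R' p" for p
    proof -
      have "2 * B / w1 * (cmod (s p))\<^sup>2 + 2 / (\<kappa> * w1) * Re (gradient_product (\<lambda>p. cnj (s p)) s p) \<le> R' p"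
        unfolding R'_def distrib_left using C gn[of p] by (intro add_mono mult_right_mono) auto
      moreover have "0 \<le> R' p" unfolding R'_def using C gn[of p] by simp
      ultimately show ?thesis by (cases "p \<in> ?K") (auto simp: R_def)
    qed
    have Ri: "integrable v R"
      by (rule Bochner_Integration.integrable_bound[OF R'i Rm]) (use R0 RR' order_trans[OF RR' abs_ge_self] in auto)
    have Rz: "R p = 0" if "p \<in> topspace X" "p \<notin> U \<inter> Xint" for p
    proof -
      have "p \<notin> ?K" using that PB(3) by blast
      then show ?thesis by (simp add: R_def)
    qed
    have pw: "(\<Sum>i\<in>UNIV. (cmod (partial_deriv i (pull U \<phi> ?f) y))\<^sup>2) \<le> density U \<phi> y *\<^sub>R pull U \<phi> R y" for y
    proof (cases "y \<in> ?T")
      case True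
      then have y: "y \<in> coords U \<phi>" using \<rho>(2) by blast
      let ?p = "inv_into U \<phi> y"
      have p: "?p \<in> U" "?p \<in> Xint" "\<phi> ?p = y" "?p \<in> ?K" using inv_coords[OF c y] True by auto
      have "(cmod (partial_deriv i (pull U \<phi> ?f) y))\<^sup>2 \<le> 2 * (M i)\<^sup>2 * (cmod (s ?p))\<^sup>2 + 2 * (cmod (partial_deriv i ?s y))\<^sup>2" for i
      proof -
        have "(cmod (partial_deriv i (pull U \<phi> ?f) y))\<^sup>2 \<le>
           2 * (cmod (partial_deriv i (bump y0 \<rho>) y * ?s y))\<^sup>2 + 2 * (cmod (bump y0 \<rho> y * partial_deriv i ?s y))\<^sup>2"
          using dF[of i y] True cmod_add_sq_le by simp
        moreover have "(cmod (partial_deriv i (bump y0 \<rho>) y * ?s y))\<^sup>2 \<le> (M i)\<^sup>2 * (cmod (s ?p))\<^sup>2"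
          using M(2)[of i y] by (simp add: norm_mult power_mult_distrib mult_right_mono power_mono)
        moreover have "(cmod (bump y0 \<rho> y * partial_deriv i ?s y))\<^sup>2 \<le> 1 * (cmod (partial_deriv i ?s y))\<^sup>2"
          unfolding norm_mult power_mult_distrib using bump_norm[of y0 \<rho> y]
          by (intro mult_right_mono power_le_one) auto
        ultimately show ?thesis by linarith
      qed
      then have "(\<Sum>i\<in>UNIV. (cmod (partial_deriv i (pull U \<phi> ?f) y))\<^sup>2) \<le>
          (\<Sum>i\<in>UNIV. 2 * (M i)\<^sup>2 * (cmod (s ?p))\<^sup>2 + 2 * (cmod (partial_deriv i ?s y))\<^sup>2)" by (intro sum_mono) simp
      also have "\<dots> = 2 * B * (cmod (s ?p))\<^sup>2 + 2 * (\<Sum>i\<in>UNIV. (cmod (partial_deriv i ?s y))\<^sup>2)"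
        by (simp add: sum.distrib B_def sum_distrib_left sum_distrib_right)
      also have "(\<Sum>i\<in>UNIV. (cmod (partial_deriv i ?s y))\<^sup>2) \<le> Re (gradient_product (\<lambda>p. cnj (s p)) s ?p) / \<kappa>"
        using complex_quadratic_form_bound[OF \<kappa>(2)[OF True], of "\<lambda>i. partial_deriv i ?s y"] \<kappa>(1)
          gradient_square_chart[OF s(1) c p(1,2)] p(3) by (simp add: field_simps)
      finally have 1: "(\<Sum>i\<in>UNIV. (cmod (partial_deriv i (pull U \<phi> ?f) y))\<^sup>2) \<le>
         2 * B * (cmod (s ?p))\<^sup>2 + 2 * (Re (gradient_product (\<lambda>p. cnj (s p)) s ?p) / \<kappa>)" by simp
      have "w1 * R ?p \<le> density U \<phi> y * R ?p" using w(3)[OF True] R0 by (intro mult_right_mono) auto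
      moreover have "w1 * R ?p = 2 * B * (cmod (s ?p))\<^sup>2 + 2 * (Re (gradient_product (\<lambda>p. cnj (s p)) s ?p) / \<kappa>)"
        using p(4) w(1) \<kappa>(1) by (simp add: R_def field_simps)
      ultimately show ?thesis using 1 y by (simp add: pull_def)
    next
      case False
      have "0 \<le> density U \<phi> y *\<^sub>R pull U \<phi> R y"
        using R0 density_pos[OF c, of y] by (auto simp: pull_def)
      then show ?thesis using dF False by simp
    qed
    have cont: "continuous_on ?T (\<lambda>y. \<Sum>i\<in>UNIV. (cmod (partial_deriv i (pull U \<phi> ?f) y))\<^sup>2)"
      by (intro continuous_on_sum continuous_on_power continuous_on_norm
        continuous_on_subset[OF Ck_imp_continuous_on[OF partial_deriv_Ck[OF P(1)[of "Suc 0"]]] subset_UNIV])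
    have "(LINT y|lborel. (\<Sum>i\<in>UNIV. (cmod (partial_deriv i (pull U \<phi> ?f) y))\<^sup>2)) \<le> (LINT y|lborel. density U \<phi> y *\<^sub>R pull U \<phi> R y)"
    proof (rule integral_mono[OF _ _ pw])
      show "integrable lborel (\<lambda>y. \<Sum>i\<in>UNIV. (cmod (partial_deriv i (pull U \<phi> ?f) y))\<^sup>2)"
        by (rule continuous_compact_support_integrable[OF cT _ cont]) (simp add: dF)
      show "integrable lborel (\<lambda>y. density U \<phi> y *\<^sub>R pull U \<phi> R y)"
        using integral_chart(1)[OF c Rm Rz] Ri by simp
    qed
    also have "\<dots> = (LINT p|v. R p)" by (rule integral_chart(2)[OF c Rm Rz, symmetric])
    also have "\<dots> \<le> (LINT p|v. R' p)" by (rule integral_mono[OF Ri R'i RR'])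
    also have "\<dots> = C * (L2_sq v s + Re (LINT p|v. gradient_product (\<lambda>p. cnj (s p)) s p))"
      unfolding R'_def L2_sq_def using G(2) s(2) by (simp add: L2_def)
    also have "\<dots> \<le> C * (L2_sq v s + sqrt (L2_sq v s) * sqrt (L2_sq v (laplacian A g s)))"
      using C(1) energy_le[OF s] by (intro mult_left_mono add_left_mono)
    finally show ?thesis .
  qed
  then show ?thesis using C(1) by blast
qed

text \<open>The squared norm on \<open>E\<close> is bounded by a finite rank part, given by the
  inner products with the family \<open>e\<close>, and a remainder with the factor \<open>c\<close>
  that stays bounded in the norm of the graph of the Laplacian.\<close>

definition finite_rank_bound :: "'a set \<Rightarrow> 'i set \<Rightarrow> ('i \<Rightarrow> 'a \<Rightarrow> complex) \<Rightarrow> real \<Rightarrow> bool" where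
  "finite_rank_bound E Z e c \<longleftrightarrow> finite Z \<and> (\<forall>z\<in>Z. e z \<in> L2 v) \<and>
     (\<forall>s\<in>tests. s \<in> L2 v \<longrightarrow> laplacian A g s \<in> L2 v \<longrightarrow>
        L2_sq v (\<lambda>p. indicator E p * s p) \<le> (\<Sum>z\<in>Z. (cmod (L2_inner v s (e z)))\<^sup>2)
          + c * (L2_sq v s + sqrt (L2_sq v s) * sqrt (L2_sq v (laplacian A g s))))"

text \<open>The Poincare inequality on a grid of cubes of side \<open>r\<close> is applied to the
  cut off function in coordinates. Each mean over a cube is the inner product with a function
  \<open>e z\<close>, in which division by the density turns Lebesgue into Riemannian measure. The
  cubes are disjoint, so that the squared norms of these functions add up to a multiple of \<open>1
  / r ^ CARD('n option)\<close>.\<close>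

lemma chart_ball_estimate:
  assumes c: "(U, \<phi>) \<in> A" and \<rho>: "\<rho> > 0" "cball y0 (2 * \<rho>) \<subseteq> coords U \<phi>"
  defines "E \<equiv> {q \<in> U. \<phi> q \<in> ball y0 \<rho>}"
  shows "\<exists>C\<ge>0. \<forall>r. 0 < r \<longrightarrow> r \<le> 1 \<longrightarrow>
    (\<exists>(Z :: (int ^ 'n option) set) e. finite_rank_bound E Z e (C * r\<^sup>2) \<and>
       (\<Sum>z\<in>Z. L2_sq v (e z)) \<le> C / r ^ CARD('n option))"
proof -
  let ?T = "cball y0 (2 * \<rho>)"
  let ?K = "inv_into U \<phi> ` ?T"
  let ?b = "push U \<phi> (bump y0 \<rho>)"
  let ?n = "CARD('n option)"
  note PB = pull_bump_test[OF c \<rho>]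
  have cT: "compact ?T" by simp
  obtain w1 w2 where w: "0 < w1" "0 < w2" "\<And>y. y \<in> ?T \<Longrightarrow> w1 \<le> density U \<phi> y \<and> density U \<phi> y \<le> w2"
    using density_bounds[OF c cT \<rho>(2)] by blast
  obtain C0 where C0: "C0 \<ge> 0" "\<And>s. s \<in> tests \<Longrightarrow> s \<in> L2 v \<Longrightarrow> laplacian A g s \<in> L2 v \<Longrightarrow>
    (LINT y|lborel. (\<Sum>i\<in>UNIV. (cmod (partial_deriv i (pull U \<phi> (\<lambda>p. ?b p * s p)) y))\<^sup>2))
      \<le> C0 * (L2_sq v s + sqrt (L2_sq v s) * sqrt (L2_sq v (laplacian A g s)))"
    using coordinate_energy_bound[OF c \<rho>] by blast
  define C where "C = max (2 * w2 / w1 * measure lborel ?T) (w2 * (2 * 2 ^ ?n * (real ?n * C0)))"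
  have C: "0 \<le> C" "2 * w2 / w1 * measure lborel ?T \<le> C" "w2 * (2 * 2 ^ ?n * (real ?n * C0)) \<le> C"
    using w by (auto simp: C_def le_max_iff_disj)
  have bz: "bump y0 \<rho> y = 0" if "y \<notin> ?T" for y using bump_eq_0[OF \<rho>(1), of y y0] that by auto
  have E_sub: "E \<subseteq> U \<inter> Xint"
  proof
    fix q assume q: "q \<in> E"
    then have "\<phi> q \<in> ?T" using \<rho>(1) by (simp add: E_def)
    then have "inv_into U \<phi> (\<phi> q) \<in> U \<inter> Xint" using inv_coords(1)[OF c] \<rho>(2) by blast
    then show "q \<in> U \<inter> Xint" using q c by (simp add: E_def)
  qed
  have Em: "E \<in> sets v" unfolding E_def by (intro open_sets chart_preimage_open[OF c]) simp
  have main: "\<exists>(Z :: (int ^ 'n option) set) e. finite_rank_bound E Z e (C * r\<^sup>2) \<and>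
      (\<Sum>z\<in>Z. L2_sq v (e z)) \<le> C / r ^ ?n"
    if r: "0 < r" for r
  proof -
    obtain Z :: "(int ^ 'n option) set" where Z: "finite Z" "?T \<subseteq> (\<Union>z\<in>Z. cube r z)"
      using finite_cubes_cover[OF compact_imp_bounded[OF cT] r] by blast
    \<comment> \<open>The constant absorbs the factor \<open>2 / r ^ ?n\<close> of the Poincare
      inequality and the upper bound \<open>w2\<close> for the density.\<close>
    define k where "k = sqrt (2 * w2 / r ^ ?n)"
    have k2: "k\<^sup>2 = 2 * w2 / r ^ ?n" using w r by (simp add: k_def)
    define \<beta> where "\<beta> z y = bump y0 \<rho> y * of_real (k * indicator (cube r z) y * (indicator (coords U \<phi>) y *\<^sub>R inverse (density U \<phi> y)))" for z y
    define e where "e z = push U \<phi> (\<beta> z)" for z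
    have "continuous_on (coords U \<phi>) (\<lambda>y. inverse (density U \<phi> y))"
      using density_pos[OF c] Ck_imp_continuous_on[OF density_Ck[OF c, of 0]] by (intro continuous_on_inverse) force+
    then have [measurable]: "(\<lambda>y. indicator (coords U \<phi>) y *\<^sub>R inverse (density U \<phi> y)) \<in> borel_measurable borel"
      using coords_open[OF c] by (intro borel_measurable_continuous_on_indicator) auto
    have [measurable]: "bump y0 \<rho> \<in> borel_measurable borel"
      by (rule borel_measurable_continuous_onI[OF Ck_imp_continuous_on[OF bump_Ck[of 0]]])
    have \<beta>m: "\<beta> z \<in> borel_measurable borel" for z unfolding \<beta>_def by measurable
    have em: "e z \<in> borel_measurable v" for z unfolding e_def by (rule push_measurable[OF c \<beta>m])
    have ez: "e z p = 0" if "p \<in> topspace X" "p \<notin> U \<inter> Xint" for z p using that by (auto simp: e_def push_def)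
    have pe: "pull U \<phi> (e z) y = \<beta> z y" for z y unfolding e_def pull_push[OF c] by (simp add: \<beta>_def)
    have e_bound: "density U \<phi> y * (cmod (pull U \<phi> (e z) y))\<^sup>2 \<le> k\<^sup>2 / w1 * indicator (?T \<inter> cube r z) y" for z y
    proof (cases "y \<in> ?T \<inter> cube r z")
      case True
      then have y: "y \<in> coords U \<phi>" using \<rho>(2) by blast
      have d: "0 < density U \<phi> y" "w1 \<le> density U \<phi> y" using density_pos[OF c y] w(3) True by auto
      have b1: "(cmod (bump y0 \<rho> y))\<^sup>2 \<le> 1" using bump_norm[of y0 \<rho> y] by (simp add: power_le_one)
      have "density U \<phi> y * (cmod (pull U \<phi> (e z) y))\<^sup>2 = (cmod (bump y0 \<rho> y))\<^sup>2 * (k\<^sup>2 / density U \<phi> y)"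
        using True y d(1) by (simp add: pe \<beta>_def norm_mult norm_divide norm_inverse power_mult_distrib power2_eq_square field_simps)
      also have "\<dots> \<le> 1 * (k\<^sup>2 / density U \<phi> y)" using b1 d by (intro mult_right_mono) auto
      also have "\<dots> \<le> k\<^sup>2 / w1" using d w(1) by (simp add: frac_le)
      finally show ?thesis using True by simp
    next
      case False
      then have "\<beta> z y = 0" using bz[of y] by (auto simp: \<beta>_def)
      then show ?thesis using w(1) by (simp add: pe)
    qed
    have Tz: "emeasure lborel (?T \<inter> cube r z) < \<infinity>" for z
      using emeasure_mono[of "?T \<inter> cube r z" ?T lborel] emeasure_compact_finite[OF cT] by (auto intro: le_less_trans)
    have ind_int: "integrable lborel (\<lambda>y. k\<^sup>2 / w1 * indicator (?T \<inter> cube r z) y)" for z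
      using Tz[of z] by (intro integrable_mult_right integrable_real_indicator) auto
    have dn: "0 \<le> density U \<phi> y * (cmod (pull U \<phi> (e z) y))\<^sup>2" for z y
      using density_pos[OF c, of y] by (cases "y \<in> coords U \<phi>") (auto simp: pull_def)
    have dem: "(\<lambda>y. density U \<phi> y * (cmod (pull U \<phi> (e z) y))\<^sup>2) \<in> borel_measurable borel" for z
    proof -
      have "(\<lambda>y. (indicator (coords U \<phi>) y * density U \<phi> y) * (cmod (pull U \<phi> (e z) y))\<^sup>2) \<in> borel_measurable borel"
        using density_measurable[OF c] pull_measurable[OF c em] by measurable
      moreover have "(indicator (coords U \<phi>) y * density U \<phi> y) * (cmod (pull U \<phi> (e z) y))\<^sup>2 =
          density U \<phi> y * (cmod (pull U \<phi> (e z) y))\<^sup>2" for y by (simp add: pull_def)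
      ultimately show ?thesis by simp
    qed
    have e_int: "integrable lborel (\<lambda>y. density U \<phi> y * (cmod (pull U \<phi> (e z) y))\<^sup>2)" for z
      by (rule Bochner_Integration.integrable_bound[OF ind_int[of z]])
        (use dem dn e_bound[of _ z] order_trans[OF e_bound abs_ge_self] in \<open>auto intro!: AE_I2\<close>)
    have eL2: "e z \<in> L2 v" for z using L2_sq_chart(1)[OF c em ez] e_int by blast
    have "L2_sq v (e z) \<le> k\<^sup>2 / w1 * measure lborel (?T \<inter> cube r z)" for z
    proof -
      have "L2_sq v (e z) = (LINT y|lborel. density U \<phi> y * (cmod (pull U \<phi> (e z) y))\<^sup>2)"
        by (rule L2_sq_chart(2)[OF c em ez])
      also have "\<dots> \<le> (LINT y|lborel. k\<^sup>2 / w1 * indicator (?T \<inter> cube r z) y)"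
        by (rule integral_mono[OF e_int ind_int e_bound])
      finally have "L2_sq v (e z) \<le> (LINT y|lborel. k\<^sup>2 / w1 * indicator (?T \<inter> cube r z) y)" .
      then show ?thesis by simp
    qed
    then have "(\<Sum>z\<in>Z. L2_sq v (e z)) \<le> (\<Sum>z\<in>Z. k\<^sup>2 / w1 * measure lborel (?T \<inter> cube r z))" by (intro sum_mono)
    also have "\<dots> = k\<^sup>2 / w1 * (\<Sum>z\<in>Z. measure lborel (?T \<inter> cube r z))" by (simp add: sum_distrib_left)
    also have "\<dots> \<le> k\<^sup>2 / w1 * measure lborel ?T"
    proof (rule mult_left_mono)
      have "disjoint_family_on (\<lambda>z. ?T \<inter> cube r z) Z"
        unfolding disjoint_family_on_def using cubes_disjoint by blast
      then have "(\<Sum>z\<in>Z. emeasure lborel (?T \<inter> cube r z)) = emeasure lborel (\<Union>z\<in>Z. ?T \<inter> cube r z)"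
        using Z(1) by (intro sum_emeasure) auto
      also have "\<dots> \<le> emeasure lborel ?T" by (intro emeasure_mono) auto
      finally have "(\<Sum>z\<in>Z. ennreal (measure lborel (?T \<inter> cube r z))) \<le> ennreal (measure lborel ?T)"
        using Tz emeasure_compact_finite[OF cT] by (simp add: emeasure_eq_ennreal_measure less_top)
      then show "(\<Sum>z\<in>Z. measure lborel (?T \<inter> cube r z)) \<le> measure lborel ?T" by (simp add: sum_ennreal)
    qed (use w(1) in simp)
    also have "\<dots> = (2 * w2 / w1 * measure lborel ?T) / r ^ ?n" by (simp add: k2 field_simps)
    also have "\<dots> \<le> C / r ^ ?n" using C(2) r by (intro divide_right_mono) auto
    finally have sum_e: "(\<Sum>z\<in>Z. L2_sq v (e z)) \<le> C / r ^ ?n" .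
    have est: "L2_sq v (\<lambda>p. indicator E p * s p) \<le> (\<Sum>z\<in>Z. (cmod (L2_inner v s (e z)))\<^sup>2)
          + C * r\<^sup>2 * (L2_sq v s + sqrt (L2_sq v s) * sqrt (L2_sq v (laplacian A g s)))"
      if s: "s \<in> tests" "s \<in> L2 v" "laplacian A g s \<in> L2 v" for s
    proof -
      let ?f = "\<lambda>p. ?b p * s p"
      let ?F = "pull U \<phi> ?f"
      let ?N = "L2_sq v s + sqrt (L2_sq v s) * sqrt (L2_sq v (laplacian A g s))"
      have f: "?f \<in> tests" by (rule test_mult[OF PB(1) s(1)])
      have fz: "?f p = 0" if "p \<in> topspace X - ?K" for p using PB(4)[of p] that by simp
      note P = pull_compact_support[OF c f PB(2,3) fz, unfolded PB(5)]
      interpret F: compactly_supported_C1 ?F ?T using P by unfold_locales auto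
      have F_eq: "?F y = bump y0 \<rho> y * s (inv_into U \<phi> y)" if "y \<in> coords U \<phi>" for y
        using inv_coords[OF c that] that by (simp add: pull_def push_def)
      obtain M where M: "\<And>x. norm (?F x) \<le> M"
        using continuous_compact_support_bounded[OF cT P(4) F.continuous] by blast
      let ?S = "\<lambda>y. \<Sum>i\<in>UNIV. (cmod (partial_deriv i ?F y))\<^sup>2"
      define D1 where "D1 = (LINT y|lborel. ?S y)"
      have D1: "D1 \<le> C0 * ?N" unfolding D1_def by (rule C0(2)[OF s])
      have S_cont: "continuous_on ?T ?S"
        by (intro continuous_on_sum continuous_on_power continuous_on_norm
          continuous_on_subset[OF Ck_imp_continuous_on[OF partial_deriv_Ck[OF P(1)[of "Suc 0"]]] subset_UNIV])
      have S_int: "integrable lborel ?S"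
        by (rule continuous_compact_support_integrable[OF cT _ S_cont]) (use F.derivative_zero in \<open>simp add: partial_deriv_def\<close>)
      have D1_nonneg: "D1 \<ge> 0" unfolding D1_def by (intro integral_nonneg_AE AE_I2 sum_nonneg) auto
      have D: "(\<integral>\<^sup>+ y. ennreal ((norm (?F (y + h) - ?F y))\<^sup>2) \<partial>lborel) \<le> ennreal (real ?n * r\<^sup>2 * D1)"
        if h: "\<And>i. \<bar>h $ i\<bar> \<le> r" for h :: "real ^ 'n option"
      proof -
        have pw: "(norm (frechet_derivative ?F (at y) h))\<^sup>2 \<le> real ?n * r\<^sup>2 * ?S y" for y
        proof -
          interpret L: bounded_linear "frechet_derivative ?F (at y)"
            using has_derivative_bounded_linear[OF F.has_derivative] .
          have "frechet_derivative ?F (at y) h = frechet_derivative ?F (at y) (\<Sum>i\<in>UNIV. (h $ i) *\<^sub>R axis i 1)"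
            by (metis (no_types, lifting) basis_expansion scalar_mult_eq_scaleR sum.cong)
          also have "\<dots> = (\<Sum>i\<in>UNIV. (h $ i) *\<^sub>R partial_deriv i ?F y)" by (simp add: L.sum L.scaleR partial_deriv_def)
          finally have "norm (frechet_derivative ?F (at y) h) \<le> (\<Sum>i\<in>UNIV. norm ((h $ i) *\<^sub>R partial_deriv i ?F y))"
            by (simp only: norm_sum)
          also have "\<dots> \<le> (\<Sum>i\<in>UNIV. r * cmod (partial_deriv i ?F y))"
            using h by (intro sum_mono) (auto intro: mult_right_mono)
          finally have "(norm (frechet_derivative ?F (at y) h))\<^sup>2 \<le> (\<Sum>i\<in>UNIV. r * cmod (partial_deriv i ?F y))\<^sup>2"
            by (intro power_mono) auto
          also have "\<dots> \<le> (\<Sum>i\<in>UNIV. (r * cmod (partial_deriv i ?F y))\<^sup>2) * real (card (UNIV :: 'n option set))"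
            by (rule sum_squared_le_sum_of_squares)
          also have "\<dots> = real ?n * r\<^sup>2 * ?S y" by (simp add: power_mult_distrib sum_distrib_left mult_ac)
          finally show ?thesis .
        qed
        have "(\<integral>\<^sup>+ y. ennreal ((norm (?F (y + h) - ?F y))\<^sup>2) \<partial>lborel) = ennreal (LINT y|lborel. (norm (?F (y + h) - ?F y))\<^sup>2)"
          by (rule nn_integral_eq_integral[OF F.shift_difference_integrable]) auto
        also have "(LINT y|lborel. (norm (?F (y + h) - ?F y))\<^sup>2) \<le> (LINT y|lborel. (norm (frechet_derivative ?F (at y) h))\<^sup>2)"
          by (rule F.integral_shift_difference)
        also have "\<dots> \<le> (LINT y|lborel. real ?n * r\<^sup>2 * ?S y)"
        proof (rule integral_mono[OF _ _ pw])
          show "integrable lborel (\<lambda>y. (norm (frechet_derivative ?F (at y) h))\<^sup>2)"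
            by (rule continuous_compact_support_integrable[OF cT])
              (use F.derivative_zero in \<open>auto intro!: continuous_on_power continuous_on_norm F.continuous_derivative\<close>)
          show "integrable lborel (\<lambda>y. real ?n * r\<^sup>2 * ?S y)" by (rule integrable_mult_right[OF S_int])
        qed
        also have "\<dots> = real ?n * r\<^sup>2 * D1" unfolding D1_def by (rule integral_mult_right_zero)
        finally show ?thesis by (simp add: ennreal_leI)
      qed
      have Zc: "?F x = 0" if "x \<notin> (\<Union>z\<in>Z. cube r z)" for x
        using P(4)[of x] Z(2) that by blast
      have Fi: "integrable lborel (\<lambda>y. (norm (?F y))\<^sup>2)"
        by (rule continuous_compact_support_integrable[OF cT])
          (use P(4) in \<open>auto intro!: continuous_on_power continuous_on_norm F.continuous\<close>)
      let ?I = "\<lambda>z. LINT y:cube r z|lborel. ?F y"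
      have "ennreal (LINT y|lborel. (norm (?F y))\<^sup>2) = (\<integral>\<^sup>+ x. ennreal ((norm (?F x))\<^sup>2) \<partial>lborel)"
        by (rule nn_integral_eq_integral[symmetric, OF Fi]) auto
      also have "\<dots> \<le> (\<Sum>z\<in>Z. ennreal (2 / r ^ ?n * (norm (?I z))\<^sup>2)) + ennreal (2 * 2 ^ ?n) * ennreal (real ?n * r\<^sup>2 * D1)"
        by (rule grid_Poincare[OF F.measurable M r Z(1) Zc D])
      also have "\<dots> = ennreal ((\<Sum>z\<in>Z. 2 / r ^ ?n * (norm (?I z))\<^sup>2) + 2 * 2 ^ ?n * (real ?n * r\<^sup>2 * D1))"
      proof -
        have "(\<Sum>z\<in>Z. ennreal (2 / r ^ ?n * (norm (?I z))\<^sup>2)) = ennreal (\<Sum>z\<in>Z. 2 / r ^ ?n * (norm (?I z))\<^sup>2)"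
          using r by (intro sum_ennreal) auto
        moreover have "ennreal (2 * 2 ^ ?n) * ennreal (real ?n * r\<^sup>2 * D1) = ennreal (2 * 2 ^ ?n * (real ?n * r\<^sup>2 * D1))"
          by (rule ennreal_mult'[symmetric]) simp
        ultimately show ?thesis
          using r D1_nonneg by (simp add: sum_nonneg flip: ennreal_plus)
      qed
      finally have "(LINT y|lborel. (norm (?F y))\<^sup>2) \<le> (\<Sum>z\<in>Z. 2 / r ^ ?n * (norm (?I z))\<^sup>2) + 2 * 2 ^ ?n * (real ?n * r\<^sup>2 * D1)"
        using r D1_nonneg by (subst (asm) ennreal_le_iff) (auto intro!: add_nonneg_nonneg sum_nonneg)
      then have "w2 * (LINT y|lborel. (norm (?F y))\<^sup>2) \<le> w2 * ((\<Sum>z\<in>Z. 2 / r ^ ?n * (norm (?I z))\<^sup>2) + 2 * 2 ^ ?n * (real ?n * r\<^sup>2 * D1))"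
        using w(2) by (intro mult_left_mono) auto
      also have "\<dots> = (\<Sum>z\<in>Z. k\<^sup>2 * (norm (?I z))\<^sup>2) + w2 * (2 * 2 ^ ?n * (real ?n * D1)) * r\<^sup>2"
      proof -
        obtain N where N: "real ?n = N" by blast
        show ?thesis unfolding N by (simp add: k2 distrib_left sum_distrib_left mult_ac)
      qed
      also have "w2 * (2 * 2 ^ ?n * (real ?n * D1)) \<le> w2 * (2 * 2 ^ ?n * (real ?n * (C0 * ?N)))"
        using w(2) D1 by (intro mult_left_mono) auto
      also have "\<dots> = w2 * (2 * 2 ^ ?n * (real ?n * C0)) * ?N" by (simp add: mult_ac)
      also have "\<dots> \<le> C * ?N" using C(3) by (intro mult_right_mono add_nonneg_nonneg mult_nonneg_nonneg) auto
      finally have F_est: "w2 * (LINT y|lborel. (norm (?F y))\<^sup>2) \<le> (\<Sum>z\<in>Z. k\<^sup>2 * (norm (?I z))\<^sup>2) + C * ?N * r\<^sup>2"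
        by (simp add: mult_right_mono)
      have inner: "(cmod (L2_inner v s (e z)))\<^sup>2 = k\<^sup>2 * (norm (?I z))\<^sup>2" for z
      proof -
        let ?h = "\<lambda>p. s p * cnj (e z p)"
        have hm: "?h \<in> borel_measurable v" using test_measurable[OF s(1)] em by measurable
        have hz: "?h p = 0" if "p \<in> topspace X" "p \<notin> U \<inter> Xint" for p using ez[OF that] by simp
        have "density U \<phi> y *\<^sub>R pull U \<phi> ?h y = of_real k * (indicator (cube r z) y *\<^sub>R ?F y)" for y
        proof (cases "y \<in> coords U \<phi>")
          case True
          have "pull U \<phi> ?h y = s (inv_into U \<phi> y) * cnj (\<beta> z y)" using True pe[of z y] by (simp add: pull_def)
          moreover obtain t where t: "bump y0 \<rho> y = of_real t" using bump_real by blast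
          ultimately show ?thesis using True density_pos[OF c True] F_eq[OF True]
            by (simp add: \<beta>_def t scaleR_conv_of_real field_simps)
        qed (simp add: pull_def)
        moreover have "(LINT p|v. ?h p) = (LINT y|lborel. density U \<phi> y *\<^sub>R pull U \<phi> ?h y)"
          by (rule integral_chart(2)[OF c hm hz])
        ultimately have "L2_inner v s (e z) = (LINT y|lborel. of_real k * (indicator (cube r z) y *\<^sub>R ?F y))"
          unfolding L2_inner_def by (simp only:)
        also have "\<dots> = of_real k * ?I z"
          unfolding set_lebesgue_integral_def by (rule integral_mult_right_zero)
        finally show ?thesis by (simp add: norm_mult power_mult_distrib)
      qed
      let ?u = "\<lambda>p. indicator E p * s p"
      have uL2: "?u \<in> L2 v" by (rule L2_indicator[OF s(2) Em])
      have um: "?u \<in> borel_measurable v" using uL2 by (rule L2_measurable)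
      have uz: "?u p = 0" if "p \<in> topspace X" "p \<notin> U \<inter> Xint" for p
      proof -
        have "p \<notin> E" using that E_sub by blast
        then show ?thesis by simp
      qed
      have u_le: "density U \<phi> y * (cmod (pull U \<phi> ?u y))\<^sup>2 \<le> w2 * (norm (?F y))\<^sup>2" for y
      proof (cases "y \<in> coords U \<phi> \<and> inv_into U \<phi> y \<in> E")
        case True
        then have y: "y \<in> ball y0 \<rho>" "y \<in> coords U \<phi>" using inv_coords(2)[OF c, of y] by (auto simp: E_def)
        then have yT: "y \<in> ?T" "y \<in> cball y0 \<rho>" using \<rho>(1) by auto
        have "pull U \<phi> ?u y = ?F y" using True F_eq[OF y(2)] bump_eq_1[OF \<rho>(1) yT(2)] by (simp add: pull_def)
        then show ?thesis using w(3)[OF yT(1)] by (simp add: mult_right_mono)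
      next
        case False
        then have "pull U \<phi> ?u y = 0" by (auto simp: pull_def)
        then show ?thesis using w(2) by simp
      qed
      have ui: "integrable lborel (\<lambda>y. density U \<phi> y * (cmod (pull U \<phi> ?u y))\<^sup>2)"
        using L2_sq_chart(1)[OF c um uz] uL2 by blast
      have "L2_sq v ?u = (LINT y|lborel. density U \<phi> y * (cmod (pull U \<phi> ?u y))\<^sup>2)"
        by (rule L2_sq_chart(2)[OF c um uz])
      also have "\<dots> \<le> (LINT y|lborel. w2 * (norm (?F y))\<^sup>2)"
        by (rule integral_mono[OF ui integrable_mult_right[OF Fi] u_le])
      also have "\<dots> = w2 * (LINT y|lborel. (norm (?F y))\<^sup>2)" by (rule integral_mult_right_zero)
      finally show ?thesis using F_est inner by (simp add: mult_ac)
    qed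
    show ?thesis unfolding finite_rank_bound_def
      using Z(1) eL2 sum_e est by (intro exI[of _ Z] exI[of _ e]) blast
  qed
  then show ?thesis using C(1) by blast
qed

end

section \<open>Eigenfunctions\<close>

lemma matrix_inv_symmetric:
  fixes G :: "real ^ 'k::finite ^ 'k"
  assumes "transpose G = G" "invertible G"
  shows "matrix_inv G $ i $ j = matrix_inv G $ j $ i"
proof -
  have "transpose (matrix_inv G) ** G = transpose (G ** matrix_inv G)"
    using assms(1) by (simp add: matrix_transpose_mul)
  also have "\<dots> = mat 1" using matrix_inv_right[OF assms(2)] by simp
  finally have "transpose (matrix_inv G) ** (G ** matrix_inv G) = matrix_inv G"
    by (simp add: matrix_mul_assoc)
  then have sym: "transpose (matrix_inv G) = matrix_inv G" using matrix_inv_right[OF assms(2)] by simp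
  have "matrix_inv G $ i $ j = transpose (matrix_inv G) $ i $ j" by (simp only: sym)
  also have "\<dots> = matrix_inv G $ j $ i" by (simp add: transpose_def)
  finally show ?thesis .
qed

context singular_riemannian
begin

lemma gradient_product_commute:
  assumes f: "f \<in> tests" "h \<in> tests"
  shows "gradient_product f h p = gradient_product h f p"
proof (cases "p \<in> Xint")
  case True
  obtain U \<phi> where c: "(U, \<phi>) \<in> A" "p \<in> U" using interior_chartE[OF True] by blast
  have y: "\<phi> p \<in> coords U \<phi>" using c True by (auto simp: coords_def)
  have sym: "matrix_inv (g (U, \<phi>) (\<phi> p)) $ i $ j = matrix_inv (g (U, \<phi>) (\<phi> p)) $ j $ i" for i j
    by (rule matrix_inv_symmetric[OF metric_sym[OF c(1) y] posdef_invertible[OF metric_pos[OF c(1) y]]])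
  show ?thesis
    unfolding gradient_product_chart[OF f c True] gradient_product_chart[OF f(2,1) c True] coord_gradient_product_def
    by (subst sum.swap) (simp add: sym mult.commute)
qed (simp add: gradient_product_def)

lemma gradient_product_cnj:
  assumes f: "f \<in> tests" "h \<in> tests"
  shows "gradient_product (\<lambda>p. cnj (f p)) (\<lambda>p. cnj (h p)) p = cnj (gradient_product f h p)"
proof (cases "p \<in> Xint")
  case True
  obtain U \<phi> where c: "(U, \<phi>) \<in> A" "p \<in> U" using interior_chartE[OF True] by blast
  have y: "\<phi> p \<in> coords U \<phi>" using c True by (auto simp: coords_def)
  show ?thesis
    unfolding gradient_product_chart[OF f c True] gradient_product_chart[OF test_cnj[OF f(1)] test_cnj[OF f(2)] c True]
      coord_gradient_product_def partial_deriv_cnj[OF f(1) c(1) y] partial_deriv_cnj[OF f(2) c(1) y]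
    by simp
qed (simp add: gradient_product_def)

lemma laplacian_symmetric:
  assumes "s \<in> tests" "t \<in> tests"
  shows "L2_inner v s (laplacian A g t) = L2_inner v (laplacian A g s) t"
proof -
  note cs = test_cnj[OF assms(1)] and ct = test_cnj[OF assms(2)]
  have "L2_inner v (laplacian A g t) s = (LINT p|v. cnj (s p) * laplacian A g t p)"
    by (simp add: L2_inner_def mult.commute)
  also have "\<dots> = (LINT p|v. gradient_product (\<lambda>p. cnj (s p)) t p)" by (rule Green(3)[OF cs assms(2)])
  finally have "L2_inner v s (laplacian A g t) = cnj (LINT p|v. gradient_product (\<lambda>p. cnj (s p)) t p)"
    by (metis L2_inner_cnj)
  also have "\<dots> = (LINT p|v. cnj (gradient_product (\<lambda>p. cnj (s p)) t p))" by simp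
  also have "(\<lambda>p. cnj (gradient_product (\<lambda>p. cnj (s p)) t p)) = gradient_product (\<lambda>p. cnj (t p)) s"
    using gradient_product_cnj[OF cs assms(2)] gradient_product_commute[OF ct assms(1)] by (simp add: fun_eq_iff)
  also have "(LINT p|v. gradient_product (\<lambda>p. cnj (t p)) s p) = (LINT p|v. cnj (t p) * laplacian A g s p)"
    by (rule Green(3)[OF ct assms(1), symmetric])
  also have "\<dots> = L2_inner v (laplacian A g s) t" by (simp add: L2_inner_def mult.commute)
  finally show ?thesis .
qed

lemma L2_chart_supported:
  assumes c: "(U, \<phi>) \<in> A" and F: "F \<in> borel_measurable v" and K: "compactin X K" "K \<subseteq> U \<inter> Xint"
    "\<And>p. p \<in> topspace X - K \<Longrightarrow> F p = 0" and cont: "continuous_on (coords U \<phi>) (\<lambda>y. F (inv_into U \<phi> y))"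
  shows "F \<in> L2 v"
proof -
  have z: "F p = 0" if "p \<in> topspace X" "p \<notin> U \<inter> Xint" for p using that K(2) by (intro K(3)) blast
  have cK: "compact (\<phi> ` K)" using chart_image_compact[OF c K(1)] K(2) by blast
  have KC: "\<phi> ` K \<subseteq> coords U \<phi>" using K(2) by (auto simp: coords_def)
  have out: "pull U \<phi> F y = 0" if "y \<notin> \<phi> ` K" for y
  proof (cases "y \<in> coords U \<phi>")
    case True
    then have "inv_into U \<phi> y \<notin> K" using that inv_coords(2)[OF c True] by (metis image_eqI)
    then show ?thesis using True K(3) inv_coords(1)[OF c True] chart_subset[OF c] by (auto simp: pull_def)
  qed (simp add: pull_def)
  have "continuous_on (coords U \<phi>) (\<lambda>y. density U \<phi> y * (cmod (pull U \<phi> F y))\<^sup>2)"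
  proof -
    have "continuous_on (coords U \<phi>) (pull U \<phi> F)"
      using cont by (simp add: pull_def cong: continuous_on_cong)
    then show ?thesis
      by (intro continuous_on_mult continuous_on_power continuous_on_norm Ck_imp_continuous_on[OF density_Ck[OF c, of 0]])
  qed
  then have "continuous_on (\<phi> ` K) (\<lambda>y. density U \<phi> y * (cmod (pull U \<phi> F y))\<^sup>2)"
    by (rule continuous_on_subset[OF _ KC])
  then have "integrable lborel (\<lambda>y. density U \<phi> y * (cmod (pull U \<phi> F y))\<^sup>2)"
    by (intro continuous_compact_support_integrable[OF cK]) (use out in auto)
  then show ?thesis using L2_sq_chart(1)[OF c F z] by blast
qed

lemma test_L2: assumes f: "f \<in> tests" shows "f \<in> L2 v"
proof -
  obtain K where K: "compactin X K" "K \<subseteq> Xint" "\<And>p. p \<in> topspace X - K \<Longrightarrow> f p = 0"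
    using test_support[OF f] by blast
  obtain H where H: "finite H" "\<And>\<eta>. \<eta> \<in> H \<Longrightarrow> chart_plateau \<eta>" "\<And>q. q \<in> K \<Longrightarrow> \<exists>\<eta>\<in>H. \<eta> q = 1"
    using plateau_cover[OF K(1,2)] by blast
  have "(\<lambda>p. f p * \<eta> p) \<in> L2 v" if \<eta>_in: "\<eta> \<in> H" for \<eta>
  proof -
    obtain U \<phi> K' where \<eta>: "\<eta> \<in> tests" "(U, \<phi>) \<in> A" "compactin X K'" "K' \<subseteq> U" "\<And>p. p \<in> topspace X - K' \<Longrightarrow> \<eta> p = 0"
      using H(2)[OF \<eta>_in] unfolding chart_plateau_def by blast
    have t: "(\<lambda>p. f p * \<eta> p) \<in> tests" by (rule test_mult[OF f \<eta>(1)])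
    have KK: "compactin X (K \<inter> K')"
      by (rule closed_Int_compactin[OF compactin_imp_closedin[OF hausdorff K(1)] \<eta>(3)])
    have z: "f p * \<eta> p = 0" if "p \<in> topspace X - (K \<inter> K')" for p
      using that K(3)[of p] \<eta>(5)[of p] by auto
    have sub: "K \<inter> K' \<subseteq> U \<inter> Xint" using K(2) \<eta>(4) by blast
    show ?thesis
      by (rule L2_chart_supported[OF \<eta>(2) test_measurable[OF t] KK sub z Ck_imp_continuous_on[OF test_Ck[OF t \<eta>(2), of 0]]])
  qed
  then have "integrable v (\<lambda>p. \<Sum>\<eta>\<in>H. (cmod (f p * \<eta> p))\<^sup>2)" by (auto simp: L2_def)
  then show ?thesis
  proof (rule L2_bound[OF test_measurable[OF f]])
    fix p assume p: "p \<in> space v"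
    show "(cmod (f p))\<^sup>2 \<le> (\<Sum>\<eta>\<in>H. (cmod (f p * \<eta> p))\<^sup>2)"
    proof (cases "p \<in> K")
      case True
      then obtain \<eta> where "\<eta> \<in> H" "\<eta> p = 1" using H(3) by blast
      then have "(cmod (f p))\<^sup>2 = (cmod (f p * \<eta> p))\<^sup>2" by simp
      also have "\<dots> \<le> (\<Sum>\<eta>\<in>H. (cmod (f p * \<eta> p))\<^sup>2)"
        by (rule member_le_sum[where f = "\<lambda>\<eta>. (cmod (f p * \<eta> p))\<^sup>2", OF \<open>\<eta> \<in> H\<close> _ H(1)]) simp
      finally show ?thesis .
    next
      case False
      then have "f p = 0" using K(3) p by simp
      then show ?thesis by (simp add: sum_nonneg)
    qed
  qed
qed

lemma laplacian_zero:
  assumes f: "f \<in> tests" and K: "compactin X K" "\<And>p. p \<in> topspace X - K \<Longrightarrow> f p = 0"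
    and p: "p \<in> topspace X - K"
  shows "laplacian A g f p = 0"
proof (cases "p \<in> Xint")
  case True
  obtain U \<phi> where c: "(U, \<phi>) \<in> A" "p \<in> U" using interior_chartE[OF True] by blast
  let ?N = "\<phi> ` (U \<inter> Xint - K)"
  have op: "openin X (U \<inter> Xint - K)"
    by (rule openin_diff[OF interior_chart_open[OF c(1)] compactin_imp_closedin[OF hausdorff K(1)]])
  have N: "open ?N" by (rule chart_image_open[OF c(1) op]) blast
  have pN: "\<phi> p \<in> ?N" using True c p by blast
  have f0: "f (inv_into U \<phi> y) = 0" if "y \<in> ?N" for y
    using that c(1) K(2) chart_subset[OF c(1)] by auto
  have const: "frechet_derivative (\<lambda>y :: real ^ 'n option. 0 :: complex) (at x) = (\<lambda>v. 0)" for x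
    using frechet_derivative_at[OF has_derivative_const] by metis
  have "partial_deriv j (\<lambda>y. f (inv_into U \<phi> y)) x = 0" if "x \<in> ?N" for j x
  proof -
    have "frechet_derivative (\<lambda>y. f (inv_into U \<phi> y)) (at x) = frechet_derivative (\<lambda>y. 0) (at x)"
      by (rule frechet_derivative_cong_open[OF N that f0])
    then show ?thesis by (simp add: partial_deriv_def const)
  qed
  then have fl: "flux U \<phi> f i x = 0" if "x \<in> ?N" for i x using that by (simp add: flux_def)
  have "partial_deriv i (flux U \<phi> f i) (\<phi> p) = 0" for i
  proof -
    have "frechet_derivative (flux U \<phi> f i) (at (\<phi> p)) = frechet_derivative (\<lambda>y. 0) (at (\<phi> p))"
      by (rule frechet_derivative_cong_open[OF N pN fl])
    then show ?thesis by (simp add: partial_deriv_def const)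
  qed
  then show ?thesis unfolding laplacian_chart[OF f c True] coord_laplacian_flux by simp
next
  case False
  then show ?thesis using p by (intro laplacian_boundary) auto
qed

text \<open>The bumps used as trial functions are supported in one chart, where their Laplacians are
  continuous with compact support.\<close>

lemma laplacian_L2_chart:
  assumes c: "(U, \<phi>) \<in> A" and f: "f \<in> tests" and K: "compactin X K" "K \<subseteq> U \<inter> Xint"
    "\<And>p. p \<in> topspace X - K \<Longrightarrow> f p = 0"
  shows "laplacian A g f \<in> L2 v"
proof (rule L2_chart_supported[OF c laplacian_measurable[OF f] K(1,2) laplacian_zero[OF f K(1,3)]])
  have "laplacian A g f (inv_into U \<phi> y) = coord_laplacian (g (U, \<phi>)) (\<lambda>y. f (inv_into U \<phi> y)) y" if "y \<in> coords U \<phi>" for y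
    using laplacian_chart[OF f c, of "inv_into U \<phi> y"] inv_coords[OF c that] by simp
  then show "continuous_on (coords U \<phi>) (\<lambda>y. laplacian A g f (inv_into U \<phi> y))"
    using coord_laplacian_continuous[OF f c] by (simp cong: continuous_on_cong)
qed

end

locale laplace_eigenfunctions = singular_riemannian X A g v
  for X :: "'a topology" and A :: "('a, real ^ 'n::finite option) chart set"
    and g :: "('a, 'n option) tensor2" and v :: "'a measure" +
  fixes ev :: "nat \<Rightarrow> real" and u :: "nat \<Rightarrow> 'a \<Rightarrow> complex"
  assumes eigenbasis: "laplace_eigenbasis X A g v ev u"
begin

lemma ev_pos: "0 < ev j" and ev_mono: "i \<le> j \<Longrightarrow> ev i \<le> ev j" and basis: "orthonormal_basis v u"
  and graph: "(u j, \<lambda>p. of_real (ev j) * u j p) \<in> laplace_graph X A g v"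
  using eigenbasis by (auto simp: laplace_eigenbasis_def dest: monoD)

lemma u_L2: "u j \<in> L2 v" using basis by (simp add: orthonormal_basis_def)

lemma eigenfunction_approximation:
  "\<exists>s. (\<forall>k. s k \<in> tests) \<and> (\<forall>k. s k \<in> L2 v) \<and> (\<forall>k. laplacian A g (s k) \<in> L2 v) \<and>
    L2_tendsto v s (u j) \<and> L2_tendsto v (\<lambda>k. laplacian A g (s k)) (\<lambda>p. of_real (ev j) * u j p)"
proof -
  obtain s where s: "\<And>k. s k \<in> tests" "L2_tendsto v s (u j)"
      "L2_tendsto v (\<lambda>k. laplacian A g (s k)) (\<lambda>p. of_real (ev j) * u j p)"
    using graph[of j] unfolding laplace_graph_def by blast
  have "\<forall>\<^sub>F k in sequentially. laplacian A g (s k) \<in> L2 v"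
    by (rule L2_tendsto_eventually_L2[OF s(3) L2_scale[OF u_L2] laplacian_measurable[OF s(1)]])
  then obtain N where N: "\<And>k. k \<ge> N \<Longrightarrow> laplacian A g (s k) \<in> L2 v"
    unfolding eventually_sequentially by blast
  have mono: "strict_mono (\<lambda>k. k + N)" by (auto simp: strict_mono_def)
  show ?thesis
    by (rule exI[of _ "\<lambda>k. s (k + N)"])
      (use s(1) N test_L2[OF s(1)] L2_tendsto_subseq[OF s(2) mono] L2_tendsto_subseq[OF s(3) mono] in auto)
qed

text \<open>The symmetry of the Laplacian on test functions extends to its closure, of which the
  eigenfunctions are elements.\<close>

lemma eigenfunction_inner_laplacian:
  assumes t: "t \<in> tests" "laplacian A g t \<in> L2 v"
  shows "L2_inner v (u j) (laplacian A g t) = of_real (ev j) * L2_inner v (u j) t"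
proof -
  obtain s where s: "\<And>k. s k \<in> tests" "\<And>k. s k \<in> L2 v" "\<And>k. laplacian A g (s k) \<in> L2 v"
    "L2_tendsto v s (u j)" "L2_tendsto v (\<lambda>k. laplacian A g (s k)) (\<lambda>p. of_real (ev j) * u j p)"
    using eigenfunction_approximation[of j] by blast
  have "(\<lambda>k. L2_inner v (s k) (laplacian A g t)) \<longlonglongrightarrow> L2_inner v (u j) (laplacian A g t)"
    by (rule L2_tendsto_inner[OF s(4) u_L2 s(2) t(2)])
  moreover have "(\<lambda>k. L2_inner v (laplacian A g (s k)) t) \<longlonglongrightarrow> L2_inner v (\<lambda>p. of_real (ev j) * u j p) t"
    by (rule L2_tendsto_inner[OF s(5) L2_scale[OF u_L2] s(3) test_L2[OF t(1)]])
  ultimately show ?thesis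
    using laplacian_symmetric[OF s(1) t(1)] LIMSEQ_unique by (simp add: L2_inner_scale_left)
qed

lemma L2_sq_scaled_eigenfunction: "L2_sq v (\<lambda>p. of_real (ev j) * u j p) = (ev j)\<^sup>2"
proof -
  have "L2_sq v (\<lambda>p. of_real (ev j) * u j p) = (LINT p|v. (ev j)\<^sup>2 * (cmod (u j p))\<^sup>2)"
    unfolding L2_sq_def by (simp add: norm_mult power_mult_distrib)
  also have "\<dots> = (ev j)\<^sup>2 * L2_sq v (u j)" unfolding L2_sq_def by (rule integral_mult_right_zero)
  finally show ?thesis by (simp add: orthonormal_L2_sq[OF basis])
qed

text \<open>Both sides of the estimate for test functions are continuous with respect to the norm of
  the graph; for an eigenfunction of norm 1 the norm of the Laplacian is the eigenvalue.\<close>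

lemma eigenfunction_estimate:
  assumes E: "E \<in> sets v" and Z: "finite_rank_bound E Z e C"
  shows "L2_sq v (\<lambda>p. indicator E p * u j p) \<le> (\<Sum>z\<in>Z. (cmod (L2_inner v (u j) (e z)))\<^sup>2) + C * (1 + ev j)"
proof -
  have e: "e z \<in> L2 v" if "z \<in> Z" for z using Z that by (simp add: finite_rank_bound_def)
  have est: "L2_sq v (\<lambda>p. indicator E p * s p) \<le> (\<Sum>z\<in>Z. (cmod (L2_inner v s (e z)))\<^sup>2)
      + C * (L2_sq v s + sqrt (L2_sq v s) * sqrt (L2_sq v (laplacian A g s)))"
    if "s \<in> tests" "s \<in> L2 v" "laplacian A g s \<in> L2 v" for s
    using Z that by (simp add: finite_rank_bound_def)
  obtain s where s: "\<And>k. s k \<in> tests" "\<And>k. s k \<in> L2 v" "\<And>k. laplacian A g (s k) \<in> L2 v"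
    "L2_tendsto v s (u j)" "L2_tendsto v (\<lambda>k. laplacian A g (s k)) (\<lambda>p. of_real (ev j) * u j p)"
    using eigenfunction_approximation[of j] by blast
  note l1 = L2_tendsto_L2_sq[OF s(4) u_L2 s(2)] and l2 = L2_tendsto_L2_sq[OF s(5) L2_scale[OF u_L2] s(3)]
  have lhs: "(\<lambda>k. L2_sq v (\<lambda>p. indicator E p * s k p)) \<longlonglongrightarrow> L2_sq v (\<lambda>p. indicator E p * u j p)"
    by (rule L2_tendsto_L2_sq[OF L2_tendsto_indicator[OF s(4)] L2_indicator[OF u_L2 E] L2_indicator[OF s(2) E]])
  have sum: "(\<lambda>k. \<Sum>z\<in>Z. (cmod (L2_inner v (s k) (e z)))\<^sup>2) \<longlonglongrightarrow> (\<Sum>z\<in>Z. (cmod (L2_inner v (u j) (e z)))\<^sup>2)"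
    by (intro tendsto_sum tendsto_power tendsto_norm L2_tendsto_inner[OF s(4) u_L2 s(2) e])
  have "(\<lambda>k. (\<Sum>z\<in>Z. (cmod (L2_inner v (s k) (e z)))\<^sup>2)
          + C * (L2_sq v (s k) + sqrt (L2_sq v (s k)) * sqrt (L2_sq v (laplacian A g (s k))))) \<longlonglongrightarrow>
      (\<Sum>z\<in>Z. (cmod (L2_inner v (u j) (e z)))\<^sup>2) + C * (L2_sq v (u j) + sqrt (L2_sq v (u j)) * sqrt (L2_sq v (\<lambda>p. of_real (ev j) * u j p)))"
    by (intro tendsto_add tendsto_mult tendsto_const tendsto_real_sqrt sum l1 l2)
  from LIMSEQ_le[OF lhs this] est[OF s(1,2,3)] show ?thesis
    using ev_pos[of j] by (simp add: orthonormal_L2_sq[OF basis] L2_sq_scaled_eigenfunction)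
qed

text \<open>Summing over the first eigenfunctions, Bessel's inequality bounds the finite rank part
  independently of their number.\<close>

lemma mass_sum_bound:
  assumes c: "(U, \<phi>) \<in> A" and \<rho>: "\<rho> > 0" "cball y0 (2 * \<rho>) \<subseteq> coords U \<phi>"
  shows "\<exists>C\<ge>0. \<forall>r N. 0 < r \<longrightarrow> r \<le> 1 \<longrightarrow>
    (\<Sum>j<N. L2_sq v (\<lambda>p. indicator {q \<in> U. \<phi> q \<in> ball y0 \<rho>} p * u j p))
      \<le> C / r ^ CARD('n option) + C * r\<^sup>2 * (\<Sum>j<N. 1 + ev j)"
proof -
  let ?E = "{q \<in> U. \<phi> q \<in> ball y0 \<rho>}"
  have E: "?E \<in> sets v" by (intro open_sets chart_preimage_open[OF c]) simp
  obtain C where C: "C \<ge> 0" "\<And>r. 0 < r \<Longrightarrow> r \<le> 1 \<Longrightarrow> 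
      \<exists>(Z :: (int ^ 'n option) set) e. finite_rank_bound ?E Z e (C * r\<^sup>2) \<and>
        (\<Sum>z\<in>Z. L2_sq v (e z)) \<le> C / r ^ CARD('n option)"
    using chart_ball_estimate[OF c \<rho>] by blast
  have "(\<Sum>j<N. L2_sq v (\<lambda>p. indicator ?E p * u j p)) \<le> C / r ^ CARD('n option) + C * r\<^sup>2 * (\<Sum>j<N. 1 + ev j)"
    if r: "0 < r" "r \<le> 1" for r N
  proof -
    obtain Z :: "(int ^ 'n option) set" and e where Z: "finite_rank_bound ?E Z e (C * r\<^sup>2)"
      and e_sum: "(\<Sum>z\<in>Z. L2_sq v (e z)) \<le> C / r ^ CARD('n option)"
      using C(2)[OF r] by blast
    have e: "e z \<in> L2 v" if "z \<in> Z" for z using Z that by (simp add: finite_rank_bound_def)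
    have "(\<Sum>j<N. L2_sq v (\<lambda>p. indicator ?E p * u j p)) \<le>
       (\<Sum>j<N. (\<Sum>z\<in>Z. (cmod (L2_inner v (u j) (e z)))\<^sup>2) + C * r\<^sup>2 * (1 + ev j))"
      by (intro sum_mono eigenfunction_estimate[OF E Z])
    also have "\<dots> = (\<Sum>z\<in>Z. \<Sum>j<N. (cmod (L2_inner v (u j) (e z)))\<^sup>2) + C * r\<^sup>2 * (\<Sum>j<N. 1 + ev j)"
      unfolding sum.distrib[of _ "\<lambda>j. C * r\<^sup>2 * (1 + ev j)"] sum_distrib_left by (subst sum.swap) simp
    also have "(\<Sum>z\<in>Z. \<Sum>j<N. (cmod (L2_inner v (u j) (e z)))\<^sup>2) \<le> (\<Sum>z\<in>Z. L2_sq v (e z))"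
      by (intro sum_mono Bessel_orthonormal[OF basis] e)
    also note e_sum
    finally show ?thesis by simp
  qed
  then show ?thesis using C(1) by blast
qed

definition negligible_mean :: "'a set \<Rightarrow> bool" where
  "negligible_mean E \<longleftrightarrow> (\<lambda>N. (\<Sum>j<N. L2_sq v (\<lambda>p. indicator E p * u j p)) / real N) \<longlonglongrightarrow> 0"

text \<open>The sides of the cubes are a small multiple \<open>\<epsilon>\<close> of the wave length
  \<open>1 / a\<close> of the highest eigenfunction. The finite rank part is then negligible by the
  growth of the eigenvalues, and the remainder is at most a multiple of
  \<open>\<epsilon>\<^sup>2\<close>.\<close>

lemma negligible_mean_chart_ball:
  assumes growth: "(\<lambda>N. sqrt (1 + ev (N - 1)) ^ CARD('n option) / real N) \<longlonglongrightarrow> 0"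
    and c: "(U, \<phi>) \<in> A" and \<rho>: "\<rho> > 0" "cball y0 (2 * \<rho>) \<subseteq> coords U \<phi>"
  shows "negligible_mean {q \<in> U. \<phi> q \<in> ball y0 \<rho>}"
proof -
  let ?n = "CARD('n option)"
  let ?S = "\<lambda>N. \<Sum>j<N. L2_sq v (\<lambda>p. indicator {q \<in> U. \<phi> q \<in> ball y0 \<rho>} p * u j p)"
  obtain C where C: "C \<ge> 0" "\<And>r N. 0 < r \<Longrightarrow> r \<le> 1 \<Longrightarrow> ?S N \<le> C / r ^ ?n + C * r\<^sup>2 * (\<Sum>j<N. 1 + ev j)"
    using mass_sum_bound[OF c \<rho>] by blast
  have bound: "?S N / real N \<le> C / \<epsilon> ^ ?n * (sqrt (1 + ev (N - 1)) ^ ?n / real N) + C * \<epsilon>\<^sup>2"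
    if \<epsilon>: "0 < \<epsilon>" "\<epsilon> \<le> 1" and N: "N > 0" for \<epsilon> N
  proof -
    define a where "a = sqrt (1 + ev (N - 1))"
    have a1: "a \<ge> 1" using ev_pos[of "N - 1"] by (simp add: a_def)
    have a2: "a\<^sup>2 = 1 + ev (N - 1)" using ev_pos[of "N - 1"] by (simp add: a_def)
    define r where "r = \<epsilon> / a"
    have r: "0 < r" "r \<le> 1" using \<epsilon> a1 by (auto simp: r_def divide_le_eq)
    have "(\<Sum>j<N. 1 + ev j) \<le> (\<Sum>j<N. a\<^sup>2)"
      unfolding a2 using N by (intro sum_mono add_left_mono ev_mono) auto
    then have "C * r\<^sup>2 * (\<Sum>j<N. 1 + ev j) \<le> C * r\<^sup>2 * (real N * a\<^sup>2)"
      using C(1) by (intro mult_left_mono) auto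
    also have "\<dots> = C * \<epsilon>\<^sup>2 * real N" using a1 by (simp add: r_def power_divide)
    finally have "?S N \<le> C / r ^ ?n + C * \<epsilon>\<^sup>2 * real N" using C(2)[OF r, of N] by linarith
    also have "C / r ^ ?n = C / \<epsilon> ^ ?n * a ^ ?n" by (simp add: r_def power_divide)
    finally have "?S N / real N \<le> (C / \<epsilon> ^ ?n * a ^ ?n + C * \<epsilon>\<^sup>2 * real N) / real N"
      by (rule divide_right_mono) simp
    then show ?thesis using N by (simp add: a_def add_divide_distrib)
  qed
  have S0: "0 \<le> ?S N / real N" for N by (intro divide_nonneg_nonneg sum_nonneg) auto
  show ?thesis unfolding negligible_mean_def
  proof (rule LIMSEQ_I)
    fix \<delta> :: real assume \<delta>: "\<delta> > 0"
    define \<epsilon> where "\<epsilon> = min 1 (sqrt (\<delta> / (2 * (C + 1))))"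
    have \<epsilon>: "0 < \<epsilon>" "\<epsilon> \<le> 1" using \<delta> C(1) by (auto simp: \<epsilon>_def)
    have "\<epsilon>\<^sup>2 \<le> (sqrt (\<delta> / (2 * (C + 1))))\<^sup>2" using \<epsilon>(1) by (intro power_mono) (auto simp: \<epsilon>_def)
    also have "\<dots> = \<delta> / (2 * (C + 1))" using \<delta> C(1) by simp
    finally have "C * \<epsilon>\<^sup>2 \<le> C * (\<delta> / (2 * (C + 1)))" using C(1) by (intro mult_left_mono)
    also have "\<dots> \<le> \<delta> / 2" using \<delta> C(1) by (simp add: field_simps)
    finally have 1: "C * \<epsilon>\<^sup>2 \<le> \<delta> / 2" .
    have "(\<lambda>N. C / \<epsilon> ^ ?n * (sqrt (1 + ev (N - 1)) ^ ?n / real N)) \<longlonglongrightarrow> C / \<epsilon> ^ ?n * 0"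
      by (intro tendsto_mult tendsto_const growth)
    then have "\<forall>\<^sub>F N in sequentially. C / \<epsilon> ^ ?n * (sqrt (1 + ev (N - 1)) ^ ?n / real N) < \<delta> / 2"
      using \<delta> by (intro order_tendstoD(2)[where y = "C / \<epsilon> ^ ?n * 0"]) auto
    then have "\<forall>\<^sub>F N in sequentially. norm (?S N / real N - 0) < \<delta>"
      using eventually_gt_at_top[of 0]
    proof eventually_elim
      case (elim N)
      then have "?S N / real N < \<delta>" using bound[OF \<epsilon>, of N] 1 by linarith
      then show ?case by (simp only: real_norm_def diff_0_right abs_of_nonneg[OF S0])
    qed
    then show "\<exists>N0. \<forall>N\<ge>N0. norm (?S N / real N - 0) < \<delta>" by (simp add: eventually_sequentially)
  qed
qed

text \<open>On a compact manifold without boundary, constants are test functions with Laplacian 0.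
  As all eigenvalues are positive, they would be orthogonal to every eigenfunction, hence 0 almost
  everywhere. The measure would then be 0 and no function could have norm 1.\<close>

lemma boundary_nonempty:
  assumes X: "compact_space X"
  shows "boundary A \<noteq> {}"
proof
  assume empty: "boundary A = {}"
  let ?one = "\<lambda>p :: 'a. 1 :: complex"
  have Xint: "Xint = topspace X" using empty by (simp add: interior_part_def)
  have one: "?one \<in> tests"
  proof (rule testI[of _ "topspace X"])
    show "smooth_on (\<phi> ` U) (\<lambda>y. 1)" for U and \<phi> :: "'a \<Rightarrow> real ^ 'n option"
      unfolding smooth_on_def by (intro ballI exI[of _ UNIV] exI[of _ "\<lambda>y. 1"]) auto
  qed (use X Xint in \<open>auto simp: compact_space_def\<close>)
  have const: "frechet_derivative (\<lambda>y :: real ^ 'n option. a :: complex) (at x) = (\<lambda>v. 0)" for x a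
    using frechet_derivative_at[OF has_derivative_const] by metis
  have lap: "laplacian A g ?one p = 0" if p: "p \<in> topspace X" for p
  proof -
    obtain U \<phi> where c: "(U, \<phi>) \<in> A" "p \<in> U" using interior_chartE[of p] p Xint by blast
    have "flux U \<phi> ?one i = (\<lambda>x. 0)" for i by (simp add: flux_def partial_deriv_def const fun_eq_iff)
    then have "coord_laplacian (g (U, \<phi>)) (\<lambda>y. 1) (\<phi> p) = 0"
      using coord_laplacian_flux[of U \<phi> ?one "\<phi> p"] by (simp add: partial_deriv_def const)
    then show ?thesis using laplacian_chart[OF one c] p Xint by simp
  qed
  have lapL2: "laplacian A g ?one \<in> L2 v"
    by (rule L2_bound[OF laplacian_measurable[OF one], where g = "\<lambda>p. 0"]) (use lap in auto)
  have "L2_inner v (u j) (laplacian A g ?one) = 0" for j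
  proof -
    have "L2_inner v (u j) (laplacian A g ?one) = (LINT p|v. 0)"
      unfolding L2_inner_def using lap by (intro Bochner_Integration.integral_cong) auto
    then show ?thesis by simp
  qed
  then have "L2_inner v (u j) ?one = 0" for j
    using eigenfunction_inner_laplacian[OF one lapL2, of j] ev_pos[of j] by simp
  then have "(\<lambda>N::nat. 0) \<longlonglongrightarrow> L2_inner v ?one ?one"
    using Parseval[OF basis test_L2[OF one] test_L2[OF one]] by simp
  then have "L2_inner v ?one ?one = 0" using LIMSEQ_unique tendsto_const by blast
  then have "(LINT p|v. (1::real)) = 0" using L2_inner_self[of v ?one] by (simp add: L2_sq_def)
  moreover have int1: "integrable v (\<lambda>p. 1 :: real)" using test_L2[OF one] by (simp add: L2_def)
  ultimately have "AE p in v. (1::real) = 0" by (subst (asm) integral_nonneg_eq_0_iff_AE) auto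
  then have "AE p in v. (cmod (u 0 p))\<^sup>2 = 0" by eventually_elim simp
  then have "L2_sq v (u 0) = 0" unfolding L2_sq_def by (rule integral_eq_zero_AE)
  then show False using orthonormal_L2_sq[OF basis, of 0] by simp
qed

end

section \<open>The metric near a boundary point\<close>

lemma smooth_on_continuous_on:
  assumes "smooth_on S f"
  shows "continuous_on S f"
  unfolding continuous_on_eq_continuous_within
proof
  fix x assume x: "x \<in> S"
  obtain U h where U: "open U" "x \<in> U" "\<forall>k. Ck k h U" "\<forall>y\<in>S \<inter> U. h y = f y"
    using assms x unfolding smooth_on_def by metis
  obtain e where e: "e > 0" "ball x e \<subseteq> U" using U(1,2) open_contains_ball by blast
  have "continuous_on U h" using U(3) Ck_imp_continuous_on by blast
  then have "continuous (at x within S) h"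
    using U(1,2) by (simp add: continuous_on_eq_continuous_at continuous_at_imp_continuous_within)
  then show "continuous (at x within S) f"
    by (rule continuous_transform_within[OF _ e(1) x]) (use e(2) U(4) in \<open>auto simp: dist_commute subset_iff\<close>)
qed

text \<open>For \<open>y = matrix_inv G *v x\<close> the hypothesis and the Cauchy-Schwarz
  inequality give \<open>m * (norm y)\<^sup>2 \<le> y \<bullet> x \<le> norm y * norm
  x\<close>.\<close>

lemma inverse_form_upper_bound:
  fixes G :: "real ^ 'k::finite ^ 'k"
  assumes m: "m > 0" "\<And>w. m * (w \<bullet> w) \<le> w \<bullet> (G *v w)"
  shows "x \<bullet> (matrix_inv G *v x) \<le> (1 / m) * (x \<bullet> x)"
proof -
  have pos: "0 < w \<bullet> (G *v w)" if "w \<noteq> 0" for w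
    using m(2)[of w] that m(1) by (smt (verit) inner_gt_zero_iff mult_pos_pos)
  let ?y = "matrix_inv G *v x"
  have Gy: "G *v ?y = x"
    using matrix_inv_right[OF posdef_invertible[OF pos]] by (simp add: matrix_vector_mul_assoc)
  have cs: "x \<bullet> ?y \<le> norm x * norm ?y" by (rule norm_cauchy_schwarz)
  have "m * (norm ?y)\<^sup>2 \<le> norm x * norm ?y"
    using m(2)[of ?y] cs by (simp add: Gy inner_commute dot_square_norm)
  then have "m * norm ?y \<le> norm x"
    by (cases "norm ?y = 0") (auto simp: power2_eq_square mult.assoc[symmetric])
  then have "norm ?y \<le> norm x / m" using m(1) by (simp add: field_simps)
  then have "norm x * norm ?y \<le> norm x * (norm x / m)" by (intro mult_left_mono) auto
  also have "\<dots> = (1 / m) * (x \<bullet> x)" by (simp add: dot_square_norm power2_eq_square)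
  finally show ?thesis using cs by linarith
qed

lemma half_space_ball:
  fixes y0 :: "real ^ 'n::finite option"
  assumes "openin (top_of_set half_space) S" "y0 \<in> S"
  obtains e where "e > 0" "cball y0 e \<inter> half_space \<subseteq> S"
proof -
  obtain T where T: "open T" "S = half_space \<inter> T" using assms(1) by (auto simp: openin_open)
  then obtain e where "e > 0" "cball y0 e \<subseteq> T" using assms(2) open_contains_cball by blast
  then show ?thesis using that T(2) by blast
qed

text \<open>The mean value inequality along the transverse segment that joins a point to the
  hyperplane.\<close>

lemma Lipschitz_from_hyperplane:
  fixes f :: "real ^ 'n::finite option \<Rightarrow> real"
  assumes O: "open O'" "Ck 1 f O'" "cball y0 e \<subseteq> O'" and y0: "y0 $ None = 0" and e: "e > 0"
    and zero: "\<And>y. y \<in> cball y0 e \<Longrightarrow> y $ None = 0 \<Longrightarrow> f y = 0"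
  shows "\<exists>L>0. \<forall>y\<in>cball y0 e. 0 \<le> y $ None \<longrightarrow> f y \<le> L * y $ None"
proof -
  let ?D = "\<lambda>y. frechet_derivative f (at y) (axis None 1)"
  have "continuous_on (cball y0 e) ?D" using O(2,3) by (auto intro: continuous_on_subset)
  then have "bounded (?D ` cball y0 e)" by (intro compact_imp_bounded compact_continuous_image) auto
  then obtain L0 where "\<forall>x\<in>?D ` cball y0 e. norm x \<le> L0" unfolding bounded_iff by blast
  then have L0: "\<bar>?D y\<bar> \<le> L0" if "y \<in> cball y0 e" for y using that by (metis imageI real_norm_def)
  define L where "L = max L0 1"
  have "f y \<le> L * y $ None" if y: "y \<in> cball y0 e" "0 \<le> y $ None" for y
  proof -
    let ?t = "y $ None"
    let ?p = "\<lambda>\<tau>. y + (\<tau> - ?t) *\<^sub>R axis None 1"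
    have in_ball: "?p \<tau> \<in> cball y0 e" if \<tau>: "\<tau> \<in> {0..?t}" for \<tau>
    proof -
      have "\<bar>(?p \<tau> - y0) $ i\<bar> \<le> \<bar>(y - y0) $ i\<bar>" for i
        using \<tau> y0 by (cases i) (auto simp: axis_def)
      then have "norm (?p \<tau> - y0) \<le> norm (y - y0)" by (intro norm_le_componentwise_cart) (simp only: real_norm_def)
      then show ?thesis using y(1) by (simp add: dist_norm norm_minus_commute)
    qed
    have der: "((\<lambda>\<tau>. f (?p \<tau>)) has_derivative (\<lambda>s. s *\<^sub>R ?D (?p \<tau>))) (at \<tau> within {0..?t})" if "\<tau> \<in> {0..?t}" for \<tau>
    proof -
      have "?p \<tau> \<in> O'" using in_ball[OF that] O(3) by blast
      then have df: "(f has_derivative frechet_derivative f (at (?p \<tau>))) (at (?p \<tau>))"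
        using O(2) by (auto simp: frechet_derivative_works[symmetric])
      have "((\<lambda>\<tau>. f (?p \<tau>)) has_derivative (\<lambda>s. frechet_derivative f (at (?p \<tau>)) (s *\<^sub>R axis None 1))) (at \<tau> within {0..?t})"
        by (rule has_derivative_compose[where g = f and f = ?p, OF _ df]) (auto intro!: derivative_eq_intros)
      then show ?thesis using has_derivative_bounded_linear[OF df] by (simp add: linear_simps)
    qed
    have "norm (f (?p ?t) - f (?p 0)) \<le> L * norm (?t - 0)"
    proof (rule differentiable_bound[where S = "{0..?t}" and f = "\<lambda>\<tau>. f (?p \<tau>)", OF _ der])
      fix \<tau> assume "\<tau> \<in> {0..?t}"
      then have "\<bar>?D (?p \<tau>)\<bar> \<le> L" using L0 in_ball by (force simp: L_def)
      then have "norm (s *\<^sub>R ?D (?p \<tau>)) \<le> L * norm s" for s :: real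
        using mult_right_mono[of "\<bar>?D (?p \<tau>)\<bar>" L "\<bar>s\<bar>"] by (simp add: abs_mult mult.commute)
      then show "onorm (\<lambda>s. s *\<^sub>R ?D (?p \<tau>)) \<le> L" by (rule onorm_le)
    qed (use y in auto)
    moreover have "f (?p 0) = 0"
      using zero[OF in_ball[of 0]] y(2) by (simp add: axis_def)
    ultimately show ?thesis using y(2) by simp
  qed
  then show ?thesis by (intro exI[of _ L]) (auto simp: L_def)
qed

context singular_riemannian
begin

text \<open>The bound refers to the box of side \<open>\<sigma>\<close> that stands on the boundary
  hyperplane and has a corner with the tangential coordinates of \<open>y0\<close>.\<close>

definition inverse_metric_decay ::
    "'a set \<Rightarrow> ('a \<Rightarrow> real ^ 'n option) \<Rightarrow> real ^ 'n option \<Rightarrow> real \<Rightarrow> real \<Rightarrow> real \<Rightarrow> bool" where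
  "inverse_metric_decay U \<phi> y0 \<sigma> C \<alpha> \<longleftrightarrow>
     (\<forall>y. 0 < y $ None \<and> y $ None \<le> \<sigma> \<and>
        (\<forall>j. y0 $ Some j \<le> y $ Some j \<and> y $ Some j \<le> y0 $ Some j + \<sigma>) \<longrightarrow>
      y \<in> coords U \<phi> \<and>
      (\<forall>w. w \<bullet> (matrix_inv (g (U, \<phi>) y) *v w) \<le> C * (y $ None) powr \<alpha> * (w \<bullet> w)))"

text \<open>In a chart around a boundary point, the transverse coordinate of the collar is at most a multiple
  of the height above the boundary, so that the inverse metric decays at least like the power
  \<open>\<alpha>\<close> of the height.\<close>

lemma boundary_chart:
  fixes M :: "'b topology" and B :: "('b, real ^ 'n) chart set"
  assumes M: "smooth_manifold UNIV M B" and collar: "collar X A M B W \<Phi> \<Psi>"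
    and blow: "boundary_blow_up X A W (fst \<circ> \<Psi>) \<alpha> g" and \<alpha>: "0 < \<alpha>" and ne: "boundary A \<noteq> {}"
  shows "\<exists>U \<phi> y0 \<sigma> C. (U, \<phi>) \<in> A \<and> 0 < \<sigma> \<and> \<sigma> \<le> 1 \<and> 0 < C \<and> inverse_metric_decay U \<phi> y0 \<sigma> C \<alpha>"
proof -
  obtain p0 U \<phi> where c: "(U, \<phi>) \<in> A" and p0: "p0 \<in> U" "\<phi> p0 $ None = 0"
    using ne unfolding boundary_def by blast
  define y0 where "y0 = \<phi> p0"
  have y0: "y0 $ None = 0" using p0 by (simp add: y0_def)
  have bd: "q \<in> boundary A" if "q \<in> U" "\<phi> q $ None = 0" for q using that c unfolding boundary_def by blast
  obtain V Gbar where V: "openin X V" "boundary A \<subseteq> V" "V \<subseteq> W" "riemannian_metric_on A V Gbar"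
    "\<And>U \<phi> p. (U, \<phi>) \<in> A \<Longrightarrow> p \<in> U \<inter> V - boundary A \<Longrightarrow> g (U, \<phi>) (\<phi> p) = ((fst \<circ> \<Psi>) p powr (-\<alpha>)) *\<^sub>R Gbar (U, \<phi>) (\<phi> p)"
    using blow unfolding boundary_blow_up_def by blast
  have W: "openin X W" "\<Phi> ` ({0} \<times> topspace M) = boundary A"
    and hom: "homeomorphic_maps (prod_topology (top_of_set {0..<1}) M) (subtopology X W) \<Phi> \<Psi>"
    and smooth: "smooth_map (restrict_atlas A W) (cylinder_atlas B) \<Psi>"
    using collar unfolding collar_def diffeomorphic_maps_def by auto
  have p0V: "p0 \<in> V" "p0 \<in> W" using bd[OF p0] V by auto
  have W_top: "topspace (subtopology X W) = W" using W(1) openin_subset by (metis topspace_subtopology_subset)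
  have cont\<Psi>: "continuous_map (subtopology X W) (prod_topology (top_of_set {0..<1}) M) \<Psi>"
    using hom unfolding homeomorphic_maps_def by blast
  have \<Psi>_mem: "\<Psi> q \<in> {0..<1} \<times> topspace M" if "q \<in> W" for q
    using continuous_map_image_subset_topspace[OF cont\<Psi>] W_top that by force
  have \<Psi>_bd: "fst (\<Psi> q) = 0" if "q \<in> boundary A" for q
  proof -
    have "q \<in> \<Phi> ` ({0} \<times> topspace M)" using that W(2) by simp
    then obtain x where x: "q = \<Phi> x" "x \<in> {0} \<times> topspace M" by (rule imageE)
    then obtain m where m: "m \<in> topspace M" "q = \<Phi> (0, m)" by blast
    have "(0, m) \<in> topspace (prod_topology (top_of_set {0..<1::real}) M)" using m(1) by simp
    then have "\<Psi> (\<Phi> (0, m)) = (0, m)" using hom unfolding homeomorphic_maps_def by blast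
    then show ?thesis using m by simp
  qed
  have "snd (\<Psi> p0) \<in> topspace M" using \<Psi>_mem[OF p0V(2)] by auto
  then obtain N \<psi> where N: "(N, \<psi>) \<in> B" "snd (\<Psi> p0) \<in> N"
    using M unfolding smooth_manifold_def by blast
  have N_open: "openin M N" using M N(1) unfolding smooth_manifold_def by blast
  define \<chi>' where "\<chi>' = (\<lambda>(u, m). \<chi> i. case i of None \<Rightarrow> u | Some j \<Rightarrow> \<psi> m $ j)"
  define P where "P = U \<inter> W \<inter> \<Psi> -` ({0..<1} \<times> N)"
  have "smooth_on (\<phi> ` P) (\<chi>' \<circ> \<Psi> \<circ> inv_into (U \<inter> W) \<phi>)"
  proof -
    have "(U \<inter> W, \<phi>) \<in> restrict_atlas A W" using c unfolding restrict_atlas_def by force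
    moreover have "({0..<1} \<times> N, \<chi>') \<in> cylinder_atlas B"
      using N(1) unfolding cylinder_atlas_def \<chi>'_def by force
    ultimately show ?thesis using smooth unfolding smooth_map_def P_def by blast
  qed
  moreover have inv_W: "inv_into (U \<inter> W) \<phi> (\<phi> q) = q" if "q \<in> U \<inter> W" for q
    using inj_on_subset[OF chart_inj[OF c]] that by (intro inv_into_f_f) auto
  have "p0 \<in> P" using p0 p0V N \<Psi>_mem[OF p0V(2)] by (auto simp: P_def mem_Times_iff)
  then have y0P: "y0 \<in> \<phi> ` P" unfolding y0_def by blast
  ultimately obtain O' hh where O': "open O'" "y0 \<in> O'" "\<forall>k. Ck k hh O'"
    "\<forall>y\<in>\<phi> ` P \<inter> O'. hh y = (\<chi>' \<circ> \<Psi> \<circ> inv_into (U \<inter> W) \<phi>) y"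
    unfolding smooth_on_def by blast
  \<comment> \<open>The transverse coordinate of the collar as a function of the coordinates of the
    chart, extended smoothly across the boundary.\<close>
  define f where "f y = hh y $ None" for y
  have f_Ck: "Ck 1 f O'" unfolding f_def
    using O'(3) by (intro Ck_linear_compose[OF bounded_linear_vec_nth _ O'(1)]) blast
  have f_eq: "f (\<phi> q) = fst (\<Psi> q)" if "q \<in> P" "\<phi> q \<in> O'" for q
  proof -
    have "hh (\<phi> q) = \<chi>' (\<Psi> q)" using O'(4) that inv_W[of q] by (auto simp: P_def)
    then show ?thesis by (cases "\<Psi> q") (simp add: f_def \<chi>'_def)
  qed
  have "openin X P"
  proof -
    have "openin (prod_topology (top_of_set {0..<1::real}) M) ({0..<1} \<times> N)"
      using N_open by (simp add: openin_prod_Times_iff)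
    then have "openin (subtopology X W) {q \<in> topspace (subtopology X W). \<Psi> q \<in> {0..<1} \<times> N}"
      using openin_continuous_map_preimage[OF cont\<Psi>] by blast
    then have "openin X {q \<in> W. \<Psi> q \<in> {0..<1} \<times> N}"
      unfolding W_top using openin_trans_full W(1) by blast
    then have "openin X (U \<inter> {q \<in> W. \<Psi> q \<in> {0..<1} \<times> N})" using chart(1)[OF c] by blast
    moreover have "U \<inter> {q \<in> W. \<Psi> q \<in> {0..<1} \<times> N} = P" by (auto simp: P_def)
    ultimately show ?thesis by simp
  qed
  then have PV: "openin X (P \<inter> V)" using V(1) by blast
  have "openin (top_of_set half_space) (\<phi> ` (P \<inter> V))"
    by (rule chart_image_openin[OF c PV]) (auto simp: P_def)
  moreover have "y0 \<in> \<phi> ` (P \<inter> V)" using \<open>p0 \<in> P\<close> p0V unfolding y0_def by blast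
  ultimately obtain e1 where e1: "e1 > 0" "cball y0 e1 \<inter> half_space \<subseteq> \<phi> ` (P \<inter> V)" by (rule half_space_ball)
  obtain e2 where e2: "e2 > 0" "cball y0 e2 \<subseteq> O'" using O'(1,2) open_contains_cball by blast
  define e where "e = min e1 e2"
  have e: "e > 0" "cball y0 e \<inter> half_space \<subseteq> \<phi> ` (P \<inter> V)" "cball y0 e \<subseteq> O'"
    using e1 e2 by (auto simp: e_def)
  have "\<exists>L>0. \<forall>y\<in>cball y0 e. 0 \<le> y $ None \<longrightarrow> f y \<le> L * y $ None"
  proof (rule Lipschitz_from_hyperplane[OF O'(1) f_Ck e(3) y0 e(1)])
    fix y assume y: "y \<in> cball y0 e" "y $ None = 0"
    then have "y \<in> \<phi> ` (P \<inter> V)" using e(2) by (auto simp: half_space_def)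
    then obtain q where q: "q \<in> P" "y = \<phi> q" by blast
    then have "q \<in> boundary A" using y(2) by (intro bd) (auto simp: P_def)
    then show "f y = 0" using f_eq[OF q(1)] \<Psi>_bd q(2) y(1) e(3) by auto
  qed
  then obtain L where L: "L > 0" "\<And>y. y \<in> cball y0 e \<Longrightarrow> 0 \<le> y $ None \<Longrightarrow> f y \<le> L * y $ None" by blast
  let ?T = "cball y0 e \<inter> half_space"
  have "closed (half_space :: (real ^ 'n option) set)"
    unfolding half_space_def by (intro closed_Collect_le continuous_intros)
  then have T: "compact ?T" by (intro compact_Int_closed) auto
  have TUV: "?T \<subseteq> \<phi> ` (U \<inter> V)" using e(2) by (auto simp: P_def)
  have "smooth_on (\<phi> ` (U \<inter> V)) (Gbar (U, \<phi>))" using V(4) c unfolding riemannian_metric_on_def by blast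
  then have Gc: "continuous_on ?T (Gbar (U, \<phi>))"
    using smooth_on_continuous_on continuous_on_subset TUV by blast
  have "\<exists>\<kappa>>0. \<forall>y\<in>?T. \<forall>w. \<kappa> * (w \<bullet> w) \<le> w \<bullet> (Gbar (U, \<phi>) y *v w)"
  proof (rule quadratic_form_lower_bound[OF T])
    show "continuous_on ?T (\<lambda>y. Gbar (U, \<phi>) y $ i $ j)" for i j
      using Gc by (intro continuous_intros)
    show "0 < w \<bullet> (Gbar (U, \<phi>) y *v w)" if "y \<in> ?T" "w \<noteq> 0" for y w
    proof -
      have "y \<in> \<phi> ` (U \<inter> V)" using that(1) TUV by blast
      then show ?thesis using V(4) c that(2) unfolding riemannian_metric_on_def by blast
    qed
  qed
  then obtain \<kappa> where \<kappa>: "\<kappa> > 0" "\<And>y w. y \<in> ?T \<Longrightarrow> \<kappa> * (w \<bullet> w) \<le> w \<bullet> (Gbar (U, \<phi>) y *v w)" by blast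
  \<comment> \<open>The box of side \<open>\<sigma>\<close> then lies in the ball of radius
    \<open>e\<close>, because the norm is at most the sum of the absolute values of the
    components.\<close>
  define \<sigma> where "\<sigma> = min 1 (e / real CARD('n option))"
  have \<sigma>: "0 < \<sigma>" "\<sigma> \<le> 1" "real CARD('n option) * \<sigma> \<le> e"
  proof -
    obtain d where d: "real CARD('n option) = d" "d > 0" by (metis of_nat_0_less_iff zero_less_card_finite)
    have "\<sigma> \<le> e / d" unfolding \<sigma>_def d(1) by simp
    then show "real CARD('n option) * \<sigma> \<le> e" unfolding d(1) using d(2) by (simp add: field_simps)
    show "0 < \<sigma>" "\<sigma> \<le> 1" unfolding \<sigma>_def d(1) using e(1) d(2) by simp_all
  qed
  have main: "y \<in> coords U \<phi> \<and> (\<forall>w. w \<bullet> (matrix_inv (g (U, \<phi>) y) *v w) \<le> (L powr \<alpha> / \<kappa>) * (y $ None) powr \<alpha> * (w \<bullet> w))"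
    if y: "0 < y $ None" "y $ None \<le> \<sigma>" "\<And>j. y0 $ Some j \<le> y $ Some j \<and> y $ Some j \<le> y0 $ Some j + \<sigma>" for y
  proof -
    have "norm (y - y0) \<le> (\<Sum>i\<in>UNIV. \<bar>(y - y0) $ i\<bar>)" by (rule norm_le_l1_cart)
    also have "\<dots> \<le> (\<Sum>i\<in>(UNIV :: 'n option set). \<sigma>)"
    proof (rule sum_mono)
      fix i :: "'n option"
      show "\<bar>(y - y0) $ i\<bar> \<le> \<sigma>" using y(1,2) y(3) y0 by (cases i) (auto simp: abs_le_iff, (smt (verit))+)
    qed
    also have "\<dots> \<le> e" using \<sigma>(3) by simp
    finally have yT: "y \<in> ?T" using y(1) by (simp add: dist_norm norm_minus_commute half_space_def)
    then obtain q where q: "q \<in> P" "q \<in> V" "y = \<phi> q" using e(2) by blast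
    have qU: "q \<in> U" "q \<in> W" using q(1) by (auto simp: P_def)
    have qX: "q \<in> Xint" using interior_if_positive[OF c qU(1)] y(1) q(3) by simp
    have yc: "y \<in> coords U \<phi>" using chart_in_coords[OF qU(1) qX] q(3) by simp
    have fq: "f y = fst (\<Psi> q)" using f_eq[OF q(1)] q(3) yT e(3) by auto
    have u0: "0 \<le> fst (\<Psi> q)" using \<Psi>_mem[OF qU(2)] by auto
    have u1: "fst (\<Psi> q) \<le> L * y $ None" using L(2)[of y] yT y(1) fq by simp
    have "q \<notin> boundary A" using qX by (simp add: interior_part_def)
    then have gq: "g (U, \<phi>) y = (fst (\<Psi> q) powr (-\<alpha>)) *\<^sub>R Gbar (U, \<phi>) y"
      using V(5)[OF c, of q] qU q by simp
    have u_pos: "0 < fst (\<Psi> q)"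
    proof (rule ccontr)
      assume "\<not> 0 < fst (\<Psi> q)"
      then have "g (U, \<phi>) y = 0" using u0 gq by simp
      then show False using metric_pos[OF c yc, of "axis None 1"] by (simp add: matrix_vector_mult_def axis_eq_0_iff inner_vec_def)
    qed
    let ?m = "(L * y $ None) powr (-\<alpha>) * \<kappa>"
    have m_pos: "?m > 0" using L(1) y(1) \<kappa>(1) by simp
    have "?m * (w \<bullet> w) \<le> w \<bullet> (g (U, \<phi>) y *v w)" for w
    proof -
      have "(L * y $ None) powr (-\<alpha>) \<le> fst (\<Psi> q) powr (-\<alpha>)"
        using u_pos u1 \<alpha> by (intro powr_mono2') auto
      then have "(L * y $ None) powr (-\<alpha>) * (\<kappa> * (w \<bullet> w)) \<le> fst (\<Psi> q) powr (-\<alpha>) * (w \<bullet> (Gbar (U, \<phi>) y *v w))"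
        using \<kappa> yT by (intro mult_mono) auto
      also have "\<dots> = w \<bullet> (g (U, \<phi>) y *v w)" unfolding gq by (simp flip: scaleR_matrix_vector_assoc)
      finally show ?thesis by (simp add: mult.assoc)
    qed
    from inverse_form_upper_bound[OF m_pos this] have "w \<bullet> (matrix_inv (g (U, \<phi>) y) *v w) \<le> (1 / ?m) * (w \<bullet> w)" for w .
    moreover have "1 / ?m = (L powr \<alpha> / \<kappa>) * (y $ None) powr \<alpha>"
      using L(1) y(1) by (simp add: powr_minus powr_mult field_simps)
    ultimately show ?thesis using yc by simp
  qed
  have "inverse_metric_decay U \<phi> y0 \<sigma> (L powr \<alpha> / \<kappa>) \<alpha>"
    unfolding inverse_metric_decay_def using main by blast
  moreover have "0 < L powr \<alpha> / \<kappa>" using L(1) \<kappa>(1) by simp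
  ultimately show ?thesis using c \<sigma>(1,2) by blast
qed

end

section \<open>Trial functions\<close>

lemma bump_rescale: "bump z \<rho> y = bump 0 1 ((1 / \<rho>) *\<^sub>R (y - z))"
  by (simp add: bump_def)

text \<open>All bumps arise from one by translation and dilation, which gives a bound uniform in the
  centre and the radius.\<close>

lemma bump_partial_deriv_bound:
  "\<exists>P\<ge>0. \<forall>z \<rho> y i. 0 < \<rho> \<longrightarrow> cmod (partial_deriv i (bump z \<rho> :: real ^ 'k::finite \<Rightarrow> complex) y) \<le> P / \<rho>"
proof -
  let ?b = "bump 0 1 :: real ^ 'k \<Rightarrow> complex"
  have b0: "?b x = 0" if "x \<notin> cball 0 2" for x using bump_eq_0[of 1 x 0] that by simp
  have "\<exists>M\<ge>0. \<forall>y. norm (partial_deriv i ?b y) \<le> M" for i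
  proof (rule continuous_compact_support_bounded[of "cball 0 2"])
    show "partial_deriv i ?b x = 0" if "x \<notin> cball 0 2" for x
      unfolding partial_deriv_def
      by (subst frechet_derivative_zero_outside[OF closed_cball b0 that]) simp_all
    show "continuous_on (cball 0 2) (partial_deriv i ?b)"
      by (rule continuous_on_subset[OF Ck_imp_continuous_on[OF partial_deriv_Ck[OF bump_Ck[of "Suc 0"]]]]) simp
  qed simp
  then obtain M where M: "\<And>i. M i \<ge> 0" "\<And>i y. cmod (partial_deriv i ?b y) \<le> M i" by metis
  define P where "P = (\<Sum>i\<in>UNIV. M i)"
  have MP: "M i \<le> P" for i unfolding P_def using M(1) by (intro member_le_sum) auto
  have "cmod (partial_deriv i (bump z \<rho> :: real ^ 'k \<Rightarrow> complex) y) \<le> P / \<rho>" if "0 < \<rho>" for z \<rho> y i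
  proof -
    let ?x = "(1 / \<rho>) *\<^sub>R (y - z)"
    have db: "(?b has_derivative frechet_derivative ?b (at ?x)) (at ?x)"
      using bump_Ck[of 1 0 1] by (auto simp: frechet_derivative_works[symmetric])
    have "((\<lambda>y. ?b ((1 / \<rho>) *\<^sub>R (y - z))) has_derivative (\<lambda>v. frechet_derivative ?b (at ?x) ((1 / \<rho>) *\<^sub>R v))) (at y)"
      by (rule has_derivative_compose[where g = ?b and f = "\<lambda>y. (1 / \<rho>) *\<^sub>R (y - z)", OF _ db])
        (auto intro!: derivative_eq_intros)
    then have "(bump z \<rho> has_derivative (\<lambda>v. frechet_derivative ?b (at ?x) ((1 / \<rho>) *\<^sub>R v))) (at y)"
      by (simp add: bump_rescale[of z \<rho>, symmetric])
    from frechet_derivative_at[OF this, symmetric]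
    have "partial_deriv i (bump z \<rho>) y = frechet_derivative ?b (at ?x) ((1 / \<rho>) *\<^sub>R axis i 1)"
      by (simp add: partial_deriv_def)
    also have "\<dots> = (1 / \<rho>) *\<^sub>R partial_deriv i ?b ?x"
      unfolding partial_deriv_def by (rule linear_cmul[OF bounded_linear.linear[OF has_derivative_bounded_linear[OF db]]])
    finally have "cmod (partial_deriv i (bump z \<rho>) y) = cmod (partial_deriv i ?b ?x) / \<rho>" using that by simp
    also have "\<dots> \<le> P / \<rho>" using M(2)[of i ?x] MP[of i] that by (intro divide_right_mono) auto
    finally show ?thesis .
  qed
  moreover have "P \<ge> 0" unfolding P_def using M(1) by (simp add: sum_nonneg)
  ultimately show ?thesis by blast
qed

lemma complex_quadratic_form_upper_bound:
  fixes B :: "real ^ 'k::finite ^ 'k" and a :: "'k \<Rightarrow> complex"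
  assumes "\<And>w. w \<bullet> (B *v w) \<le> \<kappa> * (w \<bullet> w)"
  shows "Re (\<Sum>i\<in>UNIV. \<Sum>j\<in>UNIV. (B $ i $ j) *\<^sub>R (cnj (a i) * a j)) \<le> \<kappa> * (\<Sum>i\<in>UNIV. (cmod (a i))\<^sup>2)"
proof -
  let ?x = "(\<chi> i. Re (a i)) :: real ^ 'k" and ?y = "(\<chi> i. Im (a i)) :: real ^ 'k"
  have "(\<Sum>i\<in>UNIV. (cmod (a i))\<^sup>2) = ?x \<bullet> ?x + ?y \<bullet> ?y"
    by (simp add: inner_vec_def cmod_power2 sum.distrib) (simp add: power2_eq_square)
  then show ?thesis
    unfolding complex_quadratic_form using assms[of ?x] assms[of ?y] by (simp add: distrib_left)
qed

context singular_riemannian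
begin

text \<open>The bump is 1 on the ball of radius \<open>\<rho>\<close>, and on the ball of radius
  \<open>2 * \<rho>\<close> its squared gradient is at most \<open>\<Lambda>\<close> times the
  Euclidean one. The volumes of the two balls differ by the factor \<open>2 ^ CARD('n
  option)\<close>, and the density on them is the one at the centre up to a factor 2, so that it
  cancels in the quotient.\<close>

lemma bump_Rayleigh_quotient:
  assumes c: "(U, \<phi>) \<in> A" and \<rho>: "\<rho> > 0" "cball z (2 * \<rho>) \<subseteq> coords U \<phi>"
    and P: "\<And>y i. cmod (partial_deriv i (bump z \<rho>) y) \<le> P / \<rho>" "P \<ge> 0"
    and \<Lambda>: "\<And>y w. y \<in> cball z (2 * \<rho>) \<Longrightarrow> w \<bullet> (matrix_inv (g (U, \<phi>) y) *v w) \<le> \<Lambda> * (w \<bullet> w)" "\<Lambda> \<ge> 0"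
    and dens: "\<And>y. y \<in> cball z (2 * \<rho>) \<Longrightarrow> density U \<phi> y \<le> 2 * density U \<phi> z \<and> density U \<phi> z \<le> 2 * density U \<phi> y"
  defines "t \<equiv> push U \<phi> (bump z \<rho>)"
  shows "0 < L2_sq v t"
    and "Re (L2_inner v t (laplacian A g t)) \<le> (4 * real CARD('n option) * P\<^sup>2 * 2 ^ CARD('n option)) * \<Lambda> / \<rho>\<^sup>2 * L2_sq v t"
proof -
  let ?n = "CARD('n option)"
  let ?T = "cball z (2 * \<rho>)"
  let ?K = "inv_into U \<phi> ` ?T"
  let ?dz = "density U \<phi> z"
  note PB = pull_bump_test[OF c \<rho>, folded t_def]
  have zT: "z \<in> ?T" using \<rho>(1) by simp
  have dz: "?dz > 0" using density_pos[OF c] \<rho>(2) zT by blast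
  have tz: "t p = 0" if "p \<in> topspace X" "p \<notin> U \<inter> Xint" for p using that by (auto simp: t_def push_def)
  have tm: "t \<in> borel_measurable v" by (rule test_measurable[OF PB(1)])
  have pt: "pull U \<phi> t y = (if y \<in> coords U \<phi> then bump z \<rho> y else 0)" for y
    unfolding t_def by (rule pull_push[OF c])
  define \<omega> where "\<omega> = measure lborel (ball z \<rho>)"
  have \<omega>: "\<omega> > 0" using content_ball_pos[OF \<rho>(1)] by (simp add: \<omega>_def)
  have vol: "measure lborel ?T = 2 ^ ?n * \<omega>"
    using \<rho>(1) by (simp add: \<omega>_def content_ball content_cball power_mult_distrib)
  have tL2: "integrable lborel (\<lambda>y. density U \<phi> y * (cmod (pull U \<phi> t y))\<^sup>2)"
    using L2_sq_chart(1)[OF c tm tz] test_L2[OF PB(1)] by blast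
  have "?dz / 2 * \<omega> = (LINT y|lborel. ?dz / 2 * indicator (ball z \<rho>) y)" by (simp add: \<omega>_def)
  also have "\<dots> \<le> (LINT y|lborel. density U \<phi> y * (cmod (pull U \<phi> t y))\<^sup>2)"
  proof (rule integral_mono[OF _ tL2])
    show "integrable lborel (\<lambda>y. ?dz / 2 * indicator (ball z \<rho>) y)"
      using emeasure_lborel_ball_finite[of z \<rho>] by (intro integrable_mult_right integrable_real_indicator) auto
    show "?dz / 2 * indicator (ball z \<rho>) y \<le> density U \<phi> y * (cmod (pull U \<phi> t y))\<^sup>2" for y
    proof (cases "y \<in> ball z \<rho>")
      case True
      then have y: "y \<in> ?T" "y \<in> cball z \<rho>" using \<rho>(1) by auto
      then have "pull U \<phi> t y = 1" using bump_eq_1[OF \<rho>(1) y(2)] \<rho>(2) by (auto simp: pt)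
      then show ?thesis using True dens[OF y(1)] by simp
    next
      case False
      have "0 \<le> density U \<phi> y * (cmod (pull U \<phi> t y))\<^sup>2"
        using density_pos[OF c, of y] by (cases "y \<in> coords U \<phi>") (auto simp: pt)
      then show ?thesis using False by simp
    qed
  qed
  also have "\<dots> = L2_sq v t" by (rule L2_sq_chart(2)[OF c tm tz, symmetric])
  finally have lower: "?dz / 2 * \<omega> \<le> L2_sq v t" .
  then show "0 < L2_sq v t" using dz \<omega> by (smt (verit) divide_pos_pos mult_pos_pos)
  define R where "R p = Re (gradient_product (\<lambda>p. cnj (t p)) t p)" for p
  note G = Green[OF test_cnj[OF PB(1)] PB(1)]
  have Ri: "integrable v R" unfolding R_def using G(2) by auto
  have Rm: "R \<in> borel_measurable v" using Ri by auto
  have R_out: "R p = 0" if "p \<in> topspace X - ?K" for p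
  proof -
    have "cnj (t q) = 0" if "q \<in> topspace X - ?K" for q using PB(4)[of q] that by simp
    from gradient_product_zero[OF test_cnj[OF PB(1)] PB(1) PB(2) this] that show ?thesis by (simp add: R_def)
  qed
  have Rz: "R p = 0" if "p \<in> topspace X" "p \<notin> U \<inter> Xint" for p using that PB(3) by (intro R_out) blast
  let ?E = "2 * ?dz * (\<Lambda> * (real ?n * (P / \<rho>)\<^sup>2))"
  have E0: "?E \<ge> 0" using dz \<Lambda>(2) by simp
  have pw: "density U \<phi> y *\<^sub>R pull U \<phi> R y \<le> ?E * indicator ?T y" for y
  proof (cases "y \<in> ?T")
    case True
    then have y: "y \<in> coords U \<phi>" using \<rho>(2) by blast
    let ?p = "inv_into U \<phi> y"
    have p: "?p \<in> U" "?p \<in> Xint" "\<phi> ?p = y" using inv_coords[OF c y] by auto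
    have pd: "partial_deriv i (\<lambda>y. t (inv_into U \<phi> y)) y = partial_deriv i (bump z \<rho>) y" for i
    proof -
      have "frechet_derivative (\<lambda>y. t (inv_into U \<phi> y)) (at y) = frechet_derivative (bump z \<rho>) (at y)"
      proof (rule frechet_derivative_cong_open[OF coords_open[OF c] y])
        show "t (inv_into U \<phi> x) = bump z \<rho> x" if "x \<in> coords U \<phi>" for x
          using pt[of x] that by (simp add: pull_def)
      qed
      then show ?thesis by (simp add: partial_deriv_def)
    qed
    have "R ?p \<le> \<Lambda> * (\<Sum>i\<in>UNIV. (cmod (partial_deriv i (bump z \<rho>) y))\<^sup>2)"
      unfolding R_def gradient_square_chart[OF PB(1) c p(1,2)] p(3) pd
      by (rule complex_quadratic_form_upper_bound[OF \<Lambda>(1)[OF True]])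
    also have "\<dots> \<le> \<Lambda> * (\<Sum>i\<in>(UNIV :: 'n option set). (P / \<rho>)\<^sup>2)"
      using \<Lambda>(2) P(1) by (intro mult_left_mono sum_mono power_mono) auto
    also have "\<dots> = \<Lambda> * (real ?n * (P / \<rho>)\<^sup>2)" by simp
    finally have "R ?p \<le> \<Lambda> * (real ?n * (P / \<rho>)\<^sup>2)" .
    then have "density U \<phi> y * R ?p \<le> (2 * ?dz) * (\<Lambda> * (real ?n * (P / \<rho>)\<^sup>2))"
      using dens[OF True] density_pos[OF c y] gradient_square_nonneg[OF PB(1), of ?p] dz
      by (intro mult_mono) (auto simp: R_def)
    then show ?thesis using True y by (simp add: pull_def)
  next
    case False
    have "pull U \<phi> R y = 0"
    proof (cases "y \<in> coords U \<phi>")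
      case True
      have "inv_into U \<phi> y \<notin> ?K" using False PB(5) inv_coords(2)[OF c True] by (metis image_eqI)
      then show ?thesis using True R_out inv_coords(1)[OF c True] chart_subset[OF c] by (auto simp: pull_def)
    qed (simp add: pull_def)
    moreover have "indicator ?T y = (0 :: real)" using False by (rule indicator_simps(2))
    ultimately show ?thesis by (simp only: scaleR_zero_right mult_zero_right order_refl)
  qed
  have "L2_inner v (laplacian A g t) t = (LINT p|v. gradient_product (\<lambda>p. cnj (t p)) t p)"
    using G(3) by (simp add: L2_inner_def mult.commute)
  then have "Re (L2_inner v t (laplacian A g t)) = Re (LINT p|v. gradient_product (\<lambda>p. cnj (t p)) t p)"
    using L2_inner_cnj[of v t "laplacian A g t"] by simp
  also have "\<dots> = (LINT p|v. R p)" unfolding R_def using G(2) by simp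
  also have "\<dots> = (LINT y|lborel. density U \<phi> y *\<^sub>R pull U \<phi> R y)" by (rule integral_chart(2)[OF c Rm Rz])
  also have "\<dots> \<le> (LINT y|lborel. ?E * indicator ?T y)"
  proof (rule integral_mono[OF _ _ pw])
    show "integrable lborel (\<lambda>y. density U \<phi> y *\<^sub>R pull U \<phi> R y)"
      using integral_chart(1)[OF c Rm Rz] Ri by blast
    show "integrable lborel (\<lambda>y. ?E * indicator ?T y)"
      using emeasure_compact_finite[OF compact_cball] by (intro integrable_mult_right integrable_real_indicator) auto
  qed
  also have "\<dots> = ?E * (2 ^ ?n * \<omega>)" by (simp add: vol del: card_option)
  also have "\<dots> = (4 * real ?n * P\<^sup>2 * 2 ^ ?n) * \<Lambda> / \<rho>\<^sup>2 * (?dz / 2 * \<omega>)"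
    by (simp add: power_divide field_simps del: card_option)
  also have "\<dots> \<le> (4 * real ?n * P\<^sup>2 * 2 ^ ?n) * \<Lambda> / \<rho>\<^sup>2 * L2_sq v t"
    using lower \<Lambda>(2) by (intro mult_left_mono) auto
  finally show "Re (L2_inner v t (laplacian A g t)) \<le> (4 * real ?n * P\<^sup>2 * 2 ^ ?n) * \<Lambda> / \<rho>\<^sup>2 * L2_sq v t" .
qed

lemma density_slowly_varying:
  assumes c: "(U, \<phi>) \<in> A" and T: "compact T" "T \<subseteq> coords U \<phi>"
  shows "\<exists>\<delta>>0. \<forall>y\<in>T. \<forall>z\<in>T. dist y z < \<delta> \<longrightarrow> density U \<phi> y \<le> 2 * density U \<phi> z"
proof -
  obtain w1 w2 where w: "0 < w1" "\<And>y. y \<in> T \<Longrightarrow> w1 \<le> density U \<phi> y \<and> density U \<phi> y \<le> w2"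
    using density_bounds[OF c T] by blast
  have "continuous_on T (density U \<phi>)"
    by (rule continuous_on_subset[OF Ck_imp_continuous_on[OF density_Ck[OF c, of 0]] T(2)])
  then have "uniformly_continuous_on T (density U \<phi>)" using T(1) compact_uniformly_continuous by blast
  then obtain \<delta> where \<delta>: "\<delta> > 0" "\<And>y z. y \<in> T \<Longrightarrow> z \<in> T \<Longrightarrow> dist z y < \<delta> \<Longrightarrow> dist (density U \<phi> z) (density U \<phi> y) < w1"
    using w(1) unfolding uniformly_continuous_on_def by metis
  have "density U \<phi> y \<le> 2 * density U \<phi> z" if "y \<in> T" "z \<in> T" "dist y z < \<delta>" for y z
    using \<delta>(2)[OF that(2,1,3)] w(2)[OF that(2)] unfolding dist_real_def by linarith
  then show ?thesis using \<delta>(1) by blast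
qed

text \<open>The disjoint balls make the bumps of one layer orthogonal, and the bounds on the height
  separate the bumps of different layers. A Rayleigh quotient below \<open>\<mu> / 2\<close> rather
  than \<open>\<mu>\<close> is what \<open>card_trial_functions_le\<close> requires.\<close>

definition trial_bumps ::
    "'a set \<Rightarrow> ('a \<Rightarrow> real ^ 'n option) \<Rightarrow> real \<Rightarrow> real \<Rightarrow> (real ^ 'n option) set \<Rightarrow> real \<Rightarrow> bool" where
  "trial_bumps U \<phi> h \<mu> Z \<rho> \<longleftrightarrow> finite Z \<and> 0 < \<rho> \<and>
    (\<forall>z\<in>Z. cball z (2 * \<rho>) \<subseteq> coords U \<phi> \<and> (\<forall>y\<in>ball z (2 * \<rho>). h < y $ None \<and> y $ None < 2 * h) \<and>
       0 < L2_sq v (push U \<phi> (bump z \<rho>)) \<and>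
       Re (L2_inner v (push U \<phi> (bump z \<rho>)) (laplacian A g (push U \<phi> (bump z \<rho>)))) \<le>
         \<mu> / 2 * L2_sq v (push U \<phi> (bump z \<rho>))) \<and>
    (\<forall>z\<in>Z. \<forall>z'\<in>Z. z \<noteq> z' \<longrightarrow> ball z (2 * \<rho>) \<inter> ball z' (2 * \<rho>) = {})"

text \<open>In the layer between the heights \<open>h\<close> and \<open>2 * h\<close> the bumps have radius proportional to
  \<open>h powr (\<alpha> / 2) / sqrt \<mu>\<close>. The layer has thickness \<open>h\<close>, so that the number of bumps that fit is
  at least a multiple of \<open>h powr (1 - \<alpha> * d / 2) * sqrt \<mu> ^ d\<close>, where \<open>d\<close> is the dimension;
  as \<open>\<alpha> * d \<ge> 2\<close>, this power of \<open>h\<close> is at least 1. The constant in front of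
  \<open>sqrt \<mu> ^ d\<close> does not depend on \<open>h\<close>; only the threshold \<open>\<mu>0\<close> does.\<close>

lemma trial_functions_in_layer:
  assumes c: "(U, \<phi>) \<in> A"
    and decay: "inverse_metric_decay U \<phi> y0 \<sigma> C \<alpha>"
    and pos: "0 < \<sigma>" "0 < C" "0 < \<alpha>" "0 < P" and critical: "2 \<le> \<alpha> * real CARD('n option)"
    and h: "0 < h" "2 * h \<le> \<sigma>" "h \<le> 1"
    and P: "\<And>z \<rho> y i. 0 < \<rho> \<Longrightarrow> cmod (partial_deriv i (bump z \<rho> :: real ^ 'n option \<Rightarrow> complex) y) \<le> P / \<rho>"
  defines "E0 \<equiv> sqrt (2 * (4 * real CARD('n option) * P\<^sup>2 * 2 ^ CARD('n option)) * (C * 2 powr \<alpha>))"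
  shows "\<exists>\<mu>0>0. \<forall>\<mu>\<ge>\<mu>0. \<exists>Z \<rho>. trial_bumps U \<phi> h \<mu> Z \<rho> \<and>
    \<sigma> ^ CARD('n) / (8 * E0) ^ CARD('n option) * sqrt \<mu> ^ CARD('n option) \<le> real (card Z)"
proof -
  let ?d = "CARD('n option)"
  define K where "K = 4 * real ?d * P\<^sup>2 * 2 ^ ?d"
  have K: "K > 0" using pos(4) by (simp add: K_def del: card_option)
  define \<Lambda> where "\<Lambda> = C * (2 * h) powr \<alpha>"
  have \<Lambda>: "\<Lambda> > 0" using pos h by (simp add: \<Lambda>_def)
  have E0: "E0 > 0" using K pos by (simp add: E0_def K_def[symmetric] del: card_option)
  \<comment> \<open>With this constant, bumps of radius \<open>a / sqrt \<mu>\<close> have Rayleigh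
    quotient at most \<open>K * \<Lambda> * \<mu> / a\<^sup>2 = \<mu> / 2\<close>, where
    \<open>\<Lambda>\<close> bounds the inverse metric on the layer.\<close>
  define a where "a = E0 * h powr (\<alpha> / 2)"
  have a: "a > 0" using E0 h by (simp add: a_def)
  have a2: "a\<^sup>2 = 2 * K * \<Lambda>"
  proof -
    have "(h powr (\<alpha> / 2))\<^sup>2 = h powr \<alpha>" using h(1) by (simp add: powr_power)
    moreover have "E0\<^sup>2 = 2 * K * (C * 2 powr \<alpha>)"
      unfolding E0_def K_def[symmetric] using K pos by (intro real_sqrt_pow2) simp
    ultimately show ?thesis using h(1) by (simp add: a_def \<Lambda>_def power_mult_distrib powr_mult)
  qed
  define base where "base i = (case i of None \<Rightarrow> h | Some j \<Rightarrow> y0 $ Some j)" for i :: "'n option"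
  define len where "len i = (case i of None \<Rightarrow> h | Some j \<Rightarrow> \<sigma>)" for i :: "'n option"
  have len: "h \<le> len i" for i using h by (auto simp: len_def split: option.splits)
  define T where "T = cbox (\<chi> i. base i) (\<chi> i. base i + len i)"
  have T_mem: "y \<in> T \<longleftrightarrow> (\<forall>i. base i \<le> y $ i \<and> y $ i \<le> base i + len i)" for y
    by (simp add: T_def mem_box_cart)
  have T_box: "h \<le> y $ None \<and> y $ None \<le> 2 * h \<and> (\<forall>j. y0 $ Some j \<le> y $ Some j \<and> y $ Some j \<le> y0 $ Some j + \<sigma>)" if "y \<in> T" for y
    using that[unfolded T_mem, rule_format, of None] that[unfolded T_mem, rule_format, of "Some j" for j]
    by (auto simp: base_def len_def)
  have T_coords: "y \<in> coords U \<phi>" and T_form: "w \<bullet> (matrix_inv (g (U, \<phi>) y) *v w) \<le> \<Lambda> * (w \<bullet> w)" if "y \<in> T" for y w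
  proof -
    have y: "0 < y $ None" "y $ None \<le> \<sigma>" using T_box[OF that] h by auto
    have b: "y \<in> coords U \<phi> \<and> (\<forall>w. w \<bullet> (matrix_inv (g (U, \<phi>) y) *v w) \<le> C * (y $ None) powr \<alpha> * (w \<bullet> w))"
      using decay T_box[OF that] y unfolding inverse_metric_decay_def by blast
    then show "y \<in> coords U \<phi>" by blast
    have "C * (y $ None) powr \<alpha> \<le> \<Lambda>" unfolding \<Lambda>_def
      using T_box[OF that] y(1) pos by (intro mult_left_mono powr_mono2) auto
    then have "C * (y $ None) powr \<alpha> * (w \<bullet> w) \<le> \<Lambda> * (w \<bullet> w)" by (intro mult_right_mono) auto
    then show "w \<bullet> (matrix_inv (g (U, \<phi>) y) *v w) \<le> \<Lambda> * (w \<bullet> w)" using b order_trans by blast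
  qed
  have "compact T" "T \<subseteq> coords U \<phi>" using T_coords by (auto simp: T_def)
  from density_slowly_varying[OF c this] obtain \<delta> where \<delta>: "\<delta> > 0"
    "\<And>y z. y \<in> T \<Longrightarrow> z \<in> T \<Longrightarrow> dist y z < \<delta> \<Longrightarrow> density U \<phi> y \<le> 2 * density U \<phi> z" by blast
  \<comment> \<open>An upper bound for the radius: at least one ball of diameter \<open>4 *
    \<rho>\<close> fits into the height \<open>h\<close> of the layer, and the density varies by a
    factor at most 2 on each ball.\<close>
  define \<eta> where "\<eta> = min (h / 4) (\<delta> / 3)"
  have \<eta>: "\<eta> > 0" "4 * \<eta> \<le> h" "3 * \<eta> \<le> \<delta>" using h \<delta>(1) by (auto simp: \<eta>_def)
  define \<mu>0 where "\<mu>0 = (a / \<eta>)\<^sup>2"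
  have \<mu>0: "\<mu>0 > 0" using a \<eta> by (simp add: \<mu>0_def)
  have "\<exists>Z \<rho>. trial_bumps U \<phi> h \<mu> Z \<rho> \<and>
    \<sigma> ^ CARD('n) / (8 * E0) ^ ?d * sqrt \<mu> ^ ?d \<le> real (card Z)"
    if \<mu>: "\<mu> \<ge> \<mu>0" for \<mu>
  proof -
    have \<mu>_pos: "\<mu> > 0" using \<mu> \<mu>0 by linarith
    define \<rho> where "\<rho> = a / sqrt \<mu>"
    have \<rho>: "\<rho> > 0" using a \<mu>_pos by (simp add: \<rho>_def)
    have "a / \<eta> \<le> sqrt \<mu>" using \<mu> unfolding \<mu>0_def by (rule real_le_rsqrt)
    then have \<rho>\<eta>: "\<rho> \<le> \<eta>" using \<eta>(1) \<mu>_pos by (simp add: \<rho>_def field_simps)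
    have \<rho>h: "4 * \<rho> \<le> h" and \<rho>\<delta>: "2 * \<rho> < \<delta>" using \<rho>\<eta> \<eta> \<rho> by linarith+
    have quot: "K * \<Lambda> / \<rho>\<^sup>2 = \<mu> / 2"
      using a2 a \<mu>_pos K \<Lambda> by (simp add: \<rho>_def power_divide field_simps)
    \<comment> \<open>Number of balls of diameter \<open>4 * \<rho>\<close> in a row along the
      direction \<open>i\<close>; rounding down loses at most a factor 2.\<close>
    define N where "N i = nat \<lfloor>len i / (4 * \<rho>)\<rfloor>" for i
    have N_le: "4 * \<rho> * real (N i) \<le> len i" for i
    proof -
      have "real (N i) \<le> len i / (4 * \<rho>)" unfolding N_def using len[of i] h \<rho> by (simp add: of_nat_nat)
      then show ?thesis using \<rho> by (simp add: field_simps)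
    qed
    have N_ge: "len i / (8 * \<rho>) \<le> real (N i)" for i
    proof -
      have x: "1 \<le> len i / (4 * \<rho>)" using len[of i] \<rho>h \<rho> by (simp add: field_simps)
      have "len i / (4 * \<rho>) - 1 < real (N i)" unfolding N_def using x by linarith
      moreover have "1 \<le> N i" unfolding N_def by (rule le_nat_floor) (use x in simp)
      ultimately show ?thesis by (simp add: field_simps)
    qed
    define zc where "zc k = (\<chi> i. base i + 4 * \<rho> * (real (k i) + 1 / 2)) " for k :: "'n option \<Rightarrow> nat"
    define I where "I = PiE UNIV (\<lambda>i. {..<N i})"
    define Z where "Z = zc ` I"
    have fin: "finite I" unfolding I_def by (intro finite_PiE) auto
    have sep: "ball (zc k) (2 * \<rho>) \<inter> ball (zc k') (2 * \<rho>) = {}" if "k \<noteq> k'" for k k'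
    proof (rule ccontr)
      assume "ball (zc k) (2 * \<rho>) \<inter> ball (zc k') (2 * \<rho>) \<noteq> {}"
      then obtain y where y: "dist (zc k) y < 2 * \<rho>" "dist (zc k') y < 2 * \<rho>" by auto
      have "dist (zc k) (zc k') < 4 * \<rho>" using y dist_triangle2[of "zc k" "zc k'" y] by linarith
      then have "\<bar>(zc k - zc k') $ i\<bar> < 4 * \<rho>" for i
        using component_le_norm_cart[of "zc k - zc k'" i] by (simp add: dist_norm)
      then have "\<bar>4 * \<rho> * (real (k i) - real (k' i))\<bar> < 4 * \<rho>" for i by (simp add: zc_def algebra_simps)
      then have "\<bar>real (k i) - real (k' i)\<bar> < 1" for i using \<rho> by (simp add: abs_mult)
      then have "k i = k' i" for i by (smt (verit) of_nat_eq_iff of_nat_less_iff of_nat_Suc not_less_eq nat_neq_iff)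
      then show False using that by blast
    qed
    have "inj_on zc I"
    proof (rule inj_onI)
      fix k k' assume "zc k = zc k'"
      then show "k = k'" using sep[of k k'] \<rho> by (metis ball_eq_empty inf.idem mult_pos_pos not_le zero_less_numeral)
    qed
    then have "card Z = card I" unfolding Z_def by (rule card_image)
    also have "\<dots> = (\<Prod>i\<in>UNIV. N i)" unfolding I_def by (subst card_PiE) auto
    finally have "real (card Z) = (\<Prod>i\<in>UNIV. real (N i))" by simp
    also have "\<dots> \<ge> (\<Prod>i\<in>(UNIV :: 'n option set). len i / (8 * \<rho>))"
      using N_ge len h \<rho> by (intro prod_mono) (auto intro!: divide_nonneg_pos intro: order_trans[OF less_imp_le])
    finally have card1: "(\<Prod>i\<in>(UNIV :: 'n option set). len i / (8 * \<rho>)) \<le> real (card Z)" .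
    have "(\<Prod>i\<in>(UNIV :: 'n option set). len i / (8 * \<rho>)) = (\<Prod>i\<in>(UNIV :: 'n option set). len i) / (8 * \<rho>) ^ ?d"
      by (simp add: prod_dividef del: card_option)
    also have "(\<Prod>i\<in>(UNIV :: 'n option set). len i) = h * \<sigma> ^ CARD('n)"
      unfolding UNIV_option_conv by (subst prod.insert) (auto simp: prod.reindex len_def)
    finally have card2: "h * \<sigma> ^ CARD('n) / (8 * \<rho>) ^ ?d \<le> real (card Z)" using card1 by simp
    have hp: "(h powr (\<alpha> / 2)) ^ ?d \<le> h"
    proof -
      have "(h powr (\<alpha> / 2)) ^ ?d = h powr (\<alpha> / 2 * real ?d)"
        using h(1) by (simp add: powr_power mult.commute del: card_option power_Suc)
      also have "\<dots> \<le> h powr 1" using h critical by (intro powr_mono') (auto simp del: card_option)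
      finally show ?thesis using h(1) by simp
    qed
    have "\<sigma> ^ CARD('n) / (8 * E0) ^ ?d * sqrt \<mu> ^ ?d * ((h powr (\<alpha> / 2)) ^ ?d / (h powr (\<alpha> / 2)) ^ ?d)
      \<le> \<sigma> ^ CARD('n) / (8 * E0) ^ ?d * sqrt \<mu> ^ ?d * (h / (h powr (\<alpha> / 2)) ^ ?d)"
      using hp pos E0 \<mu>_pos h by (intro mult_left_mono divide_right_mono) auto
    also have "\<dots> = h * \<sigma> ^ CARD('n) / (8 * \<rho>) ^ ?d"
      by (simp add: \<rho>_def a_def power_mult_distrib power_divide field_simps del: card_option power_Suc)
    also note card2
    finally have card3: "\<sigma> ^ CARD('n) / (8 * E0) ^ ?d * sqrt \<mu> ^ ?d \<le> real (card Z)" using h(1) by simp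
    have each: "cball z (2 * \<rho>) \<subseteq> coords U \<phi> \<and> (\<forall>y\<in>ball z (2 * \<rho>). h < y $ None \<and> y $ None < 2 * h) \<and>
       0 < L2_sq v (push U \<phi> (bump z \<rho>)) \<and>
       Re (L2_inner v (push U \<phi> (bump z \<rho>)) (laplacian A g (push U \<phi> (bump z \<rho>)))) \<le> \<mu> / 2 * L2_sq v (push U \<phi> (bump z \<rho>))"
      if "z \<in> Z" for z
    proof -
      obtain k where k: "k \<in> I" "z = zc k" using \<open>z \<in> Z\<close> unfolding Z_def by blast
      define q where "q i = 4 * \<rho> * real (k i)" for i
      have kN: "q i + 4 * \<rho> \<le> len i" for i
      proof -
        have "k i < N i" using k(1) by (auto simp: I_def PiE_def)
        then have "real (k i) + 1 \<le> real (N i)" by linarith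
        then have "4 * \<rho> * (real (k i) + 1) \<le> 4 * \<rho> * real (N i)" using \<rho> by (intro mult_left_mono) auto
        then show ?thesis using N_le[of i] by (simp add: q_def distrib_left)
      qed
      have comp: "\<bar>z $ i - y $ i\<bar> \<le> dist z y" for i y
        using component_le_norm_cart[of "z - y" i] by (simp add: dist_norm)
      have zi: "z $ i = base i + q i + 2 * \<rho>" for i by (simp add: k(2) zc_def q_def algebra_simps)
      have k0: "0 \<le> q i" for i using \<rho> by (simp add: q_def)
      have ball_T: "cball z (2 * \<rho>) \<subseteq> T"
      proof
        fix y assume "y \<in> cball z (2 * \<rho>)"
        then have "\<bar>z $ i - y $ i\<bar> \<le> 2 * \<rho>" for i using comp[of i y] by simp
        from this[unfolded abs_le_iff] have "base i \<le> y $ i \<and> y $ i \<le> base i + len i" for i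
          using zi[of i] kN[of i] k0[of i] by (smt (verit))
        then show "y \<in> T" by (simp add: T_mem)
      qed
      have sub: "cball z (2 * \<rho>) \<subseteq> coords U \<phi>" using ball_T T_coords by blast
      have height: "h < y $ None \<and> y $ None < 2 * h" if "y \<in> ball z (2 * \<rho>)" for y
      proof -
        have "\<bar>z $ None - y $ None\<bar> < 2 * \<rho>" using comp[of None y] that by simp
        then show ?thesis
          using zi[of None] kN[of None] k0[of None] by (simp add: base_def len_def abs_less_iff)
      qed
      have zT: "z \<in> T" using ball_T \<rho> by auto
      have dens: "density U \<phi> y \<le> 2 * density U \<phi> z \<and> density U \<phi> z \<le> 2 * density U \<phi> y" if "y \<in> cball z (2 * \<rho>)" for y
      proof -
        have "y \<in> T" "dist y z < \<delta>" "dist z y < \<delta>" using that ball_T \<rho>\<delta> by (auto simp: dist_commute)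
        then show ?thesis using \<delta>(2) zT by blast
      qed
      note RQ = bump_Rayleigh_quotient[OF c \<rho> sub P[OF \<rho>] less_imp_le[OF pos(4)] T_form[OF subsetD[OF ball_T]] less_imp_le[OF \<Lambda>] dens]
      have "Re (L2_inner v (push U \<phi> (bump z \<rho>)) (laplacian A g (push U \<phi> (bump z \<rho>)))) \<le> K * \<Lambda> / \<rho>\<^sup>2 * L2_sq v (push U \<phi> (bump z \<rho>))"
        unfolding K_def by (rule RQ(2))
      moreover have "0 < L2_sq v (push U \<phi> (bump z \<rho>))" by (rule RQ(1))
      ultimately show ?thesis unfolding quot using sub height by blast
    qed
    have disj: "ball z (2 * \<rho>) \<inter> ball z' (2 * \<rho>) = {}" if zz: "z \<in> Z" "z' \<in> Z" "z \<noteq> z'" for z z'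
    proof -
      obtain k k' where "z = zc k" "z' = zc k'" using zz(1,2) unfolding Z_def by blast
      then show ?thesis using sep[of k k'] zz(3) by metis
    qed
    have "\<forall>z\<in>Z. \<forall>z'\<in>Z. z \<noteq> z' \<longrightarrow> ball z (2 * \<rho>) \<inter> ball z' (2 * \<rho>) = {}"
      by (intro ballI impI disj)
    moreover have "finite Z" using fin by (simp add: Z_def)
    ultimately have "trial_bumps U \<phi> h \<mu> Z \<rho>" using \<rho> each unfolding trial_bumps_def by blast
    then show ?thesis using card3 by blast
  qed
  then show ?thesis using \<mu>0 by blast
qed

end

section \<open>Growth of the eigenvalues and concentration\<close>

context laplace_eigenfunctions
begin

text \<open>The layers at the heights \<open>\<sigma> / 2 ^ l\<close> are disjoint and contribute equally many trial functions.\<close>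

lemma eigenvalue_count:
  assumes c: "(U, \<phi>) \<in> A"
    and decay: "inverse_metric_decay U \<phi> y0 \<sigma> C \<alpha>"
    and pos: "0 < \<sigma>" "\<sigma> \<le> 1" "0 < C" "0 < \<alpha>" and critical: "2 \<le> \<alpha> * real CARD('n option)"
  shows "\<exists>\<kappa>>0. \<forall>m :: nat. \<exists>\<mu>1. \<forall>N>0. \<mu>1 \<le> ev (N - 1) \<longrightarrow> real m * \<kappa> * sqrt (ev (N - 1)) ^ CARD('n option) \<le> 2 * real N"
proof -
  let ?d = "CARD('n option)"
  obtain P0 where P0: "P0 \<ge> 0" "\<And>z \<rho> y i. 0 < \<rho> \<Longrightarrow> cmod (partial_deriv i (bump z \<rho> :: real ^ 'n option \<Rightarrow> complex) y) \<le> P0 / \<rho>"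
    using bump_partial_deriv_bound by metis
  \<comment> \<open>The bound for the derivatives is made strictly positive, so that the radii
    defined from it do not vanish.\<close>
  define P where "P = P0 + 1"
  have P: "P > 0" using P0(1) by (simp add: P_def)
  have P_bound: "cmod (partial_deriv i (bump z \<rho> :: real ^ 'n option \<Rightarrow> complex) y) \<le> P / \<rho>" if "0 < \<rho>" for z \<rho> y i
    using P0(2)[OF that, of i z y] divide_right_mono[of P0 P \<rho>] that by (simp add: P_def)
  define E0 where "E0 = sqrt (2 * (4 * real CARD('n option) * P\<^sup>2 * 2 ^ CARD('n option)) * (C * 2 powr \<alpha>))"
  define \<kappa> where "\<kappa> = \<sigma> ^ CARD('n) / (8 * E0) ^ ?d"
  have "E0 > 0" using P pos by (simp add: E0_def del: card_option)
  then have \<kappa>: "\<kappa> > 0" using pos by (simp add: \<kappa>_def)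
  define h where "h l = \<sigma> / 2 ^ Suc l" for l :: nat
  have h: "0 < h l" "2 * h l \<le> \<sigma>" "h l \<le> 1" for l
  proof -
    show "0 < h l" using pos by (simp add: h_def)
    have "\<sigma> / 2 ^ l \<le> \<sigma> / 1" using pos(1) by (intro divide_left_mono) auto
    then show "2 * h l \<le> \<sigma>" by (simp add: h_def)
    then show "h l \<le> 1" using pos \<open>0 < h l\<close> by linarith
  qed
  have h_mono: "2 * h l' \<le> h l" if "l < l'" for l l'
  proof -
    have "(2::real) ^ Suc l \<le> 2 ^ l'" using that by (intro power_increasing) auto
    then have "\<sigma> / 2 ^ l' \<le> \<sigma> / 2 ^ Suc l" using pos(1) by (intro divide_left_mono) auto
    then show ?thesis by (simp add: h_def)
  qed
  have "\<exists>\<mu>0>0. \<forall>\<mu>\<ge>\<mu>0. \<exists>Z \<rho>. trial_bumps U \<phi> (h l) \<mu> Z \<rho> \<and> \<kappa> * sqrt \<mu> ^ ?d \<le> real (card Z)" for l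
    unfolding \<kappa>_def E0_def
    by (rule trial_functions_in_layer[OF c decay pos(1,3,4) P critical h P_bound])
  then obtain \<mu>0 where \<mu>0: "\<And>l. 0 < \<mu>0 l" and layer: "\<And>l \<mu>. \<mu>0 l \<le> \<mu> \<Longrightarrow>
      \<exists>Z \<rho>. trial_bumps U \<phi> (h l) \<mu> Z \<rho> \<and> \<kappa> * sqrt \<mu> ^ ?d \<le> real (card Z)"
    by metis
  have "real m * \<kappa> * sqrt (ev (N - 1)) ^ ?d \<le> 2 * real N" if N: "N > 0" and big: "(\<Sum>l<m. \<mu>0 l) \<le> ev (N - 1)" for m N
  proof -
    define \<mu> where "\<mu> = ev (N - 1)"
    have \<mu>_pos: "\<mu> > 0" unfolding \<mu>_def by (rule ev_pos)
    have "\<exists>Z \<rho>. trial_bumps U \<phi> (h l) \<mu> Z \<rho> \<and> \<kappa> * sqrt \<mu> ^ ?d \<le> real (card Z)" if "l < m" for l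
    proof -
      have "\<mu>0 l \<le> (\<Sum>l<m. \<mu>0 l)" using \<mu>0 that by (intro member_le_sum) (auto intro: less_imp_le)
      then show ?thesis using big by (intro layer) (simp add: \<mu>_def)
    qed
    then obtain Z \<rho> where Z\<rho>: "\<And>l. l < m \<Longrightarrow> trial_bumps U \<phi> (h l) \<mu> (Z l) (\<rho> l)"
      and Z_card: "\<And>l. l < m \<Longrightarrow> \<kappa> * sqrt \<mu> ^ ?d \<le> real (card (Z l))"
      by metis
    have \<rho>_pos: "0 < \<rho> l" and Z_fin: "finite (Z l)" if "l < m" for l
      using Z\<rho>[OF that] by (simp_all add: trial_bumps_def)
    define I where "I = Sigma {..<m} Z"
    define t where "t = (\<lambda>(l, z). push U \<phi> (bump z (\<rho> l)))"
    have I_fin: "finite I" unfolding I_def using Z_fin by (intro finite_SigmaI) auto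
    have t: "t i \<in> tests" "laplacian A g (t i) \<in> L2 v" "0 < L2_sq v (t i)"
      "Re (L2_inner v (t i) (laplacian A g (t i))) \<le> \<mu> / 2 * L2_sq v (t i)" if i: "i \<in> I" for i
    proof -
      obtain l z where lz: "i = (l, z)" "l < m" "z \<in> Z l" using i by (auto simp: I_def)
      have sub: "cball z (2 * \<rho> l) \<subseteq> coords U \<phi>" using Z\<rho>[OF lz(2)] lz(3) by (simp add: trial_bumps_def)
      note PB = pull_bump_test[OF c \<rho>_pos[OF lz(2)] sub]
      show "t i \<in> tests" using PB(1) by (simp add: t_def lz)
      have out: "push U \<phi> (bump z (\<rho> l)) p = 0" if "p \<in> topspace X - inv_into U \<phi> ` cball z (2 * \<rho> l)" for p
        using PB(4)[of p] that by simp
      show "laplacian A g (t i) \<in> L2 v"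
        using laplacian_L2_chart[OF c PB(1,2,3) out] by (simp add: t_def lz)
      show "0 < L2_sq v (t i)" "Re (L2_inner v (t i) (laplacian A g (t i))) \<le> \<mu> / 2 * L2_sq v (t i)"
        using Z\<rho>[OF lz(2)] lz(1,3) by (simp_all add: t_def trial_bumps_def)
    qed
    have supp: "\<phi> p \<in> ball z (2 * \<rho> l)" if "t (l, z) p \<noteq> 0" "l < m" for l z p
      using that bump_eq_0[OF \<rho>_pos[OF that(2)], of "\<phi> p" z] by (auto simp: t_def push_def split: if_splits)
    have prod0: "t i p * cnj (t j p) = 0" if ij: "i \<in> I" "j \<in> I" "i \<noteq> j" for i j p
    proof (rule ccontr)
      assume "t i p * cnj (t j p) \<noteq> 0"
      then have nz: "t i p \<noteq> 0" "t j p \<noteq> 0" by auto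
      obtain l z where i: "i = (l, z)" "l < m" "z \<in> Z l" using ij(1) by (auto simp: I_def)
      obtain l' z' where j: "j = (l', z')" "l' < m" "z' \<in> Z l'" using ij(2) by (auto simp: I_def)
      have y: "\<phi> p \<in> ball z (2 * \<rho> l)" "\<phi> p \<in> ball z' (2 * \<rho> l')" using supp nz i j by auto
      show False
      proof (cases "l = l'")
        case True
        then have "z \<noteq> z'" using ij(3) i j by simp
        then have "ball z (2 * \<rho> l) \<inter> ball z' (2 * \<rho> l) = {}" using Z\<rho>[OF i(2)] i(3) j(3) True by (simp add: trial_bumps_def)
        then show False using y True by blast
      next
        case False
        have "h l < \<phi> p $ None" "\<phi> p $ None < 2 * h l" using Z\<rho>[OF i(2)] i(3) y(1) by (auto simp: trial_bumps_def)
        moreover have "h l' < \<phi> p $ None" "\<phi> p $ None < 2 * h l'" using Z\<rho>[OF j(2)] j(3) y(2) by (auto simp: trial_bumps_def)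
        ultimately show False using False h_mono[of l l'] h_mono[of l' l] by linarith
      qed
    qed
    have orth: "L2_inner v (t i) (t j) = 0" if "i \<in> I" "j \<in> I" "i \<noteq> j" for i j
    proof -
      have "(\<lambda>p. t i p * cnj (t j p)) = (\<lambda>p. 0)" using prod0[OF that] by (rule ext)
      then show ?thesis by (simp add: L2_inner_def)
    qed
    have "real (card I) \<le> 2 * real (N - 1)"
    proof (rule card_trial_functions_le[OF basis I_fin, where f = t and h = "\<lambda>i. laplacian A g (t i)" and \<mu> = \<mu> and ev = ev])
      show "\<mu> \<le> ev j" if "N - 1 \<le> j" for j unfolding \<mu>_def by (rule ev_mono[OF that])
    qed (use t test_L2 orth eigenfunction_inner_laplacian \<mu>_pos less_imp_le[OF ev_pos] in auto)
    moreover have "real (card I) = (\<Sum>l<m. real (card (Z l)))" using Z_fin by (simp add: I_def)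
    moreover have "(\<Sum>l<m. \<kappa> * sqrt \<mu> ^ ?d) \<le> (\<Sum>l<m. real (card (Z l)))" using Z_card by (intro sum_mono) simp
    ultimately have "real m * (\<kappa> * sqrt \<mu> ^ ?d) \<le> 2 * real (N - 1)" by (simp del: card_option)
    also have "\<dots> \<le> 2 * real N" by simp
    finally show ?thesis by (simp only: \<mu>_def mult.assoc)
  qed
  then show ?thesis using \<kappa> by blast
qed

text \<open>For eigenvalues beyond the threshold of the count with a large factor \<open>m\<close>
  the quotient is at most a multiple of \<open>1 / m\<close>; below it the numerator is
  bounded.\<close>

lemma eigenvalue_growth:
  assumes \<kappa>: "\<kappa> > 0"
    and count: "\<And>m :: nat. \<exists>\<mu>1. \<forall>N>0. \<mu>1 \<le> ev (N - 1) \<longrightarrow> real m * \<kappa> * sqrt (ev (N - 1)) ^ d \<le> 2 * real N"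
  shows "(\<lambda>N. sqrt (1 + ev (N - 1)) ^ d / real N) \<longlonglongrightarrow> 0"
proof (rule LIMSEQ_I)
  fix \<epsilon> :: real assume \<epsilon>: "\<epsilon> > 0"
  obtain m :: nat where m: "2 * 2 ^ d / (\<kappa> * \<epsilon>) < real m" using reals_Archimedean2 by blast
  have m_pos: "real m > 0" using m \<kappa> \<epsilon> by (smt (verit) divide_pos_pos mult_pos_pos zero_less_power)
  obtain \<mu>1 where \<mu>1: "\<And>N. N > 0 \<Longrightarrow> \<mu>1 \<le> ev (N - 1) \<Longrightarrow> real m * \<kappa> * sqrt (ev (N - 1)) ^ d \<le> 2 * real N"
    using count[of m] by blast
  define b where "b = max \<mu>1 1"
  have "(\<lambda>N. sqrt (1 + b) ^ d / real N) \<longlonglongrightarrow> 0" by (rule lim_const_over_n)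
  then have "\<forall>\<^sub>F N in sequentially. sqrt (1 + b) ^ d / real N < \<epsilon>" using \<epsilon> by (rule order_tendstoD(2))
  then have "\<forall>\<^sub>F N in sequentially. norm (sqrt (1 + ev (N - 1)) ^ d / real N - 0) < \<epsilon>"
    using eventually_gt_at_top[of 0]
  proof eventually_elim
    case (elim N)
    let ?e = "ev (N - 1)"
    have e0: "0 < ?e" by (rule ev_pos)
    have "sqrt (1 + ?e) ^ d / real N < \<epsilon>"
    proof (cases "b \<le> ?e")
      case True
      have "sqrt (1 + ?e) \<le> sqrt (4 * ?e)" using True by (intro real_sqrt_le_mono) (simp add: b_def)
      then have "sqrt (1 + ?e) \<le> 2 * sqrt ?e" by (simp add: real_sqrt_mult)
      then have "sqrt (1 + ?e) ^ d \<le> (2 * sqrt ?e) ^ d" using e0 by (intro power_mono) auto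
      also have "\<dots> = 2 ^ d * sqrt ?e ^ d" by (simp add: power_mult_distrib)
      also have "sqrt ?e ^ d \<le> 2 * real N / (real m * \<kappa>)"
        using \<mu>1[OF elim(2)] True m_pos \<kappa> by (simp add: b_def field_simps)
      finally have "sqrt (1 + ?e) ^ d \<le> 2 ^ d * (2 * real N / (real m * \<kappa>))" by simp
      then have "sqrt (1 + ?e) ^ d / real N \<le> 2 * 2 ^ d / (real m * \<kappa>)"
        using elim(2) by (simp add: field_simps)
      also have "\<dots> < \<epsilon>" using m m_pos \<kappa> \<epsilon> by (simp add: field_simps)
      finally show ?thesis .
    next
      case False
      then have "sqrt (1 + ?e) ^ d \<le> sqrt (1 + b) ^ d" using e0 by (intro power_mono real_sqrt_le_mono) auto
      then have "sqrt (1 + ?e) ^ d / real N \<le> sqrt (1 + b) ^ d / real N" by (rule divide_right_mono) simp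
      then show ?thesis using elim(1) by linarith
    qed
    moreover have "0 \<le> sqrt (1 + ?e) ^ d / real N" using e0 by simp
    ultimately show ?case by simp
  qed
  then show "\<exists>N0. \<forall>N\<ge>N0. norm (sqrt (1 + ev (N - 1)) ^ d / real N - 0) < \<epsilon>"
    by (simp add: eventually_sequentially)
qed

lemma L2_sq_indicator_mono:
  assumes f: "f \<in> L2 v" and E: "E \<in> sets v" "E' \<in> sets v" "E' \<subseteq> E"
  shows "L2_sq v (\<lambda>p. indicator E' p * f p) \<le> L2_sq v (\<lambda>p. indicator E p * f p)"
  unfolding L2_sq_def
  using L2_indicator[OF f E(1)] L2_indicator[OF f E(2)] E(3)
  by (intro integral_mono) (auto simp: L2_def indicator_def)

lemma negligible_mean_subset:
  assumes "negligible_mean E" "E \<in> sets v" "E' \<in> sets v" "E' \<subseteq> E"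
  shows "negligible_mean E'"
  unfolding negligible_mean_def
proof (rule tendsto_sandwich[OF _ _ tendsto_const assms(1)[unfolded negligible_mean_def]])
  show "\<forall>\<^sub>F N in sequentially. 0 \<le> (\<Sum>j<N. L2_sq v (\<lambda>p. indicator E' p * u j p)) / real N"
    by (intro always_eventually allI divide_nonneg_nonneg sum_nonneg) auto
  show "\<forall>\<^sub>F N in sequentially. (\<Sum>j<N. L2_sq v (\<lambda>p. indicator E' p * u j p)) / real N
      \<le> (\<Sum>j<N. L2_sq v (\<lambda>p. indicator E p * u j p)) / real N"
    by (intro always_eventually allI divide_right_mono sum_mono L2_sq_indicator_mono[OF u_L2 assms(2-4)]) auto
qed

text \<open>A countable base of the topology reduces all compact sets to countably many open sets.\<close>

lemma concentration:
  assumes local_negligible: "\<And>p. p \<in> Xint \<Longrightarrow> \<exists>E. openin X E \<and> p \<in> E \<and> negligible_mean E"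
  shows "\<exists>s. density_one_subseq s \<and>
    (\<forall>K. compactin X K \<and> K \<subseteq> Xint \<longrightarrow> (\<lambda>k. LINT p:K|v. (cmod (u (s k) p))\<^sup>2) \<longlonglongrightarrow> 0)"
proof -
  obtain \<B> where \<B>: "countable \<B>" "\<And>V. V \<in> \<B> \<Longrightarrow> openin X V"
    "\<And>U x. openin X U \<Longrightarrow> x \<in> U \<Longrightarrow> \<exists>V\<in>\<B>. x \<in> V \<and> V \<subseteq> U"
    using second_countable unfolding second_countable_def by metis
  define \<G> where "\<G> = insert {} {V \<in> \<B>. negligible_mean V}"
  have \<G>: "countable \<G>" "\<G> \<noteq> {}" using \<B>(1) by (auto simp: \<G>_def)
  have "negligible_mean {}" by (simp add: negligible_mean_def L2_sq_def)
  then have neg: "negligible_mean V" and op: "openin X V" if "V \<in> \<G>" for V using that \<B>(2) by (auto simp: \<G>_def)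
  define a where "a m j = L2_sq v (\<lambda>p. indicator (from_nat_into \<G> m) p * u j p)" for m j
  have G_in: "from_nat_into \<G> m \<in> \<G>" for m by (rule from_nat_into[OF \<G>(2)])
  have a1: "a m j \<le> 1" for m j
  proof -
    have "a m j \<le> L2_sq v (\<lambda>p. indicator (space v) p * u j p)"
      unfolding a_def using op[OF G_in] openin_subset by (intro L2_sq_indicator_mono u_L2 open_sets) auto
    also have "\<dots> = L2_sq v (u j)" unfolding L2_sq_def by (intro Bochner_Integration.integral_cong) (auto simp: indicator_def)
    finally show ?thesis by (simp add: orthonormal_L2_sq[OF basis])
  qed
  have "\<exists>s. density_one_subseq s \<and> (\<forall>m. (\<lambda>k. a m (s k)) \<longlonglongrightarrow> 0)"
  proof (rule Koopman_von_Neumann_countable)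
    show "(\<lambda>N. (\<Sum>j<N. a m j) / real N) \<longlonglongrightarrow> 0" for m
      using neg[OF G_in[of m]] unfolding a_def negligible_mean_def .
  qed (use a1 in \<open>auto simp: a_def\<close>)
  then obtain s where s: "density_one_subseq s" "\<And>m. (\<lambda>k. a m (s k)) \<longlonglongrightarrow> 0" by blast
  have sV: "(\<lambda>k. L2_sq v (\<lambda>p. indicator V p * u (s k) p)) \<longlonglongrightarrow> 0" if V: "V \<in> \<G>" for V
  proof -
    obtain m where "from_nat_into \<G> m = V" using from_nat_into_surj[OF \<G>(1) V] by blast
    then show ?thesis using s(2)[of m] by (simp add: a_def)
  qed
  have "(\<lambda>k. LINT p:K|v. (cmod (u (s k) p))\<^sup>2) \<longlonglongrightarrow> 0" if K: "compactin X K" "K \<subseteq> Xint" for K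
  proof -
    have "\<exists>V\<in>\<G>. p \<in> V" if p: "p \<in> K" for p
    proof -
      obtain E where E: "openin X E" "p \<in> E" "negligible_mean E" using local_negligible p K(2) by blast
      obtain V where V: "V \<in> \<B>" "p \<in> V" "V \<subseteq> E" using \<B>(3)[OF E(1,2)] by blast
      have "negligible_mean V" by (rule negligible_mean_subset[OF E(3) open_sets[OF E(1)] open_sets[OF \<B>(2)[OF V(1)]] V(3)])
      then show ?thesis using V by (auto simp: \<G>_def)
    qed
    then have "(\<forall>V\<in>\<G>. openin X V) \<and> K \<subseteq> \<Union> \<G>" using op by blast
    then obtain F where F: "finite F" "F \<subseteq> \<G>" "K \<subseteq> \<Union> F" using K(1) unfolding compactin_def by metis
    have Km: "K \<in> sets v" by (rule compact_sets[OF K(1)])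
    have Fm: "V \<in> sets v" if "V \<in> F" for V using F(2) that op open_sets by blast
    have eq: "(LINT p:K|v. (cmod (f p))\<^sup>2) = L2_sq v (\<lambda>p. indicator K p * f p)" for f :: "'a \<Rightarrow> complex"
      unfolding set_lebesgue_integral_def L2_sq_def
      by (intro Bochner_Integration.integral_cong) (auto simp: indicator_def)
    have le: "(LINT p:K|v. (cmod (u j p))\<^sup>2) \<le> (\<Sum>V\<in>F. L2_sq v (\<lambda>p. indicator V p * u j p))" for j
    proof -
      have Vi: "integrable v (\<lambda>p. (cmod (indicator V p * u j p))\<^sup>2)" if "V \<in> F" for V
        using L2_indicator[OF u_L2 Fm[OF that]] by (simp add: L2_def)
      have "L2_sq v (\<lambda>p. indicator K p * u j p) \<le> (LINT p|v. (\<Sum>V\<in>F. (cmod (indicator V p * u j p))\<^sup>2))"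
        unfolding L2_sq_def
      proof (rule integral_mono)
        show "integrable v (\<lambda>p. (cmod (indicator K p * u j p))\<^sup>2)"
          using L2_indicator[OF u_L2 Km] by (simp add: L2_def)
        show "integrable v (\<lambda>p. \<Sum>V\<in>F. (cmod (indicator V p * u j p))\<^sup>2)" using Vi by simp
        fix p
        show "(cmod (indicator K p * u j p))\<^sup>2 \<le> (\<Sum>V\<in>F. (cmod (indicator V p * u j p))\<^sup>2)"
        proof (cases "p \<in> K")
          case True
          then obtain V where V: "V \<in> F" "p \<in> V" using F(3) by blast
          have "(cmod (indicator K p * u j p))\<^sup>2 = (cmod (indicator V p * u j p))\<^sup>2" using True V(2) by simp
          also have "\<dots> \<le> (\<Sum>V\<in>F. (cmod (indicator V p * u j p))\<^sup>2)"
            by (rule member_le_sum[where f = "\<lambda>V. (cmod (indicator V p * u j p))\<^sup>2", OF V(1) _ F(1)]) simp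
          finally show ?thesis .
        qed (simp add: sum_nonneg)
      qed
      also have "\<dots> = (\<Sum>V\<in>F. L2_sq v (\<lambda>p. indicator V p * u j p))"
        unfolding L2_sq_def using Vi by (rule Bochner_Integration.integral_sum)
      finally show ?thesis by (simp only: eq)
    qed
    show ?thesis
    proof (rule tendsto_sandwich[OF _ _ tendsto_const])
      show "\<forall>\<^sub>F k in sequentially. 0 \<le> (LINT p:K|v. (cmod (u (s k) p))\<^sup>2)" by (simp add: eq)
      show "\<forall>\<^sub>F k in sequentially. (LINT p:K|v. (cmod (u (s k) p))\<^sup>2) \<le> (\<Sum>V\<in>F. L2_sq v (\<lambda>p. indicator V p * u (s k) p))"
        using le by simp
      have "(\<lambda>k. \<Sum>V\<in>F. L2_sq v (\<lambda>p. indicator V p * u (s k) p)) \<longlonglongrightarrow> (\<Sum>V\<in>F. 0)"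
        using sV F(2) by (intro tendsto_sum) blast
      then show "(\<lambda>k. \<Sum>V\<in>F. L2_sq v (\<lambda>p. indicator V p * u (s k) p)) \<longlonglongrightarrow> 0" by simp
    qed
  qed
  then show ?thesis using s(1) by blast
qed

end

theorem corollary1:
  fixes X :: "'a topology" and A :: "('a, real ^ 'n::finite option) chart set"
    and M :: "'b topology" and B :: "('b, real ^ 'n) chart set"
    and W :: "'a set" and \<Phi> :: "real \<times> 'b \<Rightarrow> 'a" and \<Psi> :: "'a \<Rightarrow> real \<times> 'b"
    and g :: "('a, 'n option) tensor2" and v :: "'a measure"
    and \<alpha> \<beta> :: real
    and ev :: "nat \<Rightarrow> real" and \<phi> :: "nat \<Rightarrow> 'a \<Rightarrow> complex"
  assumes "smooth_manifold half_space X A" and "compact_space X"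
    and "smooth_manifold UNIV M B" and "compact_space M"
    and "collar X A M B W \<Phi> \<Psi>"
    and "0 < \<alpha>" and "\<alpha> < 2"
    and "riemannian_metric_on A (interior_part X A) g"
    and "boundary_blow_up X A W (fst \<circ> \<Psi>) \<alpha> g"
    and "riemannian_volume X A g v"
    and "laplace_eigenbasis X A g v ev \<phi>"
    and "\<beta> = 2 * \<alpha> / (2 - \<alpha>)"
    and "\<beta> \<ge> 2 / real CARD('n)"
  shows "\<exists>s. density_one_subseq s \<and>
    (\<forall>K. compactin X K \<and> K \<subseteq> interior_part X A \<longrightarrow>
       (\<lambda>k. LINT p:K|v. (cmod (\<phi> (s k) p))\<^sup>2) \<longlonglongrightarrow> 0)"
proof -
  interpret laplace_eigenfunctions X A g v ev \<phi>
    using assms by unfold_locales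
  have critical: "2 \<le> \<alpha> * real CARD('n option)"
  proof -
    have "2 / real CARD('n) \<le> 2 * \<alpha> / (2 - \<alpha>)" using assms by simp
    then have "2 * (2 - \<alpha>) \<le> 2 * \<alpha> * real CARD('n)" using assms(7) by (simp add: field_simps)
    then show ?thesis by (simp add: algebra_simps)
  qed
  obtain U \<psi> y0 \<sigma> C where c: "(U, \<psi>) \<in> A" and pos: "0 < \<sigma>" "\<sigma> \<le> 1" "0 < C"
    and decay: "inverse_metric_decay U \<psi> y0 \<sigma> C \<alpha>"
    using boundary_chart[OF assms(3,5,9,6) boundary_nonempty[OF assms(2)]] by blast
  obtain \<kappa> where "\<kappa> > 0" "\<And>m :: nat. \<exists>\<mu>1. \<forall>N>0. \<mu>1 \<le> ev (N - 1) \<longrightarrow> real m * \<kappa> * sqrt (ev (N - 1)) ^ CARD('n option) \<le> 2 * real N"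
    using eigenvalue_count[OF c decay pos assms(6) critical] by blast
  then have growth: "(\<lambda>N. sqrt (1 + ev (N - 1)) ^ CARD('n option) / real N) \<longlonglongrightarrow> 0" by (rule eigenvalue_growth)
  show ?thesis
  proof (rule concentration)
    fix p assume p: "p \<in> interior_part X A"
    obtain V \<chi>' where V: "(V, \<chi>') \<in> A" "p \<in> V" using interior_chartE[OF p] by blast
    have "\<chi>' p \<in> coords V \<chi>'" by (rule chart_in_coords[OF V(2) p])
    then obtain e where e: "e > 0" "cball (\<chi>' p) e \<subseteq> coords V \<chi>'"
      using coords_open[OF V(1)] open_contains_cball by blast
    then have "negligible_mean {q \<in> V. \<chi>' q \<in> ball (\<chi>' p) (e / 2)}"
      by (intro negligible_mean_chart_ball[OF growth V(1)]) auto
    moreover have "openin X {q \<in> V. \<chi>' q \<in> ball (\<chi>' p) (e / 2)}" by (rule chart_preimage_open[OF V(1)]) simp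
    ultimately show "\<exists>E. openin X E \<and> p \<in> E \<and> negligible_mean E" using V(2) e(1) by (intro exI) auto
  qed
qed

end
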